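(* Let $u\in\mathfrak S^f(S_1^+)$ with $f\in L_\infty(S_1^+)$ satisfying the following condition: there are a positive monotone nondecreasing function $\mu(r)$ which is a $\log$-convex function of $\log r$, and constants $\sigma>0$ and $C_\mu>0$, such that $$\mu(r)\ge C_\mu\, r^{4-2\sigma}\int_{\mathbb R^n_+} f^2(\cdot,-r^2)\,G(\cdot,-r^2)\,dx,\qquad r\in(0,1).$$ Then there exists $C>0$, depending only on $\sigma$, $C_\mu$ and $n$, such that the function $$\Phi_u(r)=\tfrac12\, r e^{Cr^\sigma}\frac{d}{dr}\log\max\{H_u(r),\mu(r)\}+2\,(e^{Cr^\sigma}-1)$$ is nondecreasing for $r\in(0,1)$.
   Context: Notation: $n\ge 2$; $x=(x',x_n)\in\mathbb R^n$ with $x'\in\mathbb R^{n-1}$, and $\mathbb R^{n-1}$ is identified with $\{x_n=0\}$; $\mathbb R^n_+=\{x_n>0\}$; $S_r^+=\mathbb R^n_+\times(-r^2,0]$, $S_r'=\mathbb R^{n-1}\times(-r^2,0]$. $G(x,t)=(-4\pi t)^{-n/2}e^{|x|^2/(4t)}$ for $t<0$ and $G=0$ for $t\ge0$. Function classes: $W^{2,1}_2(E)$ is the space of $u\in L_2(E)$ whose distributional derivatives $\partial_x^\alpha\partial_t^j u$, $|\alpha|+2j\le2$, lie in $L_2(E)$. For $0<\alpha<1$, $H^{\alpha,\alpha/2}(E)$ is the space of bounded functions that are $\alpha$-Hölder in $x$ and $\alpha/2$-Hölder in $t$. Class $\mathfrak S^f(S_1^+)$: for $f\in L_\infty(S_1^+)$,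 $u\in\mathfrak S^f(S_1^+)$ means $u\in W^{2,1}_2(S_1^+)\cap L_\infty(S_1^+)$, $\nabla u\in H^{\alpha,\alpha/2}(S_1^+\cup S_1')$ for some $0<\alpha<1$, $u$ has bounded support, $\Delta u-\partial_t u=f$ in $S_1^+$; $u\ge0$, $-\partial_{x_n}u\ge0$, $u\,\partial_{x_n}u=0$ on $S_1'$; and $(0,0)\in\Gamma_*(u):=\partial_{S_1'}\{(x',t)\in S_1'\mid u(x',0,t)=0,\ \partial_{x_n}u(x',0,t)=0\}$ (boundary in the relative topology of $S_1'$). $H_u(r)=\dfrac1{r^2}\displaystyle\int_{S_r^+}u^2G\,dx\,dt$. A positive function $\mu$ is a $\log$-convex function of $\log r$ if $s\mapsto\log\mu(e^s)$ is convex; equivalently $\mu$ is locally absolutely continuous and $r\mu'(r)/\mu(r)$ is nondecreasing. Since $H_u$ and $\mu$ are absolutely continuous, $\Phi_u$ is defined for a.e. $r$; "nondecreasing" means that $\Phi_u$ agrees a.e. on $(0,1)$ with a nondecreasing function. *)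

theory Defs
  imports "HOL-Analysis.Analysis"
begin

(* A point x = (x', x_n) of R^n is a pair in real^'m * real, so n = CARD('m) + 1 ranges over all
   n >= 2 and DIM((real^'m) * real) = n.  A space-time point is ((x', x_n), t). *)

type_synonym 'm sp = "(real^'m) \<times> real"
type_synonym 'm spt = "'m sp \<times> real"

definition half_space :: "('m::finite) sp set" where
  "half_space = {x. 0 < snd x}"

definition half_space_closed :: "('m::finite) sp set" where
  "half_space_closed = {x. 0 \<le> snd x}"

definition S_plus :: "real \<Rightarrow> ('m::finite) spt set" where
  "S_plus r = half_space \<times> {- r\<^sup>2<..0}"

definition S_prime :: "real \<Rightarrow> ('m::finite) spt set" where
  "S_prime r = {x. snd x = 0} \<times> {- r\<^sup>2<..0}"

definition G :: "('m::finite) spt \<Rightarrow> real" where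
  "G p = (case p of (x, t) \<Rightarrow>
     if t < 0
     then (- 4 * pi * t) powr (- real DIM('m sp) / 2) * exp ((norm x)\<^sup>2 / (4 * t))
     else 0)"

definition L2 :: "'a::euclidean_space set \<Rightarrow> ('a \<Rightarrow> real) set" where
  "L2 E = {u \<in> borel_measurable (lebesgue_on E). integrable (lebesgue_on E) (\<lambda>p. (u p)\<^sup>2)}"

definition Linf :: "'a::euclidean_space set \<Rightarrow> ('a \<Rightarrow> real) set" where
  "Linf E = {u \<in> borel_measurable (lebesgue_on E). \<exists>M. AE p in lebesgue_on E. \<bar>u p\<bar> \<le> M}"

primrec Ck :: "nat \<Rightarrow> ('a::euclidean_space \<Rightarrow> real) \<Rightarrow> bool" where
  "Ck 0 f \<longleftrightarrow> continuous_on UNIV f"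
| "Ck (Suc k) f \<longleftrightarrow> (\<forall>x. f differentiable (at x)) \<and>
     (\<forall>b\<in>Basis. Ck k (\<lambda>x. frechet_derivative f (at x) b))"

definition test_function :: "'a::euclidean_space set \<Rightarrow> ('a \<Rightarrow> real) \<Rightarrow> bool" where
  "test_function U \<phi> \<longleftrightarrow> (\<forall>k. Ck k \<phi>) \<and>
     compact (closure {x. \<phi> x \<noteq> 0}) \<and> closure {x. \<phi> x \<noteq> 0} \<subseteq> U"

primrec iter_deriv :: "'a::euclidean_space list \<Rightarrow> ('a \<Rightarrow> real) \<Rightarrow> 'a \<Rightarrow> real" where
  "iter_deriv [] f = f"
| "iter_deriv (v # vs) f = (\<lambda>x. frechet_derivative (iter_deriv vs f) (at x) v)"

(* w is the distributional derivative of u along the list of directions vs in the open set U;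
   only used for u and w in L2. *)
definition weak_deriv ::
  "'a::euclidean_space set \<Rightarrow> 'a list \<Rightarrow> ('a \<Rightarrow> real) \<Rightarrow> ('a \<Rightarrow> real) \<Rightarrow> bool" where
  "weak_deriv U vs u w \<longleftrightarrow> (\<forall>\<phi>. test_function U \<phi> \<longrightarrow>
     (LINT p:U|lebesgue. u p * iter_deriv vs \<phi> p)
       = (- 1) ^ length vs * (LINT p:U|lebesgue. w p * \<phi> p))"

(* Distributions live on open sets, hence interior E: S_plus r contains its final time slice t = 0. *)
definition W221 :: "('a::euclidean_space \<times> real) set \<Rightarrow> ('a \<times> real \<Rightarrow> real) set" where
  "W221 E = {u \<in> L2 E.
     (\<forall>i\<in>Basis. \<exists>w\<in>L2 E. weak_deriv (interior E) [(i, 0)] u w) \<and>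
     (\<forall>i\<in>Basis. \<forall>j\<in>Basis. \<exists>w\<in>L2 E. weak_deriv (interior E) [(i, 0), (j, 0)] u w) \<and>
     (\<exists>w\<in>L2 E. weak_deriv (interior E) [(0, 1)] u w)}"

definition heat_eq ::
  "('a::euclidean_space \<times> real) set \<Rightarrow> ('a \<times> real \<Rightarrow> real) \<Rightarrow> ('a \<times> real \<Rightarrow> real) \<Rightarrow> bool" where
  "heat_eq E u f \<longleftrightarrow> (\<exists>D Dt.
     (\<forall>i\<in>Basis. D i \<in> L2 E \<and> weak_deriv (interior E) [(i, 0), (i, 0)] u (D i)) \<and>
     Dt \<in> L2 E \<and> weak_deriv (interior E) [(0, 1)] u Dt \<and>
     (AE p in lebesgue_on E. (\<Sum>i\<in>Basis. D i p) - Dt p = f p))"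

definition Holder_par ::
  "real \<Rightarrow> ('a::real_normed_vector \<times> real) set \<Rightarrow> ('a \<times> real \<Rightarrow> 'b::real_normed_vector) \<Rightarrow> bool" where
  "Holder_par \<alpha> E g \<longleftrightarrow> bounded (g ` E) \<and> (\<exists>K.
     (\<forall>x y t. (x, t) \<in> E \<longrightarrow> (y, t) \<in> E \<longrightarrow>
        norm (g (x, t) - g (y, t)) \<le> K * norm (x - y) powr \<alpha>) \<and>
     (\<forall>x t s. (x, t) \<in> E \<longrightarrow> (x, s) \<in> E \<longrightarrow>
        norm (g (x, t) - g (x, s)) \<le> K * \<bar>t - s\<bar> powr (\<alpha> / 2)))"

(* Derivatives are taken within the closed half-space, so they are one-sided in x_n on S_prime. *)
definition space_deriv :: "(('m::finite) spt \<Rightarrow> real) \<Rightarrow> 'm spt \<Rightarrow> 'm sp \<Rightarrow> real" where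
  "space_deriv u p = frechet_derivative (\<lambda>x. u (x, snd p)) (at (fst p) within half_space_closed)"

definition space_grad :: "(('m::finite) spt \<Rightarrow> real) \<Rightarrow> 'm spt \<Rightarrow> 'm sp" where
  "space_grad u p = (\<Sum>b\<in>Basis. space_deriv u p b *\<^sub>R b)"

definition dn :: "(('m::finite) spt \<Rightarrow> real) \<Rightarrow> 'm spt \<Rightarrow> real" where
  "dn u p = space_deriv u p (0, 1)"

definition Gamma_star :: "(('m::finite) spt \<Rightarrow> real) \<Rightarrow> 'm spt set" where
  "Gamma_star u = top_of_set (S_prime 1) frontier_of {p \<in> S_prime 1. u p = 0 \<and> dn u p = 0}"

(* u is the pointwise representative that is differentiable in x up to {x_n = 0} at every time;
   the traces of u and its normal derivative on S_prime 1 are pointwise values. *)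
definition Sf_class :: "(('m::finite) spt \<Rightarrow> real) \<Rightarrow> ('m spt \<Rightarrow> real) set" where
  "Sf_class f = {u.
     u \<in> W221 (S_plus 1) \<and> u \<in> Linf (S_plus 1) \<and>
     (\<forall>p \<in> S_plus 1 \<union> S_prime 1.
        (\<lambda>x. u (x, snd p)) differentiable (at (fst p) within half_space_closed)) \<and>
     (\<exists>\<alpha>. 0 < \<alpha> \<and> \<alpha> < 1 \<and> Holder_par \<alpha> (S_plus 1 \<union> S_prime 1) (space_grad u)) \<and>
     bounded {p \<in> S_plus 1 \<union> S_prime 1. u p \<noteq> 0} \<and>
     heat_eq (S_plus 1) u f \<and>
     (\<forall>p \<in> S_prime 1. 0 \<le> u p \<and> 0 \<le> - dn u p \<and> u p * dn u p = 0) \<and>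
     ((0, 0), 0) \<in> Gamma_star u}"

definition H :: "(('m::finite) spt \<Rightarrow> real) \<Rightarrow> real \<Rightarrow> real" where
  "H u r = 1 / r\<^sup>2 * (LINT p:S_plus r|lebesgue. (u p)\<^sup>2 * G p)"

definition Phi ::
  "real \<Rightarrow> real \<Rightarrow> (real \<Rightarrow> real) \<Rightarrow> (('m::finite) spt \<Rightarrow> real) \<Rightarrow> real \<Rightarrow> real" where
  "Phi C \<sigma> \<mu> u r =
     1 / 2 * r * exp (C * r powr \<sigma>) * deriv (\<lambda>s. ln (max (H u s) (\<mu> s))) r
       + 2 * (exp (C * r powr \<sigma>) - 1)"

(* Phi is only defined where the logarithm is differentiable; both this and the agreement with a
   monotone function are almost-everywhere statements on (0,1). *)
definition Phi_nondecreasing ::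
  "real \<Rightarrow> real \<Rightarrow> (real \<Rightarrow> real) \<Rightarrow> (('m::finite) spt \<Rightarrow> real) \<Rightarrow> bool" where
  "Phi_nondecreasing C \<sigma> \<mu> u \<longleftrightarrow> (\<exists>\<psi>. mono_on {0<..<1} \<psi> \<and>
     (AE r in lebesgue_on {0<..<1}.
        (\<lambda>s. ln (max (H u s) (\<mu> s))) differentiable (at r) \<and> Phi C \<sigma> \<mu> u r = \<psi> r))"

end

theory Submission
  imports Defs "HOL-Probability.Distributions" "HOL-Real_Asymp.Real_Asymp"
begin

text \<open>In the variables \<open>y = x / sqrt (- t)\<close>, \<open>z = - t\<close> put \<open>v y z = u (sqrt z y, - z)\<close>, and let \<open>h z\<close>, \<open>i z\<close> be the
  integrals of \<open>v\<^sup>2\<close> and \<open>|grad v|\<^sup>2\<close> over the half-space with the Gaussian weight, so that \<open>H r\<close> is the average of \<open>h\<close>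
  over \<open>(0, r\<^sup>2)\<close>. With \<open>e z = z * norm f(\<cdot>, - z)\<close>, the equation and the Signorini conditions give \<open>h' / 2 = i / z\<close> up to
  \<open>e sqrt h / z\<close>. Testing instead with the difference to a frozen slice \<open>v y b\<close>, whose boundary term has a sign by
  the complementarity conditions, gives a lower bound on the growth of \<open>i\<close> in terms of the L2 distance of the slices;
  only first derivatives of \<open>u\<close> in space enter. Averaging this in \<open>z\<close> bounds the energy from below by its average and makes
  \<open>exp (C z powr (\<sigma> / 2)) * (h / ave h + 1)\<close> nondecreasing wherever \<open>H > \<mu>\<close>, since there \<open>e\<close> is at most
  \<open>z powr (\<sigma> / 2) * sqrt H\<close> up to a constant.

  Finally \<open>\<Phi> + 2\<close> is the derivative of \<open>R = ln (max H \<mu>) / 2 + 2 ln r\<close> with respect to the parameter \<open>T\<close> with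
  \<open>T' = exp (- C r powr \<sigma>) / r\<close>. Hence it suffices that \<open>R\<close> has a local supporting line in \<open>T\<close> at every point: where
  \<open>H > \<mu>\<close> by the monotonicity above, elsewhere because \<open>\<mu>\<close> is a log-convex function of \<open>ln r\<close> and lies below the maximum.\<close>

section \<open>Mollifiers\<close>

text \<open>Differentiating the energy would involve second space derivatives up to the boundary, so
  \<open>i\<close> is controlled only from below and only through left difference quotients. The
  Almgren bound, z i' at least 2 i^2 / h, is used through its tangents z i' \<ge> 4 l i - 2 l^2 h,
  up to errors, for every l \<ge> 0: these are linear in i and h, so they can be averaged over (0,
  z) with l fixed, and l is chosen afterwards. Write A for the average of h, N = h / A - 1, and I
  for the average of i. Averaging h' gives 2 I = N A up to errors, and the optimal l = I / A = N / 2
  turns the averaged tangent into 2 i \<ge> N (N + 1) A. This is what the quotient asks for, as z (h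
  / A)' = 2 i / A - N (N + 1) apart from the terms with f. In z = r^2 one has r H' / H = 2 N, so
  where H > \<mu> the function \<Phi> + 2 equals exp (C r powr \<sigma>) * (N + 2). Since N \<ge>
  -1, the summand 2 makes N + 2 \<ge> 1, so that errors constant in N and errors linear in N are
  absorbed together by the derivative of the exponential.\<close>

text \<open>The functions \<open>bump_jet j\<close> span all derivatives of \<open>exp (- (1 / x))\<close>, continued by 0 to \<open>x \<le> 0\<close>.\<close>

definition bump_jet :: "nat \<Rightarrow> real \<Rightarrow> real" where
  "bump_jet j x = (if x \<le> 0 then 0 else exp (- (1 / x)) / x ^ j)"

lemma bump_jet_tendsto_0: "(bump_jet j \<longlongrightarrow> 0) (at 0)"
proof -
  have "((\<lambda>y::real. y ^ j / exp y) \<longlongrightarrow> 0) at_top"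
    by (rule tendsto_power_div_exp_0)
  then have "((\<lambda>x::real. (inverse x) ^ j / exp (inverse x)) \<longlongrightarrow> 0) (at_right 0)"
    by (rule filterlim_compose) (rule filterlim_inverse_at_top_right)
  moreover have "\<forall>\<^sub>F x in at_right 0. (inverse x) ^ j / exp (inverse x) = bump_jet j x"
    by (auto simp: eventually_at_right_less bump_jet_def field_simps exp_minus
        intro!: eventually_mono[OF eventually_at_right_less])
  ultimately have R: "(bump_jet j \<longlongrightarrow> 0) (at_right 0)"
    using Lim_transform_eventually by fast
  have "(bump_jet j \<longlongrightarrow> 0) (at_left 0)"
    by (rule tendsto_eventually) (auto simp: eventually_at_left_field bump_jet_def intro!: exI[of _ "-1"])
  with R show ?thesis
    by (simp add: filterlim_split_at)
qed

text \<open>The span of the family is closed under differentiation, so smoothness follows by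
  induction without formulas for higher derivatives. At 0 the right difference quotient of
  \<open>bump_jet j\<close> is \<open>bump_jet (Suc j)\<close>, which tends to 0.\<close>

lemma has_real_derivative_bump_jet:
  "(bump_jet j has_real_derivative bump_jet (j + 2) x - real j * bump_jet (j + 1) x) (at x)"
proof -
  consider "x < 0" | "x = 0" | "x > 0" by linarith
  then show ?thesis
  proof cases
    case 1
    have "((\<lambda>x. 0) has_real_derivative 0) (at x)" by simp
    moreover have "bump_jet (j + 2) x - real j * bump_jet (j + 1) x = 0"
      using 1 by (simp add: bump_jet_def)
    ultimately show ?thesis
      by (subst DERIV_cong_ev[OF refl _ refl, of _ "\<lambda>_. 0"])
         (auto simp: bump_jet_def 1 intro!: eventually_mono[OF eventually_nhds_in_open[of "{..<0}" x]])
  next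
    case 2
    have "((\<lambda>h. bump_jet (Suc j) h) \<longlongrightarrow> 0) (at 0)"
      by (rule bump_jet_tendsto_0)
    then have "((\<lambda>h. (bump_jet j (0 + h) - bump_jet j 0) / h) \<longlongrightarrow> 0) (at 0)"
      by (rule Lim_transform_eventually) (auto simp: bump_jet_def eventually_at intro!: exI[of _ 1])
    then show ?thesis
      using 2 by (simp add: DERIV_def bump_jet_def)
  next
    case 3
    have "((\<lambda>x. exp (- (1 / x)) / x ^ j) has_real_derivative
       (exp (- (1 / x)) * (1 / x\<^sup>2) * x ^ j - exp (- (1 / x)) * (real j * x ^ (j - 1))) / (x ^ j * x ^ j)) (at x)"
      using 3 by (auto intro!: derivative_eq_intros simp: power2_eq_square)
    moreover have "(exp (- (1 / x)) * (1 / x\<^sup>2) * x ^ j - exp (- (1 / x)) * (real j * x ^ (j - 1))) / (x ^ j * x ^ j)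
       = bump_jet (j + 2) x - real j * bump_jet (j + 1) x"
      using 3 by (cases j) (auto simp: bump_jet_def field_simps power2_eq_square)
    ultimately show ?thesis
      by (subst DERIV_cong_ev[OF refl _ refl, of _ "\<lambda>x. exp (- (1 / x)) / x ^ j"])
         (auto simp: bump_jet_def 3 intro!: eventually_mono[OF eventually_nhds_in_open[of "{0<..}" x]])
  qed
qed

lemma continuous_bump_jet: "continuous_on A (bump_jet j)"
  by (meson DERIV_isCont continuous_at_imp_continuous_on has_real_derivative_bump_jet)

lemma bump_jet_nonneg: "0 \<le> bump_jet j x"
  by (simp add: bump_jet_def)

section \<open>Smoothness of the mollifier as a test function\<close>

lemma Ck_SucI:
  assumes "\<And>x. (f has_derivative f' x) (at x)" and "\<And>b. b \<in> Basis \<Longrightarrow> Ck k (\<lambda>x. f' x b)"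
  shows "Ck (Suc k) f"
proof -
  have "frechet_derivative f (at x) = f' x" for x
    using frechet_derivative_at[OF assms(1)] by simp
  then show ?thesis using assms by (auto simp: differentiable_def)
qed

lemma Ck_SucD: "Ck (Suc k) f \<Longrightarrow> Ck k f"
proof (induction k arbitrary: f)
  case 0
  then show ?case
    by (auto intro!: continuous_at_imp_continuous_on differentiable_imp_continuous_within)
qed (metis Ck.simps(2))

lemma Ck_add: "Ck k f \<Longrightarrow> Ck k g \<Longrightarrow> Ck k (\<lambda>x. f x + g x)"
proof (induction k arbitrary: f g)
  case (Suc k)
  show ?case
  proof (rule Ck_SucI)
    show "((\<lambda>x. f x + g x) has_derivative
        (\<lambda>h. frechet_derivative f (at x) h + frechet_derivative g (at x) h)) (at x)" for x
      using Suc.prems by (auto intro!: has_derivative_add simp: frechet_derivative_works[symmetric])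
  qed (use Suc in auto)
qed (auto intro: continuous_intros)

lemma Ck_mult: "Ck k f \<Longrightarrow> Ck k g \<Longrightarrow> Ck k (\<lambda>x. f x * g x)"
proof (induction k arbitrary: f g)
  case (Suc k)
  show ?case
  proof (rule Ck_SucI)
    show "((\<lambda>x. f x * g x) has_derivative
        (\<lambda>h. f x * frechet_derivative g (at x) h + frechet_derivative f (at x) h * g x)) (at x)" for x
      using Suc.prems by (auto intro!: has_derivative_mult simp: frechet_derivative_works[symmetric])
    show "Ck k (\<lambda>x. f x * frechet_derivative g (at x) b + frechet_derivative f (at x) b * g x)"
      if "b \<in> Basis" for b
      using Suc that Ck_SucD[OF Suc.prems(1)] Ck_SucD[OF Suc.prems(2)] by (intro Ck_add Suc.IH) auto
  qed
qed (auto intro: continuous_intros)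

lemma Ck_const: "Ck k (\<lambda>_. c)"
proof (induction k arbitrary: c)
  case (Suc k)
  show ?case by (rule Ck_SucI[where f' = "\<lambda>_ _. 0"]) (use Suc in auto)
qed simp

lemma Ck_inner: "Ck k (\<lambda>x. (x - p) \<bullet> b)"
proof (cases k)
  case (Suc k)
  show ?thesis unfolding Suc
    by (rule Ck_SucI[where f' = "\<lambda>_ h. h \<bullet> b"]) (auto intro!: derivative_eq_intros Ck_const)
qed (auto intro!: continuous_intros)

lemma has_derivative_bump_jet_quadratic:
  fixes p q :: "'a::euclidean_space"
  shows "((\<lambda>q. bump_jet j (1 - s * ((q - p) \<bullet> (q - p)))) has_derivative
     (\<lambda>h. (bump_jet (j + 2) (1 - s * ((q - p) \<bullet> (q - p)))
        - real j * bump_jet (j + 1) (1 - s * ((q - p) \<bullet> (q - p)))) * (- 2 * s * ((q - p) \<bullet> h)))) (at q)"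
  by (rule has_derivative_eq_rhs, rule DERIV_compose_FDERIV[OF has_real_derivative_bump_jet])
     (auto intro!: derivative_eq_intros simp: inner_commute algebra_simps)

text \<open>One derivative leads to members of the same family with larger \<open>j\<close>,
  multiplied by an affine function; hence the induction on \<open>k\<close> with \<open>j\<close>
  arbitrary.\<close>

lemma Ck_bump_jet_quadratic:
  fixes p :: "'a::euclidean_space"
  shows "Ck k (\<lambda>q. bump_jet j (1 - s * ((q - p) \<bullet> (q - p))))"
proof (induction k arbitrary: j)
  case 0
  show ?case
    by (auto intro!: continuous_intros continuous_on_compose2[OF continuous_bump_jet[of UNIV]])
next
  case (Suc k)
  show ?case
  proof (rule Ck_SucI[OF has_derivative_bump_jet_quadratic])
    fix b :: 'a
    let ?a = "\<lambda>q. 1 - s * ((q - p) \<bullet> (q - p))"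
    have "Ck k (\<lambda>q. (bump_jet (j + 2) (?a q) + (- real j) * bump_jet (j + 1) (?a q))
        * ((- 2 * s) * ((q - p) \<bullet> b)))"
      by (intro Ck_mult Ck_add Ck_const Suc.IH Ck_inner)
    then show "Ck k (\<lambda>q. (bump_jet (j + 2) (?a q) - real j * bump_jet (j + 1) (?a q))
        * (- 2 * s * ((q - p) \<bullet> b)))"
      by (simp add: mult.assoc)
  qed
qed

text \<open>The standard bump exp (- 1 / (1 - |q|^2)) on the unit ball. It is not normalized; limits
  below divide by \<open>moll_mass\<close>.\<close>

definition moll :: "'a::euclidean_space \<Rightarrow> real" where
  "moll q = bump_jet 0 (1 - q \<bullet> q)"

text \<open>The derivative of \<open>moll\<close> at \<open>q\<close> in direction \<open>e\<close>,
  as \<open>bump_jet 2\<close> is the derivative of \<open>bump_jet 0\<close>.\<close>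

definition dmoll :: "'a::euclidean_space \<Rightarrow> 'a \<Rightarrow> real" where
  "dmoll e q = bump_jet 2 (1 - q \<bullet> q) * (- 2 * (q \<bullet> e))"

lemma moll_nonneg: "0 \<le> moll q"
  by (simp add: moll_def bump_jet_nonneg)

lemma moll_minus [simp]: "moll (- q) = moll q"
  by (simp add: moll_def)

lemma dmoll_minus [simp]: "dmoll e (- q) = - dmoll e q"
  by (simp add: dmoll_def)

lemma norm_ge_1_inner: "1 \<le> norm q \<Longrightarrow> 1 - q \<bullet> q \<le> 0"
  by (simp add: dot_square_norm one_le_power)

lemma moll_eq_0: "1 \<le> norm q \<Longrightarrow> moll q = 0"
  using norm_ge_1_inner[of q] by (simp add: moll_def bump_jet_def)

lemma dmoll_eq_0: "1 \<le> norm q \<Longrightarrow> dmoll e q = 0"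
  using norm_ge_1_inner[of q] by (simp add: dmoll_def bump_jet_def)

lemma continuous_moll [continuous_intros]:
  "continuous_on A f \<Longrightarrow> continuous_on A (\<lambda>x. moll (f x))"
  unfolding moll_def
  by (auto intro!: continuous_intros continuous_on_compose2[OF continuous_bump_jet[of UNIV]])

lemma continuous_dmoll [continuous_intros]:
  "continuous_on A f \<Longrightarrow> continuous_on A (\<lambda>x. dmoll e (f x))"
  unfolding dmoll_def
  by (auto intro!: continuous_intros continuous_on_compose2[OF continuous_bump_jet[of UNIV]])

lemma has_derivative_moll_scaled:
  "((\<lambda>q. moll ((q - p) /\<^sub>R \<epsilon>)) has_derivative (\<lambda>h. dmoll h ((q - p) /\<^sub>R \<epsilon>) / \<epsilon>)) (at q)"
proof -
  have eq: "moll ((q - p) /\<^sub>R \<epsilon>) = bump_jet 0 (1 - (1 / \<epsilon>\<^sup>2) * ((q - p) \<bullet> (q - p)))" for q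
    by (simp add: moll_def power2_eq_square divide_inverse mult.assoc)
  show ?thesis unfolding eq
    by (rule has_derivative_eq_rhs, rule has_derivative_bump_jet_quadratic)
       (auto simp: dmoll_def power2_eq_square divide_inverse inner_commute mult.assoc fun_eq_iff
          simp flip: numeral_2_eq_2)
qed

lemma test_function_moll:
  fixes p :: "'a::euclidean_space"
  assumes "0 < \<epsilon>" and "cball p \<epsilon> \<subseteq> U"
  shows "test_function U (\<lambda>q. moll ((q - p) /\<^sub>R \<epsilon>))"
proof -
  have eq: "(\<lambda>q. moll ((q - p) /\<^sub>R \<epsilon>)) = (\<lambda>q. bump_jet 0 (1 - (1 / \<epsilon>\<^sup>2) * ((q - p) \<bullet> (q - p))))"
    by (auto simp: moll_def power2_eq_square divide_inverse mult.assoc)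
  have "{q. moll ((q - p) /\<^sub>R \<epsilon>) \<noteq> 0} \<subseteq> cball p \<epsilon>"
  proof safe
    fix q assume "moll ((q - p) /\<^sub>R \<epsilon>) \<noteq> 0"
    then have "norm ((q - p) /\<^sub>R \<epsilon>) < 1" using moll_eq_0 not_le by blast
    then have "norm (q - p) < \<epsilon>"
      using assms(1) by (simp only: norm_scaleR) (simp add: field_simps)
    then show "q \<in> cball p \<epsilon>" by (simp add: dist_norm norm_minus_commute)
  qed
  then have "closure {q. moll ((q - p) /\<^sub>R \<epsilon>) \<noteq> 0} \<subseteq> cball p \<epsilon>"
    by (simp add: closure_minimal)
  moreover have "compact (closure {q. moll ((q - p) /\<^sub>R \<epsilon>) \<noteq> 0})"
    using calculation bounded_subset[OF bounded_cball] by (auto simp: compact_eq_bounded_closed)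
  moreover have "Ck k (\<lambda>q. moll ((q - p) /\<^sub>R \<epsilon>))" for k
    unfolding eq by (rule Ck_bump_jet_quadratic)
  ultimately show ?thesis
    using assms(2) unfolding test_function_def by auto
qed

section \<open>Compactly supported functions and their Lebesgue integrals\<close>

lemma continuous_extend_zero:
  fixes f :: "'a::euclidean_space \<Rightarrow> 'b::real_normed_vector"
  assumes "open Q" "compact K" "K \<subseteq> Q" "continuous_on Q f" "\<And>x. x \<notin> K \<Longrightarrow> f x = 0"
  shows "continuous_on UNIV f"
proof -
  have "continuous_on (- K) f"
    by (rule continuous_on_cong[THEN iffD2, of _ _ _ "\<lambda>_. 0"]) (auto simp: assms)
  then have "continuous_on (Q \<union> - K) f"
    using assms by (intro continuous_on_open_Un) (auto intro: compact_imp_closed open_Compl)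
  moreover have "Q \<union> - K = UNIV" using assms(3) by auto
  ultimately show ?thesis by simp
qed

lemma integrable_bounded_support:
  fixes f :: "'a::euclidean_space \<Rightarrow> 'b::{banach,second_countable_topology}"
  assumes "f \<in> borel_measurable borel" "bounded K" "\<And>x. x \<notin> K \<Longrightarrow> f x = 0" "\<And>x. norm (f x) \<le> M"
  shows "integrable lborel f"
proof -
  obtain R where "\<And>x. x \<in> K \<Longrightarrow> norm x \<le> R" using assms(2) unfolding bounded_iff by blast
  then have R: "K \<subseteq> cball 0 R" by auto
  have "f x = 0" if "x \<notin> cball 0 R" for x using assms(3) R that by blast
  moreover have "emeasure lborel (cball (0::'a) R) < \<infinity>" by (rule emeasure_lborel_cball_finite)
  ultimately show ?thesis
    using assms by (intro integrableI_bounded_set[of "cball 0 R" _ _ M]) (auto intro!: AE_I2)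
qed

lemma bounded_continuous_support:
  fixes f :: "'a::euclidean_space \<Rightarrow> 'b::real_normed_vector"
  assumes "continuous_on UNIV f" "compact K" "\<And>x. x \<notin> K \<Longrightarrow> f x = 0"
  obtains M where "0 \<le> M" "\<And>x. norm (f x) \<le> M"
proof -
  have "bounded (f ` K)"
    using assms by (meson compact_continuous_image compact_imp_bounded continuous_on_subset subset_UNIV)
  then obtain M where "\<And>x. x \<in> K \<Longrightarrow> norm (f x) \<le> M" by (auto simp: bounded_iff)
  then have "norm (f x) \<le> max M 0" for x using assms(3)[of x] by (cases "x \<in> K") (auto simp: le_max_iff_disj)
  then show ?thesis by (intro that[of "max M 0"]) auto
qed

lemma integrable_continuous_support:
  fixes f :: "'a::euclidean_space \<Rightarrow> 'b::{banach,second_countable_topology}"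
  assumes "continuous_on UNIV f" "compact K" "\<And>x. x \<notin> K \<Longrightarrow> f x = 0"
  shows "integrable lborel f"
proof -
  obtain M where "\<And>x. norm (f x) \<le> M" using bounded_continuous_support[OF assms] by metis
  then show ?thesis
    by (intro integrable_bounded_support[of f K M])
       (use assms in \<open>auto intro: compact_imp_bounded borel_measurable_continuous_onI\<close>)
qed

lemma integral_lborel_translate:
  fixes f :: "'a::euclidean_space \<Rightarrow> real"
  assumes "f \<in> borel_measurable borel"
  shows "(LINT x|lborel. f (c + x)) = (LINT x|lborel. f x)"
proof -
  have "(LINT x|lborel. f x) = (LINT x|distr lborel borel ((+) c). f x)"
    by (simp add: lborel_distr_plus)
  also have "\<dots> = (LINT x|lborel. f (c + x))"
    using assms by (intro integral_distr) auto
  finally show ?thesis by simp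
qed

lemma integral_lborel_reflect:
  fixes f :: "'a::euclidean_space \<Rightarrow> real"
  assumes "f \<in> borel_measurable borel"
  shows "(LINT x|lborel. f (c - x)) = (LINT x|lborel. f x)"
proof -
  have "(lborel :: 'a measure) = density (distr lborel borel (\<lambda>x. c + (-1) *\<^sub>R x)) (\<lambda>_. ennreal (\<bar>-1\<bar> ^ DIM('a)))"
    by (rule lborel_affine) simp
  then have eq: "(lborel :: 'a measure) = distr lborel borel (\<lambda>x. c - x)"
    by (simp add: density_1)
  have "(LINT x|lborel. f x) = (LINT x|distr lborel borel (\<lambda>x. c - x). f x)"
    by (subst eq) simp
  also have "\<dots> = (LINT x|lborel. f (c - x))"
    using assms by (intro integral_distr) auto
  finally show ?thesis by simp
qed

lemma integral_lborel_scale: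
  fixes f :: "'a::euclidean_space \<Rightarrow> real"
  assumes "f \<in> borel_measurable borel" and "0 < c"
  shows "(LINT x|lborel. f x) = c ^ DIM('a) * (LINT x|lborel. f (c *\<^sub>R x))"
proof -
  have eq: "(lborel :: 'a measure) = density (distr lborel borel (\<lambda>x. 0 + c *\<^sub>R x)) (\<lambda>_. ennreal (\<bar>c\<bar> ^ DIM('a)))"
    using assms by (intro lborel_affine) auto
  have "(LINT x|lborel. f x) = (LINT x|density (distr lborel borel (\<lambda>x. 0 + c *\<^sub>R x)) (\<lambda>_. ennreal (\<bar>c\<bar> ^ DIM('a))). f x)"
    by (subst eq) simp
  also have "\<dots> = (LINT x|distr lborel borel (\<lambda>x. 0 + c *\<^sub>R x). \<bar>c\<bar> ^ DIM('a) * f x)"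
    using assms by (subst integral_density) auto
  also have "\<dots> = (LINT x|lborel. \<bar>c\<bar> ^ DIM('a) * f (0 + c *\<^sub>R x))"
    using assms by (intro integral_distr) auto
  finally show ?thesis using assms by simp
qed

text \<open>Difference quotients of \<open>F\<close> have integral zero by translation invariance.
  By the mean value theorem they are bounded by the maximum of |\<open>F'\<close>|, so dominated
  convergence carries this over to \<open>F'\<close>. The integrations by parts in space-time below
  rest on this fact.\<close>

lemma integral_directional_derivative_zero:
  fixes F F' :: "'a::euclidean_space \<Rightarrow> real"
  assumes cont: "continuous_on UNIV F" "continuous_on UNIV F'"
    and K: "compact K" "\<And>x. x \<notin> K \<Longrightarrow> F x = 0" "\<And>x. x \<notin> K \<Longrightarrow> F' x = 0"
    and deriv: "\<And>x. ((\<lambda>s. F (x + s *\<^sub>R e)) has_real_derivative F' x) (at 0)"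
  shows "(LINT x|lborel. F' x) = 0"
proof -
  obtain B where B: "0 \<le> B" "\<And>x. \<bar>F' x\<bar> \<le> B"
    using bounded_continuous_support[OF cont(2) K(1,3)] by auto
  have D: "((\<lambda>s. F (x + s *\<^sub>R e)) has_real_derivative F' (x + s *\<^sub>R e)) (at s)" for x s
  proof -
    have "((\<lambda>r. F ((x + s *\<^sub>R e) + (r - s) *\<^sub>R e)) has_real_derivative F' (x + s *\<^sub>R e)) (at s)"
    proof -
      have A: "((\<lambda>r. r - s) has_real_derivative 1) (at s)" by (auto intro!: derivative_eq_intros)
      have B: "((\<lambda>r. F ((x + s *\<^sub>R e) + r *\<^sub>R e)) has_real_derivative F' (x + s *\<^sub>R e)) (at (s - s))"
        using deriv by simp
      show ?thesis using DERIV_chain2[OF B A] by simp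
    qed
    then show ?thesis by (simp add: algebra_simps)
  qed
  \<comment> \<open>Steps of length at most 1 keep all quotients supported in one ball, of radius
    \<open>R + norm e\<close>.\<close>
  define h where "h n = 1 / (real n + 1)" for n
  have h: "0 < h n" "h n \<le> 1" for n by (auto simp: h_def)
  define d where "d n x = (F (h n *\<^sub>R e + x) - F x) / h n" for n x
  have dB: "\<bar>d n x\<bar> \<le> B" for n x
  proof -
    obtain z where "F (x + h n *\<^sub>R e) - F (x + 0 *\<^sub>R e) = (h n - 0) * F' (x + z *\<^sub>R e)"
      using MVT2[OF h(1)[of n], of "\<lambda>s. F (x + s *\<^sub>R e)" "\<lambda>s. F' (x + s *\<^sub>R e)"] D by blast
    then have "d n x = F' (x + z *\<^sub>R e)" using h(1)[of n] by (simp add: d_def add.commute)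
    then show ?thesis using B by simp
  qed
  obtain R where "\<And>x. x \<in> K \<Longrightarrow> norm x \<le> R" using compact_imp_bounded[OF K(1)] unfolding bounded_iff by blast
  then have R: "K \<subseteq> cball 0 R" by auto
  let ?S = "cball (0::'a) (R + norm e)"
  have d0: "d n x = 0" if "x \<notin> ?S" for n x
  proof -
    have "x \<notin> K" using that R by (smt (verit, best) mem_cball norm_ge_zero subsetD dist_norm)
    moreover have "h n *\<^sub>R e + x \<notin> K"
    proof
      assume "h n *\<^sub>R e + x \<in> K"
      then have "norm (h n *\<^sub>R e + x) \<le> R" using R by auto
      moreover have "norm (h n *\<^sub>R e) \<le> norm e" using h[of n] by (simp add: mult_left_le_one_le)
      ultimately have "norm x \<le> R + norm e"
        by (smt (verit) add_diff_cancel_left' norm_triangle_sub norm_minus_commute norm_triangle_ineq4)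
      then show False using that by simp
    qed
    ultimately show ?thesis by (simp add: d_def K)
  qed
  have F: "F \<in> borel_measurable borel" "F' \<in> borel_measurable borel"
    using cont borel_measurable_continuous_onI by blast+
  have intF: "integrable lborel F" using integrable_continuous_support[OF cont(1) K(1,2)] .
  have "(LINT x|lborel. d n x) = 0" for n
  proof -
    obtain C where C: "\<And>x. norm (F x) \<le> C" using bounded_continuous_support[OF cont(1) K(1,2)] by metis
    have "integrable lborel (\<lambda>x. F (h n *\<^sub>R e + x))"
    proof (rule integrable_bounded_support[of _ "?S"])
      from C show "norm (F (h n *\<^sub>R e + x)) \<le> C" for x by simp
      show "F (h n *\<^sub>R e + x) = 0" if "x \<notin> ?S" for x
      proof -
        have "x \<notin> K" using that R by (smt (verit, best) mem_cball norm_ge_zero subsetD dist_norm)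
        then show ?thesis using d0[OF that, of n] h(1)[of n] K(2) by (simp add: d_def)
      qed
    qed (use F in auto)
    then show ?thesis
      unfolding d_def using intF integral_lborel_translate[OF F(1), of "h n *\<^sub>R e"] by simp
  qed
  moreover have "(\<lambda>n. LINT x|lborel. d n x) \<longlonglongrightarrow> (LINT x|lborel. F' x)"
  proof (rule integral_dominated_convergence[where w = "\<lambda>x. indicator ?S x * B"])
    show "AE x in lborel. (\<lambda>n. d n x) \<longlonglongrightarrow> F' x"
    proof (rule AE_I2)
      fix x
      have "((\<lambda>s. (F (x + (0 + s) *\<^sub>R e) - F (x + 0 *\<^sub>R e)) / s) \<longlongrightarrow> F' x) (at 0)"
        using deriv[of x] unfolding DERIV_def .
      note A = this
      have B: "filterlim h (at 0) sequentially"
      proof -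
        have "h = (\<lambda>n. inverse (real (Suc n)))" by (auto simp: h_def inverse_eq_divide add.commute)
        then have "h \<longlonglongrightarrow> 0" using LIMSEQ_inverse_real_of_nat by simp
        then show ?thesis using h(1) by (auto simp: filterlim_at less_imp_neq[THEN not_sym])
      qed
      show "(\<lambda>n. d n x) \<longlonglongrightarrow> F' x"
        unfolding d_def using filterlim_compose[OF A B] by (simp add: add.commute)
    qed
    show "integrable lborel (\<lambda>x. indicator ?S x * B)"
      using emeasure_lborel_cball_finite[of 0 "R + norm e"]
      by (intro integrable_mult_left integrable_real_indicator) auto
    show "AE x in lborel. norm (d n x) \<le> indicator ?S x * B" for n
      using dB d0 B(1) by (auto intro!: AE_I2 simp: indicator_def)
  qed (use F in \<open>auto simp: d_def\<close>)
  ultimately show ?thesis by (simp add: LIMSEQ_const_iff)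
qed

text \<open>Space and time regularity of test functions are kept apart because \<open>u\<close> has
  a continuous gradient in space but no known derivative in time: a product of \<open>u\<close> with
  a smooth cutoff satisfies \<open>Cx\<close> and in general not \<open>Ct\<close>.\<close>

definition Cx :: "('a::euclidean_space \<times> real) set \<Rightarrow> ('a \<times> real \<Rightarrow> real) \<Rightarrow> ('a \<times> real \<Rightarrow> 'a) \<Rightarrow> bool" where
  "Cx K \<psi> g \<longleftrightarrow> compact K \<and> continuous_on UNIV \<psi> \<and> continuous_on UNIV g \<and>
     (\<forall>p. p \<notin> K \<longrightarrow> \<psi> p = 0 \<and> g p = 0) \<and>
     (\<forall>x t. ((\<lambda>x. \<psi> (x, t)) has_derivative (\<lambda>h. g (x, t) \<bullet> h)) (at x))"

definition Ct :: "('a::euclidean_space \<times> real) set \<Rightarrow> ('a \<times> real \<Rightarrow> real) \<Rightarrow> ('a \<times> real \<Rightarrow> real) \<Rightarrow> bool" where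
  "Ct K \<psi> \<psi>t \<longleftrightarrow> compact K \<and> continuous_on UNIV \<psi> \<and> continuous_on UNIV \<psi>t \<and>
     (\<forall>p. p \<notin> K \<longrightarrow> \<psi> p = 0 \<and> \<psi>t p = 0) \<and>
     (\<forall>x t. ((\<lambda>t. \<psi> (x, t)) has_real_derivative \<psi>t (x, t)) (at t))"

lemma CxI:
  assumes "open Q" "compact K" "K \<subseteq> Q" "continuous_on Q \<psi>" "continuous_on Q g"
    "\<And>p. p \<notin> K \<Longrightarrow> \<psi> p = 0" "\<And>p. p \<notin> K \<Longrightarrow> g p = 0"
    "\<And>x t. (x, t) \<in> Q \<Longrightarrow> ((\<lambda>x. \<psi> (x, t)) has_derivative (\<lambda>h. g (x, t) \<bullet> h)) (at x)"
  shows "Cx K \<psi> g"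
proof -
  have "((\<lambda>x. \<psi> (x, t)) has_derivative (\<lambda>h. g (x, t) \<bullet> h)) (at x)" for x t
  proof (cases "(x, t) \<in> Q")
    case False
    have 1: "open {x. (x, t) \<in> - K}"
    proof -
      have "continuous_on UNIV (\<lambda>x. (x, t))" by (intro continuous_intros)
      then show ?thesis
        using open_vimage[of "- K" "\<lambda>x. (x, t)"] compact_imp_closed[OF assms(2)]
        by (simp add: vimage_def open_Compl)
    qed
    have 2: "((\<lambda>x. 0) has_derivative (\<lambda>h. g (x, t) \<bullet> h)) (at x)"
    proof -
      have "g (x, t) = 0" using False assms(3) assms(7)[of "(x, t)"] by blast
      then show ?thesis by simp
    qed
    show ?thesis
      by (rule has_derivative_transform_within_open[OF 2 1]) (use False assms(3) in \<open>auto simp: assms(6)\<close>)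
  qed (use assms in auto)
  then show ?thesis
    unfolding Cx_def using assms(2,6,7)
      continuous_extend_zero[OF assms(1-3) assms(4,6)] continuous_extend_zero[OF assms(1-3) assms(5,7)] by simp
qed

lemma CtI:
  assumes "open Q" "compact K" "K \<subseteq> Q" "continuous_on Q \<psi>" "continuous_on Q g"
    "\<And>p. p \<notin> K \<Longrightarrow> \<psi> p = 0" "\<And>p. p \<notin> K \<Longrightarrow> g p = 0"
    "\<And>x t. (x, t) \<in> Q \<Longrightarrow> ((\<lambda>t. \<psi> (x, t)) has_real_derivative g (x, t)) (at t)"
  shows "Ct K \<psi> g"
proof -
  have "((\<lambda>t. \<psi> (x, t)) has_real_derivative g (x, t)) (at t)" for x t
  proof (cases "(x, t) \<in> Q")
    case False
    have 1: "open {t. (x, t) \<in> - K}"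
    proof -
      have "continuous_on UNIV (\<lambda>t. (x, t))" by (intro continuous_intros)
      then show ?thesis
        using open_vimage[of "- K" "\<lambda>t. (x, t)"] compact_imp_closed[OF assms(2)]
        by (simp add: vimage_def open_Compl)
    qed
    have 2: "((\<lambda>t. 0) has_real_derivative g (x, t)) (at t)"
    proof -
      have "g (x, t) = 0" using False assms(3) assms(7)[of "(x, t)"] by blast
      then show ?thesis by simp
    qed
    show ?thesis
      by (rule has_field_derivative_transform_within_open[OF 2 1]) (use False assms(3) in \<open>auto simp: assms(6)\<close>)
  qed (use assms in auto)
  then show ?thesis
    unfolding Ct_def using assms(2,6,7)
      continuous_extend_zero[OF assms(1-3) assms(4,6)] continuous_extend_zero[OF assms(1-3) assms(5,7)] by simp
qed

lemma Fubini_bounded_support: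
  fixes F :: "'a::euclidean_space \<Rightarrow> 'b::euclidean_space \<Rightarrow> real"
  assumes [measurable]: "(\<lambda>z. F (fst z) (snd z)) \<in> borel_measurable borel"
    and K: "bounded K1" "bounded K2" "\<And>p q. p \<notin> K1 \<or> q \<notin> K2 \<Longrightarrow> F p q = 0"
    and M: "\<And>p q. \<bar>F p q\<bar> \<le> M"
  shows "(LINT p|lborel. LINT q|lborel. F p q) = (LINT q|lborel. LINT p|lborel. F p q)"
    and "integrable lborel (\<lambda>q. LINT p|lborel. F p q)"
proof -
  have int: "integrable (lborel \<Otimes>\<^sub>M lborel) (\<lambda>z. F (fst z) (snd z))"
    unfolding lborel_prod
    by (rule integrable_bounded_support[of _ "K1 \<times> K2" M]) (use K M in \<open>auto simp: mem_Times_iff intro: bounded_Times\<close>)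
  then have int': "integrable (lborel \<Otimes>\<^sub>M lborel) (\<lambda>(p, q). F p q)"
    by (simp add: case_prod_unfold)
  show "(LINT p|lborel. LINT q|lborel. F p q) = (LINT q|lborel. LINT p|lborel. F p q)"
    using lborel_pair.Fubini_integral[OF int'] by simp
  show "integrable lborel (\<lambda>q. LINT p|lborel. F p q)"
    using lborel_pair.integrable_snd[OF int'] by simp
qed

lemma uniformly_continuous_support:
  fixes f :: "'a::euclidean_space \<Rightarrow> 'b::real_normed_vector"
  assumes "continuous_on UNIV f" "compact K" "\<And>x. x \<notin> K \<Longrightarrow> f x = 0" "0 < e"
  obtains d where "0 < d" "\<And>x y. norm (x - y) < d \<Longrightarrow> norm (f x - f y) \<le> e"
proof -
  obtain R where R: "\<And>x. x \<in> K \<Longrightarrow> norm x \<le> R"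
    using compact_imp_bounded[OF assms(2)] unfolding bounded_iff by blast
  have "uniformly_continuous_on (cball 0 (R + 1)) f"
    using assms(1) by (intro compact_uniformly_continuous) (auto intro: continuous_on_subset)
  then obtain d where d: "0 < d" "\<And>x y. x \<in> cball 0 (R + 1) \<Longrightarrow> y \<in> cball 0 (R + 1) \<Longrightarrow> dist y x < d \<Longrightarrow> dist (f y) (f x) < e"
    unfolding uniformly_continuous_on_def using assms(4) by metis
  have "norm (f x - f y) \<le> e" if "norm (x - y) < min d 1" for x y
  proof (cases "x \<in> cball 0 (R + 1) \<and> y \<in> cball 0 (R + 1)")
    case True
    then show ?thesis using d(2)[of y x] that by (auto simp: dist_norm)
  next
    case False
    have "norm x \<le> norm y + norm (x - y)" "norm y \<le> norm x + norm (x - y)"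
      using norm_triangle_sub[of x y] norm_triangle_sub[of y x] by (auto simp: norm_minus_commute)
    then have "\<not> norm x \<le> R" "\<not> norm y \<le> R" using False that by auto
    then have "f x = 0" "f y = 0" using R assms(3) by blast+
    then show ?thesis using assms(4) by simp
  qed
  then show ?thesis using d(1) by (intro that[of "min d 1"]) auto
qed

section \<open>Convolution with rescaled mollifiers\<close>

lemma moll_le_1: "moll q \<le> 1"
  by (simp add: moll_def bump_jet_def)

lemma borel_measurable_moll [measurable]: "moll \<in> borel_measurable borel"
  by (intro borel_measurable_continuous_onI continuous_intros)

lemma borel_measurable_dmoll [measurable]: "dmoll e \<in> borel_measurable borel"
  by (intro borel_measurable_continuous_onI continuous_intros)

lemma bounded_dmoll:
  obtains M where "0 \<le> M" "\<And>e q. \<bar>dmoll e q\<bar> \<le> M * norm e"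
proof -
  obtain M where M: "0 \<le> M" "\<And>q::'a. norm (bump_jet 2 (1 - q \<bullet> q)) \<le> M"
  proof (rule bounded_continuous_support[of "\<lambda>q::'a. bump_jet 2 (1 - q \<bullet> q)" "cball 0 1"])
    show "continuous_on UNIV (\<lambda>q::'a. bump_jet 2 (1 - q \<bullet> q))"
      by (auto intro!: continuous_intros continuous_on_compose2[OF continuous_bump_jet[of UNIV]])
    show "bump_jet 2 (1 - x \<bullet> x) = 0" if "x \<notin> cball 0 1" for x :: 'a
      using that norm_ge_1_inner[of x] by (simp add: bump_jet_def)
  qed auto
  have "\<bar>dmoll e q\<bar> \<le> (2 * M) * norm e" for e q :: 'a
  proof (cases "1 \<le> norm q")
    case False
    have "\<bar>q \<bullet> e\<bar> \<le> 1 * norm e"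
      using Cauchy_Schwarz_ineq2[of q e] False mult_right_mono[of "norm q" 1 "norm e"] by auto
    then have "\<bar>bump_jet 2 (1 - q \<bullet> q)\<bar> * (2 * \<bar>q \<bullet> e\<bar>) \<le> M * (2 * norm e)"
      using M by (intro mult_mono) auto
    then show ?thesis by (simp add: dmoll_def abs_mult)
  qed (use M in \<open>simp add: dmoll_eq_0\<close>)
  then show ?thesis using M by (intro that[of "2 * M"]) auto
qed

definition moll_mass :: "'a::euclidean_space itself \<Rightarrow> real \<Rightarrow> real" where
  "moll_mass _ \<epsilon> = (LINT x|lborel. moll ((x :: 'a) /\<^sub>R \<epsilon>))"

lemma scaled_eq_0:
  assumes "0 < \<epsilon>" "\<epsilon> \<le> norm (x::'a::euclidean_space)"
  shows "moll (x /\<^sub>R \<epsilon>) = 0" "dmoll e (x /\<^sub>R \<epsilon>) = 0"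
proof -
  have "1 \<le> norm (x /\<^sub>R \<epsilon>)" using assms by (simp add: field_simps)
  then show "moll (x /\<^sub>R \<epsilon>) = 0" "dmoll e (x /\<^sub>R \<epsilon>) = 0" by (simp_all add: moll_eq_0 dmoll_eq_0)
qed

lemma moll_mass_scale:
  assumes "0 < \<epsilon>"
  shows "moll_mass TYPE('a::euclidean_space) \<epsilon> = \<epsilon> ^ DIM('a) * moll_mass TYPE('a) 1"
  using assms unfolding moll_mass_def
  by (subst integral_lborel_scale[of _ \<epsilon>]) auto

lemma integrable_moll_scaled:
  assumes "0 < \<epsilon>"
  shows "integrable lborel (\<lambda>x::'a::euclidean_space. moll (x /\<^sub>R \<epsilon>))"
    "integrable lborel (\<lambda>p::'a. moll ((q - p) /\<^sub>R \<epsilon>))"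
proof -
  have "moll ((x - y) /\<^sub>R \<epsilon>) = 0" if "y \<notin> cball x \<epsilon>" for x y :: 'a
    using that scaled_eq_0[OF assms, of "x - y"] by (simp add: dist_norm)
  moreover have "moll (y /\<^sub>R \<epsilon>) = 0" if "y \<notin> cball 0 \<epsilon>" for y :: 'a
    using that scaled_eq_0[OF assms, of y] by (simp add: dist_norm)
  ultimately show "integrable lborel (\<lambda>x::'a. moll (x /\<^sub>R \<epsilon>))" "integrable lborel (\<lambda>p::'a. moll ((q - p) /\<^sub>R \<epsilon>))"
    by (intro integrable_continuous_support[where K = "cball 0 \<epsilon>"] integrable_continuous_support[where K = "cball q \<epsilon>"];
        auto intro!: continuous_intros)+
qed

lemma moll_mass_translate:
  fixes q :: "'a::euclidean_space"
  shows "(LINT p|lborel. moll ((q - p) /\<^sub>R \<epsilon>)) = moll_mass TYPE('a) \<epsilon>"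
  unfolding moll_mass_def
  using integral_lborel_reflect[of "\<lambda>x. moll (x /\<^sub>R \<epsilon>)" q] by simp

lemma moll_mass_pos:
  assumes "0 < \<epsilon>"
  shows "0 < moll_mass TYPE('a::euclidean_space) \<epsilon>"
proof -
  have "moll_mass TYPE('a) \<epsilon> \<noteq> 0"
  proof
    assume "moll_mass TYPE('a) \<epsilon> = 0"
    then have "AE x in lborel. moll ((x::'a) /\<^sub>R \<epsilon>) = 0"
      unfolding moll_mass_def
      using integral_nonneg_eq_0_iff_AE[OF integrable_moll_scaled(1)[where 'a = 'a, OF assms]] by (simp add: moll_nonneg)
    then have "AE x in lborel. (x::'a) \<notin> ball 0 \<epsilon>"
    proof eventually_elim
      case (elim x)
      show ?case
      proof
        assume "x \<in> ball 0 \<epsilon>"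
        then have "norm (x /\<^sub>R \<epsilon>) < 1" using assms by (simp add: field_simps)
        then have "(norm (x /\<^sub>R \<epsilon>))\<^sup>2 < 1" by (simp add: power_less_one_iff abs_square_less_1)
        then have "0 < 1 - (x /\<^sub>R \<epsilon>) \<bullet> (x /\<^sub>R \<epsilon>)" by (simp only: dot_square_norm)
        then have "0 < moll (x /\<^sub>R \<epsilon>)" unfolding moll_def bump_jet_def by simp
        with elim show False by simp
      qed
    qed
    then have "ball (0::'a) \<epsilon> \<in> null_sets lborel"
      using AE_iff_null_sets[of "ball (0::'a) \<epsilon>" lborel] by simp
    then have "negligible (ball (0::'a) \<epsilon>)"
      by (simp add: negligible_iff_null_sets null_sets_completionI)
    then show False using assms open_not_negligible[of "ball (0::'a) \<epsilon>"] by auto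
  qed
  moreover have "0 \<le> moll_mass TYPE('a) \<epsilon>"
    unfolding moll_mass_def by (simp add: moll_nonneg)
  ultimately show ?thesis by simp
qed

text \<open>The kernel forces |q - p| < \<epsilon>, so by uniform continuity \<open>B p\<close> may
  be replaced by \<open>B q\<close> with an error uniform in \<open>q\<close>. The smoothing falls
  on \<open>B\<close> alone, which lets \<open>A\<close> be discontinuous; this is where the
  truncated \<open>u\<close>, its gradient and \<open>f\<close> go.\<close>

lemma moll_convolution_tendsto:
  fixes A B :: "'a::euclidean_space \<Rightarrow> 'b::euclidean_space"
  assumes A: "A \<in> borel_measurable borel" "bounded K1" "\<And>q. q \<notin> K1 \<Longrightarrow> A q = 0" "\<And>q. norm (A q) \<le> M"
    and B: "continuous_on UNIV B" "compact K" "\<And>q. q \<notin> K \<Longrightarrow> B q = 0"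
  shows "((\<lambda>\<epsilon>. (LINT q|lborel. LINT p|lborel. (A q \<bullet> B p) * moll ((q - p) /\<^sub>R \<epsilon>)) / moll_mass TYPE('a) \<epsilon>)
     \<longlongrightarrow> (LINT q|lborel. A q \<bullet> B q)) (at_right 0)"
proof (rule tendstoI)
  fix e :: real assume "0 < e"
  note [measurable] = A(1) borel_measurable_continuous_onI[OF B(1)]
  obtain N where N: "0 \<le> N" "\<And>x. norm (B x) \<le> N" using bounded_continuous_support[OF B] by metis
  have intA: "integrable lborel (\<lambda>q. norm (A q))"
    by (rule integrable_bounded_support[of _ K1 M]) (use A in auto)
  have intAB: "integrable lborel (\<lambda>q. A q \<bullet> B q)"
  proof (rule integrable_bounded_support[of _ K1 "M * N"])
    show "norm (A x \<bullet> B x) \<le> M * N" for x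
      using Cauchy_Schwarz_ineq2[of "A x" "B x"] mult_mono[OF A(4)[of x] N(2)[of x]] A(4)[of x]
      by (smt (verit) norm_ge_zero real_norm_def)
  qed (use A in auto)
  define I where "I = (LINT q|lborel. norm (A q))"
  have I: "0 \<le> I" unfolding I_def by simp
  define w where "w = e / (2 * (I + 1))"
  have "0 < e * (I + 2)" using \<open>0 < e\<close> I by simp
  then have w: "0 < w" "w * I < e" using \<open>0 < e\<close> I by (auto simp: w_def field_simps)
  obtain d where d: "0 < d" "\<And>x y. norm (x - y) < d \<Longrightarrow> norm (B x - B y) \<le> w"
    using uniformly_continuous_support[OF B w(1)] by metis
  show "\<forall>\<^sub>F \<epsilon> in at_right 0. dist ((LINT q|lborel. LINT p|lborel. (A q \<bullet> B p) * moll ((q - p) /\<^sub>R \<epsilon>)) / moll_mass TYPE('a) \<epsilon>)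
      (LINT q|lborel. A q \<bullet> B q) < e"
    unfolding eventually_at_right_field
  proof (intro exI[of _ d] conjI d(1) allI impI)
    fix \<epsilon> :: real assume \<epsilon>: "0 < \<epsilon>" "\<epsilon> < d"
    let ?Z = "moll_mass TYPE('a) \<epsilon>"
    have Z: "0 < ?Z" by (rule moll_mass_pos) fact
    have bd: "\<bar>A q \<bullet> B p * moll ((q - p) /\<^sub>R \<epsilon>)\<bar> \<le> M * N" for p q
    proof -
      have "\<bar>A q \<bullet> B p\<bar> \<le> M * N"
        using Cauchy_Schwarz_ineq2[of "A q" "B p"] mult_mono[OF A(4)[of q] N(2)[of p]] A(4)[of q]
        by (smt (verit) norm_ge_zero)
      then show ?thesis
        using mult_mono[of "\<bar>A q \<bullet> B p\<bar>" "M * N" "moll ((q - p) /\<^sub>R \<epsilon>)" 1] moll_nonneg moll_le_1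
        by (fastforce simp: abs_mult)
    qed
    have meas: "(\<lambda>z. (A (snd z) \<bullet> B (fst z)) * moll ((snd z - fst z) /\<^sub>R \<epsilon>)) \<in> borel_measurable borel"
      unfolding borel_prod[symmetric] by measurable
    have int1: "integrable lborel (\<lambda>q. LINT p|lborel. (A q \<bullet> B p) * moll ((q - p) /\<^sub>R \<epsilon>))"
      by (rule Fubini_bounded_support(2)[of "\<lambda>p q. (A q \<bullet> B p) * moll ((q - p) /\<^sub>R \<epsilon>)" K K1 "M * N", OF meas])
         (use A B bd in \<open>auto intro: compact_imp_bounded\<close>)
    have pt: "\<bar>(LINT p|lborel. (A q \<bullet> B p) * moll ((q - p) /\<^sub>R \<epsilon>)) - ?Z * (A q \<bullet> B q)\<bar> \<le> norm (A q) * w * ?Z" for q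
    proof -
      have i2: "integrable lborel (\<lambda>p. (A q \<bullet> B p) * moll ((q - p) /\<^sub>R \<epsilon>))"
        by (rule integrable_bounded_support[of _ K "M * N"])
           (use B bd in \<open>auto intro: compact_imp_bounded\<close>)
      have "(LINT p|lborel. (A q \<bullet> B p) * moll ((q - p) /\<^sub>R \<epsilon>)) - ?Z * (A q \<bullet> B q)
         = (LINT p|lborel. (A q \<bullet> B p) * moll ((q - p) /\<^sub>R \<epsilon>) - (A q \<bullet> B q) * moll ((q - p) /\<^sub>R \<epsilon>))"
        using i2 integrable_moll_scaled(2)[OF \<epsilon>(1), of q]
        by (simp add: moll_mass_translate)
      also have "\<bar>\<dots>\<bar> \<le> (LINT p|lborel. (norm (A q) * w) * moll ((q - p) /\<^sub>R \<epsilon>))"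
      proof (rule integral_abs_bound_integral)
        show "\<bar>(A q \<bullet> B p) * moll ((q - p) /\<^sub>R \<epsilon>) - (A q \<bullet> B q) * moll ((q - p) /\<^sub>R \<epsilon>)\<bar> \<le> (norm (A q) * w) * moll ((q - p) /\<^sub>R \<epsilon>)" for p
        proof (cases "norm (q - p) < \<epsilon>")
          case True
          then have "norm (B p - B q) \<le> w" using d(2)[of p q] \<epsilon> by (simp add: norm_minus_commute)
          then have "\<bar>A q \<bullet> (B p - B q)\<bar> \<le> norm (A q) * w"
            using Cauchy_Schwarz_ineq2[of "A q" "B p - B q"] mult_left_mono[of _ w "norm (A q)"] by (meson norm_ge_zero order_trans)
          then show ?thesis
            using mult_right_mono[of "\<bar>A q \<bullet> (B p - B q)\<bar>" _ "moll ((q - p) /\<^sub>R \<epsilon>)"] moll_nonneg[of "(q - p) /\<^sub>R \<epsilon>"]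
            by (simp add: abs_mult inner_diff_right flip: left_diff_distrib)
        qed (use scaled_eq_0(1)[OF \<epsilon>(1), of "q - p"] in simp)
      qed (use i2 integrable_moll_scaled(2)[OF \<epsilon>(1), of q] in auto)
      finally show ?thesis by (simp add: moll_mass_translate)
    qed
    have "(LINT q|lborel. LINT p|lborel. (A q \<bullet> B p) * moll ((q - p) /\<^sub>R \<epsilon>)) - ?Z * (LINT q|lborel. A q \<bullet> B q)
       = (LINT q|lborel. (LINT p|lborel. (A q \<bullet> B p) * moll ((q - p) /\<^sub>R \<epsilon>)) - ?Z * (A q \<bullet> B q))"
      using int1 intAB by simp
    also have "\<bar>\<dots>\<bar> \<le> (LINT q|lborel. norm (A q) * w * ?Z)"
      by (rule integral_abs_bound_integral) (use pt int1 intAB intA in auto)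
    also have "\<dots> = I * w * ?Z" by (simp add: I_def)
    finally have "\<bar>(LINT q|lborel. LINT p|lborel. (A q \<bullet> B p) * moll ((q - p) /\<^sub>R \<epsilon>)) / ?Z - (LINT q|lborel. A q \<bullet> B q)\<bar> \<le> I * w"
      using Z by (simp add: field_simps abs_if split: if_splits)
    then show "dist ((LINT q|lborel. LINT p|lborel. (A q \<bullet> B p) * moll ((q - p) /\<^sub>R \<epsilon>)) / ?Z) (LINT q|lborel. A q \<bullet> B q) < e"
      using w by (simp add: dist_real_def mult.commute)
  qed
qed

text \<open>The kernel depends on q - p, so its derivative in \<open>q\<close> is minus its
  derivative in \<open>p\<close>; the integration by parts in \<open>p\<close> supplies the second
  minus sign.\<close>

lemma kernel_by_parts:
  fixes \<psi> \<psi>' :: "'a::euclidean_space \<Rightarrow> real"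
  assumes "0 < \<epsilon>" "continuous_on UNIV \<psi>" "continuous_on UNIV \<psi>'" "compact K"
    "\<And>p. p \<notin> K \<Longrightarrow> \<psi> p = 0" "\<And>p. p \<notin> K \<Longrightarrow> \<psi>' p = 0"
    "\<And>p. ((\<lambda>s. \<psi> (p + s *\<^sub>R e)) has_real_derivative \<psi>' p) (at 0)"
  shows "(LINT p|lborel. \<psi> p * (dmoll e ((q - p) /\<^sub>R \<epsilon>) / \<epsilon>)) = (LINT p|lborel. \<psi>' p * moll ((q - p) /\<^sub>R \<epsilon>))"
proof -
  let ?F' = "\<lambda>p. \<psi>' p * moll ((q - p) /\<^sub>R \<epsilon>) - \<psi> p * (dmoll e ((q - p) /\<^sub>R \<epsilon>) / \<epsilon>)"
  have int: "integrable lborel (\<lambda>p. \<psi>' p * moll ((q - p) /\<^sub>R \<epsilon>))"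
    "integrable lborel (\<lambda>p. \<psi> p * (dmoll e ((q - p) /\<^sub>R \<epsilon>) / \<epsilon>))"
    using assms by (auto intro!: integrable_continuous_support[where K = K] continuous_intros)
  have "(LINT p|lborel. ?F' p) = 0"
  proof (rule integral_directional_derivative_zero[of "\<lambda>p. \<psi> p * moll ((q - p) /\<^sub>R \<epsilon>)" _ K e])
    fix p
    have eq: "moll ((q - p) /\<^sub>R \<epsilon>) = moll ((p - q) /\<^sub>R \<epsilon>)" "dmoll e ((q - p) /\<^sub>R \<epsilon>) = - dmoll e ((p - q) /\<^sub>R \<epsilon>)" for p e
      by (metis minus_diff_eq scaleR_minus_right moll_minus, metis minus_diff_eq scaleR_minus_right dmoll_minus)
    have "((\<lambda>q'. moll ((q' - q) /\<^sub>R \<epsilon>)) has_derivative (\<lambda>h. dmoll h ((p - q) /\<^sub>R \<epsilon>) / \<epsilon>)) (at (p + 0 *\<^sub>R e))"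
      using has_derivative_moll_scaled[where p = q and q = p and \<epsilon> = \<epsilon>] by simp
    from has_derivative_compose[where f = "\<lambda>s. p + s *\<^sub>R e" and f' = "\<lambda>s. s *\<^sub>R e" and x = 0 and s = UNIV, OF _ this]
    have "((\<lambda>s. p + s *\<^sub>R e) has_derivative (\<lambda>s. s *\<^sub>R e)) (at 0) \<Longrightarrow>
       ((\<lambda>s. moll ((p + s *\<^sub>R e - q) /\<^sub>R \<epsilon>)) has_derivative (\<lambda>s. dmoll (s *\<^sub>R e) ((p - q) /\<^sub>R \<epsilon>) / \<epsilon>)) (at 0)" .
    moreover have "((\<lambda>s. p + s *\<^sub>R e) has_derivative (\<lambda>s. s *\<^sub>R e)) (at 0)"
      by (auto intro!: derivative_eq_intros)
    ultimately have X: "((\<lambda>s. moll ((p + s *\<^sub>R e - q) /\<^sub>R \<epsilon>)) has_derivative (\<lambda>s. dmoll (s *\<^sub>R e) ((p - q) /\<^sub>R \<epsilon>) / \<epsilon>)) (at 0)"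
      by blast
    have "((\<lambda>s. moll ((p + s *\<^sub>R e - q) /\<^sub>R \<epsilon>)) has_real_derivative dmoll e ((p - q) /\<^sub>R \<epsilon>) / \<epsilon>) (at 0)"
      unfolding has_field_derivative_def by (rule has_derivative_eq_rhs[OF X]) (auto simp: dmoll_def fun_eq_iff)
    then show "((\<lambda>s. \<psi> (p + s *\<^sub>R e) * moll ((q - (p + s *\<^sub>R e)) /\<^sub>R \<epsilon>)) has_real_derivative ?F' p) (at 0)"
      unfolding eq by (rule DERIV_cong[OF DERIV_mult[OF assms(7)]]) simp
  qed (use assms in \<open>auto intro!: continuous_intros\<close>)
  then show ?thesis using int by simp
qed

lemma CxD:
  assumes "Cx K \<psi> g"
  shows "compact K" "continuous_on UNIV \<psi>" "continuous_on UNIV g" "\<And>p. p \<notin> K \<Longrightarrow> \<psi> p = 0"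
    "\<And>p. p \<notin> K \<Longrightarrow> g p = 0" "\<And>x t. ((\<lambda>x. \<psi> (x, t)) has_derivative (\<lambda>h. g (x, t) \<bullet> h)) (at x)"
  using assms by (auto simp: Cx_def)

lemma CtD:
  assumes "Ct K \<psi> g"
  shows "compact K" "continuous_on UNIV \<psi>" "continuous_on UNIV g" "\<And>p. p \<notin> K \<Longrightarrow> \<psi> p = 0"
    "\<And>p. p \<notin> K \<Longrightarrow> g p = 0" "\<And>x t. ((\<lambda>t. \<psi> (x, t)) has_real_derivative g (x, t)) (at t)"
  using assms by (auto simp: Ct_def)

lemma onorm_inner_left_le: "onorm (\<lambda>h. a \<bullet> h) \<le> norm (a :: 'a::euclidean_space)"
  by (rule onorm_le) (simp add: Cauchy_Schwarz_ineq2)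

lemma C1_Lipschitz:
  assumes "Cx K \<zeta> g" "Ct K \<zeta> \<zeta>t"
  obtains L where "0 \<le> L" "\<And>p q. \<bar>\<zeta> p - \<zeta> q\<bar> \<le> L * norm (p - q)"
proof -
  obtain A where A: "0 \<le> A" "\<And>p. norm (g p) \<le> A"
    using bounded_continuous_support[OF CxD(3,1,5)[OF assms(1)]] by metis
  obtain B where B: "0 \<le> B" "\<And>p. norm (\<zeta>t p) \<le> B"
    using bounded_continuous_support[OF CtD(3,1,5)[OF assms(2)]] by metis
  have "\<bar>\<zeta> p - \<zeta> q\<bar> \<le> (A + B) * norm (p - q)" for p q
  proof -
    obtain x t y s where p: "p = (x, t)" and q: "q = (y, s)" by (cases p, cases q)
    have "norm (\<zeta> (x, t) - \<zeta> (y, t)) \<le> A * norm (x - y)"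
      by (rule differentiable_bound[of UNIV "\<lambda>x. \<zeta> (x, t)" "\<lambda>x h. g (x, t) \<bullet> h"])
         (use CxD(6)[OF assms(1)] A onorm_inner_left_le order_trans in \<open>auto, blast\<close>)
    moreover have "norm (\<zeta> (y, t) - \<zeta> (y, s)) \<le> B * norm (t - s)"
      by (rule field_differentiable_bound[of UNIV "\<lambda>t. \<zeta> (y, t)" "\<lambda>t. \<zeta>t (y, t)"])
         (use CtD(6)[OF assms(2)] B in auto)
    moreover have "A * norm (x - y) \<le> A * norm (p - q)" "B * norm (t - s) \<le> B * norm (p - q)"
      using norm_fst_le[of "x - y" "t - s"] norm_snd_le[of "t - s" "x - y"] A B by (auto simp: p q intro!: mult_left_mono)
    ultimately show ?thesis by (simp add: p q distrib_right)
  qed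
  then show ?thesis using A B by (intro that[of "A + B"]) auto
qed

text \<open>Reflection about \<open>q\<close> changes the sign of the integrand.\<close>

lemma integral_dmoll_zero:
  "(LINT p|lborel. dmoll e ((q - p) /\<^sub>R \<epsilon>) / \<epsilon>) = 0" for q :: "'a::euclidean_space"
proof -
  let ?d = "\<lambda>x. dmoll e (x /\<^sub>R \<epsilon>) / \<epsilon>"
  have "(LINT x|lborel. ?d (0 - x)) = (LINT x|lborel. ?d x)"
    by (rule integral_lborel_reflect) simp
  then have "(LINT x|lborel. ?d x) = 0" by simp
  then show ?thesis using integral_lborel_reflect[of ?d q] by auto
qed

section \<open>Weak solutions with continuous spatial gradient\<close>

text \<open>The equation is assumed only against rescaled mollifiers, and with one of the two space
  derivatives left on \<open>u\<close>. Less regular test functions are reached by superposing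
  mollifiers over their centres.\<close>

locale weak_heat =
  fixes Q :: "('a::euclidean_space \<times> real) set" and u f :: "'a \<times> real \<Rightarrow> real"
    and gu :: "'a \<times> real \<Rightarrow> 'a" and M :: real
  assumes open_Q: "open Q"
    and cont_u: "continuous_on Q u" and cont_gu: "continuous_on Q gu"
    and deriv_u: "\<And>x t. (x, t) \<in> Q \<Longrightarrow> ((\<lambda>x. u (x, t)) has_derivative (\<lambda>h. gu (x, t) \<bullet> h)) (at x)"
    and meas_f: "f \<in> borel_measurable borel" and bound_f: "\<And>p. \<bar>f p\<bar> \<le> M"
    and weak: "\<And>p \<epsilon>. 0 < \<epsilon> \<Longrightarrow> cball p \<epsilon> \<subseteq> Q \<Longrightarrow>
      (LINT q|lborel. indicator Q q * (u q * (dmoll (0, 1) ((q - p) /\<^sub>R \<epsilon>) / \<epsilon>)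
         - dmoll (gu q, 0) ((q - p) /\<^sub>R \<epsilon>) / \<epsilon> - f q * moll ((q - p) /\<^sub>R \<epsilon>))) = 0"
begin

text \<open>Truncating \<open>u\<close>, its gradient and \<open>f\<close> to \<open>K'\<close>
  makes them bounded on the whole space, and kernels of radius at most \<delta> centred in
  \<open>K\<close> do not notice the truncation.\<close>

lemma collar:
  assumes "compact K" "K \<subseteq> Q"
  obtains \<delta> K' where "0 < \<delta>" "compact K'" "K' \<subseteq> Q" "\<And>p q. p \<in> K \<Longrightarrow> norm (q - p) \<le> \<delta> \<Longrightarrow> q \<in> K'"
proof -
  obtain \<delta> where \<delta>: "0 < \<delta>" "(\<Union>x\<in>K. cball x \<delta>) \<subseteq> Q"
    using compact_subset_open_imp_cball_epsilon_subset[OF assms(1) open_Q assms(2)] by metis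
  have eq: "(\<Union>x\<in>K. cball x \<delta>) = {x + y |x y. x \<in> K \<and> y \<in> cball 0 \<delta>}"
  proof (intro set_eqI iffI)
    fix q assume "q \<in> (\<Union>x\<in>K. cball x \<delta>)"
    then obtain x where "x \<in> K" "q \<in> cball x \<delta>" by blast
    then have "x \<in> K \<and> q - x \<in> cball 0 \<delta> \<and> q = x + (q - x)"
      by (simp add: dist_norm norm_minus_commute)
    then show "q \<in> {x + y |x y. x \<in> K \<and> y \<in> cball 0 \<delta>}" by blast
  next
    fix q assume "q \<in> {x + y |x y. x \<in> K \<and> y \<in> cball 0 \<delta>}"
    then obtain x y where "x \<in> K" "y \<in> cball 0 \<delta>" "q = x + y" by blast
    then show "q \<in> (\<Union>x\<in>K. cball x \<delta>)"
      by (intro UN_I[of x]) (simp_all add: dist_norm)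
  qed
  show ?thesis
  proof (rule that[of \<delta> "{x + y |x y. x \<in> K \<and> y \<in> cball 0 \<delta>}"])
    show "compact {x + y |x y. x \<in> K \<and> y \<in> cball 0 \<delta>}"
      using assms(1) by (intro compact_sums) auto
    show "q \<in> {x + y |x y. x \<in> K \<and> y \<in> cball 0 \<delta>}" if "p \<in> K" "norm (q - p) \<le> \<delta>" for p q
      unfolding eq[symmetric] using that by (auto simp: dist_norm norm_minus_commute intro!: bexI[of _ p])
  qed (use \<delta> eq in auto)
qed

lemma bounded_cutoff:
  fixes g :: "'a \<times> real \<Rightarrow> 'b::euclidean_space"
  assumes "compact K'" "K' \<subseteq> Q" "continuous_on Q g"
  obtains N where "0 \<le> N" "\<And>q. norm (indicator K' q *\<^sub>R g q) \<le> N"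
    "(\<lambda>q. indicator K' q *\<^sub>R g q) \<in> borel_measurable borel"
proof -
  have c: "continuous_on K' g" using assms continuous_on_subset by blast
  then have "bounded (g ` K')" using assms(1) compact_continuous_image compact_imp_bounded by blast
  then obtain N where "\<And>q. q \<in> K' \<Longrightarrow> norm (g q) \<le> N" unfolding bounded_iff by blast
  then have "norm (indicator K' q *\<^sub>R g q) \<le> max N 0" for q
    by (cases "q \<in> K'") (auto simp: le_max_iff_disj)
  moreover have "(\<lambda>q. indicator K' q *\<^sub>R g q) \<in> borel_measurable borel"
    using assms(1) c by (intro borel_measurable_continuous_on_indicator) (auto intro: borel_compact)
  ultimately show ?thesis by (intro that[of "max N 0"]) auto
qed

text \<open>The equation with centre \<open>p\<close> is multiplied by \<open>\<psi> p\<close> and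
  integrated over \<open>p\<close>; after Fubini the gradient of the kernel moves onto \<psi>. The
  time derivative stays on the kernel, because \<psi> may be a product with \<open>u\<close>, which
  cannot be differentiated in time.\<close>

lemma mollified_identity:
  assumes K': "compact K'" "K' \<subseteq> Q" "\<And>p q. p \<in> K \<Longrightarrow> norm (q - p) \<le> \<epsilon> \<Longrightarrow> q \<in> K'"
    and \<epsilon>: "0 < \<epsilon>" and \<psi>: "Cx K \<psi> g"
  defines "U \<equiv> \<lambda>q. indicator K' q *\<^sub>R u q" and "V \<equiv> \<lambda>q. indicator K' q *\<^sub>R gu q"
    and "W \<equiv> \<lambda>q. indicator K' q *\<^sub>R f q"
  shows "(LINT q|lborel. LINT p|lborel. U q * \<psi> p * (dmoll (0, 1) ((q - p) /\<^sub>R \<epsilon>) / \<epsilon>))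
     = (LINT q|lborel. LINT p|lborel. (V q \<bullet> g p) * moll ((q - p) /\<^sub>R \<epsilon>))
     + (LINT q|lborel. LINT p|lborel. (W q \<bullet> \<psi> p) * moll ((q - p) /\<^sub>R \<epsilon>))"
proof -
  have K: "compact K" "continuous_on UNIV \<psi>" "continuous_on UNIV g" "\<And>p. p \<notin> K \<Longrightarrow> \<psi> p = 0" "\<And>p. p \<notin> K \<Longrightarrow> g p = 0"
    using \<psi> by (auto simp: Cx_def)
  obtain NU where NU: "0 \<le> NU" "\<And>q. norm (U q) \<le> NU" and mU[measurable]: "U \<in> borel_measurable borel"
    unfolding U_def using bounded_cutoff[OF K'(1,2) cont_u] by metis
  obtain NV where NV: "0 \<le> NV" "\<And>q. norm (V q) \<le> NV" and mV[measurable]: "V \<in> borel_measurable borel"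
    unfolding V_def using bounded_cutoff[OF K'(1,2) cont_gu] by metis
  have [measurable]: "K' \<in> sets borel" using K'(1) by (simp add: borel_compact)
  have mW[measurable]: "W \<in> borel_measurable borel" using meas_f unfolding W_def by simp
  have NW: "\<bar>W q\<bar> \<le> \<bar>M\<bar>" for q
    using bound_f[of q] by (auto simp: W_def indicator_def)
  obtain N\<psi> where N\<psi>: "0 \<le> N\<psi>" "\<And>q. norm (\<psi> q) \<le> N\<psi>" using bounded_continuous_support[OF K(2,1,4)] by metis
  obtain D where D: "0 \<le> D" "\<And>e (q::'a\<times>real). \<bar>dmoll e q\<bar> \<le> D * norm e" using bounded_dmoll by metis
  have [measurable]: "\<psi> \<in> borel_measurable borel" "g \<in> borel_measurable borel"
    using K borel_measurable_continuous_onI by blast+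
  let ?A = "\<lambda>p q. U q * \<psi> p * (dmoll (0, 1) ((q - p) /\<^sub>R \<epsilon>) / \<epsilon>)"
  let ?B = "\<lambda>p q. \<psi> p * (dmoll (V q, 0) ((q - p) /\<^sub>R \<epsilon>) / \<epsilon>)"
  let ?C = "\<lambda>p q. (W q \<bullet> \<psi> p) * moll ((q - p) /\<^sub>R \<epsilon>)"
  have supp: "U q = 0" "V q = 0" "W q = 0" if "q \<notin> K'" for q using that by (auto simp: U_def V_def W_def)
  have d0: "dmoll 0 q = 0" for q :: "'a \<times> real" by (simp add: dmoll_def)
  have mA: "(\<lambda>z. ?A (fst z) (snd z)) \<in> borel_measurable borel"
    and mB: "(\<lambda>z. ?B (fst z) (snd z)) \<in> borel_measurable borel"
    and mC: "(\<lambda>z. ?C (fst z) (snd z)) \<in> borel_measurable borel"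
    unfolding borel_prod[symmetric, where 'a = "'a \<times> real" and 'b = "'a \<times> real"] dmoll_def
      using borel_measurable_continuous_onI[OF continuous_bump_jet[of UNIV 2], measurable] by measurable
  have bA: "\<bar>?A p q\<bar> \<le> NU * N\<psi> * (D / \<epsilon>)" for p q
  proof -
    have "\<bar>dmoll (0, 1) ((q - p) /\<^sub>R \<epsilon>) / \<epsilon>\<bar> \<le> D / \<epsilon>"
      using D(2)[of "(0, 1)"] \<epsilon> by (simp add: divide_right_mono abs_divide)
    then show ?thesis
      unfolding abs_mult using NU N\<psi> D \<epsilon> by (intro mult_mono) (auto intro!: divide_nonneg_pos)
  qed
  have bB: "\<bar>?B p q\<bar> \<le> N\<psi> * (D * NV / \<epsilon>)" for p q
  proof -
    have "\<bar>dmoll (V q, 0) ((q - p) /\<^sub>R \<epsilon>)\<bar> \<le> D * NV"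
      using D(2)[of "(V q, 0)" "(q - p) /\<^sub>R \<epsilon>"] mult_left_mono[OF NV(2)[of q] D(1)] by simp
    then have "\<bar>dmoll (V q, 0) ((q - p) /\<^sub>R \<epsilon>) / \<epsilon>\<bar> \<le> D * NV / \<epsilon>"
      using \<epsilon> by (simp add: divide_right_mono abs_divide)
    then show ?thesis
      unfolding abs_mult using NV N\<psi> D \<epsilon> by (intro mult_mono) auto
  qed
  have bC: "\<bar>?C p q\<bar> \<le> \<bar>M\<bar> * N\<psi> * 1" for p q
    unfolding abs_mult inner_real_def using NW N\<psi> moll_nonneg[of "(q - p) /\<^sub>R \<epsilon>"] moll_le_1
    by (intro mult_mono) auto
  note bK = compact_imp_bounded[OF K(1)] compact_imp_bounded[OF K'(1)]
  have zA: "?A p q = 0" if "p \<notin> K \<or> q \<notin> K'" for p q using that K(4)[of p] supp[of q] by (elim disjE) simp_all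
  have zB: "?B p q = 0" if "p \<notin> K \<or> q \<notin> K'" for p q using that K(4)[of p] supp[of q] by (elim disjE) (simp_all add: d0 zero_prod_def[symmetric])
  have zC: "?C p q = 0" if "p \<notin> K \<or> q \<notin> K'" for p q using that K(4)[of p] supp[of q] by (elim disjE) simp_all
  have slice: "integrable lborel (\<lambda>q. F p q)"
    if "(\<lambda>z. F (fst z) (snd z)) \<in> borel_measurable borel"
      "\<And>p q. p \<notin> K \<or> q \<notin> K' \<Longrightarrow> F p q = 0" "\<And>p q. \<bar>F p q\<bar> \<le> N" for F :: "'a \<times> real \<Rightarrow> 'a \<times> real \<Rightarrow> real" and N p
  proof (rule integrable_bounded_support[of _ K' N])
    have "(\<lambda>q. (p, q)) \<in> borel_measurable borel"
      by (intro borel_measurable_continuous_onI continuous_intros)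
    from measurable_compose[OF this that(1)] show "F p \<in> borel_measurable borel" by simp
  qed (use that bK in auto)
  have slice2: "integrable lborel (\<lambda>p. LINT q|lborel. F p q)"
    if "(\<lambda>z. F (fst z) (snd z)) \<in> borel_measurable borel"
      "\<And>p q. p \<notin> K \<or> q \<notin> K' \<Longrightarrow> F p q = 0" "\<And>p q. \<bar>F p q\<bar> \<le> N" for F :: "'a \<times> real \<Rightarrow> 'a \<times> real \<Rightarrow> real" and N
  proof (rule Fubini_bounded_support(2)[of "\<lambda>q p. F p q" K' K N])
    have "(\<lambda>z::('a\<times>real)\<times>('a\<times>real). (snd z, fst z)) \<in> borel_measurable borel"
      unfolding borel_prod[symmetric, where 'a = "'a \<times> real" and 'b = "'a \<times> real"] by measurable
    from measurable_compose[OF this that(1)]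
    show "(\<lambda>z. F (snd z) (fst z)) \<in> borel_measurable borel" by simp
  qed (use that bK in auto)
  have "(LINT q|lborel. ?A p q) - (LINT q|lborel. ?B p q) - (LINT q|lborel. ?C p q) = 0" for p
  proof (cases "p \<in> K")
    case True
    have ball: "cball p \<epsilon> \<subseteq> K'" using K'(3)[OF True] by (auto simp: dist_norm norm_minus_commute)
    have "(LINT q|lborel. indicator Q q * (u q * (dmoll (0, 1) ((q - p) /\<^sub>R \<epsilon>) / \<epsilon>)
         - dmoll (gu q, 0) ((q - p) /\<^sub>R \<epsilon>) / \<epsilon> - f q * moll ((q - p) /\<^sub>R \<epsilon>))) = 0"
      using ball K'(2) \<epsilon> by (intro weak) auto
    then have "0 = \<psi> p * (LINT q|lborel. indicator Q q * (u q * (dmoll (0, 1) ((q - p) /\<^sub>R \<epsilon>) / \<epsilon>)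
         - dmoll (gu q, 0) ((q - p) /\<^sub>R \<epsilon>) / \<epsilon> - f q * moll ((q - p) /\<^sub>R \<epsilon>)))"
      by simp
    also have "\<dots> = (LINT q|lborel. \<psi> p * (indicator Q q * (u q * (dmoll (0, 1) ((q - p) /\<^sub>R \<epsilon>) / \<epsilon>)
         - dmoll (gu q, 0) ((q - p) /\<^sub>R \<epsilon>) / \<epsilon> - f q * moll ((q - p) /\<^sub>R \<epsilon>))))"
      by simp
    also have "\<dots> = (LINT q|lborel. ?A p q - ?B p q - ?C p q)"
    proof (intro Bochner_Integration.integral_cong refl)
      fix q
      show "\<psi> p * (indicator Q q * (u q * (dmoll (0, 1) ((q - p) /\<^sub>R \<epsilon>) / \<epsilon>)
         - dmoll (gu q, 0) ((q - p) /\<^sub>R \<epsilon>) / \<epsilon> - f q * moll ((q - p) /\<^sub>R \<epsilon>))) = ?A p q - ?B p q - ?C p q"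
      proof (cases "q \<in> K'")
        case True
        then have "q \<in> Q" using K'(2) by auto
        then show ?thesis using True by (simp add: U_def V_def W_def algebra_simps)
      next
        case False
        then have "q \<notin> cball p \<epsilon>" using ball by auto
        then have "\<epsilon> \<le> norm (q - p)" by (simp add: dist_norm norm_minus_commute)
        from scaled_eq_0[OF \<epsilon> this] show ?thesis by simp
      qed
    qed
    also have "\<dots> = (LINT q|lborel. ?A p q) - (LINT q|lborel. ?B p q) - (LINT q|lborel. ?C p q)"
      using slice[OF mA zA bA] slice[OF mB zB bB] slice[OF mC zC bC] by simp
    finally show ?thesis by simp
  qed (use K in simp)
  then have "0 = (LINT p|lborel. (LINT q|lborel. ?A p q) - (LINT q|lborel. ?B p q) - (LINT q|lborel. ?C p q))"
    by simp
  also have "\<dots> = (LINT p|lborel. LINT q|lborel. ?A p q) - (LINT p|lborel. LINT q|lborel. ?B p q) - (LINT p|lborel. LINT q|lborel. ?C p q)"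
    using slice2[OF mA zA bA] slice2[OF mB zB bB] slice2[OF mC zC bC] by simp
  also have "(LINT p|lborel. LINT q|lborel. ?A p q) = (LINT q|lborel. LINT p|lborel. ?A p q)"
    by (rule Fubini_bounded_support(1)[OF mA bK zA bA])
  also have "(LINT p|lborel. LINT q|lborel. ?B p q) = (LINT q|lborel. LINT p|lborel. ?B p q)"
    by (rule Fubini_bounded_support(1)[OF mB bK zB bB])
  also have "(LINT p|lborel. LINT q|lborel. ?C p q) = (LINT q|lborel. LINT p|lborel. ?C p q)"
    by (rule Fubini_bounded_support(1)[OF mC bK zC bC])
  finally have fin: "(LINT q|lborel. LINT p|lborel. ?A p q) = (LINT q|lborel. LINT p|lborel. ?B p q) + (LINT q|lborel. LINT p|lborel. ?C p q)"
    by linarith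
  \<comment> \<open>The direction \<open>V q\<close> varies with \<open>q\<close> but is constant in
    the inner integral, so the integration by parts applies along \<open>(V q, 0)\<close>.\<close>
  have eqB: "(LINT p|lborel. ?B p q) = (LINT p|lborel. (V q \<bullet> g p) * moll ((q - p) /\<^sub>R \<epsilon>))" for q
  proof (rule kernel_by_parts[OF \<epsilon> K(2) _ K(1) K(4)])
    fix p :: "'a \<times> real"
    obtain x t where p: "p = (x, t)" by (cases p)
    have d: "((\<lambda>x. \<psi> (x, t)) has_derivative (\<lambda>h. g (x, t) \<bullet> h)) (at (x + 0 *\<^sub>R V q))"
      using \<psi> by (simp add: Cx_def)
    have l: "((\<lambda>s. x + s *\<^sub>R V q) has_derivative (\<lambda>s. s *\<^sub>R V q)) (at 0)"
      by (auto intro!: derivative_eq_intros)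
    have "((\<lambda>s. \<psi> (x + s *\<^sub>R V q, t)) has_derivative (\<lambda>s. g (x, t) \<bullet> (s *\<^sub>R V q))) (at 0)"
      using has_derivative_compose[where f = "\<lambda>s. x + s *\<^sub>R V q" and f' = "\<lambda>s. s *\<^sub>R V q" and x = 0 and s = UNIV, OF l d] .
    then show "((\<lambda>s. \<psi> (p + s *\<^sub>R (V q, 0))) has_real_derivative V q \<bullet> g p) (at 0)"
      by (simp add: has_field_derivative_def p inner_commute mult_commute_abs)
  qed (use K in \<open>auto intro!: continuous_intros\<close>)
  show ?thesis using fin unfolding eqB .
qed

text \<open>Here \<psi> also has a time derivative, so the remaining derivative of the kernel can be
  moved as well before the radius tends to 0.\<close>

lemma weak_C1:
  assumes "Cx K \<psi> g" "Ct K \<psi> \<psi>t" "K \<subseteq> Q"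
  shows "(LINT q|lborel. u q * \<psi>t q) = (LINT q|lborel. gu q \<bullet> g q) + (LINT q|lborel. f q * \<psi> q)"
proof -
  note K = CxD[OF assms(1)] and Kt = CtD[OF assms(2)]
  obtain \<delta> K' where \<delta>: "0 < \<delta>" and K': "compact K'" "K' \<subseteq> Q" "\<And>p q. p \<in> K \<Longrightarrow> norm (q - p) \<le> \<delta> \<Longrightarrow> q \<in> K'"
    using collar[OF K(1) assms(3)] by metis
  have KK': "p \<in> K'" if "p \<in> K" for p using K'(3)[OF that, of p] \<delta> by simp
  define U where "U \<equiv> \<lambda>q. indicator K' q *\<^sub>R u q"
  define V where "V \<equiv> \<lambda>q. indicator K' q *\<^sub>R gu q"
  define W where "W \<equiv> \<lambda>q. indicator K' q *\<^sub>R f q"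
  obtain NU where NU: "\<And>q. norm (U q) \<le> NU" and mU: "U \<in> borel_measurable borel"
    unfolding U_def using bounded_cutoff[OF K'(1,2) cont_u] by metis
  obtain NV where NV: "\<And>q. norm (V q) \<le> NV" and mV: "V \<in> borel_measurable borel"
    unfolding V_def using bounded_cutoff[OF K'(1,2) cont_gu] by metis
  have [measurable]: "K' \<in> sets borel" using K'(1) by (simp add: borel_compact)
  have mW: "W \<in> borel_measurable borel" using meas_f unfolding W_def by simp
  have NW: "norm (W q) \<le> \<bar>M\<bar>" for q
    using bound_f[of q] by (auto simp: W_def indicator_def)
  have supp: "U q = 0" "V q = 0" "W q = 0" if "q \<notin> K'" for q using that by (auto simp: U_def V_def W_def)
  note b = compact_imp_bounded[OF K'(1)]
  let ?Z = "moll_mass TYPE('a \<times> real)"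
  have 1: "((\<lambda>\<epsilon>. (LINT q|lborel. LINT p|lborel. (U q \<bullet> \<psi>t p) * moll ((q - p) /\<^sub>R \<epsilon>)) / ?Z \<epsilon>) \<longlongrightarrow> (LINT q|lborel. U q \<bullet> \<psi>t q)) (at_right 0)"
    by (rule moll_convolution_tendsto[OF mU b supp(1) NU Kt(3,1,5)])
  have 2: "((\<lambda>\<epsilon>. (LINT q|lborel. LINT p|lborel. (V q \<bullet> g p) * moll ((q - p) /\<^sub>R \<epsilon>)) / ?Z \<epsilon>) \<longlongrightarrow> (LINT q|lborel. V q \<bullet> g q)) (at_right 0)"
    by (rule moll_convolution_tendsto[OF mV b supp(2) NV K(3,1,5)])
  have 3: "((\<lambda>\<epsilon>. (LINT q|lborel. LINT p|lborel. (W q \<bullet> \<psi> p) * moll ((q - p) /\<^sub>R \<epsilon>)) / ?Z \<epsilon>) \<longlongrightarrow> (LINT q|lborel. W q \<bullet> \<psi> q)) (at_right 0)"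
    by (rule moll_convolution_tendsto[OF mW b supp(3) NW K(2,1,4)])
  have ev: "\<forall>\<^sub>F \<epsilon> in at_right 0. (LINT q|lborel. LINT p|lborel. (U q \<bullet> \<psi>t p) * moll ((q - p) /\<^sub>R \<epsilon>)) / ?Z \<epsilon>
    = (LINT q|lborel. LINT p|lborel. (V q \<bullet> g p) * moll ((q - p) /\<^sub>R \<epsilon>)) / ?Z \<epsilon>
    + (LINT q|lborel. LINT p|lborel. (W q \<bullet> \<psi> p) * moll ((q - p) /\<^sub>R \<epsilon>)) / ?Z \<epsilon>"
    unfolding eventually_at_right_field
  proof (intro exI[of _ \<delta>] conjI \<delta> allI impI)
    fix \<epsilon> :: real assume \<epsilon>: "0 < \<epsilon>" "\<epsilon> < \<delta>"
    have "(LINT p|lborel. U q * \<psi> p * (dmoll (0, 1) ((q - p) /\<^sub>R \<epsilon>) / \<epsilon>)) = (LINT p|lborel. (U q \<bullet> \<psi>t p) * moll ((q - p) /\<^sub>R \<epsilon>))" for q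
    proof -
      have "(LINT p|lborel. \<psi> p * (dmoll (0, 1) ((q - p) /\<^sub>R \<epsilon>) / \<epsilon>)) = (LINT p|lborel. \<psi>t p * moll ((q - p) /\<^sub>R \<epsilon>))"
      proof (rule kernel_by_parts[OF \<epsilon>(1) K(2) Kt(3) K(1) K(4) Kt(5)])
        fix p :: "'a \<times> real"
        obtain x t where p: "p = (x, t)" by (cases p)
        show "((\<lambda>s. \<psi> (p + s *\<^sub>R (0, 1))) has_real_derivative \<psi>t p) (at 0)"
          using DERIV_at_within_shift[of "\<lambda>t. \<psi> (x, t)" "\<psi>t p" t 0 UNIV] Kt(6)[of x t] by (simp add: p)
      qed
      then show ?thesis by (simp only: mult.assoc integral_mult_right_zero inner_real_def)
    qed
    moreover have "(LINT q|lborel. LINT p|lborel. U q * \<psi> p * (dmoll (0, 1) ((q - p) /\<^sub>R \<epsilon>) / \<epsilon>))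
     = (LINT q|lborel. LINT p|lborel. (V q \<bullet> g p) * moll ((q - p) /\<^sub>R \<epsilon>))
     + (LINT q|lborel. LINT p|lborel. (W q \<bullet> \<psi> p) * moll ((q - p) /\<^sub>R \<epsilon>))"
      unfolding U_def V_def W_def
      by (rule mollified_identity[OF K'(1,2) _ \<epsilon>(1) assms(1)]) (use K'(3) \<epsilon> in auto)
    ultimately show "(LINT q|lborel. LINT p|lborel. (U q \<bullet> \<psi>t p) * moll ((q - p) /\<^sub>R \<epsilon>)) / ?Z \<epsilon>
    = (LINT q|lborel. LINT p|lborel. (V q \<bullet> g p) * moll ((q - p) /\<^sub>R \<epsilon>)) / ?Z \<epsilon>
    + (LINT q|lborel. LINT p|lborel. (W q \<bullet> \<psi> p) * moll ((q - p) /\<^sub>R \<epsilon>)) / ?Z \<epsilon>"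
      by (simp add: add_divide_distrib)
  qed
  have "(LINT q|lborel. U q \<bullet> \<psi>t q) = (LINT q|lborel. V q \<bullet> g q) + (LINT q|lborel. W q \<bullet> \<psi> q)"
    using tendsto_unique[OF _ tendsto_cong[OF ev, THEN iffD1, OF 1] tendsto_add[OF 2 3]] by simp
  moreover have "U q \<bullet> \<psi>t q = u q * \<psi>t q" "V q \<bullet> g q = gu q \<bullet> g q" "W q \<bullet> \<psi> q = f q * \<psi> q" for q
    using KK'[of q] K(4,5)[of q] Kt(5)[of q] by (cases "q \<in> K"; simp add: U_def V_def W_def)+
  ultimately show ?thesis by (simp only:)
qed

text \<open>The chain rule \<open>2 u u\<^sub>t = (u\<^sup>2)\<^sub>t\<close>, although \<open>u\<close> need not be differentiable in time:
  the time derivative of the mollifier is odd, so the double integral can be antisymmetrized.\<close>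

lemma antisymmetrized_tendsto:
  assumes "Cx K \<zeta> g\<zeta>" "Ct K \<zeta> \<zeta>t"
    and \<delta>: "0 < \<delta>" and K': "compact K'" "K' \<subseteq> Q" "\<And>p q. p \<in> K \<Longrightarrow> norm (q - p) \<le> \<delta> \<Longrightarrow> q \<in> K'"
  defines "U \<equiv> \<lambda>q. indicator K' q *\<^sub>R u q"
  shows "((\<lambda>\<epsilon>. (LINT q|lborel. LINT p|lborel. U q * (U p * \<zeta> p) * (dmoll (0, 1) ((q - p) /\<^sub>R \<epsilon>) / \<epsilon>))
      / moll_mass TYPE('a \<times> real) \<epsilon>) \<longlongrightarrow> (LINT q|lborel. (U q)\<^sup>2 * \<zeta>t q) / 2) (at_right 0)"
proof -
  note K = CxD[OF assms(1)] and Kt = CtD[OF assms(2)]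
  let ?Z = "moll_mass TYPE('a \<times> real)"
  have KK': "p \<in> K'" if "p \<in> K" for p using K'(3)[OF that, of p] \<delta> by simp
  obtain N where N: "0 \<le> N" "\<And>q. norm (U q) \<le> N" and mU[measurable]: "U \<in> borel_measurable borel"
    unfolding U_def using bounded_cutoff[OF K'(1,2) cont_u] by metis
  have [measurable]: "\<zeta> \<in> borel_measurable borel" "\<zeta>t \<in> borel_measurable borel" "K' \<in> sets borel"
    using K(2) Kt(3) K'(1) borel_measurable_continuous_onI by (blast, blast, simp add: borel_compact)
  obtain D where D: "0 \<le> D" "\<And>e (q::'a\<times>real). \<bar>dmoll e q\<bar> \<le> D * norm e" using bounded_dmoll by metis
  obtain L where L: "0 \<le> L" "\<And>p q. \<bar>\<zeta> p - \<zeta> q\<bar> \<le> L * norm (p - q)" using C1_Lipschitz[OF assms(1,2)] by metis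
  obtain N\<zeta> where N\<zeta>: "0 \<le> N\<zeta>" "\<And>q. norm (\<zeta> q) \<le> N\<zeta>" using bounded_continuous_support[OF K(2,1,4)] by metis
  have supp: "U q = 0" if "q \<notin> K'" for q using that by (auto simp: U_def)
  note b = compact_imp_bounded[OF K'(1)]
  let ?m = "\<lambda>\<epsilon> (q :: 'a \<times> real) p. dmoll (0, 1) ((q - p) /\<^sub>R \<epsilon>) / \<epsilon>"
  have m_odd: "?m \<epsilon> p q = - ?m \<epsilon> q p" for \<epsilon> and p q :: "'a \<times> real"
    using dmoll_minus[of "(0, 1)" "(q - p) /\<^sub>R \<epsilon>"] by (simp flip: scaleR_minus_right)
  have m_meas: "(\<lambda>z :: ('a \<times> real) \<times> ('a \<times> real). ?m \<epsilon> (snd z) (fst z)) \<in> borel_measurable borel" for \<epsilon>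
  proof -
    have "(\<lambda>z. dmoll (0, 1) ((snd z - fst z) /\<^sub>R \<epsilon>) :: real) \<in> borel_measurable (borel :: (('a \<times> real) \<times> ('a \<times> real)) measure)"
      by (intro borel_measurable_continuous_onI continuous_intros)
    then show ?thesis by (intro borel_measurable_divide borel_measurable_const)
  qed
  note m_meas[measurable]
  have cU: "continuous_on K' U"
    using cont_u K'(2) by (auto simp: U_def intro: continuous_on_subset cong: continuous_on_cong)
  have limit: "((\<lambda>\<epsilon>. (LINT q|lborel. LINT p|lborel. ((U q)\<^sup>2 \<bullet> \<zeta>t p) * moll ((q - p) /\<^sub>R \<epsilon>)) / ?Z \<epsilon>)
      \<longlongrightarrow> (LINT q|lborel. (U q)\<^sup>2 \<bullet> \<zeta>t q)) (at_right 0)"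
  proof (rule moll_convolution_tendsto[of _ K' "N\<^sup>2", OF _ b _ _ Kt(3,1,5)])
    show "norm ((U q)\<^sup>2) \<le> N\<^sup>2" for q using N power_mono[of "\<bar>U q\<bar>" N 2] by auto
  qed (use supp in auto)
  \<comment> \<open>Twice the double integral is symmetrized in \<open>p\<close> and
    \<open>q\<close>. It differs from the convergent expression of \<open>limit\<close> by an
    integral that contains an increment of \<zeta> and an increment of \<open>U\<close>.\<close>
  have rem: "((\<lambda>\<epsilon>. (2 * (LINT q|lborel. LINT p|lborel. U q * (U p * \<zeta> p) * ?m \<epsilon> q p)
     - (LINT q|lborel. LINT p|lborel. ((U q)\<^sup>2 \<bullet> \<zeta>t p) * moll ((q - p) /\<^sub>R \<epsilon>))) / ?Z \<epsilon>) \<longlongrightarrow> 0) (at_right 0)"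
  proof (rule tendstoI)
    fix e :: real assume "0 < e"
    define n where "n = DIM('a \<times> real)"
    \<comment> \<open>The factors are the bounds for \<open>U\<close>, the increment of \<zeta>, the
      kernel and the measures of \<open>K'\<close> and of a ball. The powers of \<epsilon> from the
      ball and from \<open>?Z \<epsilon>\<close> cancel, which leaves \<open>?Z 1\<close>.\<close>
    define A where "A = N * L * D * measure lborel K' * unit_ball_vol n / ?Z 1"
    have A: "0 \<le> A" unfolding A_def using N L D moll_mass_pos[of 1, where 'a = "'a \<times> real"] by simp
    define w where "w = e / (A + 1)"
    have w: "0 < w" "A * w < e" using A \<open>0 < e\<close> by (auto simp: w_def field_simps)
    obtain d where d: "0 < d" "\<And>x y. x \<in> K' \<Longrightarrow> y \<in> K' \<Longrightarrow> dist y x < d \<Longrightarrow> dist (U y) (U x) < w"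
      using compact_uniformly_continuous[OF cU K'(1)] w(1) unfolding uniformly_continuous_on_def by metis
    show "\<forall>\<^sub>F \<epsilon> in at_right 0. dist ((2 * (LINT q|lborel. LINT p|lborel. U q * (U p * \<zeta> p) * ?m \<epsilon> q p)
       - (LINT q|lborel. LINT p|lborel. ((U q)\<^sup>2 \<bullet> \<zeta>t p) * moll ((q - p) /\<^sub>R \<epsilon>))) / ?Z \<epsilon>) 0 < e"
      unfolding eventually_at_right_field
    proof (intro exI[of _ "min d \<delta>"] conjI allI impI)
      fix \<epsilon> :: real assume \<epsilon>: "0 < \<epsilon>" "\<epsilon> < min d \<delta>"
      have m_bd: "\<bar>?m \<epsilon> q p\<bar> \<le> D / \<epsilon>" for p q
        using D(2)[of "(0, 1)" "(q - p) /\<^sub>R \<epsilon>"] \<epsilon>(1) by (simp add: divide_right_mono abs_divide)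
      have m0: "?m \<epsilon> q p = 0" if "\<epsilon> \<le> norm (q - p)" for p q
        using scaled_eq_0(2)[OF \<epsilon>(1) that] by simp
      let ?E = "\<lambda>p q. U q * (U p * \<zeta> p) * ?m \<epsilon> q p"
      let ?E' = "\<lambda>p q. U p * (U q * \<zeta> q) * ?m \<epsilon> p q"
      let ?R = "\<lambda>p q. U q * (U p - U q) * (\<zeta> p - \<zeta> q) * ?m \<epsilon> q p"
      let ?S = "\<lambda>p q. (U q)\<^sup>2 * (\<zeta> p - \<zeta> q) * ?m \<epsilon> q p"
      have meas_pair: "(\<lambda>z. F (fst z) (snd z)) \<in> borel_measurable borel \<Longrightarrow> F p \<in> borel_measurable borel
          \<and> (\<lambda>p. F p q) \<in> borel_measurable borel" for F :: "'a \<times> real \<Rightarrow> 'a \<times> real \<Rightarrow> real" and p q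
      proof -
        assume F: "(\<lambda>z. F (fst z) (snd z)) \<in> borel_measurable borel"
        have "(\<lambda>q. (p, q)) \<in> borel_measurable borel" "(\<lambda>p. (p, q)) \<in> borel_measurable borel"
          by (intro borel_measurable_continuous_onI continuous_intros)+
        from measurable_compose[OF this(1) F] measurable_compose[OF this(2) F] show ?thesis by simp
      qed
      have bE: "\<bar>?E p q\<bar> \<le> N * (N * N\<zeta>) * (D / \<epsilon>)" for p q
        unfolding abs_mult using N(2)[of p] N(2)[of q] N(1) N\<zeta>(2)[of p] N\<zeta>(1) m_bd[of q p] D(1) \<epsilon>(1)
        by (intro mult_mono) auto
      have mE: "(\<lambda>z. ?E (fst z) (snd z)) \<in> borel_measurable borel"
        and mE': "(\<lambda>z. ?E' (fst z) (snd z)) \<in> borel_measurable borel"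
        and mR: "(\<lambda>z. ?R (fst z) (snd z)) \<in> borel_measurable borel"
        using m_meas[of \<epsilon>] unfolding m_odd[of \<epsilon> "fst _"] borel_prod[symmetric, where 'a = "'a \<times> real" and 'b = "'a \<times> real"]
        by measurable
      have zE: "?E p q = 0" if "p \<notin> K' \<or> q \<notin> K'" for p q using that supp[of p] supp[of q] by (elim disjE) simp_all
      have zE': "?E' p q = 0" if "p \<notin> K' \<or> q \<notin> K'" for p q using that supp[of p] supp[of q] by (elim disjE) simp_all
      have bE': "\<bar>?E' p q\<bar> \<le> N * (N * N\<zeta>) * (D / \<epsilon>)" for p q by (rule bE)
      have swap: "(LINT q|lborel. LINT p|lborel. ?E p q) = (LINT q|lborel. LINT p|lborel. ?E' p q)"
        by (rule Fubini_bounded_support(1)[OF mE b b zE bE, symmetric])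
      have i1a: "integrable lborel (\<lambda>q. LINT p|lborel. ?E p q)"
        using Fubini_bounded_support(2)[where F = ?E, OF mE b b zE bE] by simp
      have i1b: "integrable lborel (\<lambda>q. LINT p|lborel. ?E' p q)"
        using Fubini_bounded_support(2)[where F = ?E', OF mE' b b zE' bE'] by simp
      note i1 = i1a i1b
      have slice: "integrable lborel (\<lambda>p. F p q)"
        if F: "(\<lambda>z. F (fst z) (snd z)) \<in> borel_measurable borel"
          "\<And>p q. p \<notin> K' \<or> q \<notin> K' \<Longrightarrow> F p q = 0" "\<And>p q. \<bar>F p q\<bar> \<le> C"
        for F :: "'a \<times> real \<Rightarrow> 'a \<times> real \<Rightarrow> real" and q C
      proof (rule integrable_bounded_support[OF _ b, of _ C])
        show "(\<lambda>p. F p q) \<in> borel_measurable borel" using meas_pair[where F = F, OF F(1)] by blast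
      qed (use F(2,3) in \<open>simp_all\<close>)
      have i2a: "integrable lborel (\<lambda>p. ?E p q)" for q
        by (rule slice[where F = ?E, OF mE zE bE])
      have i2b: "integrable lborel (\<lambda>p. ?E' p q)" for q
        by (rule slice[where F = ?E', OF mE' zE' bE'])
      note i2 = i2a i2b
      \<comment> \<open>Oddness of the kernel turns the symmetrized integrand into U q * U p *
        (\<zeta> p - \<zeta> q) times the kernel. In \<open>?S\<close> the factor \<open>U p\<close>
        is frozen at \<open>q\<close>, so that the integration by parts hits \<zeta> alone;
        \<open>?R\<close> is the error of freezing.\<close>
      have split: "?E p q + ?E' p q = ?R p q + ?S p q" for p q
        unfolding m_odd[of \<epsilon> p q] by (simp add: algebra_simps power2_eq_square)
      have im: "integrable lborel (\<lambda>p. ?m \<epsilon> q p)" for q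
        using m0 \<epsilon>(1) by (intro integrable_continuous_support[where K = "cball q \<epsilon>"])
          (auto intro!: continuous_intros simp: dist_norm)
      have i\<zeta>m: "integrable lborel (\<lambda>p. \<zeta> p * ?m \<epsilon> q p)" for q
        using K \<epsilon>(1) by (intro integrable_continuous_support[where K = K]) (auto intro!: continuous_intros)
      have S: "(LINT p|lborel. ?S p q) = (LINT p|lborel. ((U q)\<^sup>2 \<bullet> \<zeta>t p) * moll ((q - p) /\<^sub>R \<epsilon>))"
        and iS: "integrable lborel (\<lambda>p. ?S p q)" for q
      proof -
        have "(LINT p|lborel. \<zeta> p * ?m \<epsilon> q p) = (LINT p|lborel. \<zeta>t p * moll ((q - p) /\<^sub>R \<epsilon>))"
        proof (rule kernel_by_parts[OF \<epsilon>(1) K(2) Kt(3) K(1) K(4) Kt(5)])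
          fix p :: "'a \<times> real"
          obtain x t where p: "p = (x, t)" by (cases p)
          show "((\<lambda>s. \<zeta> (p + s *\<^sub>R (0, 1))) has_real_derivative \<zeta>t p) (at 0)"
            using DERIV_at_within_shift[of "\<lambda>t. \<zeta> (x, t)" "\<zeta>t p" t 0 UNIV] Kt(6)[of x t] by (simp add: p)
        qed
        note parts = this
        have S_eq: "(\<lambda>p. ?S p q) = (\<lambda>p. (U q)\<^sup>2 * (\<zeta> p * ?m \<epsilon> q p) - ((U q)\<^sup>2 * \<zeta> q) * ?m \<epsilon> q p)"
          by (simp add: fun_eq_iff algebra_simps)
        have A: "integrable lborel (\<lambda>p. (U q)\<^sup>2 * (\<zeta> p * ?m \<epsilon> q p))"
          and B: "integrable lborel (\<lambda>p. ((U q)\<^sup>2 * \<zeta> q) * ?m \<epsilon> q p)"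
          by (intro integrable_mult_right i\<zeta>m im)+
        show "integrable lborel (\<lambda>p. ?S p q)"
          unfolding S_eq by (rule Bochner_Integration.integrable_diff[OF A B])
        have "(LINT p|lborel. ?S p q) = (U q)\<^sup>2 * (LINT p|lborel. \<zeta> p * ?m \<epsilon> q p) - ((U q)\<^sup>2 * \<zeta> q) * (LINT p|lborel. ?m \<epsilon> q p)"
          unfolding S_eq by (subst Bochner_Integration.integral_diff[OF A B]) (simp only: integral_mult_right_zero)
        also have "\<dots> = (U q)\<^sup>2 * (LINT p|lborel. \<zeta>t p * moll ((q - p) /\<^sub>R \<epsilon>))"
          unfolding parts integral_dmoll_zero by simp
        also have "\<dots> = (LINT p|lborel. ((U q)\<^sup>2 \<bullet> \<zeta>t p) * moll ((q - p) /\<^sub>R \<epsilon>))"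
          by (simp only: inner_real_def mult.assoc integral_mult_right_zero)
        finally show "(LINT p|lborel. ?S p q) = (LINT p|lborel. ((U q)\<^sup>2 \<bullet> \<zeta>t p) * moll ((q - p) /\<^sub>R \<epsilon>))" .
      qed
      have iR: "integrable lborel (\<lambda>p. ?R p q)" for q
      proof -
        have "?R p q = ?E p q + ?E' p q - ?S p q" for p using split[of q p] by linarith
        then show ?thesis using i2[of q] iS[of q] by simp
      qed
      \<comment> \<open>The Lipschitz increment L \<epsilon> of \<zeta> cancels the 1 / \<epsilon>
        of the differentiated kernel, and the increment of \<open>U\<close> supplies the small
        factor \<open>w\<close>.\<close>
      have bR: "\<bar>?R p q\<bar> \<le> (N * w * (L * D)) * (indicator (ball q \<epsilon>) p * indicator K' q)" for p q
      proof (cases "norm (q - p) < \<epsilon> \<and> q \<in> K' \<and> (p \<in> K \<or> q \<in> K)")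
        case True
        then have "p \<in> K'" using K'(3)[of q p] KK'[of p] \<epsilon>(2) by (auto simp: norm_minus_commute)
        then have "\<bar>U p - U q\<bar> \<le> w"
          using d(2)[of q p] True \<epsilon>(2) by (auto simp: dist_norm norm_minus_commute)
        moreover have "\<bar>\<zeta> p - \<zeta> q\<bar> \<le> L * \<epsilon>"
          using L(2)[of p q] True mult_left_mono[of "norm (p - q)" \<epsilon> L] L(1) by (auto simp: norm_minus_commute)
        ultimately have "\<bar>?R p q\<bar> \<le> N * w * (L * \<epsilon>) * (D / \<epsilon>)"
          unfolding abs_mult using N(2)[of q] N(1) m_bd[of q p] w(1) L(1) \<epsilon>(1)
          by (intro mult_mono) auto
        then show ?thesis using True \<epsilon>(1) by (simp add: dist_norm)
      next
        case False
        then have "?R p q = 0" using m0[of q p] supp[of q] K(4)[of p] K(4)[of q] by (auto simp: not_less)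
        moreover have "0 \<le> (N * w * (L * D)) * (indicator (ball q \<epsilon>) p * indicator K' q)"
          using N w L D by simp
        ultimately show ?thesis by (simp only: abs_zero)
      qed
      have ballint: "(LINT p|lborel. (N * w * (L * D)) * (indicator (ball q \<epsilon>) p * indicator K' q))
          = (N * w * (L * D)) * (unit_ball_vol n * \<epsilon> ^ n) * indicator K' q"
        and iball: "integrable lborel (\<lambda>p. (N * w * (L * D)) * (indicator (ball q \<epsilon>) p * indicator K' q))" for q
        using content_ball[of \<epsilon> q] \<epsilon>(1) emeasure_lborel_ball_finite[of q \<epsilon>] by (simp_all add: n_def)
      have "2 * (LINT q|lborel. LINT p|lborel. ?E p q) = (LINT q|lborel. (LINT p|lborel. ?E p q) + (LINT p|lborel. ?E' p q))"
        unfolding Bochner_Integration.integral_add[OF i1] swap[symmetric] by (rule mult_2)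
      also have "\<dots> = (LINT q|lborel. (LINT p|lborel. ?R p q) + (LINT p|lborel. ((U q)\<^sup>2 \<bullet> \<zeta>t p) * moll ((q - p) /\<^sub>R \<epsilon>)))"
      proof (intro Bochner_Integration.integral_cong refl)
        fix q
        have "(LINT p|lborel. ?E p q) + (LINT p|lborel. ?E' p q) = (LINT p|lborel. ?R p q + ?S p q)"
          unfolding Bochner_Integration.integral_add[OF i2, symmetric] split ..
        also have "\<dots> = (LINT p|lborel. ?R p q) + (LINT p|lborel. ?S p q)" by (rule Bochner_Integration.integral_add[OF iR iS])
        finally show "(LINT p|lborel. ?E p q) + (LINT p|lborel. ?E' p q)
          = (LINT p|lborel. ?R p q) + (LINT p|lborel. ((U q)\<^sup>2 \<bullet> \<zeta>t p) * moll ((q - p) /\<^sub>R \<epsilon>))" by (simp only: S)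
      qed
      finally have eq: "2 * (LINT q|lborel. LINT p|lborel. ?E p q)
         = (LINT q|lborel. (LINT p|lborel. ?R p q) + (LINT p|lborel. ((U q)\<^sup>2 \<bullet> \<zeta>t p) * moll ((q - p) /\<^sub>R \<epsilon>)))" .
      have iS2: "integrable lborel (\<lambda>q. LINT p|lborel. ((U q)\<^sup>2 \<bullet> \<zeta>t p) * moll ((q - p) /\<^sub>R \<epsilon>))"
      proof -
        obtain Nt where Nt: "0 \<le> Nt" "\<And>q. norm (\<zeta>t q) \<le> Nt" using bounded_continuous_support[OF Kt(3,1,5)] by metis
        show ?thesis
        proof (rule Fubini_bounded_support(2)[of "\<lambda>p q. ((U q)\<^sup>2 \<bullet> \<zeta>t p) * moll ((q - p) /\<^sub>R \<epsilon>)" K K' "N\<^sup>2 * Nt * 1"])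
          show "(\<lambda>z. ((U (snd z))\<^sup>2 \<bullet> \<zeta>t (fst z)) * moll ((snd z - fst z) /\<^sub>R \<epsilon>)) \<in> borel_measurable borel"
            unfolding borel_prod[symmetric, where 'a = "'a \<times> real" and 'b = "'a \<times> real"] by measurable
          show "\<bar>((U q)\<^sup>2 \<bullet> \<zeta>t p) * moll ((q - p) /\<^sub>R \<epsilon>)\<bar> \<le> N\<^sup>2 * Nt * 1" for p q
            unfolding abs_mult inner_real_def
            using power_mono[of "\<bar>U q\<bar>" N 2] N(2)[of q] Nt moll_nonneg[of "(q - p) /\<^sub>R \<epsilon>"] moll_le_1
            by (intro mult_mono) auto
        qed (use b K Kt supp in \<open>auto intro: compact_imp_bounded\<close>)
      qed
      have iR2: "integrable lborel (\<lambda>q. LINT p|lborel. ?R p q)"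
      proof -
        have "(LINT p|lborel. ?R p q) = (LINT p|lborel. ?E p q) + (LINT p|lborel. ?E' p q) - (LINT p|lborel. ((U q)\<^sup>2 \<bullet> \<zeta>t p) * moll ((q - p) /\<^sub>R \<epsilon>))" for q
        proof -
          have "(LINT p|lborel. ?E p q) + (LINT p|lborel. ?E' p q) = (LINT p|lborel. ?R p q + ?S p q)"
            unfolding Bochner_Integration.integral_add[OF i2, symmetric] split ..
          also have "\<dots> = (LINT p|lborel. ?R p q) + (LINT p|lborel. ?S p q)" by (rule Bochner_Integration.integral_add[OF iR iS])
          finally show ?thesis by (simp only: S)
        qed
        then show ?thesis
          by (simp only:) (intro Bochner_Integration.integrable_diff Bochner_Integration.integrable_add i1 iS2)
      qed
      have "2 * (LINT q|lborel. LINT p|lborel. ?E p q) - (LINT q|lborel. LINT p|lborel. ((U q)\<^sup>2 \<bullet> \<zeta>t p) * moll ((q - p) /\<^sub>R \<epsilon>))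
         = (LINT q|lborel. LINT p|lborel. ?R p q)"
        unfolding eq Bochner_Integration.integral_add[OF iR2 iS2] by simp
      also have "\<bar>\<dots>\<bar> \<le> (LINT q|lborel. (N * w * (L * D)) * (unit_ball_vol n * \<epsilon> ^ n) * indicator K' q)"
      proof (rule integral_abs_bound_integral[OF iR2])
        show "integrable lborel (\<lambda>q. (N * w * (L * D)) * (unit_ball_vol n * \<epsilon> ^ n) * indicator K' q)"
          using emeasure_compact_finite[OF K'(1)] by simp
        show "\<bar>LINT p|lborel. ?R p q\<bar> \<le> (N * w * (L * D)) * (unit_ball_vol n * \<epsilon> ^ n) * indicator K' q" for q
          unfolding ballint[symmetric] by (rule integral_abs_bound_integral[OF iR iball bR])
      qed
      also have "\<dots> = A * w * ?Z \<epsilon>"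
        using emeasure_compact_finite[OF K'(1)] moll_mass_pos[of 1, where 'a = "'a \<times> real"]
        by (subst moll_mass_scale[OF \<epsilon>(1)]) (simp add: A_def n_def)
      finally have "\<bar>2 * (LINT q|lborel. LINT p|lborel. ?E p q) - (LINT q|lborel. LINT p|lborel. ((U q)\<^sup>2 \<bullet> \<zeta>t p) * moll ((q - p) /\<^sub>R \<epsilon>))\<bar> / ?Z \<epsilon> \<le> A * w"
        using moll_mass_pos[OF \<epsilon>(1), where 'a = "'a \<times> real"] by (simp add: pos_divide_le_eq)
      then show "dist ((2 * (LINT q|lborel. LINT p|lborel. ?E p q)
       - (LINT q|lborel. LINT p|lborel. ((U q)\<^sup>2 \<bullet> \<zeta>t p) * moll ((q - p) /\<^sub>R \<epsilon>))) / ?Z \<epsilon>) 0 < e"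
        using w(2) moll_mass_pos[OF \<epsilon>(1), where 'a = "'a \<times> real"] by (simp add: dist_real_def abs_divide)
    qed (use d \<delta> in auto)
  qed
  have "((\<lambda>\<epsilon>. ((2 * (LINT q|lborel. LINT p|lborel. U q * (U p * \<zeta> p) * ?m \<epsilon> q p)
     - (LINT q|lborel. LINT p|lborel. ((U q)\<^sup>2 \<bullet> \<zeta>t p) * moll ((q - p) /\<^sub>R \<epsilon>))) / ?Z \<epsilon>
     + (LINT q|lborel. LINT p|lborel. ((U q)\<^sup>2 \<bullet> \<zeta>t p) * moll ((q - p) /\<^sub>R \<epsilon>)) / ?Z \<epsilon>) / 2)
      \<longlongrightarrow> (0 + (LINT q|lborel. (U q)\<^sup>2 \<bullet> \<zeta>t q)) / 2) (at_right 0)"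
    by (intro tendsto_intros rem limit) auto
  then show ?thesis by (simp add: diff_divide_distrib)
qed

text \<open>The equation tested with u \<zeta>. The right-hand side of
  \<open>mollified_identity\<close> converges as in \<open>weak_C1\<close>, the left-hand side by
  antisymmetrization.\<close>

lemma weak_square:
  assumes "Cx K \<zeta> g\<zeta>" "Ct K \<zeta> \<zeta>t" "K \<subseteq> Q"
  shows "(LINT q|lborel. (u q)\<^sup>2 * \<zeta>t q) / 2
    = (LINT q|lborel. gu q \<bullet> (\<zeta> q *\<^sub>R gu q + u q *\<^sub>R g\<zeta> q)) + (LINT q|lborel. f q * (u q * \<zeta> q))"
proof -
  note K = CxD[OF assms(1)] and Kt = CtD[OF assms(2)]
  obtain \<delta> K' where \<delta>: "0 < \<delta>" and K': "compact K'" "K' \<subseteq> Q" "\<And>p q. p \<in> K \<Longrightarrow> norm (q - p) \<le> \<delta> \<Longrightarrow> q \<in> K'"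
    using collar[OF K(1) assms(3)] by metis
  have KK': "p \<in> K'" if "p \<in> K" for p using K'(3)[OF that, of p] \<delta> by simp
  define U where "U \<equiv> \<lambda>q. indicator K' q *\<^sub>R u q"
  define V where "V \<equiv> \<lambda>q. indicator K' q *\<^sub>R gu q"
  define W where "W \<equiv> \<lambda>q. indicator K' q *\<^sub>R f q"
  let ?g = "\<lambda>q. \<zeta> q *\<^sub>R gu q + u q *\<^sub>R g\<zeta> q"
  have \<psi>: "Cx K (\<lambda>p. u p * \<zeta> p) ?g"
  proof (rule CxI[OF open_Q K(1) assms(3)])
    show "((\<lambda>x. u (x, t) * \<zeta> (x, t)) has_derivative (\<lambda>h. ?g (x, t) \<bullet> h)) (at x)" if "(x, t) \<in> Q" for x t
      by (rule has_derivative_eq_rhs[OF has_derivative_mult[OF deriv_u[OF that] K(6)]])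
         (auto simp: inner_add_left algebra_simps)
  qed (use K cont_u cont_gu in \<open>auto intro!: continuous_intros intro: continuous_on_subset\<close>)
  note K\<psi> = CxD[OF \<psi>]
  obtain NV where NV: "\<And>q. norm (V q) \<le> NV" and mV: "V \<in> borel_measurable borel"
    unfolding V_def using bounded_cutoff[OF K'(1,2) cont_gu] by metis
  have [measurable]: "K' \<in> sets borel" using K'(1) by (simp add: borel_compact)
  have mW: "W \<in> borel_measurable borel" using meas_f unfolding W_def by simp
  have NW: "norm (W q) \<le> \<bar>M\<bar>" for q
    using bound_f[of q] by (auto simp: W_def indicator_def)
  have supp: "V q = 0" "W q = 0" if "q \<notin> K'" for q using that by (auto simp: V_def W_def)
  note b = compact_imp_bounded[OF K'(1)]
  let ?Z = "moll_mass TYPE('a \<times> real)"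
  have 1: "((\<lambda>\<epsilon>. (LINT q|lborel. LINT p|lborel. U q * (U p * \<zeta> p) * (dmoll (0, 1) ((q - p) /\<^sub>R \<epsilon>) / \<epsilon>)) / ?Z \<epsilon>)
     \<longlongrightarrow> (LINT q|lborel. (U q)\<^sup>2 * \<zeta>t q) / 2) (at_right 0)"
    unfolding U_def by (rule antisymmetrized_tendsto[OF assms(1,2) \<delta> K'])
  have 2: "((\<lambda>\<epsilon>. (LINT q|lborel. LINT p|lborel. (V q \<bullet> ?g p) * moll ((q - p) /\<^sub>R \<epsilon>)) / ?Z \<epsilon>) \<longlongrightarrow> (LINT q|lborel. V q \<bullet> ?g q)) (at_right 0)"
    by (rule moll_convolution_tendsto[OF mV b supp(1) NV K\<psi>(3,1,5)])
  have 3: "((\<lambda>\<epsilon>. (LINT q|lborel. LINT p|lborel. (W q \<bullet> (u p * \<zeta> p)) * moll ((q - p) /\<^sub>R \<epsilon>)) / ?Z \<epsilon>) \<longlongrightarrow> (LINT q|lborel. W q \<bullet> (u q * \<zeta> q))) (at_right 0)"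
    by (rule moll_convolution_tendsto[OF mW b supp(2) NW K\<psi>(2,1,4)])
  have ev: "\<forall>\<^sub>F \<epsilon> in at_right 0. (LINT q|lborel. LINT p|lborel. U q * (U p * \<zeta> p) * (dmoll (0, 1) ((q - p) /\<^sub>R \<epsilon>) / \<epsilon>)) / ?Z \<epsilon>
    = (LINT q|lborel. LINT p|lborel. (V q \<bullet> ?g p) * moll ((q - p) /\<^sub>R \<epsilon>)) / ?Z \<epsilon>
    + (LINT q|lborel. LINT p|lborel. (W q \<bullet> (u p * \<zeta> p)) * moll ((q - p) /\<^sub>R \<epsilon>)) / ?Z \<epsilon>"
    unfolding eventually_at_right_field
  proof (intro exI[of _ \<delta>] conjI \<delta> allI impI)
    fix \<epsilon> :: real assume \<epsilon>: "0 < \<epsilon>" "\<epsilon> < \<delta>"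
    have U: "U p * \<zeta> p = u p * \<zeta> p" for p using KK'[of p] K(4)[of p] by (cases "p \<in> K") (simp_all add: U_def)
    have "(LINT q|lborel. LINT p|lborel. U q * (u p * \<zeta> p) * (dmoll (0, 1) ((q - p) /\<^sub>R \<epsilon>) / \<epsilon>))
     = (LINT q|lborel. LINT p|lborel. (V q \<bullet> ?g p) * moll ((q - p) /\<^sub>R \<epsilon>))
     + (LINT q|lborel. LINT p|lborel. (W q \<bullet> (u p * \<zeta> p)) * moll ((q - p) /\<^sub>R \<epsilon>))"
      unfolding U_def V_def W_def
      by (rule mollified_identity[OF K'(1,2) _ \<epsilon>(1) \<psi>]) (use K'(3) \<epsilon> in auto)
    then show "(LINT q|lborel. LINT p|lborel. U q * (U p * \<zeta> p) * (dmoll (0, 1) ((q - p) /\<^sub>R \<epsilon>) / \<epsilon>)) / ?Z \<epsilon>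
    = (LINT q|lborel. LINT p|lborel. (V q \<bullet> ?g p) * moll ((q - p) /\<^sub>R \<epsilon>)) / ?Z \<epsilon>
    + (LINT q|lborel. LINT p|lborel. (W q \<bullet> (u p * \<zeta> p)) * moll ((q - p) /\<^sub>R \<epsilon>)) / ?Z \<epsilon>"
      by (simp only: U add_divide_distrib)
  qed
  have "(LINT q|lborel. (U q)\<^sup>2 * \<zeta>t q) / 2 = (LINT q|lborel. V q \<bullet> ?g q) + (LINT q|lborel. W q \<bullet> (u q * \<zeta> q))"
    using tendsto_unique[OF _ tendsto_cong[OF ev, THEN iffD1, OF 1] tendsto_add[OF 2 3]] by simp
  moreover have "(U q)\<^sup>2 * \<zeta>t q = (u q)\<^sup>2 * \<zeta>t q" "V q \<bullet> ?g q = gu q \<bullet> ?g q" "W q \<bullet> (u q * \<zeta> q) = f q * (u q * \<zeta> q)" for q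
    using KK'[of q] K(4,5)[of q] Kt(5)[of q] by (cases "q \<in> K"; simp add: U_def V_def W_def)+
  ultimately show ?thesis by (simp only:)
qed

end

section \<open>Test functions and the equation in parabolic self-similar variables\<close>

definition C1_compact :: "'a::euclidean_space set \<Rightarrow> ('a \<Rightarrow> real) \<Rightarrow> ('a \<Rightarrow> 'a) \<Rightarrow> bool" where
  "C1_compact K \<theta> g \<longleftrightarrow> compact K \<and> continuous_on UNIV \<theta> \<and> continuous_on UNIV g \<and>
     (\<forall>y. y \<notin> K \<longrightarrow> \<theta> y = 0 \<and> g y = 0) \<and> (\<forall>y. (\<theta> has_derivative (\<lambda>h. g y \<bullet> h)) (at y))"

lemma C1_compactD:
  assumes "C1_compact K \<theta> g"
  shows "compact K" "continuous_on UNIV \<theta>" "continuous_on UNIV g" "\<And>y. y \<notin> K \<Longrightarrow> \<theta> y = 0"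
    "\<And>y. y \<notin> K \<Longrightarrow> g y = 0" "\<And>y. (\<theta> has_derivative (\<lambda>h. g y \<bullet> h)) (at y)"
  using assms by (auto simp: C1_compact_def)

lemma C1_compactI:
  assumes "open P" "compact K" "K \<subseteq> P" "continuous_on P \<theta>" "continuous_on P g"
    "\<And>p. p \<notin> K \<Longrightarrow> \<theta> p = 0" "\<And>p. p \<notin> K \<Longrightarrow> g p = 0"
    "\<And>x. x \<in> P \<Longrightarrow> (\<theta> has_derivative (\<lambda>h. g x \<bullet> h)) (at x)"
  shows "C1_compact K \<theta> g"
proof -
  have "(\<theta> has_derivative (\<lambda>h. g x \<bullet> h)) (at x)" for x
  proof (cases "x \<in> P")
    case False
    then have g0: "g x = 0" "x \<in> - K" using assms(3,7) by auto
    have 2: "((\<lambda>x. 0) has_derivative (\<lambda>h. g x \<bullet> h)) (at x)" using g0 by simp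
    show ?thesis
      by (rule has_derivative_transform_within_open[OF 2 _ g0(2)])
         (use assms(2,6) in \<open>auto simp: open_Compl compact_imp_closed\<close>)
  qed (use assms in auto)
  then show ?thesis
    unfolding C1_compact_def using assms(2,6,7)
      continuous_extend_zero[OF assms(1-3) assms(4,6)] continuous_extend_zero[OF assms(1-3) assms(5,7)] by simp
qed

text \<open>The integrand is the divergence of the field \<theta> y. This removes the terms that the
  time derivative produces through the rescaling of the space variable.\<close>

lemma integral_divergence_radial:
  fixes \<theta> :: "'a::euclidean_space \<Rightarrow> real"
  assumes "C1_compact K \<theta> g"
  shows "(LINT y|lborel. real DIM('a) * \<theta> y + g y \<bullet> y) = 0"
proof -
  note K = C1_compactD[OF assms]
  let ?F' = "\<lambda>i y. (g y \<bullet> i) * (y \<bullet> i) + \<theta> y"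
  have "(LINT y|lborel. ?F' i y) = 0" if "i \<in> Basis" for i
  proof (rule integral_directional_derivative_zero[of "\<lambda>y. \<theta> y * (y \<bullet> i)" _ K i])
    fix x
    have d: "(\<theta> has_derivative (\<lambda>h. g x \<bullet> h)) (at (x + 0 *\<^sub>R i))" using K(6) by simp
    have l: "((\<lambda>s. x + s *\<^sub>R i) has_derivative (\<lambda>s. s *\<^sub>R i)) (at 0)"
      by (auto intro!: derivative_eq_intros)
    have "((\<lambda>s. \<theta> (x + s *\<^sub>R i)) has_derivative (\<lambda>s. g x \<bullet> (s *\<^sub>R i))) (at 0)"
      using has_derivative_compose[where f = "\<lambda>s. x + s *\<^sub>R i" and f' = "\<lambda>s. s *\<^sub>R i" and x = 0 and s = UNIV, OF l d] .
    then have "((\<lambda>s. \<theta> (x + s *\<^sub>R i)) has_real_derivative g x \<bullet> i) (at 0)"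
      by (simp add: has_field_derivative_def mult_commute_abs)
    moreover have "((\<lambda>s. (x + s *\<^sub>R i) \<bullet> i) has_real_derivative 1) (at 0)"
      using that by (auto intro!: derivative_eq_intros simp: inner_add_left)
    ultimately show "((\<lambda>s. \<theta> (x + s *\<^sub>R i) * ((x + s *\<^sub>R i) \<bullet> i)) has_real_derivative ?F' i x) (at 0)"
      by (rule DERIV_cong[OF DERIV_mult]) simp
  qed (use K in \<open>auto intro!: continuous_intros\<close>)
  moreover have "real DIM('a) * \<theta> y + g y \<bullet> y = (\<Sum>i\<in>Basis. ?F' i y)" for y
    by (simp add: sum.distrib euclidean_inner[of "g y" y])
  moreover have "integrable lborel (?F' i)" for i
    using K by (intro integrable_continuous_support[where K = K]) (auto intro!: continuous_intros)
  ultimately show ?thesis by simp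
qed

text \<open>Fubini separates the time slices, each slice is scaled by sqrt z, and the time axis is
  reflected; the power of sqrt z is the Jacobian of the scaling.\<close>

lemma parabolic_change_of_variables:
  fixes \<Phi> :: "'a::euclidean_space \<times> real \<Rightarrow> real"
  assumes int: "integrable lborel \<Phi>" and meas[measurable]: "\<Phi> \<in> borel_measurable borel"
    and neg: "\<And>x t. 0 \<le> t \<Longrightarrow> \<Phi> (x, t) = 0"
  defines "S \<equiv> \<lambda>z. LINT y|lborel. sqrt z ^ DIM('a) * \<Phi> (sqrt z *\<^sub>R y, - z)"
  shows "(LINT p|lborel. \<Phi> p) = (LINT z|lborel. indicator {0<..} z * S z)"
    and "integrable lborel (\<lambda>z. indicator {0<..} z * S z)"
proof -
  have int': "integrable (lborel \<Otimes>\<^sub>M lborel) (\<lambda>(x, t). \<Phi> (x, t))"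
    using int unfolding lborel_prod by simp
  let ?I = "\<lambda>t. LINT x|lborel. \<Phi> (x, t)"
  have I: "integrable lborel ?I" "(LINT t|lborel. ?I t) = (LINT p|lborel. \<Phi> p)"
    using lborel_pair.integrable_snd[OF int'] lborel_pair.integral_snd[OF int'] by (simp_all add: lborel_prod)
  have sl: "(\<lambda>x. \<Phi> (x, t)) \<in> borel_measurable borel" for t
  proof -
    have "(\<lambda>x::'a. (x, t)) \<in> borel_measurable borel"
      by (intro borel_measurable_continuous_onI continuous_intros)
    from measurable_compose[OF this meas] show ?thesis .
  qed
  have eq: "?I (- z) = indicator {0<..} z * S z" for z
  proof (cases "0 < z")
    case True
    then have "?I (- z) = sqrt z ^ DIM('a) * (LINT y|lborel. \<Phi> (sqrt z *\<^sub>R y, - z))"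
      by (intro integral_lborel_scale sl) auto
    then show ?thesis using True by (simp add: S_def)
  next
    case False
    then have "\<Phi> (x, - z) = 0" for x using neg[of "- z" x] by simp
    then show ?thesis using False by simp
  qed
  have mI: "?I \<in> borel_measurable borel" using I(1) by auto
  have "(LINT z|lborel. ?I (0 - z)) = (LINT t|lborel. ?I t)"
    by (rule integral_lborel_reflect[OF mI])
  then show "(LINT p|lborel. \<Phi> p) = (LINT z|lborel. indicator {0<..} z * S z)"
    using I(2) by (simp add: eq)
  have "integrable lborel (\<lambda>z. ?I (0 + (- 1) * z))"
    using I(1) by (intro lborel_integrable_real_affine) auto
  then show "integrable lborel (\<lambda>z. indicator {0<..} z * S z)" by (simp add: eq)
qed

text \<open>In the parabolic variables \<open>y = x / sqrt (- t)\<close>, \<open>z = - t\<close> the function \<open>lift \<eta> \<theta>\<close> is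
  \<open>\<eta> z * \<theta> y\<close> up to the Jacobian factor.\<close>

definition lift :: "(real \<Rightarrow> real) \<Rightarrow> ('a::euclidean_space \<Rightarrow> real) \<Rightarrow> 'a \<times> real \<Rightarrow> real" where
  "lift \<eta> \<theta> = (\<lambda>(x, t). \<eta> (- t) * (1 / sqrt (- t)) ^ DIM('a) * \<theta> ((1 / sqrt (- t)) *\<^sub>R x))"

definition lift_x :: "(real \<Rightarrow> real) \<Rightarrow> ('a::euclidean_space \<Rightarrow> 'a) \<Rightarrow> 'a \<times> real \<Rightarrow> 'a" where
  "lift_x \<eta> g = (\<lambda>(x, t). (\<eta> (- t) * (1 / sqrt (- t)) ^ (DIM('a) + 1)) *\<^sub>R g ((1 / sqrt (- t)) *\<^sub>R x))"

text \<open>The time derivative of \<open>lift\<close>: s = 1 / sqrt (- t) has derivative s^3 / 2,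
  and differentiating the Jacobian factor and the argument of \<theta> produces together the
  divergence of \<theta> y, evaluated at s x.\<close>

definition lift_t :: "(real \<Rightarrow> real) \<Rightarrow> (real \<Rightarrow> real) \<Rightarrow> ('a::euclidean_space \<Rightarrow> real) \<Rightarrow> ('a \<Rightarrow> 'a) \<Rightarrow> 'a \<times> real \<Rightarrow> real" where
  "lift_t \<eta> \<eta>' \<theta> g = (\<lambda>(x, t). let s = 1 / sqrt (- t) in
     - \<eta>' (- t) * s ^ DIM('a) * \<theta> (s *\<^sub>R x)
     + \<eta> (- t) / 2 * s ^ (DIM('a) + 2) * (real DIM('a) * \<theta> (s *\<^sub>R x) + g (s *\<^sub>R x) \<bullet> (s *\<^sub>R x)))"

definition time_cutoff :: "real \<Rightarrow> real \<Rightarrow> (real \<Rightarrow> real) \<Rightarrow> (real \<Rightarrow> real) \<Rightarrow> bool" where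
  "time_cutoff a b \<eta> \<eta>' \<longleftrightarrow> 0 < a \<and> b < 1 \<and> continuous_on UNIV \<eta> \<and> continuous_on UNIV \<eta>' \<and>
     (\<forall>z. (\<eta> has_real_derivative \<eta>' z) (at z)) \<and> (\<forall>z. z \<notin> {a..b} \<longrightarrow> \<eta> z = 0 \<and> \<eta>' z = 0) \<and> (\<forall>z. 0 \<le> \<eta> z)"

lemma time_cutoffD:
  assumes "time_cutoff a b \<eta> \<eta>'"
  shows "0 < a" "b < 1" "continuous_on UNIV \<eta>" "continuous_on UNIV \<eta>'" "\<And>z. (\<eta> has_real_derivative \<eta>' z) (at z)"
    "\<And>z. z \<notin> {a..b} \<Longrightarrow> \<eta> z = 0" "\<And>z. z \<notin> {a..b} \<Longrightarrow> \<eta>' z = 0" "\<And>z. 0 \<le> \<eta> z"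
  using assms by (auto simp: time_cutoff_def)

lemma has_real_derivative_inverse_sqrt_neg:
  assumes "t < 0"
  shows "((\<lambda>t. 1 / sqrt (- t)) has_real_derivative (1 / sqrt (- t)) ^ 3 / 2) (at t)"
proof -
  have "((\<lambda>t. 1 / sqrt (- t)) has_real_derivative - (- (inverse (sqrt (- t)) / 2)) / (sqrt (- t))\<^sup>2) (at t)"
    using assms by (auto intro!: derivative_eq_intros simp: power2_eq_square)
  then show ?thesis
    by (rule DERIV_cong) (use assms in \<open>simp add: power3_eq_cube power2_eq_square inverse_eq_divide\<close>)
qed

lemma lift_C1:
  fixes \<theta> :: "'a::euclidean_space \<Rightarrow> real"
  assumes \<theta>: "C1_compact K \<theta> g" and \<eta>: "time_cutoff a b \<eta> \<eta>'"
    and P: "K \<subseteq> P" "\<And>y s. y \<in> P \<Longrightarrow> 0 < s \<Longrightarrow> s *\<^sub>R y \<in> P"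
  defines "L \<equiv> (\<lambda>(y, z). (sqrt z *\<^sub>R y, - z)) ` (K \<times> {a..b})"
  shows "Cx L (lift \<eta> \<theta>) (lift_x \<eta> g)" "Ct L (lift \<eta> \<theta>) (lift_t \<eta> \<eta>' \<theta> g)" "L \<subseteq> P \<times> {-1<..<0}"
proof -
  note K = C1_compactD[OF \<theta>] and E = time_cutoffD[OF \<eta>]
  have cL: "compact L"
    unfolding L_def case_prod_unfold using K(1)
    by (intro compact_continuous_image continuous_intros compact_Times) auto
  show L: "L \<subseteq> P \<times> {-1<..<0}"
    using P E(1,2) by (auto simp: L_def intro!: P(2))
  have L': "L \<subseteq> UNIV \<times> {-1<..<0}" using L by auto
  have oQ: "open ((UNIV :: 'a set) \<times> {-1<..<0::real})" by (intro open_Times) auto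
  have mem: "(x, t) \<in> L" if "- t \<in> {a..b}" "(1 / sqrt (- t)) *\<^sub>R x \<in> K" for x t
    unfolding L_def using that E(1) by (intro image_eqI[of _ _ "((1 / sqrt (- t)) *\<^sub>R x, - t)"]) auto
  have out: "\<eta> (- t) = 0 \<and> \<eta>' (- t) = 0 \<or> \<theta> ((1 / sqrt (- t)) *\<^sub>R x) = 0 \<and> g ((1 / sqrt (- t)) *\<^sub>R x) = 0"
    if "(x, t) \<notin> L" for x t
    using mem[of t x] that K(4,5) E(6,7) by blast
  have cs: "continuous_on (UNIV \<times> {-1<..<0}) (\<lambda>p :: 'a \<times> real. 1 / sqrt (- snd p))"
    by (auto intro!: continuous_intros)
  have c\<theta>: "continuous_on (UNIV \<times> {-1<..<0}) (\<lambda>p :: 'a \<times> real. \<theta> ((1 / sqrt (- snd p)) *\<^sub>R fst p))"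
    "continuous_on (UNIV \<times> {-1<..<0}) (\<lambda>p :: 'a \<times> real. g ((1 / sqrt (- snd p)) *\<^sub>R fst p))"
    by (rule continuous_on_compose2[OF K(2)] continuous_on_compose2[OF K(3)]; intro continuous_intros cs subset_UNIV)+
  have c\<eta>: "continuous_on (UNIV \<times> {-1<..<0}) (\<lambda>p :: 'a \<times> real. \<eta> (- snd p))"
    "continuous_on (UNIV \<times> {-1<..<0}) (\<lambda>p :: 'a \<times> real. \<eta>' (- snd p))"
    by (rule continuous_on_compose2[OF E(3)] continuous_on_compose2[OF E(4)]; intro continuous_intros subset_UNIV)+
  have cont1: "continuous_on (UNIV \<times> {-1<..<0}) (lift \<eta> \<theta>)"
    unfolding lift_def case_prod_unfold by (intro continuous_on_mult continuous_on_power cs c\<theta> c\<eta>)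
  show "Cx L (lift \<eta> \<theta>) (lift_x \<eta> g)"
  proof (rule CxI[OF oQ cL L' cont1])
    show "continuous_on (UNIV \<times> {-1<..<0}) (lift_x \<eta> g)"
      unfolding lift_x_def case_prod_unfold by (intro continuous_on_mult continuous_on_scaleR continuous_on_power cs c\<theta> c\<eta>)
    show "lift \<eta> \<theta> p = 0" "lift_x \<eta> g p = 0" if "p \<notin> L" for p
      using out[of "fst p" "snd p"] that by (auto simp: lift_def lift_x_def case_prod_unfold)
    fix x :: 'a and t :: real
    let ?s = "1 / sqrt (- t)"
    have d: "((\<lambda>x. \<theta> (?s *\<^sub>R x)) has_derivative (\<lambda>h. g (?s *\<^sub>R x) \<bullet> (?s *\<^sub>R h))) (at x)"
      by (rule has_derivative_compose[OF _ K(6)]) (auto intro!: derivative_eq_intros)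
    show "((\<lambda>x. lift \<eta> \<theta> (x, t)) has_derivative (\<lambda>h. lift_x \<eta> g (x, t) \<bullet> h)) (at x)"
      unfolding lift_def prod.case
      by (rule has_derivative_eq_rhs[OF has_derivative_mult_right[OF d]])
         (auto simp: lift_x_def fun_eq_iff)
  qed
  show "Ct L (lift \<eta> \<theta>) (lift_t \<eta> \<eta>' \<theta> g)"
  proof (rule CtI[OF oQ cL L' cont1])
    show "continuous_on (UNIV \<times> {-1<..<0}) (lift_t \<eta> \<eta>' \<theta> g)"
      unfolding lift_t_def case_prod_unfold Let_def by (intro continuous_intros cs c\<theta> c\<eta>) auto
    show "lift \<eta> \<theta> p = 0" "lift_t \<eta> \<eta>' \<theta> g p = 0" if "p \<notin> L" for p
      using out[of "fst p" "snd p"] that by (auto simp: lift_def lift_t_def case_prod_unfold Let_def)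
    fix x :: 'a and t :: real
    assume t: "(x, t) \<in> UNIV \<times> {-1<..<0}"
    define s where "s = 1 / sqrt (- t)"
    have s: "((\<lambda>t. 1 / sqrt (- t)) has_real_derivative s ^ 3 / 2) (at t)"
      using has_real_derivative_inverse_sqrt_neg[of t] t by (simp add: s_def)
    have "((\<lambda>t. (1 / sqrt (- t)) *\<^sub>R x) has_derivative (\<lambda>h. (h * (s ^ 3 / 2)) *\<^sub>R x)) (at t)"
      by (rule has_derivative_eq_rhs[OF has_derivative_scaleR_left[OF s[unfolded has_field_derivative_def]]])
         (auto simp: mult.commute)
    from has_derivative_compose[OF this K(6)]
    have "((\<lambda>t. \<theta> ((1 / sqrt (- t)) *\<^sub>R x)) has_derivative (\<lambda>h. g (s *\<^sub>R x) \<bullet> ((h * (s ^ 3 / 2)) *\<^sub>R x))) (at t)"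
      by (simp add: s_def)
    then have d: "((\<lambda>t. \<theta> ((1 / sqrt (- t)) *\<^sub>R x)) has_real_derivative s ^ 3 / 2 * (g (s *\<^sub>R x) \<bullet> x)) (at t)"
      unfolding has_field_derivative_def by (rule has_derivative_eq_rhs) (auto simp: fun_eq_iff)
    have e: "((\<lambda>t. \<eta> (- t)) has_real_derivative - \<eta>' (- t)) (at t)"
      using DERIV_chain2[OF E(5) DERIV_minus[OF DERIV_ident]] by simp
    obtain n where n: "DIM('a) = Suc n" using DIM_positive[where 'a = 'a] gr0_implies_Suc by metis
    have p: "((\<lambda>t. (1 / sqrt (- t)) ^ DIM('a)) has_real_derivative real DIM('a) * (s ^ 3 / 2) * s ^ n) (at t)"
      using DERIV_power[OF s, of "DIM('a)"] by (simp add: n s_def mult_ac)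
    show "((\<lambda>t. lift \<eta> \<theta> (x, t)) has_real_derivative lift_t \<eta> \<eta>' \<theta> g (x, t)) (at t)"
      unfolding lift_def prod.case
      by (rule DERIV_cong[OF DERIV_mult[OF DERIV_mult[OF e p] d]])
         (simp only: s_def[symmetric] lift_t_def Let_def prod.case n, simp add: algebra_simps add_divide_distrib power3_eq_cube power2_eq_square)
  qed
qed


text \<open>The domain is a cone so that it is invariant under the scalings by sqrt z.\<close>

locale heat_cone = weak_heat "P \<times> {-1<..<0}" u f gu M
  for P :: "'a::euclidean_space set" and u f gu M +
  assumes open_P: "open P" and cone: "\<And>y s. y \<in> P \<Longrightarrow> 0 < s \<Longrightarrow> s *\<^sub>R y \<in> P"
begin

definition v :: "'a \<Rightarrow> real \<Rightarrow> real" where "v y z = u (sqrt z *\<^sub>R y, - z)"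
definition gv :: "'a \<Rightarrow> real \<Rightarrow> 'a" where "gv y z = sqrt z *\<^sub>R gu (sqrt z *\<^sub>R y, - z)"
definition fv :: "'a \<Rightarrow> real \<Rightarrow> real" where "fv y z = f (sqrt z *\<^sub>R y, - z)"

lemma continuous_v: "0 < z \<Longrightarrow> z < 1 \<Longrightarrow> continuous_on P (\<lambda>y. v y z)"
  unfolding v_def by (rule continuous_on_compose2[OF cont_u]) (auto intro!: continuous_intros cone)

lemma continuous_gv: "0 < z \<Longrightarrow> z < 1 \<Longrightarrow> continuous_on P (\<lambda>y. gv y z)"
  unfolding gv_def
  by (intro continuous_on_scaleR continuous_on_const, rule continuous_on_compose2[OF cont_gu])
     (auto intro!: continuous_intros cone)

lemma has_derivative_v:
  assumes "0 < z" "z < 1" "y \<in> P"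
  shows "((\<lambda>y. v y z) has_derivative (\<lambda>h. gv y z \<bullet> h)) (at y)"
proof -
  have "((\<lambda>x. u (x, - z)) has_derivative (\<lambda>h. gu (sqrt z *\<^sub>R y, - z) \<bullet> h)) (at (sqrt z *\<^sub>R y))"
    using assms by (intro deriv_u) (auto intro: cone)
  note d = this
  have l: "((\<lambda>y. sqrt z *\<^sub>R y) has_derivative (\<lambda>h. sqrt z *\<^sub>R h)) (at y)"
    by (auto intro!: derivative_eq_intros)
  have "((\<lambda>y. v y z) has_derivative (\<lambda>h. gu (sqrt z *\<^sub>R y, - z) \<bullet> (sqrt z *\<^sub>R h))) (at y)"
    unfolding v_def
    using has_derivative_compose[where f = "\<lambda>y. sqrt z *\<^sub>R y" and f' = "\<lambda>h. sqrt z *\<^sub>R h" and x = y and s = UNIV, OF l d] .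
  then show ?thesis
    by (rule has_derivative_eq_rhs) (auto simp: gv_def fun_eq_iff)
qed

text \<open>The equation tested with (U - v) \<theta>: the part with \<open>U\<close>, which does
  not depend on \<open>z\<close>, comes from \<open>weak_C1\<close> and the part with
  \<open>v\<close> from \<open>weak_square\<close>. The rescaling adds a drift term, visible as the
  summand (\<theta> y / 2) y; for a Gaussian \<theta> the gradient \<open>g y\<close> cancels
  it.\<close>

lemma comparison_identity:
  assumes \<theta>: "C1_compact K \<theta> g" "K \<subseteq> P" and \<eta>: "time_cutoff a b \<eta> \<eta>'"
    and U: "\<And>y. y \<in> P \<Longrightarrow> (U has_derivative (\<lambda>h. gU y \<bullet> h)) (at y)" "continuous_on P U" "continuous_on P gU"
  defines "A \<equiv> \<lambda>z. \<eta>' z * (LINT y|lborel. (v y z * U y - (v y z)\<^sup>2 / 2) * \<theta> y)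
      + \<eta> z / z * (LINT y|lborel. gv y z \<bullet> ((U y - v y z) *\<^sub>R (g y + (\<theta> y / 2) *\<^sub>R y) + \<theta> y *\<^sub>R (gU y - gv y z)))"
    and "B \<equiv> \<lambda>z. \<eta> z * (LINT y|lborel. fv y z * ((U y - v y z) * \<theta> y))"
  shows "(LINT z|lborel. indicator {0<..} z * A z) = - (LINT z|lborel. indicator {0<..} z * B z)"
    "integrable lborel (\<lambda>z. indicator {0<..} z * A z)" "integrable lborel (\<lambda>z. indicator {0<..} z * B z)"
proof -
  note K = C1_compactD[OF \<theta>(1)] and E = time_cutoffD[OF \<eta>]
  let ?n = "DIM('a)" and ?Q = "P \<times> {-1<..<0::real}"
  define \<theta>2 where "\<theta>2 y = U y * \<theta> y" for y
  define g2 where "g2 y = U y *\<^sub>R g y + \<theta> y *\<^sub>R gU y" for y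
  have \<theta>2: "C1_compact K \<theta>2 g2"
  proof (rule C1_compactI[OF open_P K(1) \<theta>(2)])
    show "(\<theta>2 has_derivative (\<lambda>h. g2 x \<bullet> h)) (at x)" if "x \<in> P" for x
      unfolding \<theta>2_def g2_def
      by (rule has_derivative_eq_rhs[OF has_derivative_mult[OF U(1)[OF that] K(6)]])
         (auto simp: inner_add_left algebra_simps)
    show "\<theta>2 p = 0" "g2 p = 0" if "p \<notin> K" for p using K(4,5)[OF that] by (simp_all add: \<theta>2_def g2_def)
    show "continuous_on P \<theta>2" "continuous_on P g2" unfolding \<theta>2_def g2_def
      using K(2,3) U(2,3) by (auto intro!: continuous_intros intro: continuous_on_subset)
  qed
  let ?L = "(\<lambda>(y, z). (sqrt z *\<^sub>R y, - z)) ` (K \<times> {a..b})"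
  have L: "Cx ?L (lift \<eta> \<theta>) (lift_x \<eta> g)" "Ct ?L (lift \<eta> \<theta>) (lift_t \<eta> \<eta>' \<theta> g)" "?L \<subseteq> ?Q"
    by (rule lift_C1[OF \<theta>(1) \<eta> \<theta>(2)]; (rule cone; assumption)?)+
  have L2: "Cx ?L (lift \<eta> \<theta>2) (lift_x \<eta> g2)" "Ct ?L (lift \<eta> \<theta>2) (lift_t \<eta> \<eta>' \<theta>2 g2)" "?L \<subseteq> ?Q"
    by (rule lift_C1[OF \<theta>2 \<eta> \<theta>(2)]; (rule cone; assumption)?)+
  note D = CxD[OF L(1)] CtD[OF L(2)] and D2 = CxD[OF L2(1)] CtD[OF L2(2)]
  let ?\<psi> = "lift \<eta> \<theta>2" and ?\<psi>x = "lift_x \<eta> g2" and ?\<psi>t = "lift_t \<eta> \<eta>' \<theta>2 g2"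
  let ?\<zeta> = "lift \<eta> \<theta>" and ?\<zeta>x = "lift_x \<eta> g" and ?\<zeta>t = "lift_t \<eta> \<eta>' \<theta> g"
  have out: "?\<psi> p = 0" "?\<psi>x p = 0" "?\<psi>t p = 0" "?\<zeta> p = 0" "?\<zeta>x p = 0" "?\<zeta>t p = 0" if "p \<notin> ?L" for p
    using D(4,5,11)[OF that] D2(4,5,11)[OF that] by auto
  have cQ: "continuous_on ?Q ?\<psi>" "continuous_on ?Q ?\<psi>x" "continuous_on ?Q ?\<psi>t"
    "continuous_on ?Q ?\<zeta>" "continuous_on ?Q ?\<zeta>x" "continuous_on ?Q ?\<zeta>t"
    using D(2,3,9) D2(2,3,9) continuous_on_subset by blast+
  have good: "continuous_on UNIV F" "integrable lborel F"
    if "continuous_on ?Q F" "\<And>p. p \<notin> ?L \<Longrightarrow> F p = 0" for F :: "'a \<times> real \<Rightarrow> real"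
  proof -
    show "continuous_on UNIV F" using continuous_extend_zero[OF open_Q D(1) L(3) that] .
    then show "integrable lborel F" by (rule integrable_continuous_support[OF _ D(1)]) (rule that(2))
  qed
  \<comment> \<open>\<open>\<Phi>\<close> is the difference of the two weak identities without the
    inhomogeneity and \<open>\<Psi>\<close> the inhomogeneity. Their integrals agree, and each is
    transformed to the variables y and z separately.\<close>
  define \<Phi> where "\<Phi> p = (u p * ?\<psi>t p - gu p \<bullet> ?\<psi>x p) - ((u p)\<^sup>2 * ?\<zeta>t p / 2 - gu p \<bullet> (?\<zeta> p *\<^sub>R gu p + u p *\<^sub>R ?\<zeta>x p))" for p
  define \<Psi> where "\<Psi> p = f p * (?\<psi> p - u p * ?\<zeta> p)" for p
  have c\<Phi>: "continuous_on UNIV \<Phi>" and i\<Phi>: "integrable lborel \<Phi>"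
    by (rule good; unfold \<Phi>_def; (intro continuous_intros cQ cont_u cont_gu)?; simp add: out)+
  have c1: "continuous_on UNIV (\<lambda>p. ?\<psi> p - u p * ?\<zeta> p)"
    by (rule good; (intro continuous_intros cQ cont_u cont_gu)?; simp add: out)
  have c2: "continuous_on UNIV (\<lambda>p. u p * ?\<zeta> p)"
    by (rule good; (intro continuous_intros cQ cont_u cont_gu)?; simp add: out)
  have bdf: "integrable lborel (\<lambda>p. f p * F p)" if F: "continuous_on UNIV F" "\<And>p. p \<notin> ?L \<Longrightarrow> F p = 0" for F
  proof -
    obtain N where N: "0 \<le> N" "\<And>x. norm (F x) \<le> N" using bounded_continuous_support[OF F(1) D(1) F(2)] by metis
    have "F \<in> borel_measurable borel" using F(1) borel_measurable_continuous_onI by blast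
    then show ?thesis
      using meas_f bound_f N F(2) D(1)
      by (intro integrable_bounded_support[of _ ?L "\<bar>M\<bar> * N"])
         (auto simp: abs_mult intro: compact_imp_bounded intro!: mult_mono order_trans[OF bound_f abs_ge_self])
  qed
  have i\<Psi>: "integrable lborel \<Psi>" unfolding \<Psi>_def by (rule bdf[OF c1]) (simp add: out)
  have m\<Psi>: "\<Psi> \<in> borel_measurable borel" unfolding \<Psi>_def
    using meas_f borel_measurable_continuous_onI[OF c1] by simp
  have m\<Phi>: "\<Phi> \<in> borel_measurable borel" using c\<Phi> borel_measurable_continuous_onI by blast
  have eq: "(LINT p|lborel. \<Phi> p) = (LINT p|lborel. \<Psi> p)"
  proof -
    have i: "integrable lborel (\<lambda>p. u p * ?\<psi>t p)" "integrable lborel (\<lambda>p. gu p \<bullet> ?\<psi>x p)"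
      "integrable lborel (\<lambda>p. (u p)\<^sup>2 * ?\<zeta>t p)" "integrable lborel (\<lambda>p. gu p \<bullet> (?\<zeta> p *\<^sub>R gu p + u p *\<^sub>R ?\<zeta>x p))"
      by (rule good; (intro continuous_intros cQ cont_u cont_gu)?; simp add: out)+
    have j: "integrable lborel (\<lambda>p. f p * ?\<psi> p)" "integrable lborel (\<lambda>p. f p * (u p * ?\<zeta> p))"
      by (rule bdf[OF D2(2)] bdf[OF c2]; simp add: out)+
    have "(LINT p|lborel. \<Phi> p) = ((LINT p|lborel. u p * ?\<psi>t p) - (LINT p|lborel. gu p \<bullet> ?\<psi>x p))
       - ((LINT p|lborel. (u p)\<^sup>2 * ?\<zeta>t p) / 2 - (LINT p|lborel. gu p \<bullet> (?\<zeta> p *\<^sub>R gu p + u p *\<^sub>R ?\<zeta>x p)))"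
      unfolding \<Phi>_def using i by simp
    also have "\<dots> = (LINT p|lborel. f p * ?\<psi> p) - (LINT p|lborel. f p * (u p * ?\<zeta> p))"
      using weak_C1[OF L2(1,2,3)] weak_square[OF L(1,2,3)] by linarith
    also have "\<dots> = (LINT p|lborel. \<Psi> p)"
      unfolding \<Psi>_def using j by (simp add: right_diff_distrib)
    finally show ?thesis .
  qed
  have neg: "(x, t) \<notin> ?L" if "0 \<le> t" for x t using that E(1) by auto
  note pc\<Phi> = parabolic_change_of_variables[OF i\<Phi> m\<Phi>] and pc\<Psi> = parabolic_change_of_variables[OF i\<Psi> m\<Psi>]
  have sc: "lift \<eta> \<theta>' (sqrt z *\<^sub>R y, - z) = (1 / sqrt z) ^ ?n * (\<eta> z * \<theta>' y)"
    "lift_x \<eta> g' (sqrt z *\<^sub>R y, - z) = ((1 / sqrt z) ^ ?n * (1 / sqrt z)) *\<^sub>R \<eta> z *\<^sub>R g' y"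
    "lift_t \<eta> \<eta>' \<theta>' g' (sqrt z *\<^sub>R y, - z) = (1 / sqrt z) ^ ?n * (- \<eta>' z * \<theta>' y + \<eta> z / (2 * z) * (real ?n * \<theta>' y + g' y \<bullet> y))"
    if "0 < z" for \<theta>' :: "'a \<Rightarrow> real" and g' :: "'a \<Rightarrow> 'a" and y z
  proof -
    have "(1 / sqrt z) * (1 / sqrt z) = 1 / z" using that by simp
    then have "(1 / sqrt z) ^ (?n + 2) = (1 / sqrt z) ^ ?n * (1 / z)" by (simp only: power_add power2_eq_square)
    then show "lift_t \<eta> \<eta>' \<theta>' g' (sqrt z *\<^sub>R y, - z) = (1 / sqrt z) ^ ?n * (- \<eta>' z * \<theta>' y + \<eta> z / (2 * z) * (real ?n * \<theta>' y + g' y \<bullet> y))"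
      using that by (simp only: lift_t_def prod.case Let_def minus_minus) (simp add: algebra_simps add_divide_distrib)
  qed (use that in \<open>simp_all add: lift_def lift_x_def mult_ac\<close>)
  have S\<Psi>: "(LINT y|lborel. sqrt z ^ ?n * \<Psi> (sqrt z *\<^sub>R y, - z)) = B z" if "0 < z" for z
  proof -
    have "sqrt z ^ ?n * (1 / sqrt z) ^ ?n = 1" using that by (simp flip: power_mult_distrib)
    then have e: "sqrt z ^ ?n * ((1 / sqrt z) ^ ?n * c) = c" for c by (simp flip: mult.assoc)
    have "sqrt z ^ ?n * \<Psi> (sqrt z *\<^sub>R y, - z) = \<eta> z * (fv y z * ((U y - v y z) * \<theta> y))" for y
    proof -
      have "sqrt z ^ ?n * \<Psi> (sqrt z *\<^sub>R y, - z) = sqrt z ^ ?n * ((1 / sqrt z) ^ ?n * (\<eta> z * (fv y z * ((U y - v y z) * \<theta> y))))"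
        unfolding \<Psi>_def sc[OF that] fv_def v_def \<theta>2_def by (simp add: algebra_simps)
      then show ?thesis by (simp only: e)
    qed
    then show ?thesis unfolding B_def by simp
  qed
  have S\<Phi>: "(LINT y|lborel. sqrt z ^ ?n * \<Phi> (sqrt z *\<^sub>R y, - z)) = - A z" if "0 < z" for z
  proof (cases "z \<in> {a..b}")
    case False
    have "sqrt z ^ ?n * \<Phi> (sqrt z *\<^sub>R y, - z) = 0" for y
      using E(6,7)[OF False] unfolding \<Phi>_def sc[OF that] by simp
    then have "(LINT y|lborel. sqrt z ^ ?n * \<Phi> (sqrt z *\<^sub>R y, - z)) = 0"
      by (simp only: Bochner_Integration.integral_zero)
    moreover have "A z = 0" using E(6,7)[OF False] by (simp add: A_def)
    ultimately show ?thesis by (simp only: minus_zero)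
  next
    case True
    then have z: "0 < z" "z < 1" using E(1,2) by auto
    have "sqrt z ^ ?n * (1 / sqrt z) ^ ?n = 1" using that by (simp flip: power_mult_distrib)
    then have e: "sqrt z ^ ?n * ((1 / sqrt z) ^ ?n * c) = c" for c by (simp flip: mult.assoc)
    \<comment> \<open>As a polynomial in \<open>v\<close> this has derivative U - v, so its
      derivative in \<open>z\<close> is that of \<open>v\<close> times the test factor.\<close>
    define w where "w y = v y z * U y - (v y z)\<^sup>2 / 2" for y
    define W where "W y = w y * \<theta> y" for y
    define gW where "gW y = w y *\<^sub>R g y + \<theta> y *\<^sub>R ((U y - v y z) *\<^sub>R gv y z + v y z *\<^sub>R gU y)" for y
    define X where "X y = gv y z \<bullet> ((U y - v y z) *\<^sub>R (g y + (\<theta> y / 2) *\<^sub>R y) + \<theta> y *\<^sub>R (gU y - gv y z))" for y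
    have C: "C1_compact K W gW"
    proof (rule C1_compactI[OF open_P K(1) \<theta>(2)])
      show "(W has_derivative (\<lambda>h. gW x \<bullet> h)) (at x)" if "x \<in> P" for x
      proof -
        note dv = has_derivative_v[OF z that]
        have "((\<lambda>y. v y z * U y - (1 / 2) * (v y z * v y z)) has_derivative
            (\<lambda>h. (v x z * (gU x \<bullet> h) + (gv x z \<bullet> h) * U x) - (1 / 2) * (v x z * (gv x z \<bullet> h) + (gv x z \<bullet> h) * v x z))) (at x)"
          by (intro has_derivative_diff has_derivative_mult has_derivative_mult_right dv U(1)[OF that])
        from has_derivative_mult[OF this K(6)]
        have "((\<lambda>y. (v y z * U y - (1 / 2) * (v y z * v y z)) * \<theta> y) has_derivative (\<lambda>h. gW x \<bullet> h)) (at x)"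
          by (rule has_derivative_eq_rhs)
             (auto simp: gW_def w_def fun_eq_iff inner_add_left inner_diff_left algebra_simps power2_eq_square)
        moreover have "(\<lambda>y. (v y z * U y - (1 / 2) * (v y z * v y z)) * \<theta> y) = W"
          by (simp add: fun_eq_iff W_def w_def power2_eq_square)
        ultimately show ?thesis by (simp only:)
      qed
      show "W p = 0" "gW p = 0" if "p \<notin> K" for p using K(4,5)[OF that] by (simp_all add: W_def gW_def)
      show "continuous_on P W" "continuous_on P gW" unfolding W_def gW_def w_def
        using K(2,3) U(2,3) continuous_v[OF z] continuous_gv[OF z]
        by (auto intro!: continuous_intros intro: continuous_on_subset)
    qed
    note KW = C1_compactD[OF C]
    have iW: "integrable lborel W" "integrable lborel (\<lambda>y. real ?n * W y + gW y \<bullet> y)"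
      using KW by (auto intro!: integrable_continuous_support[where K = K] continuous_intros)
    have iX: "integrable lborel X"
    proof (rule integrable_continuous_support[where K = K])
      show "continuous_on UNIV X"
      proof (rule continuous_extend_zero[OF open_P K(1) \<theta>(2)])
        show "continuous_on P X" unfolding X_def
          using K(2,3) U(2,3) continuous_v[OF z] continuous_gv[OF z]
          by (auto intro!: continuous_intros intro: continuous_on_subset)
      qed (simp add: X_def K(4,5))
    qed (use K in \<open>auto simp: X_def\<close>)
    have gu_gv: "gu (sqrt z *\<^sub>R y, - z) = (1 / sqrt z) *\<^sub>R gv y z" for y using z by (simp add: gv_def)
    have zz: "(1 / sqrt z) * (1 / sqrt z) = 1 / z" using z by simp
    \<comment> \<open>All terms with the dimension are gathered in the last bracket, the radial
      divergence of \<open>W\<close>, whose integral vanishes. The price is the drift term contained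
      in \<open>X\<close>.\<close>
    have "sqrt z ^ ?n * \<Phi> (sqrt z *\<^sub>R y, - z) = - (\<eta>' z * W y + \<eta> z / z * X y - \<eta> z / (2 * z) * (real ?n * W y + gW y \<bullet> y))" for y
    proof -
      let ?c = "(1 / sqrt z) ^ ?n"
      define V where "V = v y z" define GV where "GV = gv y z"
      have 1: "gu (sqrt z *\<^sub>R y, - z) \<bullet> lift_x \<eta> g2 (sqrt z *\<^sub>R y, - z) = ?c * (\<eta> z / z * (GV \<bullet> g2 y))"
      proof -
        have "gu (sqrt z *\<^sub>R y, - z) \<bullet> lift_x \<eta> g2 (sqrt z *\<^sub>R y, - z) = ?c * ((1 / sqrt z) * (1 / sqrt z)) * \<eta> z * (GV \<bullet> g2 y)"
          unfolding sc[OF that] gu_gv GV_def by simp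
        then show ?thesis unfolding zz by simp
      qed
      have 2: "gu (sqrt z *\<^sub>R y, - z) \<bullet> (lift \<eta> \<theta> (sqrt z *\<^sub>R y, - z) *\<^sub>R gu (sqrt z *\<^sub>R y, - z) + u (sqrt z *\<^sub>R y, - z) *\<^sub>R lift_x \<eta> g (sqrt z *\<^sub>R y, - z))
         = ?c * (\<eta> z / z * (\<theta> y * (GV \<bullet> GV) + V * (GV \<bullet> g y)))"
      proof -
        have "gu (sqrt z *\<^sub>R y, - z) \<bullet> (lift \<eta> \<theta> (sqrt z *\<^sub>R y, - z) *\<^sub>R gu (sqrt z *\<^sub>R y, - z) + u (sqrt z *\<^sub>R y, - z) *\<^sub>R lift_x \<eta> g (sqrt z *\<^sub>R y, - z))
         = ?c * ((1 / sqrt z) * (1 / sqrt z)) * \<eta> z * (\<theta> y * (GV \<bullet> GV) + V * (GV \<bullet> g y))"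
          unfolding sc[OF that] gu_gv GV_def V_def v_def[symmetric] by (simp add: inner_add_right algebra_simps)
        then show ?thesis unfolding zz by simp
      qed
      have "\<Phi> (sqrt z *\<^sub>R y, - z) = ?c * (V * (- \<eta>' z * \<theta>2 y + \<eta> z / (2 * z) * (real ?n * \<theta>2 y + g2 y \<bullet> y)) - \<eta> z / z * (GV \<bullet> g2 y)
         - (V\<^sup>2 * (- \<eta>' z * \<theta> y + \<eta> z / (2 * z) * (real ?n * \<theta> y + g y \<bullet> y)) / 2 - \<eta> z / z * (\<theta> y * (GV \<bullet> GV) + V * (GV \<bullet> g y))))"
        unfolding \<Phi>_def 1 2 unfolding sc[OF that] V_def v_def[symmetric] by (simp add: algebra_simps)
      then have "sqrt z ^ ?n * \<Phi> (sqrt z *\<^sub>R y, - z) = V * (- \<eta>' z * \<theta>2 y + \<eta> z / (2 * z) * (real ?n * \<theta>2 y + g2 y \<bullet> y)) - \<eta> z / z * (GV \<bullet> g2 y)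
         - (V\<^sup>2 * (- \<eta>' z * \<theta> y + \<eta> z / (2 * z) * (real ?n * \<theta> y + g y \<bullet> y)) / 2 - \<eta> z / z * (\<theta> y * (GV \<bullet> GV) + V * (GV \<bullet> g y)))"
        by (simp only: e)
      also have "\<dots> = - (\<eta>' z * W y + \<eta> z / z * X y - \<eta> z / (2 * z) * (real ?n * W y + gW y \<bullet> y))"
      proof -
        define q where "q = \<eta> z / z"
        have "\<eta> z / (2 * z) = q / 2" by (simp add: q_def)
        then show ?thesis
          unfolding \<theta>2_def g2_def W_def gW_def X_def w_def V_def[symmetric] GV_def[symmetric] q_def[symmetric]
          by (simp only:) (simp add: inner_add_left inner_add_right inner_diff_left inner_diff_right algebra_simps
              add_divide_distrib diff_divide_distrib power2_eq_square)
      qed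
      finally show ?thesis .
    qed
    then have "(LINT y|lborel. sqrt z ^ ?n * \<Phi> (sqrt z *\<^sub>R y, - z))
      = (LINT y|lborel. - (\<eta>' z * W y + \<eta> z / z * X y - \<eta> z / (2 * z) * (real ?n * W y + gW y \<bullet> y)))" by simp
    also have "\<dots> = - (\<eta>' z * (LINT y|lborel. W y) + \<eta> z / z * (LINT y|lborel. X y)
       - \<eta> z / (2 * z) * (LINT y|lborel. real ?n * W y + gW y \<bullet> y))"
      using iW iX
      by (simp only: integral_minus Bochner_Integration.integral_add Bochner_Integration.integral_diff
          integrable_mult_right Bochner_Integration.integrable_add integral_mult_right_zero)
    also have "\<dots> = - A z"
      by (simp only: integral_divergence_radial[OF C]) (simp add: A_def W_def X_def w_def)
    finally show ?thesis .
  qed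
  have z\<Phi>: "\<Phi> (x, t) = 0" "\<Psi> (x, t) = 0" if "0 \<le> t" for x t
    using out[OF neg[OF that, of x]] by (simp_all add: \<Phi>_def \<Psi>_def)
  have s1: "indicator {0<..} z * (LINT y|lborel. sqrt z ^ ?n * \<Phi> (sqrt z *\<^sub>R y, - z)) = - (indicator {0<..} z * A z)" for z
    using S\<Phi>[of z] by (cases "0 < z") auto
  have s2: "indicator {0<..} z * (LINT y|lborel. sqrt z ^ ?n * \<Psi> (sqrt z *\<^sub>R y, - z)) = indicator {0<..} z * B z" for z
    using S\<Psi>[of z] by (cases "0 < z") auto
  show "(LINT z|lborel. indicator {0<..} z * A z) = - (LINT z|lborel. indicator {0<..} z * B z)"
    using pc\<Phi>(1)[OF z\<Phi>(1)] pc\<Psi>(1)[OF z\<Phi>(2)] eq unfolding s1 s2 by simp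
  show "integrable lborel (\<lambda>z. indicator {0<..} z * A z)"
    using pc\<Phi>(2)[OF z\<Phi>(1)] unfolding s1 by simp
  show "integrable lborel (\<lambda>z. indicator {0<..} z * B z)"
    using pc\<Psi>(2)[OF z\<Phi>(2)] unfolding s2 .
qed

end

section \<open>The half-space with Gaussian weight\<close>

text \<open>Two parabolic arcs glued at 1/2, namely 2 x^2 and 1 - 2 (1 - x)^2, form a C1 step from 0
  to 1 on the unit interval with slope at most 2.\<close>

definition smoothstep :: "real \<Rightarrow> real" where
  "smoothstep x = 2 * (max 0 x)\<^sup>2 - 4 * (max 0 (x - 1 / 2))\<^sup>2 + 2 * (max 0 (x - 1))\<^sup>2"

definition smoothstep' :: "real \<Rightarrow> real" where
  "smoothstep' x = 4 * max 0 x - 8 * max 0 (x - 1 / 2) + 4 * max 0 (x - 1)"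

lemma has_real_derivative_max_square:
  "((\<lambda>x::real. (max 0 (x - c))\<^sup>2) has_real_derivative 2 * max 0 (x - c)) (at x)"
proof -
  consider "x < c" | "x = c" | "c < x" by linarith
  then show ?thesis
  proof cases
    case 1
    show ?thesis
      by (rule has_field_derivative_transform_within_open[OF _ open_lessThan[of c], of "\<lambda>_. 0"]) (use 1 in auto)
  next
    case 2
    have "((\<lambda>h. max 0 h) \<longlongrightarrow> 0) (at (0::real))"
      using tendsto_max[OF tendsto_const tendsto_ident_at, of 0 "0::real" UNIV] by simp
    then have "((\<lambda>h. ((max 0 (x + h - c))\<^sup>2 - (max 0 (x - c))\<^sup>2) / h) \<longlongrightarrow> 0) (at 0)"
      by (rule Lim_transform_eventually) (auto simp: 2 eventually_at max_def power2_eq_square intro!: exI[of _ 1])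
    then show ?thesis using 2 by (simp add: DERIV_def)
  next
    case 3
    have "((\<lambda>x. (x - c)\<^sup>2) has_real_derivative 2 * (x - c)) (at x)"
      by (auto intro!: derivative_eq_intros)
    then show ?thesis
      by (rule DERIV_cong[OF has_field_derivative_transform_within_open[OF _ open_greaterThan[of c]]]) (use 3 in auto)
  qed
qed

lemma smoothstep_has_derivative: "(smoothstep has_real_derivative smoothstep' x) (at x)"
  unfolding smoothstep_def smoothstep'_def
  using DERIV_add[OF DERIV_diff[OF DERIV_cmult[OF has_real_derivative_max_square[of 0 x], of 2]
      DERIV_cmult[OF has_real_derivative_max_square[of "1 / 2" x], of 4]]
      DERIV_cmult[OF has_real_derivative_max_square[of 1 x], of 2]] by simp

lemma continuous_smoothstep': "continuous_on UNIV smoothstep'"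
  unfolding smoothstep'_def by (intro continuous_intros)

lemma continuous_smoothstep: "continuous_on UNIV smoothstep"
  unfolding smoothstep_def by (intro continuous_intros)

lemma smoothstep'_bounds: "0 \<le> smoothstep' x" "smoothstep' x \<le> 2"
  by (auto simp: smoothstep'_def max_def)

lemma smoothstep_simps [simp]: "x \<le> 0 \<Longrightarrow> smoothstep x = 0" "1 \<le> x \<Longrightarrow> smoothstep x = 1"
    "x \<le> 0 \<Longrightarrow> smoothstep' x = 0" "1 \<le> x \<Longrightarrow> smoothstep' x = 0"
  by (auto simp: smoothstep_def smoothstep'_def max_def power2_eq_square algebra_simps)

lemma smoothstep_bounds: "0 \<le> smoothstep x" "smoothstep x \<le> 1"
proof -
  have m: "smoothstep x \<le> smoothstep y" if "x \<le> y" for x y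
    by (rule DERIV_nonneg_imp_nondecreasing[OF that]) (use smoothstep_has_derivative smoothstep'_bounds(1) in blast)
  show "0 \<le> smoothstep x" using m[of "min x 0" x] by simp
  show "smoothstep x \<le> 1" using m[of x "max x 1"] by simp
qed

text \<open>The quadratic polynomial in \<open>t\<close> given by the integral of (t a + b)^2 is
  nonnegative; it is evaluated at its minimum.\<close>

lemma integral_square_Cauchy_Schwarz:
  fixes a b :: "'a \<Rightarrow> real"
  assumes "integrable N (\<lambda>x. (a x)\<^sup>2)" "integrable N (\<lambda>x. (b x)\<^sup>2)" "integrable N (\<lambda>x. a x * b x)"
  shows "\<bar>LINT x|N. a x * b x\<bar> \<le> sqrt (LINT x|N. (a x)\<^sup>2) * sqrt (LINT x|N. (b x)\<^sup>2)"
proof -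
  let ?A = "LINT x|N. (a x)\<^sup>2" and ?B = "LINT x|N. (b x)\<^sup>2" and ?X = "LINT x|N. a x * b x"
  have q: "0 \<le> t\<^sup>2 * ?A + 2 * t * ?X + ?B" for t
  proof -
    have "0 \<le> (LINT x|N. (t * a x + b x)\<^sup>2)" by simp
    also have "\<dots> = (LINT x|N. t\<^sup>2 * (a x)\<^sup>2 + (2 * t) * (a x * b x) + (b x)\<^sup>2)"
      by (intro Bochner_Integration.integral_cong) (auto simp: power2_eq_square algebra_simps)
    also have "\<dots> = t\<^sup>2 * ?A + 2 * t * ?X + ?B" using assms by simp
    finally show ?thesis .
  qed
  have AB: "0 \<le> ?A" "0 \<le> ?B" by simp_all
  have "?X\<^sup>2 \<le> ?A * ?B"
  proof (cases "?A = 0")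
    case True
    have "?X = 0"
    proof (rule ccontr)
      assume "?X \<noteq> 0"
      \<comment> \<open>For \<open>?A = 0\<close> the polynomial is affine in \<open>t\<close>, and
        at this \<open>t\<close> it takes the value -1.\<close>
      then show False using q[of "- (?B + 1) / (2 * ?X)"] unfolding True by (simp add: field_simps)
    qed
    then show ?thesis using AB by simp
  next
    case False
    then have "0 < ?A" using AB(1) by (simp add: less_le)
    have "(- ?X / ?A)\<^sup>2 * ?A + 2 * (- ?X / ?A) * ?X + ?B = ?B - ?X\<^sup>2 / ?A"
      using \<open>0 < ?A\<close> by (simp add: power2_eq_square field_simps)
    then have "0 \<le> ?B - ?X\<^sup>2 / ?A" using q[of "- ?X / ?A"] by (simp only:)
    then show ?thesis using \<open>0 < ?A\<close> by (simp add: pos_divide_le_eq mult.commute)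
  qed
  then have "\<bar>?X\<bar> \<le> sqrt (?A * ?B)" by (intro real_le_rsqrt) simp
  then show ?thesis by (simp add: real_sqrt_mult)
qed

lemma half_space_closed_eq: "half_space_closed = closure (half_space :: ('m::finite) sp set)"
proof -
  have 1: "{x :: 'm sp. 0 < snd x} = UNIV \<times> {0<..}" and 2: "{x :: 'm sp. 0 \<le> snd x} = UNIV \<times> {0..}" by auto
  show ?thesis unfolding half_space_def half_space_closed_def 1 2 closure_Times by simp
qed

lemma open_half_space: "open (half_space :: ('m::finite) sp set)"
  unfolding half_space_def by (intro open_Collect_less continuous_intros)

lemma closed_half_space_closed: "closed (half_space_closed :: ('m::finite) sp set)"
  by (simp add: half_space_closed_eq)

text \<open>The cutoff near the flat boundary has slope of order 1 / \<epsilon> inside a slab of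
  this kind; the volume of order \<epsilon> compensates for it.\<close>

lemma slab_volume:
  obtains C where "0 \<le> C"
    "\<And>\<epsilon>. 0 < \<epsilon> \<Longrightarrow> (LINT y|lborel. indicator {y :: ('m::finite) sp. norm y \<le> R \<and> 0 \<le> snd y \<and> snd y \<le> 2 * \<epsilon>} y) \<le> C * \<epsilon>"
proof (rule that)
  let ?m = "measure lborel (cball (0 :: real^'m) R)"
  show "0 \<le> 2 * ?m" by simp
  fix \<epsilon> :: real assume \<epsilon>: "0 < \<epsilon>"
  let ?B = "cball (0 :: real^'m) R \<times> {0..2 * \<epsilon>}"
  have em: "emeasure lborel ?B = ennreal (?m * (2 * \<epsilon>))"
  proof -
    have "emeasure lborel (cball (0 :: real^'m) R) = ennreal ?m"
      using emeasure_lborel_cball_finite[of "0 :: real^'m" R] by (intro emeasure_eq_ennreal_measure) auto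
    then show ?thesis
      unfolding lborel_prod[symmetric]
      using \<epsilon> by (simp add: lborel.emeasure_pair_measure_Times flip: ennreal_mult'')
  qed
  have fin: "emeasure lborel ?B < \<infinity>" by (simp only: em) simp
  have sub: "indicator {y :: 'm sp. norm y \<le> R \<and> 0 \<le> snd y \<and> snd y \<le> 2 * \<epsilon>} y \<le> (indicator ?B y :: real)" for y
    by (cases y) (auto simp: indicator_def intro: order_trans[OF norm_fst_le])
  have "(LINT y|lborel. indicator {y :: 'm sp. norm y \<le> R \<and> 0 \<le> snd y \<and> snd y \<le> 2 * \<epsilon>} y) \<le> (LINT y|lborel. (indicator ?B y :: real))"
  proof (rule integral_mono')
    show "integrable lborel (indicat_real ?B)" using fin by (intro integrable_real_indicator) (auto intro!: borel_closed closed_Times)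
  qed (use sub in auto)
  also have "\<dots> = ?m * (2 * \<epsilon>)"
    using em \<epsilon> by (simp add: measure_def)
  finally show "(LINT y|lborel. indicator {y :: 'm sp. norm y \<le> R \<and> 0 \<le> snd y \<and> snd y \<le> 2 * \<epsilon>} y) \<le> 2 * ?m * \<epsilon>" by simp
qed

text \<open>The slice of \<open>G\<close> at time -1. Its gradient is - y / 2 times itself, which is
  what cancels the drift of the self-similar variables.\<close>

definition gauss :: "('m::finite) sp \<Rightarrow> real" where
  "gauss y = (4 * pi) powr (- real DIM('m sp) / 2) * exp (- (norm y)\<^sup>2 / 4)"

lemma gauss_pos: "0 < gauss y"
  by (simp add: gauss_def)

lemma gauss_nonneg: "0 \<le> gauss y"
  by (simp add: gauss_def)

lemma gauss_le_1: "gauss (y :: ('m::finite) sp) \<le> 1"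
proof -
  have "1 \<le> 4 * pi" using pi_gt3 by simp
  then have "(4 * pi) powr (- real DIM('m sp) / 2) \<le> 1" using powr_mono[of "- real DIM('m sp) / 2" 0 "4 * pi"] by simp
  then show ?thesis unfolding gauss_def by (intro mult_le_one) auto
qed

lemma continuous_gauss: "continuous_on S gauss"
  unfolding gauss_def by (intro continuous_intros) auto

lemma has_derivative_gauss: "(gauss has_derivative (\<lambda>h. (- (gauss y / 2)) *\<^sub>R y \<bullet> h)) (at y)"
  unfolding gauss_def dot_square_norm[symmetric]
  by (rule derivative_eq_intros refl)+ (auto simp: fun_eq_iff inner_commute)

definition gint :: "(('m::finite) sp \<Rightarrow> real) \<Rightarrow> real" where
  "gint F = (LINT y|lborel. indicator half_space y * (F y * gauss y))"

lemma borel_half_space [measurable]: "half_space \<in> sets borel" "half_space_closed \<in> sets borel"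
  by (simp_all add: open_half_space closed_half_space_closed)

lemma gint_integrable:
  fixes F :: "('m::finite) sp \<Rightarrow> real"
  assumes "continuous_on half_space_closed F" "\<And>y. y \<in> half_space_closed \<Longrightarrow> R < norm y \<Longrightarrow> F y = 0"
  shows "integrable lborel (\<lambda>y. indicator half_space y * (F y * gauss y))"
proof -
  have sub: "half_space \<subseteq> (half_space_closed :: 'm sp set)" by (auto simp: half_space_def half_space_closed_def)
  have "compact (half_space_closed \<inter> cball 0 R :: 'm sp set)"
    by (intro closed_Int_compact closed_half_space_closed compact_cball)
  then have "bounded (F ` (half_space_closed \<inter> cball 0 R))"
    using assms(1) by (intro compact_imp_bounded compact_continuous_image) (auto intro: continuous_on_subset)
  then obtain B where "\<forall>x \<in> F ` (half_space_closed \<inter> cball 0 R). norm x \<le> B" unfolding bounded_iff by blast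
  then have B: "\<And>y. y \<in> half_space_closed \<inter> cball 0 R \<Longrightarrow> \<bar>F y\<bar> \<le> B" by simp
  show ?thesis
  proof (rule integrable_bounded_support[of _ "cball 0 R" "\<bar>B\<bar>"])
    have "(\<lambda>y. indicator half_space y *\<^sub>R (F y * gauss y)) \<in> borel_measurable borel"
      using assms(1) sub by (intro borel_measurable_continuous_on_indicator continuous_intros continuous_gauss borel_half_space) (auto intro: continuous_on_subset)
    then show "(\<lambda>y. indicator half_space y * (F y * gauss y)) \<in> borel_measurable borel" by simp
    show "indicator half_space y * (F y * gauss y) = 0" if "y \<notin> cball 0 R" for y
      using assms(2)[of y] that sub by (auto simp: indicator_def)
    show "norm (indicator half_space y * (F y * gauss y)) \<le> \<bar>B\<bar>" for y
    proof (cases "y \<in> half_space \<inter> cball 0 R")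
      case True
      then have "\<bar>F y\<bar> * \<bar>gauss y\<bar> \<le> \<bar>B\<bar> * 1"
        using B[of y] sub gauss_le_1[of y] gauss_pos[of y] by (intro mult_mono) auto
      then show ?thesis using True by (simp add: abs_mult)
    next
      case False
      then show ?thesis using assms(2)[of y] sub by (auto simp: indicator_def)
    qed
  qed auto
qed

lemma gint_mono:
  assumes "continuous_on half_space_closed F" "\<And>y. y \<in> half_space_closed \<Longrightarrow> R < norm y \<Longrightarrow> F y = 0"
    "continuous_on half_space_closed F'" "\<And>y. y \<in> half_space_closed \<Longrightarrow> R < norm y \<Longrightarrow> F' y = 0"
    "\<And>y. y \<in> half_space \<Longrightarrow> F y \<le> F' y"
  shows "gint F \<le> gint F'"
  unfolding gint_def
  by (intro integral_mono gint_integrable[OF assms(1,2)] gint_integrable[OF assms(3,4)])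
     (use assms(5) gauss_nonneg in \<open>auto simp: indicator_def intro!: mult_right_mono\<close>)

lemma gint_add:
  assumes "continuous_on half_space_closed F" "\<And>y. y \<in> half_space_closed \<Longrightarrow> R < norm y \<Longrightarrow> F y = 0"
    "continuous_on half_space_closed F'" "\<And>y. y \<in> half_space_closed \<Longrightarrow> R < norm y \<Longrightarrow> F' y = 0"
  shows "gint (\<lambda>y. a * F y + b * F' y) = a * gint F + b * gint F'"
proof -
  have "gint (\<lambda>y. a * F y + b * F' y) = (LINT y|lborel. a * (indicator half_space y * (F y * gauss y)) + b * (indicator half_space y * (F' y * gauss y)))"
    unfolding gint_def by (intro Bochner_Integration.integral_cong) (auto simp: algebra_simps)
  also have "\<dots> = a * gint F + b * gint F'"
    unfolding gint_def using gint_integrable[OF assms(1,2)] gint_integrable[OF assms(3,4)] by simp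
  finally show ?thesis .
qed

lemma gint_nonneg: "(\<And>y. y \<in> half_space \<Longrightarrow> 0 \<le> F y) \<Longrightarrow> 0 \<le> gint F"
  unfolding gint_def using gauss_nonneg
  by (intro Bochner_Integration.integral_nonneg) (auto simp: indicator_def intro!: mult_nonneg_nonneg)

lemma gint_Cauchy_Schwarz:
  assumes "continuous_on half_space_closed F" "\<And>y. y \<in> half_space_closed \<Longrightarrow> R < norm y \<Longrightarrow> F y = 0"
    "continuous_on half_space_closed F'" "\<And>y. y \<in> half_space_closed \<Longrightarrow> R < norm y \<Longrightarrow> F' y = 0"
  shows "\<bar>gint (\<lambda>y. F y * F' y)\<bar> \<le> sqrt (gint (\<lambda>y. (F y)\<^sup>2)) * sqrt (gint (\<lambda>y. (F' y)\<^sup>2))"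
proof -
  let ?a = "\<lambda>F y. indicator half_space y * (F y * sqrt (gauss y))"
  have e: "?a F y * ?a F' y = indicator half_space y * ((F y * F' y) * gauss y)" for F F' :: "'a sp \<Rightarrow> real" and y
    using gauss_pos[of y] by (auto simp: indicator_def)
  have e2: "(?a F y)\<^sup>2 = indicator half_space y * ((F y)\<^sup>2 * gauss y)" for F :: "'a sp \<Rightarrow> real" and y
    unfolding power2_eq_square e by simp
  have "integrable lborel (\<lambda>y. (?a F y)\<^sup>2)" "integrable lborel (\<lambda>y. (?a F' y)\<^sup>2)" "integrable lborel (\<lambda>y. ?a F y * ?a F' y)"
    unfolding e e2 by (rule gint_integrable[where R = R]; use assms in \<open>auto intro!: continuous_intros\<close>)+
  from integral_square_Cauchy_Schwarz[OF this] show ?thesis unfolding e e2 gint_def .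
qed

text \<open>For \<open>z\<close> in a compact subinterval all slices are supported in one ball and
  bounded there by compactness, so dominated convergence applies. The radius may grow as
  \<open>z\<close> tends to 0, hence the support condition for each \<open>a\<close>.\<close>

lemma gint_continuous:
  fixes F :: "('m::finite) sp \<Rightarrow> real \<Rightarrow> real"
  assumes cont: "continuous_on (half_space_closed \<times> {0<..<1}) (\<lambda>(y, z). F y z)"
    and supp: "\<And>a. 0 < a \<Longrightarrow> \<exists>R. \<forall>y z. y \<in> half_space_closed \<longrightarrow> a \<le> z \<longrightarrow> z < 1 \<longrightarrow> R < norm y \<longrightarrow> F y z = 0"
  shows "continuous_on {0<..<1} (\<lambda>z. gint (\<lambda>y. F y z))"
proof -
  have sub: "half_space \<subseteq> (half_space_closed :: 'm sp set)" by (auto simp: half_space_def half_space_closed_def)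
  have c0: "continuous_on {a..b} (\<lambda>z. gint (\<lambda>y. F y z))" if ab: "0 < a" "a < b" "b < 1" for a b
    unfolding continuous_on_sequentially
  proof (intro allI impI ballI)
    fix X z assume z: "z \<in> {a..b}" and X: "(\<forall>n. X n \<in> {a..b}) \<and> X \<longlonglongrightarrow> z"
    obtain R where R: "\<And>y z. y \<in> half_space_closed \<Longrightarrow> a \<le> z \<Longrightarrow> z < 1 \<Longrightarrow> R < norm y \<Longrightarrow> F y z = 0"
      using supp[OF ab(1)] by blast
    have "compact ((half_space_closed \<inter> cball 0 R :: 'm sp set) \<times> {a..b})"
      by (intro compact_Times closed_Int_compact closed_half_space_closed compact_cball compact_Icc)
    then have "bounded ((\<lambda>(y, z). F y z) ` ((half_space_closed \<inter> cball 0 R) \<times> {a..b}))"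
      using ab by (intro compact_imp_bounded compact_continuous_image continuous_on_subset[OF cont]) auto
    then obtain B where "\<forall>x \<in> (\<lambda>(y, z). F y z) ` ((half_space_closed \<inter> cball 0 R) \<times> {a..b}). norm x \<le> B"
      unfolding bounded_iff by blast
    then have B: "\<And>y z. y \<in> half_space_closed \<inter> cball 0 R \<Longrightarrow> z \<in> {a..b} \<Longrightarrow> \<bar>F y z\<bar> \<le> B" by force
    have slice: "continuous_on half_space_closed (\<lambda>y. F y z)" if "z \<in> {a..b}" for z
    proof -
      have "continuous_on half_space_closed (\<lambda>y. (\<lambda>(y, z). F y z) (y, z))"
        by (rule continuous_on_compose2[OF cont]) (use that ab in \<open>auto intro!: continuous_intros\<close>)
      then show ?thesis by simp
    qed
    have mz: "integrable lborel (\<lambda>y. indicator half_space y * (F y z * gauss y))" if "z \<in> {a..b}" for z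
      by (rule gint_integrable[OF slice[OF that], of R]) (use R that ab in auto)
    have "(\<lambda>n. LINT y|lborel. indicator half_space y * (F y (X n) * gauss y)) \<longlonglongrightarrow> (LINT y|lborel. indicator half_space y * (F y z * gauss y))"
    proof (rule integral_dominated_convergence[where w = "\<lambda>y. indicator (cball 0 R) y * \<bar>B\<bar>"])
      show "integrable lborel (\<lambda>y::'m sp. indicator (cball 0 R) y * \<bar>B\<bar>)"
        using emeasure_lborel_cball_finite[of "0::'m sp" R] by (intro integrable_mult_left integrable_real_indicator) auto
      show "AE y in lborel. norm (indicator half_space y * (F y (X n) * gauss y)) \<le> indicator (cball 0 R) y * \<bar>B\<bar>" for n
      proof (rule AE_I2)
        fix y :: "'m sp"
        have Xn: "X n \<in> {a..b}" using X by blast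
        show "norm (indicator half_space y * (F y (X n) * gauss y)) \<le> indicator (cball 0 R) y * \<bar>B\<bar>"
        proof (cases "y \<in> half_space \<inter> cball 0 R")
          case True
          then have "\<bar>F y (X n)\<bar> * \<bar>gauss y\<bar> \<le> \<bar>B\<bar> * 1"
            using B[of y, OF _ Xn] sub gauss_le_1[of y] gauss_pos[of y] by (intro mult_mono) auto
          then show ?thesis using True by (simp add: abs_mult)
        next
          case False
          then show ?thesis using R[of y "X n"] Xn ab sub by (auto simp: indicator_def)
        qed
      qed
      show "AE y in lborel. (\<lambda>n. indicator half_space y * (F y (X n) * gauss y)) \<longlonglongrightarrow> indicator half_space y * (F y z * gauss y)"
      proof (rule AE_I2)
        fix y :: "'m sp"
        show "(\<lambda>n. indicator half_space y * (F y (X n) * gauss y)) \<longlonglongrightarrow> indicator half_space y * (F y z * gauss y)"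
        proof (cases "y \<in> half_space")
          case True
          have "continuous_on {a..b} (\<lambda>z. F y z)"
          proof -
            have "continuous_on {a..b} (\<lambda>z. (\<lambda>(y, z). F y z) (y, z))"
              by (rule continuous_on_compose2[OF cont]) (use True sub ab in \<open>auto intro!: continuous_intros\<close>)
            then show ?thesis by simp
          qed
          then have "(\<lambda>n. F y (X n)) \<longlonglongrightarrow> F y z"
            using X z unfolding continuous_on_sequentially by (auto simp: o_def)
          then show ?thesis by (intro tendsto_intros)
        qed simp
      qed
    qed (use mz z X in auto)
    then show "((\<lambda>z. gint (\<lambda>y. F y z)) \<circ> X) \<longlonglongrightarrow> gint (\<lambda>y. F y z)"
      by (simp add: gint_def o_def)
  qed
  then have c: "continuous (at z) (\<lambda>z. gint (\<lambda>y. F y z))" if "0 < z" "z < 1" for z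
  proof -
    have "continuous_on {z / 2..(1 + z) / 2} (\<lambda>z. gint (\<lambda>y. F y z))" by (rule c0) (use that in auto)
    then show ?thesis
      by (rule continuous_on_interior) (use that in \<open>auto simp: interior_atLeastAtMost_real\<close>)
  qed
  then show ?thesis by (intro continuous_at_imp_continuous_on) auto
qed

lemma integrable_gauss: "integrable lborel (gauss :: ('m::finite) sp \<Rightarrow> real)"
proof (rule integrableI_nonneg)
  let ?e = "\<lambda>x :: real. exp (- x\<^sup>2 / 4)"
  \<comment> \<open>A multiple of the normal density of variance 2; the weight in several dimensions
    is a product of such factors.\<close>
  have "?e = (\<lambda>x. sqrt (4 * pi) * normal_density 0 (sqrt 2) x)"
    by (auto simp: normal_density_def fun_eq_iff real_sqrt_mult)
  then have "integrable lborel ?e" by simp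
  then have fin: "(\<integral>\<^sup>+ x. ennreal (?e x) \<partial>lborel) < \<infinity>"
    by (simp add: nn_integral_eq_integral)
  have split: "exp (- (norm y)\<^sup>2 / 4) = (\<Prod>b\<in>Basis. ?e (y \<bullet> b))" for y :: "'m sp"
  proof -
    have "- (norm y)\<^sup>2 / 4 = (\<Sum>b\<in>Basis. - (y \<bullet> b)\<^sup>2 / 4)"
    proof -
      have "(norm y)\<^sup>2 = (\<Sum>b\<in>Basis. (y \<bullet> b)\<^sup>2)"
        unfolding power2_norm_eq_inner by (subst euclidean_inner) (simp add: power2_eq_square)
      then show ?thesis by (simp add: sum_divide_distrib sum_negf)
    qed
    then show ?thesis by (simp only: exp_sum finite_Basis)
  qed
  have "(\<integral>\<^sup>+ y. ennreal (gauss (y :: 'm sp)) \<partial>lborel) = (\<integral>\<^sup>+ y. ennreal ((4 * pi) powr (- real DIM('m sp) / 2)) * (\<Prod>b\<in>Basis. ennreal (?e (y \<bullet> b))) \<partial>(lborel :: 'm sp measure))"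
    unfolding gauss_def split by (intro nn_integral_cong) (simp add: ennreal_mult prod_nonneg flip: prod_ennreal)
  also have "\<dots> = ennreal ((4 * pi) powr (- real DIM('m sp) / 2)) * (\<integral>\<^sup>+ y. (\<Prod>b\<in>Basis. ennreal (?e (y \<bullet> b))) \<partial>(lborel :: 'm sp measure))"
    by (intro nn_integral_cmult) simp
  also have "(\<integral>\<^sup>+ y. (\<Prod>b\<in>Basis. ennreal (?e (y \<bullet> b))) \<partial>(lborel :: 'm sp measure)) = (\<Prod>b\<in>(Basis :: 'm sp set). (\<integral>\<^sup>+ x. ennreal (?e x) \<partial>lborel))"
    by (rule nn_integral_lborel_prod) auto
  also have "ennreal ((4 * pi) powr (- real DIM('m sp) / 2)) * \<dots> < \<infinity>"
    using fin by (simp add: less_top[symmetric] ennreal_mult_eq_top_iff power_eq_top_ennreal del: DIM_prod DIM_cart DIM_real)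
  finally show "(\<integral>\<^sup>+ y. ennreal (gauss (y :: 'm sp)) \<partial>lborel) < \<infinity>" .
qed (auto simp: gauss_nonneg intro: borel_measurable_continuous_onI continuous_gauss)

section \<open>Differential inequalities in the time variable tested with cutoffs\<close>

lemma lborel_integral_eq_integral:
  fixes F :: "real \<Rightarrow> real"
  assumes "continuous_on {\<alpha>..\<beta>} F" "\<And>z. z \<notin> {\<alpha>..\<beta>} \<Longrightarrow> F z = 0"
  shows "(LINT z|lborel. F z) = integral {\<alpha>..\<beta>} F" "integrable lborel F"
proof -
  have s: "set_integrable lborel {\<alpha>..\<beta>} F"
    using assms(1) by (rule borel_integrable_atLeastAtMost')
  have e: "(\<lambda>z. indicator {\<alpha>..\<beta>} z *\<^sub>R F z) = F" using assms(2) by (auto simp: indicator_def fun_eq_iff)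
  show "(LINT z|lborel. F z) = integral {\<alpha>..\<beta>} F"
    using set_borel_integral_eq_integral(2)[OF s] unfolding set_lebesgue_integral_def e .
  show "integrable lborel F" using s unfolding set_integrable_def e .
qed

text \<open>The hypothesis says k' \<le> m in the sense of distributions. With a primitive
  \<open>N\<close> of \<open>m\<close> the function F = k - N is weakly nonincreasing; a cutoff with
  short ramps at \<alpha> and \<beta> compares the averages of \<open>F\<close> over the two ramps,
  and continuity of \<open>F\<close> lets the ramps shrink to the end points.\<close>

lemma weak_derivative_bound:
  assumes k: "continuous_on {0<..<1} k" and m: "continuous_on {0<..<1} m"
    and weak: "\<And>a b \<eta> \<eta>'. time_cutoff a b \<eta> \<eta>' \<Longrightarrow> 0 \<le> (LINT z|lborel. indicator {0<..} z * (\<eta>' z * k z + \<eta> z * m z))"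
    and \<alpha>\<beta>: "0 < \<alpha>" "\<alpha> < \<beta>" "\<beta> < 1"
  shows "k \<beta> - k \<alpha> \<le> integral {\<alpha>..\<beta>} m"
proof -
  let ?I = "{\<alpha>..\<beta>}"
  have sub: "?I \<subseteq> {0<..<1}" using \<alpha>\<beta> by auto
  have kI: "continuous_on ?I k" and mI: "continuous_on ?I m" using k m sub continuous_on_subset by blast+
  define N where "N z = integral {\<alpha>..z} m" for z
  have N: "(N has_real_derivative m z) (at z within ?I)" if "z \<in> ?I" for z
    unfolding N_def by (rule integral_has_real_derivative[OF mI that])
  have Nc: "continuous_on ?I N" using N DERIV_continuous_on by blast
  define F where "F z = k z - N z" for z
  have Fc: "continuous_on ?I F" unfolding F_def by (intro continuous_intros kI Nc)
  have "F \<beta> \<le> F \<alpha> + 2 * e" if e: "0 < e" for e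
  proof -
    have "uniformly_continuous_on ?I F" by (rule compact_uniformly_continuous[OF Fc compact_Icc])
    then obtain d where d: "0 < d" "\<And>x y. x \<in> ?I \<Longrightarrow> y \<in> ?I \<Longrightarrow> dist y x < d \<Longrightarrow> dist (F y) (F x) < e"
      unfolding uniformly_continuous_on_def using e by metis
    \<comment> \<open>The two ramps of width \<delta> do not overlap, and \<open>F\<close> varies by
      less than \<open>e\<close> on each. The slopes \<open>p\<close> and \<open>q\<close> of the
      ramps have integral 1.\<close>
    define \<delta> where "\<delta> = min (d / 2) ((\<beta> - \<alpha>) / 2)"
    have \<delta>: "0 < \<delta>" "\<delta> < d" "2 * \<delta> \<le> \<beta> - \<alpha>" using d(1) \<alpha>\<beta> by (auto simp: \<delta>_def min_def field_simps)
    define p where "p z = smoothstep' ((z - \<alpha>) / \<delta>) / \<delta>" for z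
    define q where "q z = smoothstep' ((\<beta> - z) / \<delta>) / \<delta>" for z
    define \<eta> where "\<eta> z = smoothstep ((z - \<alpha>) / \<delta>) * smoothstep ((\<beta> - z) / \<delta>)" for z
    have dp: "((\<lambda>z. smoothstep ((z - \<alpha>) / \<delta>)) has_real_derivative p z) (at z within S)" for z S
    proof -
      have "((\<lambda>z. (z - \<alpha>) / \<delta>) has_real_derivative 1 / \<delta>) (at z within S)"
        using \<delta> by (auto intro!: derivative_eq_intros)
      from DERIV_chain2[OF smoothstep_has_derivative this] show ?thesis by (simp add: p_def)
    qed
    have dq: "((\<lambda>z. smoothstep ((\<beta> - z) / \<delta>)) has_real_derivative - q z) (at z within S)" for z S
    proof -
      have "((\<lambda>z. (\<beta> - z) / \<delta>) has_real_derivative - 1 / \<delta>) (at z within S)"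
        using \<delta> by (auto intro!: derivative_eq_intros)
      from DERIV_chain2[OF smoothstep_has_derivative this] show ?thesis by (simp add: q_def)
    qed
    have p0: "p z = 0" if "z \<le> \<alpha> \<or> \<alpha> + \<delta> \<le> z" for z
      using that \<delta> by (auto simp: p_def divide_nonpos_pos)
    have q0: "q z = 0" if "z \<le> \<beta> - \<delta> \<or> \<beta> \<le> z" for z
      using that \<delta> by (auto simp: q_def divide_nonpos_pos)
    have pq: "0 \<le> p z" "0 \<le> q z" for z using \<delta> smoothstep'_bounds by (auto simp: p_def q_def)
    have \<eta>0: "\<eta> z = 0" if "z \<le> \<alpha> \<or> \<beta> \<le> z" for z using that \<delta> by (auto simp: \<eta>_def divide_nonpos_pos)
    have d\<eta>: "(\<eta> has_real_derivative p z - q z) (at z within S)" for z S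
    proof -
      have "(\<eta> has_real_derivative p z * smoothstep ((\<beta> - z) / \<delta>) + (- q z) * smoothstep ((z - \<alpha>) / \<delta>)) (at z within S)"
        unfolding \<eta>_def by (rule DERIV_mult[OF dp dq])
      moreover have "p z * smoothstep ((\<beta> - z) / \<delta>) = p z"
        using p0[of z] \<delta> by (cases "\<alpha> + \<delta> \<le> z") auto
      moreover have "q z * smoothstep ((z - \<alpha>) / \<delta>) = q z"
        using q0[of z] \<delta> by (cases "z \<le> \<beta> - \<delta>") auto
      ultimately show ?thesis by simp
    qed
    have cp: "continuous_on S p" and cq: "continuous_on S q" for S
      unfolding p_def q_def using \<delta>
      by (auto intro!: continuous_intros continuous_on_compose2[OF continuous_smoothstep'])
    have c\<eta>: "continuous_on S \<eta>" for S by (rule DERIV_continuous_on[OF d\<eta>])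
    have "time_cutoff \<alpha> \<beta> \<eta> (\<lambda>z. p z - q z)"
      unfolding time_cutoff_def
    proof (intro conjI allI impI)
      fix z show "0 \<le> \<eta> z" by (simp add: \<eta>_def smoothstep_bounds)
    next
      fix z assume "z \<notin> {\<alpha>..\<beta>}"
      then have z: "z \<le> \<alpha> \<or> \<beta> \<le> z" by auto
      then show "\<eta> z = 0" by (rule \<eta>0)
      have "p z = 0" "q z = 0" using z \<delta> by (intro p0 q0, linarith)+
      then show "p z - q z = 0" by simp
    qed (use \<alpha>\<beta> d\<eta>[of _ UNIV] in \<open>auto intro!: continuous_intros c\<eta> cp cq\<close>)
    from weak[OF this]
    have "0 \<le> (LINT z|lborel. indicator {0<..} z * ((p z - q z) * k z + \<eta> z * m z))" .
    also have "(\<lambda>z. indicator {0<..} z * ((p z - q z) * k z + \<eta> z * m z)) = (\<lambda>z. (p z - q z) * k z + \<eta> z * m z)"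
    proof
      fix z show "indicator {0<..} z * ((p z - q z) * k z + \<eta> z * m z) = (p z - q z) * k z + \<eta> z * m z"
        using \<eta>0[of z] p0[of z] q0[of z] \<alpha>\<beta> \<delta> by (cases "0 < z") auto
    qed
    also have "(LINT z|lborel. (p z - q z) * k z + \<eta> z * m z) = integral ?I (\<lambda>z. (p z - q z) * k z + \<eta> z * m z)"
    proof (rule lborel_integral_eq_integral)
      show "(p z - q z) * k z + \<eta> z * m z = 0" if "z \<notin> ?I" for z
        using that \<eta>0[of z] p0[of z] q0[of z] \<delta> by auto
    qed (intro continuous_intros cp cq kI c\<eta> mI)
    \<comment> \<open>Writing k = F + N leaves for \<open>N\<close> the derivative of \<eta> N,
      which integrates to zero because \<eta> vanishes at both ends.\<close>
    also have "\<dots> = integral ?I (\<lambda>z. (p z - q z) * F z) + integral ?I (\<lambda>z. (p z - q z) * N z + \<eta> z * m z)"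
    proof (subst Henstock_Kurzweil_Integration.integral_add[symmetric])
      show "(\<lambda>z. (p z - q z) * F z) integrable_on ?I" "(\<lambda>z. (p z - q z) * N z + \<eta> z * m z) integrable_on ?I"
        by (intro integrable_continuous_interval continuous_intros cp cq c\<eta> mI Nc Fc)+
    qed (simp add: F_def algebra_simps)
    also have "integral ?I (\<lambda>z. (p z - q z) * N z + \<eta> z * m z) = 0"
    proof -
      have "((\<lambda>z. (p z - q z) * N z + \<eta> z * m z) has_integral \<eta> \<beta> * N \<beta> - \<eta> \<alpha> * N \<alpha>) ?I"
      proof (rule fundamental_theorem_of_calculus)
        show "((\<lambda>z. \<eta> z * N z) has_vector_derivative (p z - q z) * N z + \<eta> z * m z) (at z within ?I)" if "z \<in> ?I" for z
          unfolding has_real_derivative_iff_has_vector_derivative[symmetric]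
          by (rule DERIV_cong[OF DERIV_mult[OF d\<eta> N[OF that]]]) simp
      qed (use \<alpha>\<beta> in simp)
      then show ?thesis using \<eta>0[of \<alpha>] \<eta>0[of \<beta>] by (simp add: integral_unique)
    qed
    also have "integral ?I (\<lambda>z. (p z - q z) * F z) + 0 \<le> integral ?I (\<lambda>z. (F \<alpha> + e) * p z - (F \<beta> - e) * q z)"
    proof -
      have "integral ?I (\<lambda>z. (p z - q z) * F z) \<le> integral ?I (\<lambda>z. (F \<alpha> + e) * p z - (F \<beta> - e) * q z)"
      proof (rule integral_le)
        show "(\<lambda>z. (p z - q z) * F z) integrable_on ?I" "(\<lambda>z. (F \<alpha> + e) * p z - (F \<beta> - e) * q z) integrable_on ?I"
          by (intro integrable_continuous_interval continuous_intros cp cq Fc)+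
        fix z assume z: "z \<in> ?I"
        have "p z * F z \<le> p z * (F \<alpha> + e)"
        proof (cases "z < \<alpha> + \<delta>")
          case True
          then have "dist (F z) (F \<alpha>) < e" using d(2)[of \<alpha> z] z \<delta> by (auto simp: dist_real_def)
          then show ?thesis using pq(1)[of z] by (intro mult_left_mono) (auto simp: dist_real_def)
        qed (use p0[of z] in simp)
        moreover have "q z * (F \<beta> - e) \<le> q z * F z"
        proof (cases "\<beta> - \<delta> < z")
          case True
          then have "dist (F z) (F \<beta>) < e" using d(2)[of \<beta> z] z \<delta> by (auto simp: dist_real_def)
          then show ?thesis using pq(2)[of z] by (intro mult_left_mono) (auto simp: dist_real_def)
        qed (use q0[of z] in simp)
        ultimately show "(p z - q z) * F z \<le> (F \<alpha> + e) * p z - (F \<beta> - e) * q z" by (simp add: algebra_simps)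
      qed
      then show ?thesis by simp
    qed
    also have "\<dots> = F \<alpha> + e - (F \<beta> - e)"
    proof -
      have "((\<lambda>z. (F \<alpha> + e) * p z - (F \<beta> - e) * q z) has_integral
         ((F \<alpha> + e) * smoothstep ((\<beta> - \<alpha>) / \<delta>) + (F \<beta> - e) * smoothstep ((\<beta> - \<beta>) / \<delta>))
         - ((F \<alpha> + e) * smoothstep ((\<alpha> - \<alpha>) / \<delta>) + (F \<beta> - e) * smoothstep ((\<beta> - \<alpha>) / \<delta>))) ?I"
      proof (rule fundamental_theorem_of_calculus)
        show "((\<lambda>z. (F \<alpha> + e) * smoothstep ((z - \<alpha>) / \<delta>) + (F \<beta> - e) * smoothstep ((\<beta> - z) / \<delta>))
           has_vector_derivative (F \<alpha> + e) * p z - (F \<beta> - e) * q z) (at z within ?I)" for z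
          unfolding has_real_derivative_iff_has_vector_derivative[symmetric]
          by (rule DERIV_cong[OF DERIV_add[OF DERIV_cmult[OF dp] DERIV_cmult[OF dq]]]) simp
      qed (use \<alpha>\<beta> in simp)
      moreover have "1 \<le> (\<beta> - \<alpha>) / \<delta>" using \<delta> by simp
      ultimately show ?thesis by (simp add: integral_unique)
    qed
    finally show ?thesis by simp
  qed
  note F_le = this
  have "F \<beta> \<le> F \<alpha>"
  proof (rule field_le_epsilon)
    fix e :: real assume "0 < e"
    then show "F \<beta> \<le> F \<alpha> + e" using F_le[of "e / 2"] by simp
  qed
  moreover have "N \<alpha> = 0" by (simp add: N_def)
  ultimately show ?thesis by (simp add: F_def N_def)
qed

section \<open>The Signorini flow in self-similar variables\<close>

text \<open>\<open>c z\<close> bounds the weighted L2 norm of the slice of \<open>f\<close> at time \<open>- z\<close>.\<close>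

locale signorini_flow = heat_cone "half_space :: ('m::finite) sp set" u f gu M for u f gu M +
  fixes c :: "real \<Rightarrow> real"
  assumes cont_u': "continuous_on (half_space_closed \<times> {-1<..<0}) u"
    and cont_gu': "continuous_on (half_space_closed \<times> {-1<..<0}) gu"
    and supp: "\<exists>R. \<forall>x t. x \<in> half_space_closed \<longrightarrow> -1 < t \<longrightarrow> t < 0 \<longrightarrow> R < norm x \<longrightarrow> u (x, t) = 0 \<and> gu (x, t) = 0"
    and bdry: "\<And>x t. snd x = 0 \<Longrightarrow> -1 < t \<Longrightarrow> t < 0 \<Longrightarrow> 0 \<le> u (x, t) \<and> snd (gu (x, t)) \<le> 0 \<and> u (x, t) * snd (gu (x, t)) = 0"
    and cont_c: "continuous_on {0<..<1} c" and c_nonneg: "\<And>z. 0 < z \<Longrightarrow> z < 1 \<Longrightarrow> 0 \<le> c z"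
    and f_bound: "AE z in lborel. 0 < z \<and> z < 1 \<longrightarrow> gint (\<lambda>y. (f (sqrt z *\<^sub>R y, - z))\<^sup>2) \<le> (c z)\<^sup>2"
begin

lemma half_sub: "half_space \<subseteq> (half_space_closed :: 'm sp set)"
  by (auto simp: half_space_def half_space_closed_def)

lemma cont_v': "continuous_on (half_space_closed \<times> {0<..<1}) (\<lambda>(y, z). v y z)"
  unfolding v_def case_prod_unfold
  by (rule continuous_on_compose2[OF cont_u']) (auto intro!: continuous_intros simp: half_space_closed_def)

lemma cont_gv': "continuous_on (half_space_closed \<times> {0<..<1}) (\<lambda>(y, z). gv y z)"
  unfolding gv_def case_prod_unfold
  by (intro continuous_intros, rule continuous_on_compose2[OF cont_gu']) (auto intro!: continuous_intros simp: half_space_closed_def)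

lemma cont_v_slice: "0 < z \<Longrightarrow> z < 1 \<Longrightarrow> continuous_on half_space_closed (\<lambda>y. v y z)"
  and cont_gv_slice: "0 < z \<Longrightarrow> z < 1 \<Longrightarrow> continuous_on half_space_closed (\<lambda>y. gv y z)"
  using continuous_on_compose2[OF cont_v', of half_space_closed "\<lambda>y. (y, z)"]
    continuous_on_compose2[OF cont_gv', of half_space_closed "\<lambda>y. (y, z)"]
  by (auto simp: continuous_on_Pair continuous_on_id image_subset_iff)

lemma supp_v:
  assumes "0 < a"
  obtains R where "0 \<le> R" "\<And>y z. y \<in> half_space_closed \<Longrightarrow> a \<le> z \<Longrightarrow> z < 1 \<Longrightarrow> R < norm y \<Longrightarrow> v y z = 0 \<and> gv y z = 0"
proof -
  obtain R where R: "\<And>x t. x \<in> half_space_closed \<Longrightarrow> -1 < t \<Longrightarrow> t < 0 \<Longrightarrow> R < norm x \<Longrightarrow> u (x, t) = 0 \<and> gu (x, t) = 0"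
    using supp by blast
  have "v y z = 0 \<and> gv y z = 0" if "y \<in> half_space_closed" "a \<le> z" "z < 1" "\<bar>R\<bar> / sqrt a < norm y" for y z
  proof -
    have "\<bar>R\<bar> < norm y * sqrt a" using that(4) assms by (simp add: pos_divide_less_eq)
    also have "\<dots> \<le> norm y * sqrt z" using that by (intro mult_left_mono) auto
    finally have "R < norm (sqrt z *\<^sub>R y)" using that assms by (simp add: mult.commute)
    moreover have "sqrt z *\<^sub>R y \<in> half_space_closed" using that assms by (auto simp: half_space_closed_def)
    ultimately show ?thesis using R[of "sqrt z *\<^sub>R y" "- z"] that assms by (simp add: v_def gv_def)
  qed
  then show ?thesis using assms by (intro that[of "\<bar>R\<bar> / sqrt a"]) auto
qed

text \<open>The identity is applied with \<theta> equal to the Gaussian times a cutoff that vanishes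
  near the flat boundary. As the cutoff approaches the indicator of the half-space, its normal slope
  picks up the flux snd (gv y z) * (U y - v y z) at the boundary, and \<open>sign\<close> fixes the
  direction of the inequality. The factor \<open>s\<close> allows both directions when the flux
  vanishes.\<close>

lemma comparison_inequality:
  assumes \<eta>: "time_cutoff a b \<eta> \<eta>'"
    and U: "continuous_on half_space_closed U" "continuous_on half_space_closed gU"
      "\<And>y. y \<in> half_space \<Longrightarrow> (U has_derivative (\<lambda>h. gU y \<bullet> h)) (at y)"
      "\<And>y. y \<in> half_space_closed \<Longrightarrow> RU < norm y \<Longrightarrow> U y = 0 \<and> gU y = 0"
    and s: "s = 1 \<or> s = -1"
    and sign: "\<And>y z. snd y = 0 \<Longrightarrow> 0 < z \<Longrightarrow> z < 1 \<Longrightarrow> s * (snd (gv y z) * (U y - v y z)) \<le> 0"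
  shows "0 \<le> (LINT z|lborel. indicator {0<..} z * (\<eta>' z * (s * gint (\<lambda>y. v y z * U y - (v y z)\<^sup>2 / 2))
      + \<eta> z * (s * gint (\<lambda>y. gv y z \<bullet> (gU y - gv y z)) / z + c z * sqrt (gint (\<lambda>y. (U y - v y z)\<^sup>2)))))"
proof -
  note E = time_cutoffD[OF \<eta>]
  obtain R0 where R0: "0 \<le> R0" "\<And>y z. y \<in> half_space_closed \<Longrightarrow> a \<le> z \<Longrightarrow> z < 1 \<Longrightarrow> R0 < norm y \<Longrightarrow> v y z = 0 \<and> gv y z = 0"
    using supp_v[OF E(1)] by metis
  define R where "R = max R0 RU"
  have R: "0 \<le> R" "\<And>y z. y \<in> half_space_closed \<Longrightarrow> a \<le> z \<Longrightarrow> z < 1 \<Longrightarrow> R < norm y \<Longrightarrow> v y z = 0 \<and> gv y z = 0 \<and> U y = 0 \<and> gU y = 0"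
    using R0 U(4) by (auto simp: R_def)
  define w where "w y z = v y z * U y - (v y z)\<^sup>2 / 2" for y z
  define j where "j y z = gv y z \<bullet> (gU y - gv y z)" for y z
  \<comment> \<open>The signed boundary flux, continued to the closed half-space, where it is
    continuous; near the boundary it can thus be positive only by a small amount.\<close>
  define q where "q y z = s * (snd (gv y z) * (U y - v y z))" for y z
  define T where "T z = \<eta>' z * (s * gint (\<lambda>y. w y z)) + \<eta> z * (s * gint (\<lambda>y. j y z) / z + c z * sqrt (gint (\<lambda>y. (U y - v y z)\<^sup>2)))" for z
  have cU: "continuous_on (half_space_closed \<times> {0<..<1}) (\<lambda>p. U (fst p))" "continuous_on (half_space_closed \<times> {0<..<1}) (\<lambda>p. gU (fst p))"
    by (rule continuous_on_compose2[OF U(1)] continuous_on_compose2[OF U(2)]; auto intro!: continuous_intros)+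
  note cv = cont_v'[unfolded case_prod_unfold] cont_gv'[unfolded case_prod_unfold]
  have cw: "continuous_on (half_space_closed \<times> {0<..<1}) (\<lambda>(y, z). w y z)"
    and cj: "continuous_on (half_space_closed \<times> {0<..<1}) (\<lambda>(y, z). j y z)"
    and cq: "continuous_on (half_space_closed \<times> {0<..<1}) (\<lambda>(y, z). q y z)"
    and cd: "continuous_on (half_space_closed \<times> {0<..<1}) (\<lambda>(y, z). (U y - v y z)\<^sup>2)"
    unfolding w_def j_def q_def case_prod_unfold by (intro continuous_intros cU cv; simp)+
  have supp': "\<exists>R. \<forall>y z. y \<in> half_space_closed \<longrightarrow> a' \<le> z \<longrightarrow> z < 1 \<longrightarrow> R < norm y \<longrightarrow> v y z = 0 \<and> gv y z = 0 \<and> U y = 0 \<and> gU y = 0"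
    if "0 < a'" for a'
  proof -
    obtain R' where "\<And>y z. y \<in> half_space_closed \<Longrightarrow> a' \<le> z \<Longrightarrow> z < 1 \<Longrightarrow> R' < norm y \<Longrightarrow> v y z = 0 \<and> gv y z = 0"
      using supp_v[OF \<open>0 < a'\<close>] by metis
    then show ?thesis using U(4) by (intro exI[of _ "max R' RU"]) auto
  qed
  have gw: "continuous_on {0<..<1} (\<lambda>z. gint (\<lambda>y. w y z))"
    by (rule gint_continuous[OF cw]) (use supp' in \<open>fastforce simp: w_def\<close>)
  have gj: "continuous_on {0<..<1} (\<lambda>z. gint (\<lambda>y. j y z))"
    by (rule gint_continuous[OF cj]) (use supp' in \<open>fastforce simp: j_def\<close>)
  have gd: "continuous_on {0<..<1} (\<lambda>z. gint (\<lambda>y. (U y - v y z)\<^sup>2))"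
    by (rule gint_continuous[OF cd]) (use supp' in \<open>fastforce\<close>)
  have ab: "{a..b} \<subseteq> {0<..<1}" using E(1,2) by auto
  have cT: "continuous_on {a..b} T"
  proof -
    have "continuous_on {0<..<1} T" unfolding T_def
      by (intro continuous_intros gw gj gd cont_c continuous_on_subset[OF E(3)] continuous_on_subset[OF E(4)]) auto
    then show ?thesis using ab continuous_on_subset by blast
  qed
  have T0: "T z = 0" if "z \<notin> {a..b}" for z using E(6,7)[OF that] by (simp add: T_def)
  have iT: "integrable lborel T" by (rule lborel_integral_eq_integral(2)[OF cT T0])
  have iI: "integrable lborel (\<lambda>z. r * indicator {a..b} z)" for r :: real
    by (intro integrable_mult_right, rule integrable_real_indicator; simp add: emeasure_lborel_Icc_eq)
  obtain Hb where Hb: "0 \<le> Hb" "\<And>z. \<bar>\<eta> z\<bar> \<le> Hb" "\<And>z. \<bar>\<eta>' z\<bar> \<le> Hb"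
  proof -
    obtain A B where "0 \<le> A" "\<And>z. norm (\<eta> z) \<le> A" "0 \<le> B" "\<And>z. norm (\<eta>' z) \<le> B"
      using bounded_continuous_support[OF E(3) compact_Icc E(6)] bounded_continuous_support[OF E(4) compact_Icc E(7)] by metis
    then show ?thesis by (intro that[of "max A B"]) (auto simp: le_max_iff_disj)
  qed
  let ?D = "(half_space_closed \<inter> cball 0 R) \<times> {a..b} :: ('m sp \<times> real) set"
  have cptD: "compact ?D"
    by (intro compact_Times closed_Int_compact closed_half_space_closed compact_cball compact_Icc)
  have D_sub: "?D \<subseteq> half_space_closed \<times> {0<..<1}" using ab by auto
  obtain N where N: "0 \<le> N" "\<And>y z. (y, z) \<in> ?D \<Longrightarrow> \<bar>w y z\<bar> \<le> N" "\<And>y z. (y, z) \<in> ?D \<Longrightarrow> \<bar>j y z\<bar> \<le> N"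
  proof -
    have "bounded ((\<lambda>(y, z). w y z) ` ?D)" "bounded ((\<lambda>(y, z). j y z) ` ?D)"
      using cw cj D_sub by (auto intro!: compact_imp_bounded compact_continuous_image cptD intro: continuous_on_subset)
    then obtain A B where "\<forall>x\<in>(\<lambda>(y, z). w y z) ` ?D. norm x \<le> A" "\<forall>x\<in>(\<lambda>(y, z). j y z) ` ?D. norm x \<le> B"
      unfolding bounded_iff by blast
    then have "\<And>y z. (y, z) \<in> ?D \<Longrightarrow> \<bar>w y z\<bar> \<le> A" "\<And>y z. (y, z) \<in> ?D \<Longrightarrow> \<bar>j y z\<bar> \<le> B"
      by (force, force)
    then show ?thesis by (intro that[of "max 0 (max A B)"]) (auto simp: le_max_iff_disj)
  qed
  obtain C where C: "0 \<le> C" "\<And>\<epsilon>. 0 < \<epsilon> \<Longrightarrow> (LINT y|lborel. indicator {y :: 'm sp. norm y \<le> R \<and> 0 \<le> snd y \<and> snd y \<le> 2 * \<epsilon>} y) \<le> C * \<epsilon>"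
    by (rule slab_volume[of R]) blast
  \<comment> \<open>In the error, \<open>C\<close> \<epsilon> bounds the volume of the slab where
    the cutoff is below 1. It is multiplied by the bounds for the \<eta>' term, for the energy term,
    and by 2 \<omega> / \<epsilon> for the flux times the slope of the ramp; only in the last one
    does \<epsilon> cancel.\<close>
  have main: "0 \<le> (LINT z|lborel. T z) + (C * (Hb * N * \<epsilon> + Hb / a * (2 * \<omega> + N * \<epsilon>))) * measure lborel {a..b}"
    if \<epsilon>: "0 < \<epsilon>" and \<omega>: "0 < \<omega>" and q\<omega>: "\<And>y z. (y, z) \<in> ?D \<Longrightarrow> snd y \<le> 2 * \<epsilon> \<Longrightarrow> q y z \<le> \<omega>" for \<epsilon> \<omega>
  proof -
    define S where "S = {y :: 'm sp. norm y \<le> R \<and> 0 \<le> snd y \<and> snd y \<le> 2 * \<epsilon>}"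
    have "closed S" unfolding S_def by (intro closed_Collect_conj closed_Collect_le continuous_intros)
    moreover have "bounded S" unfolding S_def bounded_iff by blast
    ultimately have cS: "compact S" by (simp add: compact_eq_bounded_closed)
    have iS: "integrable lborel (indicator S :: 'm sp \<Rightarrow> real)"
      using emeasure_compact_finite[OF cS] cS by (intro integrable_real_indicator) (auto intro: borel_compact)
    \<comment> \<open>This factor serves compactness of the support only: it is 1 with vanishing
      derivative on the ball of radius \<open>R\<close>, which contains the supports of
      \<open>U\<close> and of the slices of \<open>v\<close>. The other factor of \<kappa> rises
      from 0 to 1 between the heights \<epsilon> and 2 \<epsilon>.\<close>
    define \<phi> where "\<phi> y = smoothstep (R\<^sup>2 + 2 - y \<bullet> y)" for y :: "'m sp"
    define \<phi>' where "\<phi>' y = smoothstep' (R\<^sup>2 + 2 - y \<bullet> y)" for y :: "'m sp"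
    define \<kappa> where "\<kappa> y = smoothstep (snd y / \<epsilon> - 1) * \<phi> y" for y :: "'m sp"
    define g\<kappa> where "g\<kappa> y = (smoothstep' (snd y / \<epsilon> - 1) / \<epsilon> * \<phi> y) *\<^sub>R (0, 1) - (2 * smoothstep (snd y / \<epsilon> - 1) * \<phi>' y) *\<^sub>R y" for y :: "'m sp"
    have \<kappa>: "(\<kappa> has_derivative (\<lambda>h. g\<kappa> y \<bullet> h)) (at y)" for y
    proof -
      have d1: "((\<lambda>y :: 'm sp. smoothstep (snd y / \<epsilon> - 1)) has_derivative (\<lambda>h. (snd h / \<epsilon>) * smoothstep' (snd y / \<epsilon> - 1))) (at y)"
        by (rule DERIV_compose_FDERIV[OF smoothstep_has_derivative]) (use \<epsilon> in \<open>auto intro!: derivative_eq_intros\<close>)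
      have d2: "(\<phi> has_derivative (\<lambda>h. (- 2 * (y \<bullet> h)) * \<phi>' y)) (at y)"
        unfolding \<phi>_def \<phi>'_def
        by (rule DERIV_compose_FDERIV[OF smoothstep_has_derivative])
           (auto intro!: derivative_eq_intros simp: inner_commute)
      show ?thesis
        unfolding \<kappa>_def
        by (rule has_derivative_eq_rhs[OF has_derivative_mult[OF d1 d2]])
           (auto simp: g\<kappa>_def fun_eq_iff inner_diff_left inner_Pair_0 algebra_simps)
    qed
    define \<theta> where "\<theta> y = \<kappa> y * gauss y" for y
    define g where "g y = gauss y *\<^sub>R g\<kappa> y - (\<theta> y / 2) *\<^sub>R y" for y
    define K where "K = {y :: 'm sp. \<epsilon> \<le> snd y \<and> y \<bullet> y \<le> R\<^sup>2 + 2}"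
    have cK: "compact K"
    proof -
      have "closed K" unfolding K_def by (intro closed_Collect_conj closed_Collect_le continuous_intros)
      moreover have "norm y \<le> sqrt (R\<^sup>2 + 2)" if "y \<in> K" for y
        using that by (intro real_le_rsqrt) (auto simp: K_def dot_square_norm)
      then have "bounded K" unfolding bounded_iff by blast
      ultimately show ?thesis by (simp add: compact_eq_bounded_closed)
    qed
    have K_sub: "K \<subseteq> half_space" using \<epsilon> by (auto simp: K_def half_space_def)
    have \<phi>0: "\<kappa> y = 0 \<and> g\<kappa> y = 0" if yK: "y \<notin> K" for y
    proof -
      consider "snd y < \<epsilon>" | "R\<^sup>2 + 2 < y \<bullet> y" using yK unfolding K_def by fastforce
      then show ?thesis
      proof cases
        case 1
        then have "snd y / \<epsilon> - 1 \<le> 0" using \<epsilon> by simp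
        then show ?thesis by (simp add: \<kappa>_def g\<kappa>_def flip: zero_prod_def)
      next
        case 2
        then show ?thesis by (simp add: \<kappa>_def g\<kappa>_def \<phi>_def \<phi>'_def flip: zero_prod_def)
      qed
    qed
    have c\<phi>: "continuous_on UNIV \<phi>" "continuous_on UNIV \<phi>'"
      unfolding \<phi>_def \<phi>'_def
      by (rule continuous_on_compose2[OF continuous_smoothstep] continuous_on_compose2[OF continuous_smoothstep']; intro continuous_intros subset_UNIV)+
    have css: "continuous_on UNIV (\<lambda>y :: 'm sp. smoothstep (snd y / \<epsilon> - 1))" "continuous_on UNIV (\<lambda>y :: 'm sp. smoothstep' (snd y / \<epsilon> - 1))"
      by (rule continuous_on_compose2[OF continuous_smoothstep] continuous_on_compose2[OF continuous_smoothstep']; (intro continuous_intros subset_UNIV)?; use \<epsilon> in simp)+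
    have c\<kappa>: "continuous_on UNIV \<kappa>" "continuous_on UNIV g\<kappa>"
      unfolding \<kappa>_def g\<kappa>_def using \<epsilon> by (intro continuous_intros css c\<phi>; simp)+
    have \<theta>: "C1_compact K \<theta> g"
      unfolding C1_compact_def
    proof (intro conjI allI impI cK)
      show "continuous_on UNIV \<theta>" "continuous_on UNIV g"
        unfolding g_def \<theta>_def by (intro continuous_intros c\<kappa> continuous_gauss; simp)+
      show "\<theta> y = 0" "g y = 0" if "y \<notin> K" for y using \<phi>0[OF that] by (simp_all add: \<theta>_def g_def)
      show "(\<theta> has_derivative (\<lambda>h. g y \<bullet> h)) (at y)" for y
        unfolding \<theta>_def
        by (rule has_derivative_eq_rhs[OF has_derivative_mult[OF \<kappa> has_derivative_gauss]])
           (auto simp: g_def \<theta>_def fun_eq_iff inner_diff_left algebra_simps)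
    qed
    define A where "A z = \<eta>' z * (LINT y|lborel. (v y z * U y - (v y z)\<^sup>2 / 2) * \<theta> y)
      + \<eta> z / z * (LINT y|lborel. gv y z \<bullet> ((U y - v y z) *\<^sub>R (g y + (\<theta> y / 2) *\<^sub>R y) + \<theta> y *\<^sub>R (gU y - gv y z)))" for z
    define B where "B z = \<eta> z * (LINT y|lborel. fv y z * ((U y - v y z) * \<theta> y))" for z
    have UP: "continuous_on half_space U" "continuous_on half_space gU"
      using U(1,2) half_sub continuous_on_subset by blast+
    note ci = comparison_identity[OF \<theta> K_sub \<eta> U(3) UP, folded A_def B_def]
    have A0: "A z = 0" "B z = 0" if "z \<notin> {a..b}" for z using E(6,7)[OF that] by (simp_all add: A_def B_def)
    define Er where "Er = C * (Hb * N * \<epsilon> + Hb / a * (2 * \<omega> + N * \<epsilon>))"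
    have Abound: "s * A z \<le> \<eta>' z * (s * gint (\<lambda>y. w y z)) + \<eta> z * (s * gint (\<lambda>y. j y z) / z) + Er" if z: "z \<in> {a..b}" for z
    proof -
      have z': "0 < z" "z < 1" "a \<le> z" "z \<le> b" using z E(1,2) by auto
      let ?X = "\<lambda>y. gv y z \<bullet> ((U y - v y z) *\<^sub>R (g y + (\<theta> y / 2) *\<^sub>R y) + \<theta> y *\<^sub>R (gU y - gv y z))"
      have sl: "continuous_on half_space_closed (\<lambda>y. v y z)" "continuous_on half_space_closed (\<lambda>y. gv y z)"
        using cont_v_slice[OF z'(1,2)] cont_gv_slice[OF z'(1,2)] .
      note slP = continuous_on_subset[OF sl(1) half_sub] continuous_on_subset[OF sl(2) half_sub]
      have c\<theta>: "continuous_on half_space \<theta>" "continuous_on half_space g"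
        using C1_compactD(2,3)[OF \<theta>] continuous_on_subset by blast+
      have i1: "integrable lborel (\<lambda>y. w y z * \<theta> y)"
      proof (rule integrable_continuous_support[OF _ cK])
        show "continuous_on UNIV (\<lambda>y. w y z * \<theta> y)"
          by (rule continuous_extend_zero[OF open_half_space cK K_sub])
             (use C1_compactD(4)[OF \<theta>] in \<open>auto simp: w_def intro!: continuous_intros slP c\<theta> UP\<close>)
      qed (use C1_compactD(4)[OF \<theta>] in simp)
      have i2: "integrable lborel ?X"
      proof (rule integrable_continuous_support[OF _ cK])
        show "continuous_on UNIV ?X"
          by (rule continuous_extend_zero[OF open_half_space cK K_sub])
             (use C1_compactD(4,5)[OF \<theta>] in \<open>auto intro!: continuous_intros slP c\<theta> UP\<close>)
      qed (use C1_compactD(4,5)[OF \<theta>] in simp)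
      have j1: "integrable lborel (\<lambda>y. indicator half_space y * (w y z * gauss y))"
        by (rule gint_integrable[of _ R]) (use R(2)[OF _ z'(3,2)] in \<open>auto simp: w_def intro!: continuous_intros sl U\<close>)
      have j2: "integrable lborel (\<lambda>y. indicator half_space y * (j y z * gauss y))"
        by (rule gint_integrable[of _ R]) (use R(2)[OF _ z'(3,2)] in \<open>auto simp: j_def intro!: continuous_intros sl U\<close>)
      have pw: "(\<eta>' z * s) * (w y z * \<theta> y) + (\<eta> z / z * s) * ?X y
          \<le> (\<eta>' z * s) * (indicator half_space y * (w y z * gauss y)) + (\<eta> z / z * s) * (indicator half_space y * (j y z * gauss y))
            + (Hb * N + Hb / a * (2 * \<omega> / \<epsilon> + N)) * indicator S y" (is "?lhs \<le> ?rhs") for y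
      proof (cases "y \<in> half_space \<and> norm y \<le> R")
        case False
        have "?lhs = 0"
        proof (cases "y \<in> half_space")
          case True
          then have "R < norm y" using False by simp
          then have "v y z = 0 \<and> gv y z = 0 \<and> U y = 0 \<and> gU y = 0" using R(2)[of y z] True half_sub z' by blast
          then show ?thesis by (simp add: w_def)
        next
          case False
          then have "\<theta> y = 0" "g y = 0" using C1_compactD(4,5)[OF \<theta>] K_sub by blast+
          then show ?thesis by simp
        qed
        moreover have "indicator half_space y * (w y z * gauss y) = 0 \<and> indicator half_space y * (j y z * gauss y) = 0"
          using False R(2)[of y z] half_sub z' by (cases "y \<in> half_space") (auto simp: w_def j_def)
        moreover have "0 \<le> (Hb * N + Hb / a * (2 * \<omega> / \<epsilon> + N)) * indicator S y"
          using Hb(1) N(1) E(1) \<omega> \<epsilon> by simp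
        ultimately show ?thesis by (simp only: mult_zero_right add_0_left)
      next
        case True
        then have y: "y \<in> half_space" "norm y \<le> R" "y \<in> half_space_closed" "0 < snd y" using half_sub by (auto simp: half_space_def)
        have yD: "(y, z) \<in> ?D" using y z by simp
        have "y \<bullet> y \<le> R\<^sup>2" using y(2) by (simp add: dot_square_norm power_mono)
        then have \<phi>1: "\<phi> y = 1" "\<phi>' y = 0" by (simp_all add: \<phi>_def \<phi>'_def)
        define r where "r = smoothstep (snd y / \<epsilon> - 1)" define r' where "r' = smoothstep' (snd y / \<epsilon> - 1)"
        have r: "0 \<le> r" "r \<le> 1" "0 \<le> r'" "r' \<le> 2" using smoothstep_bounds smoothstep'_bounds by (auto simp: r_def r'_def)
        have r1: "r = 1 \<and> r' = 0" if "y \<notin> S"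
        proof -
          have "2 * \<epsilon> < snd y" using that y by (auto simp: S_def)
          then have "1 \<le> snd y / \<epsilon> - 1" using \<epsilon> by (simp add: field_simps)
          then show ?thesis by (simp add: r_def r'_def)
        qed
        have \<theta>r: "\<theta> y = r * gauss y" by (simp add: \<theta>_def \<kappa>_def \<phi>1 r_def)
        \<comment> \<open>The gradient of the Gaussian cancels the drift, and what remains is the
          normal slope of the ramp.\<close>
        have G1: "g y + (\<theta> y / 2) *\<^sub>R y = (gauss y * r' / \<epsilon>) *\<^sub>R (0, 1)" by (simp add: g_def g\<kappa>_def \<phi>1 r'_def)
        have G2: "gv y z \<bullet> (0, 1) = snd (gv y z)" by (simp add: inner_prod_def)
        have X: "?X y = (snd (gv y z) * (U y - v y z)) * (gauss y * r' / \<epsilon>) + r * gauss y * j y z"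
          unfolding G1 by (simp only: inner_add_right inner_scaleR_right G2 \<theta>r j_def mult_ac)
        have "?lhs - ((\<eta>' z * s) * (w y z * gauss y) + (\<eta> z / z * s) * (j y z * gauss y))
          = (\<eta>' z * s) * (w y z * gauss y) * (r - 1) + (\<eta> z / z) * (q y z * (gauss y * (r' / \<epsilon>))) + (\<eta> z / z * s) * (j y z * gauss y) * (r - 1)"
        proof -
          have "gauss y * r' / \<epsilon> = gauss y * (r' / \<epsilon>)" by simp
          then show ?thesis unfolding X unfolding \<theta>r q_def
            by (simp only:) (simp only: algebra_simps)
        qed
        also have "\<dots> \<le> (Hb * N + Hb / a * (2 * \<omega> / \<epsilon> + N)) * indicator S y"
        proof (cases "y \<in> S")
          case False
          then show ?thesis using r1 by simp
        next
          case True
          have g1: "0 \<le> gauss y" "gauss y \<le> 1" by (rule gauss_nonneg, rule gauss_le_1)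
          have \<eta>z: "0 \<le> \<eta> z / z" "\<eta> z / z \<le> Hb / a"
            using E(8)[of z] Hb(1) Hb(2)[of z] z' E(1) by (auto intro!: frac_le)
          have "(\<eta>' z * s) * (w y z * gauss y) * (r - 1) \<le> \<bar>(\<eta>' z * s) * (w y z * gauss y) * (r - 1)\<bar>" by simp
          also have "\<dots> \<le> (Hb * 1) * (N * 1) * 1"
            unfolding abs_mult using s Hb(1) Hb(3)[of z] N(1) N(2)[OF yD] g1 r by (intro mult_mono) auto
          finally have 1: "(\<eta>' z * s) * (w y z * gauss y) * (r - 1) \<le> Hb * N" by simp
          have "(\<eta> z / z * s) * (j y z * gauss y) * (r - 1) \<le> \<bar>(\<eta> z / z * s) * (j y z * gauss y) * (r - 1)\<bar>" by (rule abs_ge_self)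
          also have "\<dots> \<le> (Hb / a * 1) * (N * 1) * 1"
            unfolding abs_mult using s \<eta>z Hb(1) N(1) N(3)[OF yD] g1 r E(1) by (intro mult_mono) auto
          finally have 2: "(\<eta> z / z * s) * (j y z * gauss y) * (r - 1) \<le> Hb / a * N" by simp
          have "q y z \<le> \<omega>" using q\<omega>[OF yD] True by (simp add: S_def)
          then have "q y z * (gauss y * (r' / \<epsilon>)) \<le> \<omega> * (gauss y * (r' / \<epsilon>))"
            using g1 r \<epsilon> by (intro mult_right_mono) auto
          also have "\<dots> \<le> \<omega> * (1 * (2 / \<epsilon>))"
            using g1 r \<epsilon> \<omega> by (intro mult_left_mono mult_mono divide_right_mono) auto
          finally have "(\<eta> z / z) * (q y z * (gauss y * (r' / \<epsilon>))) \<le> (\<eta> z / z) * (2 * \<omega> / \<epsilon>)"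
            using \<eta>z by (intro mult_left_mono) (auto simp: mult.commute)
          also have "\<dots> \<le> Hb / a * (2 * \<omega> / \<epsilon>)" using \<eta>z \<omega> \<epsilon> by (intro mult_right_mono) auto
          finally have 3: "(\<eta> z / z) * (q y z * (gauss y * (r' / \<epsilon>))) \<le> Hb / a * (2 * \<omega> / \<epsilon>)" .
          show ?thesis using True 1 2 3 by (simp add: distrib_left)
        qed
        finally show ?thesis using y(1) by simp
      qed
      have "s * A z = (LINT y|lborel. (\<eta>' z * s) * (w y z * \<theta> y) + (\<eta> z / z * s) * ?X y)"
      proof -
        have "(LINT y|lborel. (\<eta>' z * s) * (w y z * \<theta> y) + (\<eta> z / z * s) * ?X y)
            = (\<eta>' z * s) * (LINT y|lborel. w y z * \<theta> y) + (\<eta> z / z * s) * (LINT y|lborel. ?X y)"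
          by (simp only: Bochner_Integration.integral_add integrable_mult_right i1 i2 integral_mult_right_zero)
        then show ?thesis by (simp only: A_def w_def distrib_left mult_ac)
      qed
      also have "\<dots> \<le> (LINT y|lborel. (\<eta>' z * s) * (indicator half_space y * (w y z * gauss y)) + (\<eta> z / z * s) * (indicator half_space y * (j y z * gauss y))
            + (Hb * N + Hb / a * (2 * \<omega> / \<epsilon> + N)) * indicator S y)"
        by (intro integral_mono pw Bochner_Integration.integrable_add integrable_mult_right i1 i2 j1 j2 iS)
      also have "\<dots> = (\<eta>' z * s) * gint (\<lambda>y. w y z) + (\<eta> z / z * s) * gint (\<lambda>y. j y z)
         + (Hb * N + Hb / a * (2 * \<omega> / \<epsilon> + N)) * (LINT y|lborel. indicator S y)"
        unfolding gint_def
        by (simp only: Bochner_Integration.integral_add Bochner_Integration.integrable_add integrable_mult_right i1 i2 j1 j2 iS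
            integral_mult_right_zero)
      also have "(Hb * N + Hb / a * (2 * \<omega> / \<epsilon> + N)) * (LINT y|lborel. indicator S y) \<le> (Hb * N + Hb / a * (2 * \<omega> / \<epsilon> + N)) * (C * \<epsilon>)"
        using C(2)[OF \<epsilon>] Hb(1) N(1) E(1) \<omega> \<epsilon> unfolding S_def by (intro mult_left_mono) auto
      also have "(Hb * N + Hb / a * (2 * \<omega> / \<epsilon> + N)) * (C * \<epsilon>) = Er"
        using \<epsilon> E(1) by (simp add: Er_def field_simps)
      finally show ?thesis by (simp add: algebra_simps)
    qed
    \<comment> \<open>Cauchy-Schwarz with one factor sqrt (gauss y) attached to \<open>f\<close> and
      one to U - v; the cutoff is then dropped by \<kappa> \<le> 1.\<close>
    have Bbound: "AE z in lborel. s * B z \<le> \<eta> z * (c z * sqrt (gint (\<lambda>y. (U y - v y z)\<^sup>2)))"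
      using f_bound
    proof eventually_elim
      case (elim z)
      show ?case
      proof (cases "z \<in> {a..b}")
        case False
        then show ?thesis using A0(2) E(6) by simp
      next
        case True
        then have z': "0 < z" "z < 1" "a \<le> z" "z \<le> b" using E(1,2) by auto
        have sl: "continuous_on half_space_closed (\<lambda>y. v y z)" using cont_v_slice[OF z'(1,2)] .
        have mf: "(\<lambda>y. f (sqrt z *\<^sub>R y, - z)) \<in> borel_measurable borel"
        proof -
          have "(\<lambda>y :: 'm sp. (sqrt z *\<^sub>R y, - z)) \<in> borel_measurable borel"
            by (intro borel_measurable_continuous_onI continuous_intros)
          from measurable_compose[OF this meas_f] show ?thesis .
        qed
        let ?I = "indicator (half_space :: 'm sp set) :: _ \<Rightarrow> real"
        let ?W = "\<lambda>y. U y - v y z"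
        let ?F = "\<lambda>y. f (sqrt z *\<^sub>R y, - z)"
        define a1 where "a1 y = ?I y * (?F y * sqrt (gauss y))" for y
        define a2 where "a2 y = ?I y * (?W y * \<kappa> y * sqrt (gauss y))" for y
        have sg: "sqrt (gauss y) * sqrt (gauss y) = gauss y" for y :: "'m sp" by (simp add: gauss_nonneg)
        have W0: "?W y = 0" if "y \<in> half_space_closed" "R < norm y" for y
          using R(2)[OF that(1) z'(3,2) that(2)] by simp
        have e1: "(a1 y)\<^sup>2 = ?I y * ((?F y)\<^sup>2 * gauss y)" for y
          using sg[of y] by (auto simp: a1_def power2_eq_square indicator_def algebra_simps)
        have e2: "(a2 y)\<^sup>2 = ?I y * ((?W y * \<kappa> y)\<^sup>2 * gauss y)" for y
        proof -
          have "(a2 y)\<^sup>2 = (?I y * ?I y) * ((?W y * \<kappa> y)\<^sup>2 * (sqrt (gauss y) * sqrt (gauss y)))"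
            by (simp only: a2_def power2_eq_square mult_ac)
          then show ?thesis unfolding sg by (simp add: indicator_def)
        qed
        have e3: "a1 y * a2 y = fv y z * ((U y - v y z) * \<theta> y)" for y
        proof (cases "y \<in> half_space")
          case True
          then have "a1 y * a2 y = fv y z * (?W y * (\<kappa> y * (sqrt (gauss y) * sqrt (gauss y))))"
            by (simp add: a1_def a2_def fv_def mult_ac)
          then show ?thesis unfolding sg \<theta>_def by simp
        next
          case False
          then have "\<theta> y = 0" using C1_compactD(4)[OF \<theta>] K_sub by blast
          then show ?thesis using False by (simp add: a1_def a2_def)
        qed
        have \<kappa>1: "0 \<le> \<kappa> y" "\<kappa> y \<le> 1" for y
          unfolding \<kappa>_def \<phi>_def using smoothstep_bounds by (auto intro: mult_le_one)
        have i2: "integrable lborel (\<lambda>y. (a2 y)\<^sup>2)" unfolding e2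
          by (rule gint_integrable[of _ R]) (use W0 in \<open>auto intro!: continuous_intros sl U(1) continuous_on_subset[OF c\<kappa>(1)]\<close>)
        have i3: "integrable lborel (\<lambda>y. a1 y * a2 y)"
        proof -
          obtain N where N: "0 \<le> N" "\<And>y. norm (a2 y * sqrt (gauss y)) \<le> N" "(\<lambda>y. a2 y * sqrt (gauss y)) \<in> borel_measurable borel" "\<And>y. R < norm y \<Longrightarrow> a2 y = 0"
          proof -
            have e: "a2 y * sqrt (gauss y) = (U y - v y z) * \<theta> y" for y
            proof (cases "y \<in> half_space")
              case True
              then show ?thesis using sg[of y] by (simp add: a2_def \<theta>_def algebra_simps)
            next
              case False
              then have "\<theta> y = 0" using C1_compactD(4)[OF \<theta>] K_sub by blast
              then show ?thesis using False by (simp add: a2_def)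
            qed
            have c: "continuous_on UNIV (\<lambda>y. (U y - v y z) * \<theta> y)"
              by (rule continuous_extend_zero[OF open_half_space cK K_sub])
                 (use C1_compactD(2,4)[OF \<theta>] half_sub in \<open>auto intro!: continuous_intros intro: continuous_on_subset[OF sl] continuous_on_subset UP\<close>)
            obtain N where "0 \<le> N" "\<And>y. norm ((U y - v y z) * \<theta> y) \<le> N"
              using bounded_continuous_support[OF c cK] C1_compactD(4)[OF \<theta>] by (metis mult_zero_right)
            moreover have "a2 y = 0" if "R < norm y" for y
              using W0[of y] that half_sub by (cases "y \<in> half_space") (auto simp: a2_def)
            ultimately show ?thesis
              using that[of N] borel_measurable_continuous_onI[OF c] unfolding e by blast
          qed
          have e: "a1 y * a2 y = ?F y * (a2 y * sqrt (gauss y))" for y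
            by (auto simp: a1_def a2_def indicator_def)
          show ?thesis unfolding e
          proof (rule integrable_bounded_support[of _ "cball 0 R" "\<bar>M\<bar> * N"])
            show "norm (?F y * (a2 y * sqrt (gauss y))) \<le> \<bar>M\<bar> * N" for y
              unfolding norm_mult using N(1) N(2)[of y] bound_f[of "(sqrt z *\<^sub>R y, - z)"] by (intro mult_mono) (auto simp: abs_mult)
          qed (use mf N(3,4) in auto)
        qed
        have i1: "integrable lborel (\<lambda>y. (a1 y)\<^sup>2)"
        proof -
          have ig: "integrable lborel (gauss :: 'm sp \<Rightarrow> real)" by (rule integrable_gauss)
          have [measurable]: "(gauss :: 'm sp \<Rightarrow> real) \<in> borel_measurable borel"
            by (intro borel_measurable_continuous_onI continuous_gauss)
          note mf[measurable]
          show ?thesis unfolding e1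
          proof (rule Bochner_Integration.integrable_bound[OF integrable_mult_right[OF ig, of "M\<^sup>2"]])
            show "AE y in lborel. norm (?I y * ((?F y)\<^sup>2 * gauss y)) \<le> norm (M\<^sup>2 * gauss y)"
            proof (rule AE_I2)
              fix y :: "'m sp"
              have "(?F y)\<^sup>2 \<le> M\<^sup>2" using bound_f[of "(sqrt z *\<^sub>R y, - z)"] by (simp add: abs_le_square_iff[symmetric])
              then show "norm (?I y * ((?F y)\<^sup>2 * gauss y)) \<le> norm (M\<^sup>2 * gauss y)"
                using gauss_nonneg[of y] by (auto simp: indicator_def abs_mult intro!: mult_right_mono)
            qed
          qed simp
        qed
        have "s * B z \<le> \<eta> z * \<bar>LINT y|lborel. a1 y * a2 y\<bar>"
          using s E(8)[of z] unfolding B_def e3 by (auto intro!: mult_left_mono simp: abs_if) (auto simp: mult_le_0_iff)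
        also have "\<dots> \<le> \<eta> z * (sqrt (LINT y|lborel. (a1 y)\<^sup>2) * sqrt (LINT y|lborel. (a2 y)\<^sup>2))"
          using integral_square_Cauchy_Schwarz[OF i1 i2 i3] E(8)[of z] by (rule mult_left_mono)
        also have "\<dots> \<le> \<eta> z * (c z * sqrt (gint (\<lambda>y. (U y - v y z)\<^sup>2)))"
        proof (intro mult_left_mono mult_mono E(8))
          have "(LINT y|lborel. (a1 y)\<^sup>2) \<le> (c z)\<^sup>2"
            using elim z' unfolding e1 gint_def by simp
          then show "sqrt (LINT y|lborel. (a1 y)\<^sup>2) \<le> c z" using c_nonneg[OF z'(1,2)] by (intro real_le_lsqrt) auto
          have "(LINT y|lborel. (a2 y)\<^sup>2) \<le> gint (\<lambda>y. (U y - v y z)\<^sup>2)"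
            unfolding gint_def
          proof (rule integral_mono[OF i2])
            show "integrable lborel (\<lambda>y. ?I y * ((U y - v y z)\<^sup>2 * gauss y))"
              by (rule gint_integrable[of _ R]) (use W0 in \<open>auto intro!: continuous_intros sl U(1)\<close>)
            show "(a2 y)\<^sup>2 \<le> ?I y * ((U y - v y z)\<^sup>2 * gauss y)" for y
            proof -
              have "(?W y * \<kappa> y)\<^sup>2 \<le> (?W y)\<^sup>2"
                using \<kappa>1[of y] by (simp add: power_mult_distrib mult_left_le power_le_one)
              then show ?thesis unfolding e2 using gauss_nonneg[of y] by (auto simp: indicator_def intro!: mult_right_mono)
            qed
          qed
          then show "sqrt (LINT y|lborel. (a2 y)\<^sup>2) \<le> sqrt (gint (\<lambda>y. (U y - v y z)\<^sup>2))" by simp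
        qed (use c_nonneg[OF z'(1,2)] in auto)
        finally show ?thesis .
      qed
    qed
    have "0 = s * ((LINT z|lborel. indicator {0<..} z * A z) + (LINT z|lborel. indicator {0<..} z * B z))" using ci(1) by simp
    also have "\<dots> = (LINT z|lborel. s * (indicator {0<..} z * A z) + s * (indicator {0<..} z * B z))"
      using ci(2,3) by (simp add: distrib_left)
    also have "\<dots> \<le> (LINT z|lborel. T z + Er * indicator {a..b} z)"
    proof (rule integral_mono_AE)
      show "AE z in lborel. s * (indicator {0<..} z * A z) + s * (indicator {0<..} z * B z) \<le> T z + Er * indicator {a..b} z"
        using Bbound
      proof eventually_elim
        case (elim z)
        show ?case
        proof (cases "z \<in> {a..b}")
          case True
          then show ?thesis using elim Abound[OF True] E(1) by (simp add: T_def distrib_left)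
        qed (use A0 T0 in simp)
      qed
      show "integrable lborel (\<lambda>z. s * (indicator {0<..} z * A z) + s * (indicator {0<..} z * B z))"
        by (rule Bochner_Integration.integrable_add; rule integrable_mult_right; rule ci(2) ci(3))
      show "integrable lborel (\<lambda>z. T z + Er * indicator {a..b} z)"
        by (rule Bochner_Integration.integrable_add[OF iT iI])
    qed
    also have "\<dots> = (LINT z|lborel. T z) + Er * measure lborel {a..b}"
      by (subst Bochner_Integration.integral_add[OF iT iI]) simp
    finally show ?thesis by (simp add: Er_def)
  qed
  have "- e \<le> (LINT z|lborel. T z)" if e: "0 < e" for e
  proof -
    define L where "L = measure lborel {a..b}"
    have L: "0 \<le> L" by (simp add: L_def)
    have "((\<lambda>\<omega>. (C * (Hb * N * \<omega> + Hb / a * (2 * \<omega> + N * \<omega>))) * L) \<longlongrightarrow> (C * (Hb * N * 0 + Hb / a * (2 * 0 + N * 0))) * L) (at_right 0)"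
      by (intro tendsto_intros)
    then have "\<forall>\<^sub>F \<omega> in at_right 0. (C * (Hb * N * \<omega> + Hb / a * (2 * \<omega> + N * \<omega>))) * L < e"
      using e by (intro order_tendstoD(2)) auto
    then obtain \<omega>0 where \<omega>0: "0 < \<omega>0" "\<And>\<omega>. 0 < \<omega> \<Longrightarrow> \<omega> < \<omega>0 \<Longrightarrow> (C * (Hb * N * \<omega> + Hb / a * (2 * \<omega> + N * \<omega>))) * L < e"
      unfolding eventually_at_right_field by blast
    define \<omega> where "\<omega> = \<omega>0 / 2"
    have "0 < \<omega>" "\<omega> < \<omega>0" using \<omega>0(1) by (auto simp: \<omega>_def)
    then have \<omega>: "0 < \<omega>" "(C * (Hb * N * \<omega> + Hb / a * (2 * \<omega> + N * \<omega>))) * L < e" using \<omega>0(2) by blast+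
    have "uniformly_continuous_on ?D (\<lambda>(y, z). q y z)"
      using cq D_sub by (intro compact_uniformly_continuous cptD) (auto intro: continuous_on_subset)
    then obtain d where d: "0 < d" "\<And>p p'. p \<in> ?D \<Longrightarrow> p' \<in> ?D \<Longrightarrow> dist p' p < d \<Longrightarrow> dist (case p' of (y, z) \<Rightarrow> q y z) (case p of (y, z) \<Rightarrow> q y z) < \<omega>"
      unfolding uniformly_continuous_on_def using \<omega>(1) by metis
    \<comment> \<open>A point of height at most 2 \<epsilon> < d is compared with its foot on the
      boundary, where \<open>q\<close> is at most 0 by \<open>sign\<close>; uniform continuity then
      gives \<open>q\<close> at most \<omega> on the slab.\<close>
    define \<epsilon> where "\<epsilon> = min \<omega> (d / 4)"
    have \<epsilon>: "0 < \<epsilon>" "\<epsilon> \<le> \<omega>" "2 * \<epsilon> < d" using \<omega>(1) d(1) by (auto simp: \<epsilon>_def)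
    have "q y z \<le> \<omega>" if "(y, z) \<in> ?D" "snd y \<le> 2 * \<epsilon>" for y z
    proof -
      have y: "0 \<le> snd y" "norm y \<le> R" using that(1) by (auto simp: half_space_closed_def)
      have n: "norm (fst y, 0 :: real) \<le> norm y" using norm_fst_le[of "fst y" "snd y"] by (simp add: norm_Pair)
      have "((fst y, 0), z) \<in> ?D" using that(1) y n by (auto simp: half_space_closed_def)
      moreover have "dist (y, z) ((fst y, 0), z) < d"
      proof -
        have "dist (y, z) ((fst y, 0), z) = \<bar>snd y\<bar>"
          by (cases y) (simp add: dist_prod_def dist_real_def)
        then show ?thesis using that(2) y(1) \<epsilon>(3) by simp
      qed
      ultimately have "dist (q y z) (q (fst y, 0) z) < \<omega>" using d(2)[of "((fst y, 0), z)" "(y, z)"] that(1) by simp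
      moreover have "q (fst y, 0) z \<le> 0" using sign[of "(fst y, 0)" z] that(1) E(1,2) by (auto simp: q_def)
      ultimately show ?thesis by (simp add: dist_real_def)
    qed
    from main[OF \<epsilon>(1) \<omega>(1) this]
    have "0 \<le> (LINT z|lborel. T z) + (C * (Hb * N * \<epsilon> + Hb / a * (2 * \<omega> + N * \<epsilon>))) * L" by (simp add: L_def)
    also have "\<dots> \<le> (LINT z|lborel. T z) + (C * (Hb * N * \<omega> + Hb / a * (2 * \<omega> + N * \<omega>))) * L"
      using C(1) Hb(1) N(1) E(1) \<epsilon>(2) L by (intro add_left_mono mult_right_mono mult_left_mono add_mono) auto
    finally show ?thesis using \<omega>(2) by simp
  qed
  note T_ge = this
  have "0 \<le> (LINT z|lborel. T z)"
  proof (rule ccontr)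
    assume "\<not> 0 \<le> (LINT z|lborel. T z)"
    then show False using T_ge[of "- (LINT z|lborel. T z) / 2"] by simp
  qed
  moreover have "indicator {0<..} z * T z = T z" for z using T0[of z] E(1) by (cases "0 < z") auto
  ultimately have "0 \<le> (LINT z|lborel. indicator {0<..} z * T z)" by (simp only:)
  then show ?thesis unfolding T_def w_def j_def .
qed

end

section \<open>Height, energy and distance of the slices\<close>

lemma gint_cmult: "gint (\<lambda>y. a * F y) = a * gint F"
proof -
  have "gint (\<lambda>y. a * F y) = (LINT y|lborel. a * (indicator half_space y * (F y * gauss y)))"
    unfolding gint_def by (intro Bochner_Integration.integral_cong) auto
  then show ?thesis by (simp add: gint_def)
qed

context signorini_flow
begin

definition h :: "real \<Rightarrow> real" where "h z = gint (\<lambda>y. (v y z)\<^sup>2)"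
definition en :: "real \<Rightarrow> real" where "en z = gint (\<lambda>y. gv y z \<bullet> gv y z)"
definition D :: "real \<Rightarrow> real \<Rightarrow> real" where "D b z = gint (\<lambda>y. (v y b - v y z)\<^sup>2)"

lemma h_nonneg: "0 \<le> h z" and en_nonneg: "0 \<le> en z" and D_nonneg: "0 \<le> D b z"
  unfolding h_def en_def D_def by (rule gint_nonneg; simp)+

lemma continuous_h: "continuous_on {0<..<1} h"
  unfolding h_def
proof (rule gint_continuous)
  show "continuous_on (half_space_closed \<times> {0<..<1}) (\<lambda>(y, z). (v y z)\<^sup>2)"
    using cont_v' unfolding case_prod_unfold by (intro continuous_intros)
  show "\<exists>R. \<forall>y z. y \<in> half_space_closed \<longrightarrow> a \<le> z \<longrightarrow> z < 1 \<longrightarrow> R < norm y \<longrightarrow> (v y z)\<^sup>2 = 0" if a: "0 < a" for a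
    by (rule supp_v[OF a]) (metis zero_power2)
qed

lemma continuous_en: "continuous_on {0<..<1} en"
  unfolding en_def
proof (rule gint_continuous)
  show "continuous_on (half_space_closed \<times> {0<..<1}) (\<lambda>(y, z). gv y z \<bullet> gv y z)"
    using cont_gv' unfolding case_prod_unfold by (intro continuous_intros)
  show "\<exists>R. \<forall>y z. y \<in> half_space_closed \<longrightarrow> a \<le> z \<longrightarrow> z < 1 \<longrightarrow> R < norm y \<longrightarrow> gv y z \<bullet> gv y z = 0" if a: "0 < a" for a
    by (rule supp_v[OF a]) (metis inner_zero_left)
qed

lemma continuous_slice_const: "0 < b \<Longrightarrow> b < 1 \<Longrightarrow> continuous_on (half_space_closed \<times> {0<..<1}) (\<lambda>p. v (fst p) b)"
  "0 < b \<Longrightarrow> b < 1 \<Longrightarrow> continuous_on (half_space_closed \<times> {0<..<1}) (\<lambda>p. gv (fst p) b)"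
  by (rule continuous_on_compose2[OF cont_v_slice] continuous_on_compose2[OF cont_gv_slice]; auto intro!: continuous_intros)+

lemma supp_v2:
  assumes "0 < a" "0 < b" "b < 1"
  obtains R where "\<And>y z. y \<in> half_space_closed \<Longrightarrow> a \<le> z \<Longrightarrow> z < 1 \<Longrightarrow> R < norm y \<Longrightarrow> v y z = 0 \<and> gv y z = 0 \<and> v y b = 0 \<and> gv y b = 0"
proof -
  obtain R where "\<And>y z. y \<in> half_space_closed \<Longrightarrow> min a b \<le> z \<Longrightarrow> z < 1 \<Longrightarrow> R < norm y \<Longrightarrow> v y z = 0 \<and> gv y z = 0"
    by (rule supp_v[of "min a b"]) (use assms in auto)
  then show ?thesis using assms by (intro that[of R]) auto
qed

lemma continuous_D: 
  assumes b: "0 < b" "b < 1"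
  shows "continuous_on {0<..<1} (D b)"
  unfolding D_def
proof (rule gint_continuous)
  show "continuous_on (half_space_closed \<times> {0<..<1}) (\<lambda>(y, z). (v y b - v y z)\<^sup>2)"
    unfolding case_prod_unfold by (intro continuous_intros cont_v'[unfolded case_prod_unfold] continuous_slice_const b)
  show "\<exists>R. \<forall>y z. y \<in> half_space_closed \<longrightarrow> a \<le> z \<longrightarrow> z < 1 \<longrightarrow> R < norm y \<longrightarrow> (v y b - v y z)\<^sup>2 = 0" if a: "0 < a" for a
    by (rule supp_v2[OF a b]) (metis zero_power2 diff_self)
qed

lemma boundary_signs:
  assumes "snd y = 0" "0 < z" "z < 1"
  shows "0 \<le> v y z" "snd (gv y z) \<le> 0" "snd (gv y z) * v y z = 0"
  using bdry[of "sqrt z *\<^sub>R y" "- z"] assms by (auto simp: v_def gv_def mult_nonneg_nonpos)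

text \<open>Comparison with U = 0. Complementarity makes the boundary flux vanish, so both signs of
  \<open>s\<close> are admissible, and together they say that h' / 2 equals en / z up to c * sqrt
  h.\<close>

lemma growth:
  assumes s: "s = 1 \<or> s = -1" and \<alpha>\<beta>: "0 < \<alpha>" "\<alpha> < \<beta>" "\<beta> < 1"
  shows "- (s * (h \<beta> - h \<alpha>)) / 2 \<le> integral {\<alpha>..\<beta>} (\<lambda>z. - (s * en z) / z + c z * sqrt (h z))"
proof -
  have k: "s * gint (\<lambda>y. v y z * 0 - (v y z)\<^sup>2 / 2) = - (s * h z) / 2" for z
    using gint_cmult[of "- 1 / 2" "\<lambda>y. (v y z)\<^sup>2"] by (simp add: h_def)
  have e: "s * gint (\<lambda>y. gv y z \<bullet> (0 - gv y z)) / z = - (s * en z) / z" for z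
    using gint_cmult[of "- 1" "\<lambda>y. gv y z \<bullet> gv y z"] by (simp add: en_def)
  have d: "gint (\<lambda>y. (0 - v y z)\<^sup>2) = h z" for z by (simp add: h_def)
  have "(\<lambda>z. - (s * h z) / 2) \<beta> - (\<lambda>z. - (s * h z) / 2) \<alpha> \<le> integral {\<alpha>..\<beta>} (\<lambda>z. - (s * en z) / z + c z * sqrt (h z))"
  proof (rule weak_derivative_bound[OF _ _ _ \<alpha>\<beta>])
    show "continuous_on {0<..<1} (\<lambda>z. - (s * h z) / 2)" by (intro continuous_intros continuous_h) auto
    show "continuous_on {0<..<1} (\<lambda>z. - (s * en z) / z + c z * sqrt (h z))"
      by (intro continuous_intros continuous_h continuous_en cont_c) auto
    show "0 \<le> (LINT z|lborel. indicator {0<..} z * (\<eta>' z * (- (s * h z) / 2) + \<eta> z * (- (s * en z) / z + c z * sqrt (h z))))"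
      if \<eta>: "time_cutoff a b \<eta> \<eta>'" for a b \<eta> \<eta>'
      using comparison_inequality[OF \<eta>, of "\<lambda>_. 0" "\<lambda>_. 0" 0 s] s boundary_signs(3)
      unfolding k e d by simp
  qed
  then show ?thesis by (simp add: algebra_simps diff_divide_distrib)
qed

text \<open>The difference of the squared norms is twice the product of the slice at
  \<open>b\<close> with the difference of the slices, minus D; the last term is dropped and
  Cauchy-Schwarz used for the first.\<close>

lemma h_diff_le:
  assumes b: "0 < b" "b < 1" and z: "0 < z" "z < 1"
  shows "h b - h z \<le> 2 * sqrt (h b) * sqrt (D b z)"
proof -
  obtain R where R: "\<And>y. y \<in> half_space_closed \<Longrightarrow> R < norm y \<Longrightarrow> v y z = 0 \<and> v y b = 0"
    using supp_v2[OF z(1) b] z by (metis order_refl)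
  note c = cont_v_slice[OF b] cont_v_slice[OF z]
  let ?X = "\<lambda>y. 2 * (v y b * (v y b - v y z)) - (v y b - v y z)\<^sup>2"
  have "h b = gint (\<lambda>y. 1 * (v y z)\<^sup>2 + 1 * ?X y)"
    unfolding h_def by (rule arg_cong[of _ _ gint]) (auto simp: power2_eq_square algebra_simps)
  also have "\<dots> = 1 * gint (\<lambda>y. (v y z)\<^sup>2) + 1 * gint ?X"
    by (rule gint_add[where R = R]; (intro continuous_intros c)?; simp add: R)
  finally have 1: "h b = 1 * h z + 1 * gint ?X" unfolding h_def .
  have 2: "gint ?X \<le> gint (\<lambda>y. 2 * (v y b * (v y b - v y z)))"
    by (rule gint_mono[where R = R]; (intro continuous_intros c)?; simp add: R)
  have 3: "\<bar>gint (\<lambda>y. v y b * (v y b - v y z))\<bar> \<le> sqrt (gint (\<lambda>y. (v y b)\<^sup>2)) * sqrt (gint (\<lambda>y. (v y b - v y z)\<^sup>2))"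
    by (rule gint_Cauchy_Schwarz[where R = R]; (intro continuous_intros c)?; simp add: R)
  show ?thesis
    using 1 2 3 unfolding gint_cmult h_def[symmetric] D_def[symmetric] by linarith
qed

lemma distance_growth:
  assumes \<alpha>\<beta>: "0 < \<alpha>" "\<alpha> < \<beta>" "\<beta> < 1"
  shows "D \<beta> \<alpha> / 2 \<le> integral {\<alpha>..\<beta>} (\<lambda>z. (en \<beta> - en z) / (2 * z) + c z * sqrt (D \<beta> z))"
proof -
  have b: "0 < \<beta>" "\<beta> < 1" using \<alpha>\<beta> by auto
  define k where "k z = gint (\<lambda>y. v y z * v y \<beta> - (v y z)\<^sup>2 / 2)" for z
  define j where "j z = gint (\<lambda>y. gv y z \<bullet> (gv y \<beta> - gv y z))" for z
  have k: "k z = h \<beta> / 2 - D \<beta> z / 2" if z: "0 < z" "z < 1" for z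
  proof -
    obtain R where R: "\<And>y. y \<in> half_space_closed \<Longrightarrow> R < norm y \<Longrightarrow> v y z = 0 \<and> v y \<beta> = 0"
      using supp_v2[OF z(1) b] z by (metis order_refl)
    note c = cont_v_slice[OF b] cont_v_slice[OF z]
    have "k z = gint (\<lambda>y. (1 / 2) * (v y \<beta>)\<^sup>2 + (- 1 / 2) * (v y \<beta> - v y z)\<^sup>2)"
      unfolding k_def by (rule arg_cong[of _ _ gint]) (auto simp: power2_eq_square field_simps)
    also have "\<dots> = (1 / 2) * h \<beta> + (- 1 / 2) * D \<beta> z"
      unfolding h_def D_def by (rule gint_add[where R = R]; (intro continuous_intros c)?; simp add: R)
    finally show ?thesis by simp
  qed
  have j: "j z \<le> (en \<beta> - en z) / 2" if z: "0 < z" "z < 1" for z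
  proof -
    obtain R where R: "\<And>y. y \<in> half_space_closed \<Longrightarrow> R < norm y \<Longrightarrow> gv y z = 0 \<and> gv y \<beta> = 0"
      using supp_v2[OF z(1) b] z by (metis order_refl)
    note c = cont_gv_slice[OF b] cont_gv_slice[OF z]
    have "j z \<le> gint (\<lambda>y. (1 / 2) * (gv y \<beta> \<bullet> gv y \<beta>) + (- 1 / 2) * (gv y z \<bullet> gv y z))"
      unfolding j_def
    proof (rule gint_mono[where R = R])
      show "gv y z \<bullet> (gv y \<beta> - gv y z) \<le> 1 / 2 * (gv y \<beta> \<bullet> gv y \<beta>) + - 1 / 2 * (gv y z \<bullet> gv y z)" for y
        using inner_ge_zero[of "gv y \<beta> - gv y z"]
        by (simp add: inner_diff_left inner_diff_right inner_commute)
    qed ((intro continuous_intros c)?; simp add: R)+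
    also have "\<dots> = (1 / 2) * en \<beta> + (- 1 / 2) * en z"
      unfolding en_def by (rule gint_add[where R = R]; (intro continuous_intros c)?; simp add: R)
    finally show ?thesis by simp
  qed
  have ck: "continuous_on {0<..<1} k"
  proof -
    have "continuous_on {0<..<1} (\<lambda>z. h \<beta> / 2 - D \<beta> z / 2)" by (intro continuous_intros continuous_D b) auto
    then show ?thesis by (rule continuous_on_eq) (simp add: k)
  qed
  have cj: "continuous_on {0<..<1} j"
    unfolding j_def
  proof (rule gint_continuous)
    show "continuous_on (half_space_closed \<times> {0<..<1}) (\<lambda>(y, z). gv y z \<bullet> (gv y \<beta> - gv y z))"
      unfolding case_prod_unfold by (intro continuous_intros cont_gv'[unfolded case_prod_unfold] continuous_slice_const b)
    show "\<exists>R. \<forall>y z. y \<in> half_space_closed \<longrightarrow> a \<le> z \<longrightarrow> z < 1 \<longrightarrow> R < norm y \<longrightarrow> gv y z \<bullet> (gv y \<beta> - gv y z) = 0" if a: "0 < a" for a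
      by (rule supp_v2[OF a b]) (metis inner_zero_left)
  qed
  obtain R where R: "\<And>y. y \<in> half_space_closed \<Longrightarrow> R < norm y \<Longrightarrow> v y \<beta> = 0 \<and> gv y \<beta> = 0"
    using supp_v2[OF b(1) b] b by (metis order_refl)
  have "k \<beta> - k \<alpha> \<le> integral {\<alpha>..\<beta>} (\<lambda>z. j z / z + c z * sqrt (D \<beta> z))"
  proof (rule weak_derivative_bound[OF ck _ _ \<alpha>\<beta>])
    show "continuous_on {0<..<1} (\<lambda>z. j z / z + c z * sqrt (D \<beta> z))"
      by (intro continuous_intros cj cont_c continuous_D b) auto
    fix a b' \<eta> \<eta>' assume \<eta>: "time_cutoff a b' \<eta> \<eta>'"
    have sgn: "1 * (snd (gv y z) * (v y \<beta> - v y z)) \<le> 0" if "snd y = 0" "0 < z" "z < 1" for y z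
    proof -
      have "snd (gv y z) * v y \<beta> \<le> 0"
        using boundary_signs(2)[OF that] boundary_signs(1)[OF that(1) b] by (rule mult_nonpos_nonneg)
      then show ?thesis using boundary_signs(3)[OF that] by (simp only: right_diff_distrib mult_1_left)
    qed
    have "0 \<le> (LINT z|lborel. indicator {0<..} z * (\<eta>' z * (1 * gint (\<lambda>y. v y z * v y \<beta> - (v y z)\<^sup>2 / 2))
      + \<eta> z * (1 * gint (\<lambda>y. gv y z \<bullet> (gv y \<beta> - gv y z)) / z + c z * sqrt (gint (\<lambda>y. (v y \<beta> - v y z)\<^sup>2)))))"
      by (rule comparison_inequality[OF \<eta> cont_v_slice[OF b] cont_gv_slice[OF b] has_derivative_v[OF b] R _ sgn]) auto
    then show "0 \<le> (LINT z|lborel. indicator {0<..} z * (\<eta>' z * k z + \<eta> z * (j z / z + c z * sqrt (D \<beta> z))))"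
      by (simp add: k_def j_def D_def)
  qed
  also have "\<dots> \<le> integral {\<alpha>..\<beta>} (\<lambda>z. (en \<beta> - en z) / (2 * z) + c z * sqrt (D \<beta> z))"
  proof (rule integral_le)
    have sub: "{\<alpha>..\<beta>} \<subseteq> {0<..<1}" using \<alpha>\<beta> by auto
    show "(\<lambda>z. j z / z + c z * sqrt (D \<beta> z)) integrable_on {\<alpha>..\<beta>}"
      "(\<lambda>z. (en \<beta> - en z) / (2 * z) + c z * sqrt (D \<beta> z)) integrable_on {\<alpha>..\<beta>}"
      using \<alpha>\<beta> by (intro integrable_continuous_interval continuous_intros continuous_on_subset[OF cj sub]
          continuous_on_subset[OF cont_c sub] continuous_on_subset[OF continuous_en sub] continuous_on_subset[OF continuous_D[OF b] sub]; simp)+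
    show "j z / z + c z * sqrt (D \<beta> z) \<le> (en \<beta> - en z) / (2 * z) + c z * sqrt (D \<beta> z)" if "z \<in> {\<alpha>..\<beta>}" for z
      using that \<alpha>\<beta> j[of z] divide_right_mono[OF j[of z], of z] by simp
  qed
  finally show ?thesis using k[OF b] k[of \<alpha>] \<alpha>\<beta> by (simp add: D_def gint_def)
qed

end

text \<open>For fixed \<epsilon> the points from which \<open>F\<close> drops towards
  \<open>b\<close> by at most \<epsilon> times the distance form a closed set; \<open>step\<close>
  lets its infimum move further left unless it is \<open>a\<close>. One suitable \<open>y\<close>
  for each \<open>x\<close> is enough for this, which matches the one-sided information on the
  energy.\<close>

lemma Dini_mono:
  fixes F :: "real \<Rightarrow> real"
  assumes ab: "a \<le> b" and cont: "continuous_on {a..b} F"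
    and step: "\<And>x \<epsilon>. a < x \<Longrightarrow> x \<le> b \<Longrightarrow> 0 < \<epsilon> \<Longrightarrow> \<exists>y. a \<le> y \<and> y < x \<and> - \<epsilon> * (x - y) \<le> F x - F y"
  shows "F a \<le> F b"
proof -
  have "F a \<le> F b + \<epsilon> * (b - a)" if \<epsilon>: "0 < \<epsilon>" for \<epsilon>
  proof -
    define S where "S = {x \<in> {a..b}. - \<epsilon> * (b - x) \<le> F b - F x}"
    have "closed S" unfolding S_def
      by (intro continuous_on_closed_Collect_le continuous_intros cont closed_atLeastAtMost)
    moreover have "b \<in> S" using ab by (simp add: S_def)
    moreover have "bdd_below S" by (auto simp: S_def)
    ultimately have m: "Inf S \<in> S" by (intro closed_contains_Inf) auto
    have "Inf S = a"
    proof (rule ccontr)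
      assume "Inf S \<noteq> a"
      then have "a < Inf S" "Inf S \<le> b" using m by (auto simp: S_def)
      then obtain y where y: "a \<le> y" "y < Inf S" "- \<epsilon> * (Inf S - y) \<le> F (Inf S) - F y" using step \<epsilon> by blast
      then have "y \<in> S" using m by (simp add: S_def algebra_simps)
      then show False using y(2) cInf_lower[OF _ \<open>bdd_below S\<close>, of y] by simp
    qed
    then show ?thesis using m by (simp add: S_def algebra_simps)
  qed
  note le = this
  show ?thesis
  proof (rule field_le_epsilon)
    fix e :: real assume "0 < e"
    have "e / (b - a + 1) * (b - a) \<le> e" using ab \<open>0 < e\<close> by (simp add: field_simps)
    moreover have "0 < e / (b - a + 1)" using ab \<open>0 < e\<close> by simp
    ultimately show "F a \<le> F b + e" using le[of "e / (b - a + 1)"] by linarith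
  qed
qed

section \<open>Monotonicity of the averaged frequency\<close>

text \<open>Bounded near 0 but with no control at 1: this is what makes the integral from 0 to z
  exist for every z < 1.\<close>

definition tame :: "(real \<Rightarrow> real) \<Rightarrow> bool" where
  "tame F \<longleftrightarrow> continuous_on {0<..<1} F \<and> (\<forall>b<1. \<exists>B. \<forall>z. 0 < z \<longrightarrow> z \<le> b \<longrightarrow> \<bar>F z\<bar> \<le> B)"

definition prim :: "(real \<Rightarrow> real) \<Rightarrow> real \<Rightarrow> real" where
  "prim F z = (LINT x|lborel. indicator {0<..<z} x * F x)"

lemma tame_bound:
  assumes "tame F" "b < 1"
  obtains B where "0 \<le> B" "\<And>z. 0 < z \<Longrightarrow> z \<le> b \<Longrightarrow> \<bar>F z\<bar> \<le> B"
proof -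
  obtain B where "\<And>z. 0 < z \<Longrightarrow> z \<le> b \<Longrightarrow> \<bar>F z\<bar> \<le> B" using assms unfolding tame_def by blast
  then have "\<And>z. 0 < z \<Longrightarrow> z \<le> b \<Longrightarrow> \<bar>F z\<bar> \<le> max B 0" by (meson le_max_iff_disj)
  then show ?thesis by (intro that[of "max B 0"]) auto
qed

lemma tame_add: "tame F \<Longrightarrow> tame F' \<Longrightarrow> tame (\<lambda>z. F z + F' z)"
proof -
  assume t: "tame F" "tame F'"
  have "\<exists>B. \<forall>z. 0 < z \<longrightarrow> z \<le> b \<longrightarrow> \<bar>F z + F' z\<bar> \<le> B" if b: "b < 1" for b
  proof -
    obtain B B' where "\<And>z. 0 < z \<Longrightarrow> z \<le> b \<Longrightarrow> \<bar>F z\<bar> \<le> B" "\<And>z. 0 < z \<Longrightarrow> z \<le> b \<Longrightarrow> \<bar>F' z\<bar> \<le> B'"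
      using tame_bound[OF t(1) b] tame_bound[OF t(2) b] by metis
    then show ?thesis by (intro exI[of _ "B + B'"]) (smt (verit))
  qed
  then show ?thesis using t unfolding tame_def by (auto intro: continuous_intros)
qed

lemma tame_mult: "tame F \<Longrightarrow> tame F' \<Longrightarrow> tame (\<lambda>z. F z * F' z)"
proof -
  assume t: "tame F" "tame F'"
  have "\<exists>B. \<forall>z. 0 < z \<longrightarrow> z \<le> b \<longrightarrow> \<bar>F z * F' z\<bar> \<le> B" if b: "b < 1" for b
  proof -
    obtain B B' where "0 \<le> B" "\<And>z. 0 < z \<Longrightarrow> z \<le> b \<Longrightarrow> \<bar>F z\<bar> \<le> B" "0 \<le> B'" "\<And>z. 0 < z \<Longrightarrow> z \<le> b \<Longrightarrow> \<bar>F' z\<bar> \<le> B'"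
      using tame_bound[OF t(1) b] tame_bound[OF t(2) b] by metis
    then show ?thesis by (intro exI[of _ "B * B'"]) (auto simp: abs_mult intro!: mult_mono)
  qed
  then show ?thesis using t unfolding tame_def by (auto intro: continuous_intros)
qed

lemma tame_const: "tame (\<lambda>_. k)"
  unfolding tame_def by (auto intro!: continuous_intros)

lemma tame_sqrt: "tame F \<Longrightarrow> (\<And>z. 0 \<le> F z) \<Longrightarrow> tame (\<lambda>z. sqrt (F z))"
proof -
  assume t: "tame F" "\<And>z. 0 \<le> F z"
  have "\<exists>B. \<forall>z. 0 < z \<longrightarrow> z \<le> b \<longrightarrow> \<bar>sqrt (F z)\<bar> \<le> B" if b: "b < 1" for b
  proof -
    obtain B where "0 \<le> B" "\<And>z. 0 < z \<Longrightarrow> z \<le> b \<Longrightarrow> \<bar>F z\<bar> \<le> B" using tame_bound[OF t(1) b] by metis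
    then show ?thesis using t(2) by (intro exI[of _ "sqrt B"]) auto
  qed
  then show ?thesis using t unfolding tame_def by (auto intro: continuous_intros)
qed

lemma prim_integrable:
  assumes t: "tame F" and z: "z < 1"
  shows "integrable lborel (\<lambda>x. indicator {0<..<z} x * F x)"
proof -
  obtain B where B: "0 \<le> B" "\<And>x. 0 < x \<Longrightarrow> x \<le> z \<Longrightarrow> \<bar>F x\<bar> \<le> B" using tame_bound[OF t z] by metis
  have m: "(\<lambda>x. indicator {0<..<z} x *\<^sub>R F x) \<in> borel_measurable borel"
    using t z by (intro borel_measurable_continuous_on_indicator) (auto simp: tame_def intro: continuous_on_subset)
  show ?thesis
  proof (rule integrableI_bounded_set[of "{0..z}" _ _ B])
    show "(\<lambda>x. indicator {0<..<z} x * F x) \<in> borel_measurable lborel" using m by simp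
    show "emeasure lborel {0..z} < \<infinity>" by (simp add: emeasure_lborel_Icc_eq)
    show "AE x\<in>{0..z} in lborel. norm (indicator {0<..<z} x * F x) \<le> B"
      using B by (auto intro!: AE_I2 simp: indicator_def)
    show "AE x in lborel. x \<notin> {0..z} \<longrightarrow> indicator {0<..<z} x * F x = 0"
      by (auto intro!: AE_I2 simp: indicator_def)
  qed auto
qed

lemma prim_diff:
  assumes t: "tame F" and ab: "0 < a" "a < b" "b < 1"
  shows "prim F b - prim F a = integral {a..b} F"
proof -
  have c: "continuous_on {a..b} F" using t ab by (auto simp: tame_def intro: continuous_on_subset)
  have s: "set_integrable lborel {a..b} F" using c by (rule borel_integrable_atLeastAtMost')
  have "prim F b - prim F a = (LINT x|lborel. indicator {0<..<b} x * F x - indicator {0<..<a} x * F x)"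
    unfolding prim_def using prim_integrable[OF t] ab by simp
  also have "\<dots> = (LINT x|lborel. indicator {a..b} x *\<^sub>R F x)"
  proof (rule integral_cong_AE)
    have "AE x in lborel. x \<noteq> b" by (rule AE_lborel_singleton)
    then show "AE x in lborel. indicator {0<..<b} x * F x - indicator {0<..<a} x * F x = indicator {a..b} x *\<^sub>R F x"
      by eventually_elim (use ab in \<open>auto simp: indicator_def\<close>)
    show "(\<lambda>x. indicator {0<..<b} x * F x - indicator {0<..<a} x * F x) \<in> borel_measurable lborel"
      using prim_integrable[OF t, of b] prim_integrable[OF t, of a] ab
      by (intro borel_measurable_diff) auto
  qed (use s in \<open>auto simp: set_integrable_def\<close>)
  also have "\<dots> = integral {a..b} F"
    using set_borel_integral_eq_integral(2)[OF s] by (simp add: set_lebesgue_integral_def)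
  finally show ?thesis .
qed

lemma prim_bound:
  assumes t: "tame F" and z: "0 < z" "z \<le> b" "b < 1" and B: "\<And>x. 0 < x \<Longrightarrow> x \<le> b \<Longrightarrow> \<bar>F x\<bar> \<le> B"
  shows "\<bar>prim F z\<bar> \<le> B * z"
proof -
  have i: "integrable lborel (\<lambda>x. B * indicator {0<..<z} x :: real)"
    by (rule integrable_mult_right, rule integrable_real_indicator) (use z in simp_all)
  have "\<bar>prim F z\<bar> \<le> (LINT x|lborel. B * indicator {0<..<z} x)"
    unfolding prim_def
    by (rule integral_abs_bound_integral[OF prim_integrable[OF t] i]) (use z B in \<open>auto simp: indicator_def\<close>)
  also have "\<dots> = B * z" using z by simp
  finally show ?thesis .
qed

lemma prim_mono:
  assumes "tame F" "tame F'" "z < 1" "\<And>x. 0 < x \<Longrightarrow> x < z \<Longrightarrow> F x \<le> F' x"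
  shows "prim F z \<le> prim F' z"
  unfolding prim_def
  by (intro integral_mono prim_integrable assms) (use assms(4) in \<open>auto simp: indicator_def\<close>)

lemma prim_add:
  assumes "tame F" "tame F'" "z < 1"
  shows "prim (\<lambda>x. a * F x + b * F' x) z = a * prim F z + b * prim F' z"
proof -
  have "prim (\<lambda>x. a * F x + b * F' x) z = (LINT x|lborel. a * (indicator {0<..<z} x * F x) + b * (indicator {0<..<z} x * F' x))"
    unfolding prim_def by (intro Bochner_Integration.integral_cong) (auto simp: algebra_simps)
  then show ?thesis unfolding prim_def using prim_integrable[OF assms(1,3)] prim_integrable[OF assms(2,3)] by simp
qed

lemma prim_const: "0 < z \<Longrightarrow> prim (\<lambda>_. k) z = k * z"
  unfolding prim_def by simp

lemma prim_deriv:
  assumes t: "tame F" and z: "0 < z" "z < 1"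
  shows "(prim F has_real_derivative F z) (at z)"
proof -
  define a where "a = z / 2" define b where "b = (1 + z) / 2"
  have ab: "0 < a" "a < z" "z < b" "b < 1" using z by (auto simp: a_def b_def)
  have c: "continuous_on {a..b} F" using t ab by (auto simp: tame_def intro: continuous_on_subset)
  have "((\<lambda>x. prim F a + integral {a..x} F) has_real_derivative F z) (at z within {a..b})"
    using integral_has_real_derivative[OF c, of z] ab by (auto intro!: derivative_eq_intros)
  then have "((\<lambda>x. prim F a + integral {a..x} F) has_real_derivative F z) (at z)"
    by (simp only: at_within_Icc_at[OF ab(2,3)])
  then show ?thesis
  proof (rule has_field_derivative_transform_within_open[OF _ open_greaterThanLessThan[of a b]])
    fix x assume "x \<in> {a<..<b}"
    then show "prim F a + integral {a..x} F = prim F x" using prim_diff[OF t, of a x] ab by simp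
  qed (use ab in auto)
qed

lemma prim_continuous: "tame F \<Longrightarrow> 0 < a \<Longrightarrow> z < 1 \<Longrightarrow> continuous_on {a..z} (prim F)"
  by (intro continuous_at_imp_continuous_on ballI DERIV_isCont[OF prim_deriv]) auto

lemma prim_deriv_quotient:
  assumes t: "tame F" and z: "0 < z" "z < 1"
  shows "((\<lambda>y. (prim F z - prim F y) / (z - y)) \<longlongrightarrow> F z) (at_left z)"
proof -
  have "((\<lambda>y. (prim F y - prim F z) / (y - z)) \<longlongrightarrow> F z) (at z)"
    using prim_deriv[OF assms] unfolding has_field_derivative_iff .
  then have "((\<lambda>y. (prim F y - prim F z) / (y - z)) \<longlongrightarrow> F z) (at_left z)"
    by (rule filterlim_mono) (auto simp: at_le)
  moreover have "(prim F y - prim F z) / (y - z) = (prim F z - prim F y) / (z - y)" for y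
    using minus_divide_divide[of "prim F z - prim F y" "z - y"] by simp
  ultimately show ?thesis by simp
qed

text \<open>The upper left Dini derivative of \<open>f\<close> at \<open>b\<close> is at least
  \<open>r\<close>: the bound on the quotient is asked for some points arbitrarily close to
  \<open>b\<close>. Such a statement can be obtained by contradiction from integral
  inequalities.\<close>

definition left_Dini_ge :: "(real \<Rightarrow> real) \<Rightarrow> real \<Rightarrow> real \<Rightarrow> bool" where
  "left_Dini_ge f b r \<longleftrightarrow> (\<forall>\<epsilon>>0. \<forall>\<delta>>0. \<exists>a. b - \<delta> < a \<and> a < b \<and> (r - \<epsilon>) * (b - a) \<le> f b - f a)"

text \<open>Formally z f - \<open>prim f\<close> has derivative z f', which is at least \<kappa>.
  Hence F, the difference of the two sides, is nondecreasing, and boundedness of f and \<kappa> near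
  0 makes it tend to 0 there.\<close>

lemma averaged_growth:
  assumes f: "tame f" and \<kappa>: "tame \<kappa>"
    and dini: "\<And>b. 0 < b \<Longrightarrow> b < 1 \<Longrightarrow> left_Dini_ge f b (\<kappa> b / b)"
    and z: "0 < z" "z < 1"
  shows "prim \<kappa> z \<le> z * f z - prim f z"
proof -
  define F where "F x = x * f x - prim f x - prim \<kappa> x" for x
  have cF: "continuous_on {a..z} F" if "0 < a" for a
  proof -
    have "continuous_on {a..z} f" using f that z by (auto simp: tame_def intro: continuous_on_subset)
    then show ?thesis unfolding F_def
      by (intro continuous_intros prim_continuous[OF f that z(2)] prim_continuous[OF \<kappa> that z(2)])
  qed
  have mono: "F a \<le> F z" if a: "0 < a" "a \<le> z" for a
  proof (rule Dini_mono[OF a(2) cF[OF a(1)]])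
    fix x \<epsilon> :: real assume x: "a < x" "x \<le> z" and \<epsilon>: "0 < \<epsilon>"
    have x': "0 < x" "x < 1" using x a z by auto
    have lim: "((\<lambda>y. y * (\<kappa> x / x - \<epsilon> / 2) + f x - (prim f x - prim f y) / (x - y) - (prim \<kappa> x - prim \<kappa> y) / (x - y))
       \<longlongrightarrow> x * (\<kappa> x / x - \<epsilon> / 2) + f x - f x - \<kappa> x) (at_left x)"
      by (intro tendsto_intros prim_deriv_quotient f \<kappa> x')
    have "x * \<epsilon> < 2 * \<epsilon>" using x' \<epsilon> by (intro mult_strict_right_mono) auto
    then have "- \<epsilon> < x * (\<kappa> x / x - \<epsilon> / 2) + f x - f x - \<kappa> x" using x' by (simp add: algebra_simps)
    from order_tendstoD(1)[OF lim this]
    have "\<forall>\<^sub>F y in at_left x. - \<epsilon> < y * (\<kappa> x / x - \<epsilon> / 2) + f x - (prim f x - prim f y) / (x - y) - (prim \<kappa> x - prim \<kappa> y) / (x - y)" .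
    then obtain y0 where y0: "y0 < x" "\<And>y. y0 < y \<Longrightarrow> y < x \<Longrightarrow> - \<epsilon> < y * (\<kappa> x / x - \<epsilon> / 2) + f x - (prim f x - prim f y) / (x - y) - (prim \<kappa> x - prim \<kappa> y) / (x - y)"
      unfolding eventually_at_left_field by blast
    define \<delta> where "\<delta> = x - max y0 a"
    have "0 < \<delta>" using y0 x by (auto simp: \<delta>_def)
    then obtain y where y: "x - \<delta> < y" "y < x" "(\<kappa> x / x - \<epsilon> / 2) * (x - y) \<le> f x - f y"
      using dini[OF x'] \<epsilon> unfolding left_Dini_ge_def by (meson half_gt_zero)
    have ya: "a < y" "y0 < y" using y(1) by (auto simp: \<delta>_def)
    have "- \<epsilon> * (x - y) \<le> (y * (\<kappa> x / x - \<epsilon> / 2) + f x - (prim f x - prim f y) / (x - y) - (prim \<kappa> x - prim \<kappa> y) / (x - y)) * (x - y)"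
      using y0(2)[OF ya(2) y(2)] y(2) by (intro mult_right_mono) auto
    also have "\<dots> = y * ((\<kappa> x / x - \<epsilon> / 2) * (x - y)) + f x * (x - y) - (prim f x - prim f y) - (prim \<kappa> x - prim \<kappa> y)"
    proof -
      have "x - y \<noteq> 0" using y(2) by simp
      then have "(prim f x - prim f y) / (x - y) * (x - y) = prim f x - prim f y" "(prim \<kappa> x - prim \<kappa> y) / (x - y) * (x - y) = prim \<kappa> x - prim \<kappa> y" by simp_all
      then show ?thesis by (simp only: left_diff_distrib distrib_right mult.assoc)
    qed
    also have "\<dots> \<le> y * (f x - f y) + f x * (x - y) - (prim f x - prim f y) - (prim \<kappa> x - prim \<kappa> y)"
      using y(3) ya a by (intro diff_right_mono add_right_mono mult_left_mono) auto
    also have "\<dots> = F x - F y" by (simp add: F_def algebra_simps)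
    finally show "\<exists>y. a \<le> y \<and> y < x \<and> - \<epsilon> * (x - y) \<le> F x - F y" using ya y(2) by (intro exI[of _ y]) auto
  qed
  obtain B1 B2 where B: "0 \<le> B1" "\<And>x. 0 < x \<Longrightarrow> x \<le> z \<Longrightarrow> \<bar>f x\<bar> \<le> B1" "0 \<le> B2" "\<And>x. 0 < x \<Longrightarrow> x \<le> z \<Longrightarrow> \<bar>\<kappa> x\<bar> \<le> B2"
    using tame_bound[OF f z(2)] tame_bound[OF \<kappa> z(2)] by metis
  have lower: "- ((2 * B1 + B2) * a) \<le> F a" if a: "0 < a" "a \<le> z" for a
  proof -
    have "\<bar>prim f a\<bar> \<le> B1 * a" "\<bar>prim \<kappa> a\<bar> \<le> B2 * a"
      using prim_bound[OF f a z(2) B(2)] prim_bound[OF \<kappa> a z(2) B(4)] by auto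
    moreover have "\<bar>a * f a\<bar> \<le> B1 * a" using B(2)[OF a] a by (simp add: abs_mult mult.commute mult_right_mono)
    ultimately show ?thesis unfolding F_def by (simp add: algebra_simps)
  qed
  have "0 \<le> F z"
  proof (rule ccontr)
    assume "\<not> 0 \<le> F z"
    then have neg: "F z < 0" by simp
    \<comment> \<open>Small enough for the lower bound of \<open>F a\<close> to exceed F z / 2; then
      monotonicity gives F z / 2 \<le> F z, which is impossible for negative F z.\<close>
    define a where "a = min z (- F z / (2 * (2 * B1 + B2 + 1)))"
    have p: "0 < 2 * B1 + B2 + 1" using B by simp
    have "0 < - F z / (2 * (2 * B1 + B2 + 1))" using p neg by (intro divide_pos_pos) auto
    then have a: "0 < a" "a \<le> z" using z by (auto simp: a_def min_def)
    have "(2 * B1 + B2) * a \<le> (2 * B1 + B2 + 1) * a" using a by (simp add: mult_right_mono)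
    also have "\<dots> \<le> (2 * B1 + B2 + 1) * (- F z / (2 * (2 * B1 + B2 + 1)))" using p by (intro mult_left_mono) (auto simp: a_def)
    also have "\<dots> = - F z / 2" using p by (simp add: field_simps)
    finally have "F z / 2 \<le> - ((2 * B1 + B2) * a)" by simp
    then have "F z / 2 \<le> F z" using lower[OF a] mono[OF a] by linarith
    then show False using neg by simp
  qed
  then show ?thesis by (simp add: F_def)
qed

text \<open>\<open>h\<close> is the height, \<open>i\<close> the energy, \<open>D b z\<close> the squared distance of the slices at \<open>b\<close> and \<open>z\<close>, and \<open>e z / z\<close> bounds
  the inhomogeneity. No differentiability of the energy is available, only the last inequality.\<close>

locale frequency_ode =
  fixes h i e :: "real \<Rightarrow> real" and D :: "real \<Rightarrow> real \<Rightarrow> real"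
  assumes tame_h: "tame h" and tame_i: "tame i" and tame_e: "tame e"
    and nonneg: "\<And>z. 0 \<le> h z" "\<And>z. 0 \<le> i z" "\<And>z. 0 < z \<Longrightarrow> z < 1 \<Longrightarrow> 0 \<le> e z" "\<And>b z. 0 \<le> D b z"
    and e_mono: "\<And>x y. 0 < x \<Longrightarrow> x \<le> y \<Longrightarrow> y < 1 \<Longrightarrow> e x \<le> e y"
    and cont_D: "\<And>b. 0 < b \<Longrightarrow> b < 1 \<Longrightarrow> continuous_on {0<..<1} (D b)"
    and h_lower: "\<And>a b. 0 < a \<Longrightarrow> a < b \<Longrightarrow> b < 1 \<Longrightarrow> integral {a..b} (\<lambda>z. (i z - e z * sqrt (h z)) / z) \<le> (h b - h a) / 2"
    and h_upper: "\<And>a b. 0 < a \<Longrightarrow> a < b \<Longrightarrow> b < 1 \<Longrightarrow> (h b - h a) / 2 \<le> integral {a..b} (\<lambda>z. (i z + e z * sqrt (h z)) / z)"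
    and D_h: "\<And>a b. 0 < a \<Longrightarrow> a < b \<Longrightarrow> b < 1 \<Longrightarrow> h b - h a \<le> 2 * sqrt (h b) * sqrt (D b a)"
    and D_growth: "\<And>a b. 0 < a \<Longrightarrow> a < b \<Longrightarrow> b < 1 \<Longrightarrow> D b a / 2 \<le> integral {a..b} (\<lambda>z. (i b - i z) / (2 * z) + e z / z * sqrt (D b z))"
begin

lemma cont: "continuous_on {0<..<1} h" "continuous_on {0<..<1} i" "continuous_on {0<..<1} e"
  using tame_h tame_i tame_e by (auto simp: tame_def)

lemma tame_es: "tame (\<lambda>z. e z * sqrt (h z))"
  by (intro tame_mult tame_e tame_sqrt tame_h nonneg)

lemma integral_quotient:
  fixes F :: "real \<Rightarrow> real"
  assumes F: "continuous_on {0<..<1} F" and b: "0 < b" "b < 1"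
  shows "((\<lambda>a. integral {a..b} F / (b - a)) \<longlongrightarrow> F b) (at_left b)"
proof -
  have c: "continuous_on {b / 2..b} F" using F b by (auto intro: continuous_on_subset)
  have "((\<lambda>x. integral {b / 2..x} F) has_real_derivative F b) (at b within {b / 2..b})"
    using integral_has_real_derivative[OF c, of b] b by simp
  then have "((\<lambda>x. integral {b / 2..x} F) has_real_derivative F b) (at_left b)"
    using b by (simp add: at_within_Icc_at_left)
  then have "((\<lambda>a. (integral {b / 2..a} F - integral {b / 2..b} F) / (a - b)) \<longlongrightarrow> F b) (at_left b)"
    unfolding has_field_derivative_iff .
  then show ?thesis
  proof (rule Lim_transform_eventually)
    have "\<forall>\<^sub>F a in at_left b. a \<in> {b / 2<..<b}" using b by (intro eventually_at_leftI[of "b / 2"]) auto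
    then show "\<forall>\<^sub>F a in at_left b. (integral {b / 2..a} F - integral {b / 2..b} F) / (a - b) = integral {a..b} F / (b - a)"
    proof eventually_elim
      case (elim a)
      have "integral {b / 2..a} F + integral {a..b} F = integral {b / 2..b} F"
        using elim c by (intro Henstock_Kurzweil_Integration.integral_combine integrable_continuous_interval) auto
      then have "integral {b / 2..a} F - integral {b / 2..b} F = - integral {a..b} F" by linarith
      then show ?case using minus_divide_divide[of "integral {a..b} F" "b - a"] by simp
    qed
  qed
qed

lemma Dini_from_integral:
  fixes F :: "real \<Rightarrow> real"
  assumes F: "continuous_on {0<..<1} F" and b: "0 < b" "b < 1"
    and le: "\<And>a. 0 < a \<Longrightarrow> a < b \<Longrightarrow> integral {a..b} F \<le> f b - f a"
  shows "left_Dini_ge f b (F b)"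
  unfolding left_Dini_ge_def
proof (intro allI impI)
  fix \<epsilon> \<delta> :: real assume "0 < \<epsilon>" "0 < \<delta>"
  have "\<forall>\<^sub>F a in at_left b. F b - \<epsilon> < integral {a..b} F / (b - a)"
    using integral_quotient[OF F b] \<open>0 < \<epsilon>\<close> by (intro order_tendstoD(1)) auto
  moreover have "\<forall>\<^sub>F a in at_left b. a \<in> {max 0 (b - \<delta>)<..<b}"
    using b \<open>0 < \<delta>\<close> by (intro eventually_at_leftI[of "max 0 (b - \<delta>)"]) auto
  ultimately have "\<forall>\<^sub>F a in at_left b. b - \<delta> < a \<and> a < b \<and> (F b - \<epsilon>) * (b - a) \<le> f b - f a"
  proof eventually_elim
    case (elim a)
    then have "(F b - \<epsilon>) * (b - a) \<le> integral {a..b} F" by (simp add: pos_less_divide_eq less_imp_le)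
    then show ?case using elim le[of a] by auto
  qed
  then show "\<exists>a. b - \<delta> < a \<and> a < b \<and> (F b - \<epsilon>) * (b - a) \<le> f b - f a"
    using eventually_happens'[OF trivial_limit_at_left_real] by blast
qed

text \<open>\<open>averaged_growth\<close> applied to \<open>h\<close> and to - \<open>h\<close>,
  with the lower and the upper bound for h'.\<close>

lemma h_average:
  assumes z: "0 < z" "z < 1"
  shows "2 * prim i z - 2 * prim (\<lambda>z. e z * sqrt (h z)) z \<le> z * h z - prim h z"
    and "z * h z - prim h z \<le> 2 * prim i z + 2 * prim (\<lambda>z. e z * sqrt (h z)) z"
proof -
  note tame = tame_add tame_mult tame_const tame_i tame_es tame_h
  have "prim (\<lambda>z. 2 * i z + (- 2) * (e z * sqrt (h z))) z \<le> z * h z - prim h z"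
  proof (rule averaged_growth[OF tame_h _ _ z])
    show "tame (\<lambda>z. 2 * i z + - 2 * (e z * sqrt (h z)))" by (intro tame)
    fix b :: real assume b: "0 < b" "b < 1"
    have "left_Dini_ge h b ((\<lambda>z. 2 * ((i z - e z * sqrt (h z)) / z)) b)"
    proof (rule Dini_from_integral[OF _ b])
      show "continuous_on {0<..<1} (\<lambda>z. 2 * ((i z - e z * sqrt (h z)) / z))" by (intro continuous_intros cont) auto
      show "integral {a..b} (\<lambda>z. 2 * ((i z - e z * sqrt (h z)) / z)) \<le> h b - h a" if "0 < a" "a < b" for a
      proof -
        define J where "J = integral {a..b} (\<lambda>z. (i z - e z * sqrt (h z)) / z)"
        have "J \<le> (h b - h a) / 2" unfolding J_def by (rule h_lower[OF that b(2)])
        then show ?thesis unfolding Henstock_Kurzweil_Integration.integral_mult_right J_def[symmetric] by simp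
      qed
    qed
    then show "left_Dini_ge h b ((2 * i b + - 2 * (e b * sqrt (h b))) / b)" by (simp add: field_simps)
  qed
  then show "2 * prim i z - 2 * prim (\<lambda>z. e z * sqrt (h z)) z \<le> z * h z - prim h z"
    using prim_add[OF tame_i tame_es z(2), of 2 "- 2"] by simp
  have th: "tame (\<lambda>z. (- 1) * h z)" by (intro tame)
  have "prim (\<lambda>z. (- 2) * i z + (- 2) * (e z * sqrt (h z))) z \<le> z * ((- 1) * h z) - prim (\<lambda>z. (- 1) * h z) z"
  proof (rule averaged_growth[OF th _ _ z])
    show "tame (\<lambda>z. - 2 * i z + - 2 * (e z * sqrt (h z)))" by (intro tame)
    fix b :: real assume b: "0 < b" "b < 1"
    have "left_Dini_ge (\<lambda>z. (- 1) * h z) b ((\<lambda>z. (- 2) * ((i z + e z * sqrt (h z)) / z)) b)"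
    proof (rule Dini_from_integral[OF _ b])
      show "continuous_on {0<..<1} (\<lambda>z. (- 2) * ((i z + e z * sqrt (h z)) / z))" by (intro continuous_intros cont) auto
      show "integral {a..b} (\<lambda>z. (- 2) * ((i z + e z * sqrt (h z)) / z)) \<le> (- 1) * h b - (- 1) * h a" if "0 < a" "a < b" for a
      proof -
        define J where "J = integral {a..b} (\<lambda>z. (i z + e z * sqrt (h z)) / z)"
        have "(h b - h a) / 2 \<le> J" unfolding J_def by (rule h_upper[OF that b(2)])
        then show ?thesis unfolding Henstock_Kurzweil_Integration.integral_mult_right J_def[symmetric] by simp
      qed
    qed
    then show "left_Dini_ge (\<lambda>z. (- 1) * h z) b ((- 2 * i b + - 2 * (e b * sqrt (h b))) / b)" by (simp add: field_simps)
  qed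
  then show "z * h z - prim h z \<le> 2 * prim i z + 2 * prim (\<lambda>z. e z * sqrt (h z)) z"
    using prim_add[OF tame_i tame_es z(2), of "- 2" "- 2"] prim_add[OF tame_h tame_h z(2), of "- 1" 0] by simp
qed

text \<open>The tangent with parameter \<open>l\<close> of the bound z i' \<ge> 2 i^2 / h, with
  errors from \<open>e\<close>. If the energy grew too slowly to the left of \<open>b\<close>, say
  with rate \<open>K\<close>, then \<open>D_growth\<close> would bound D b a by about K (b - a)^2 /
  (2 b); by \<open>D_h\<close> the height could then change only little between \<open>a\<close> and
  \<open>b\<close>, against the growth forced by \<open>h_lower\<close>.\<close>

lemma energy_Dini:
  assumes b: "0 < b" "b < 1" and l: "0 \<le> l"
  shows "left_Dini_ge i b ((4 * l * i b - 8 * l * (e b * sqrt (h b)) - 2 * l\<^sup>2 * h b - 2 * (e b)\<^sup>2) / b)"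
  unfolding left_Dini_ge_def
proof (intro allI impI, rule ccontr)
  fix \<epsilon> \<delta> :: real assume \<epsilon>: "0 < \<epsilon>" and \<delta>: "0 < \<delta>"
  let ?\<kappa> = "4 * l * i b - 8 * l * (e b * sqrt (h b)) - 2 * l\<^sup>2 * h b - 2 * (e b)\<^sup>2"
  assume "\<not> (\<exists>a. b - \<delta> < a \<and> a < b \<and> (?\<kappa> / b - \<epsilon>) * (b - a) \<le> i b - i a)"
  then have small: "i b - i a \<le> (?\<kappa> / b - \<epsilon>) * (b - a)" if "b - \<delta> < a" "a < b" for a
    using that by (meson less_imp_le not_le)
  define K where "K = ?\<kappa> / b - \<epsilon>"
  define p where "p = (i b - e b * sqrt (h b)) / b"
  \<comment> \<open>Chosen so that the loss 2 l b \<epsilon>' stays below b \<epsilon> / 2 at the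
    end; the summand 1 covers l = 0.\<close>
  define \<epsilon>' where "\<epsilon>' = \<epsilon> / (8 * (l + 1))"
  have \<epsilon>': "0 < \<epsilon>'" using \<epsilon> l by (simp add: \<epsilon>'_def)
  have eb: "0 \<le> e b" using nonneg(3) b by blast
  have cp: "continuous_on {0<..<1} (\<lambda>z. (i z - e z * sqrt (h z)) / z)" by (intro continuous_intros cont) auto
  have "((\<lambda>z. (i z - e z * sqrt (h z)) / z) \<longlongrightarrow> p) (at b)"
  proof -
    have "isCont (\<lambda>z. (i z - e z * sqrt (h z)) / z) b"
      using cp b by (simp only: continuous_on_eq_continuous_at open_greaterThanLessThan) auto
    then show ?thesis unfolding p_def isCont_def .
  qed
  then have "((\<lambda>z. (i z - e z * sqrt (h z)) / z) \<longlongrightarrow> p) (at_left b)" by (rule filterlim_mono) (auto simp: at_le)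
  then have "\<forall>\<^sub>F z in at_left b. p - \<epsilon>' < (i z - e z * sqrt (h z)) / z" using \<epsilon>' by (intro order_tendstoD(1)) auto
  then obtain b0 where b0: "b0 < b" "\<And>z. b0 < z \<Longrightarrow> z < b \<Longrightarrow> p - \<epsilon>' < (i z - e z * sqrt (h z)) / z"
    unfolding eventually_at_left_field by blast
  define b1 where "b1 = max (max b0 (b - \<delta>)) (b / 2)"
  have b1: "b1 < b" "0 < b1" using b0 \<delta> b by (auto simp: b1_def)
  \<comment> \<open>The estimate for a left end \<alpha> before the limit \<alpha> to
    \<open>b\<close>. The comparison takes place on [a, b], where \<open>a\<close> in [\<alpha>, b)
    is a point at which D b is maximal, so that the distance in the inhomogeneous term is at most D
    b a throughout.\<close>
  have key: "2 * l * (b * (p - \<epsilon>') - sqrt (h b) * (e b * b / \<alpha>)) - l\<^sup>2 * h b - (e b * b / \<alpha>)\<^sup>2 \<le> b\<^sup>2 * max (K / \<alpha>) (K / b) / 2"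
    if \<alpha>: "b1 < \<alpha>" "\<alpha> < b" for \<alpha>
  proof -
    have \<alpha>0: "0 < \<alpha>" using \<alpha> b1 by simp
    have sub: "{\<alpha>..b} \<subseteq> {0<..<1}" using \<alpha>0 b by auto
    have cD: "continuous_on {\<alpha>..b} (D b)" using cont_D[OF b] sub continuous_on_subset by blast
    obtain a' where a': "a' \<in> {\<alpha>..b}" "\<And>z. z \<in> {\<alpha>..b} \<Longrightarrow> D b z \<le> D b a'"
      using continuous_attains_sup[OF compact_Icc _ cD] \<alpha> by auto
    obtain a where a: "\<alpha> \<le> a" "a < b" "\<And>z. z \<in> {a..b} \<Longrightarrow> D b z \<le> D b a"
    proof (cases "a' < b")
      case True
      then show ?thesis using that[of a'] a' by auto
    next
      case False
      then have "a' = b" using a' by simp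
      \<comment> \<open>If the maximum sits at \<open>b\<close> itself, it must be 0: the integral
        in \<open>D_growth\<close> over [x, b] tends to 0 as x tends to b. Then D b vanishes on the
        whole interval and \<alpha> can serve as \<open>a\<close>.\<close>
      have "D b b \<le> 0"
      proof -
        have "isCont (D b) b"
          using cont_D[OF b] b by (simp only: continuous_on_eq_continuous_at open_greaterThanLessThan) auto
        then have "(D b \<longlongrightarrow> D b b) (at_left b)"
          unfolding isCont_def by (rule filterlim_mono) (auto simp: at_le)
        then have T1: "((\<lambda>x. D b x / 2) \<longlongrightarrow> D b b / 2) (at_left b)" by (intro tendsto_intros) auto
        have T2: "((\<lambda>x. integral {x..b} (\<lambda>z. (i b - i z) / (2 * z) + e z / z * sqrt (D b z)) / (b - x) * (b - x))
            \<longlongrightarrow> ((i b - i b) / (2 * b) + e b / b * sqrt (D b b)) * (b - b)) (at_left b)"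
          by (intro tendsto_intros integral_quotient[OF _ b] continuous_intros cont cont_D[OF b]) auto
        have EV: "\<forall>\<^sub>F x in at_left b. D b x / 2 \<le> integral {x..b} (\<lambda>z. (i b - i z) / (2 * z) + e z / z * sqrt (D b z)) / (b - x) * (b - x)"
        proof (rule eventually_at_leftI[of 0])
          fix x assume x: "x \<in> {0<..<b}"
          define J where "J = integral {x..b} (\<lambda>z. (i b - i z) / (2 * z) + e z / z * sqrt (D b z))"
          have "D b x / 2 \<le> J" unfolding J_def by (rule D_growth) (use x b in auto)
          then show "D b x / 2 \<le> integral {x..b} (\<lambda>z. (i b - i z) / (2 * z) + e z / z * sqrt (D b z)) / (b - x) * (b - x)"
            unfolding J_def[symmetric] using x by simp
        qed (use b in simp)
        have "D b b / 2 \<le> ((i b - i b) / (2 * b) + e b / b * sqrt (D b b)) * (b - b)"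
          by (rule tendsto_le[OF trivial_limit_at_left_real T2 T1 EV])
        then show ?thesis by simp
      qed
      then have "D b z \<le> D b \<alpha>" if "z \<in> {\<alpha>..b}" for z
        using a'(2)[OF that] \<open>a' = b\<close> nonneg(4)[of b \<alpha>] by simp
      then show ?thesis using that[of \<alpha>] \<alpha> by auto
    qed
    have a0: "0 < a" using a \<alpha>0 by simp
    have suba: "{a..b} \<subseteq> {0<..<1}" using a0 b by auto
    define d where "d = sqrt (D b a)"
    have d: "0 \<le> d" "d\<^sup>2 = D b a" using nonneg(4) by (auto simp: d_def)
    define k where "k = b - a"
    have k: "0 < k" using a by (simp add: k_def)
    \<comment> \<open>The sign of \<open>K\<close> is unknown, so K / z on [\<alpha>, b] is bounded
      by the larger of its two end values.\<close>
    define K' where "K' = max (K / \<alpha>) (K / b)"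
    have "D b a / 2 \<le> integral {a..b} (\<lambda>z. (i b - i z) / (2 * z) + e z / z * sqrt (D b z))"
      using D_growth[OF a0 a(2) b(2)] .
    also have "\<dots> \<le> integral {a..b} (\<lambda>z. K' / 2 * (b - z) + e b / \<alpha> * d)"
    proof (rule integral_le)
      show "(\<lambda>z. (i b - i z) / (2 * z) + e z / z * sqrt (D b z)) integrable_on {a..b}"
        using a0 by (intro integrable_continuous_interval continuous_intros continuous_on_subset[OF cont(2) suba]
            continuous_on_subset[OF cont(3) suba] continuous_on_subset[OF cont_D[OF b] suba]) auto
      show "(\<lambda>z. K' / 2 * (b - z) + e b / \<alpha> * d) integrable_on {a..b}"
        by (intro integrable_continuous_interval continuous_intros)
      fix z assume z: "z \<in> {a..b}"
      have z0: "0 < z" "\<alpha> \<le> z" "z \<le> b" using z a0 a by auto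
      have "(i b - i z) / (2 * z) \<le> K' / 2 * (b - z)"
      proof (cases "z = b")
        case False
        then have "i b - i z \<le> K * (b - z)" using small[of z] z0 \<alpha> unfolding K_def b1_def by auto
        then have "(i b - i z) / (2 * z) \<le> K * (b - z) / (2 * z)" using z0 by (intro divide_right_mono) auto
        also have "\<dots> = (K / z) * ((b - z) / 2)" by simp
        also have "\<dots> \<le> K' * ((b - z) / 2)"
        proof (rule mult_right_mono)
          show "K / z \<le> K'"
          proof (cases "0 \<le> K")
            case True
            then have "K / z \<le> K / \<alpha>" using z0 \<alpha>0 by (intro divide_left_mono) auto
            then show ?thesis by (simp add: K'_def)
          next
            case False
            then have "K / z \<le> K / b" using z0 b by (intro divide_left_mono_neg) auto
            then show ?thesis by (simp add: K'_def)
          qed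
        qed (use z0 in simp)
        finally show ?thesis by simp
      qed simp
      moreover have "e z / z * sqrt (D b z) \<le> e b / \<alpha> * d"
      proof (rule mult_mono)
        show "e z / z \<le> e b / \<alpha>"
          using e_mono[of z b] z0 b \<alpha>0 nonneg(3)[of b] by (intro frac_le) auto
        show "sqrt (D b z) \<le> d" using a(3)[OF z] by (simp add: d_def)
      qed (use eb \<alpha>0 nonneg(4) in auto)
      ultimately show "(i b - i z) / (2 * z) + e z / z * sqrt (D b z) \<le> K' / 2 * (b - z) + e b / \<alpha> * d" by (rule add_mono)
    qed
    also have "\<dots> = K' / 4 * k\<^sup>2 + e b / \<alpha> * d * k"
    proof -
      have "((\<lambda>z. K' / 2 * (b - z) + e b / \<alpha> * d) has_integral
         (- K' / 4 * (b - b)\<^sup>2 + e b / \<alpha> * d * b) - (- K' / 4 * (b - a)\<^sup>2 + e b / \<alpha> * d * a)) {a..b}"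
      proof (rule fundamental_theorem_of_calculus)
        show "((\<lambda>z. - K' / 4 * (b - z)\<^sup>2 + e b / \<alpha> * d * z) has_vector_derivative K' / 2 * (b - z) + e b / \<alpha> * d) (at z within {a..b})" for z
          unfolding has_real_derivative_iff_has_vector_derivative[symmetric]
        proof -
          have A: "((\<lambda>z. (b - z)\<^sup>2) has_real_derivative 2 * (b - z) * (- 1)) (at z within {a..b})"
            by (auto intro!: derivative_eq_intros)
          show "((\<lambda>z. - K' / 4 * (b - z)\<^sup>2 + e b / \<alpha> * d * z) has_real_derivative K' / 2 * (b - z) + e b / \<alpha> * d) (at z within {a..b})"
            by (rule DERIV_cong[OF DERIV_add[OF DERIV_cmult[OF A] DERIV_cmult[OF DERIV_ident]]]) (simp add: field_simps)
        qed
      qed (use a in simp)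
      then have "integral {a..b} (\<lambda>z. K' / 2 * (b - z) + e b / \<alpha> * d) =
         (- K' / 4 * (b - b)\<^sup>2 + e b / \<alpha> * d * b) - (- K' / 4 * (b - a)\<^sup>2 + e b / \<alpha> * d * a)"
        by (rule integral_unique)
      also have "\<dots> = K' / 4 * k\<^sup>2 + e b / \<alpha> * d * k" by (simp add: k_def right_diff_distrib)
      finally show ?thesis .
    qed
    finally have q1: "d\<^sup>2 / 2 \<le> K' / 4 * k\<^sup>2 + e b / \<alpha> * d * k" using d by simp
    \<comment> \<open>The mean L2 speed between the slices at \<open>a\<close> and \<open>b\<close>.
      It satisfies a quadratic inequality, \<open>q2\<close>, and bounds the growth of the height,
      \<open>q3\<close>.\<close>
    define x where "x = d / k"
    have dx: "d = x * k" using k by (simp add: x_def)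
    have "k\<^sup>2 * (x\<^sup>2 / 2) \<le> k\<^sup>2 * (K' / 4 + e b / \<alpha> * x)"
      using q1 unfolding dx by (simp add: power2_eq_square algebra_simps)
    then have q2: "x\<^sup>2 / 2 \<le> K' / 4 + e b / \<alpha> * x" using k by simp
    have "(p - \<epsilon>') * k \<le> sqrt (h b) * x * k"
    proof -
      have "(p - \<epsilon>') * k = integral {a..b} (\<lambda>z. p - \<epsilon>')" using a by (simp add: k_def)
      also have "\<dots> \<le> integral {a..b} (\<lambda>z. (i z - e z * sqrt (h z)) / z)"
      proof (rule integral_le)
        show "(\<lambda>z. (i z - e z * sqrt (h z)) / z) integrable_on {a..b}"
          by (intro integrable_continuous_interval continuous_on_subset[OF cp suba])
        show "p - \<epsilon>' \<le> (i z - e z * sqrt (h z)) / z" if "z \<in> {a..b}" for z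
        proof (cases "z = b")
          case True
          then show ?thesis using \<epsilon>' by (simp add: p_def)
        next
          case False
          then show ?thesis using that a \<alpha> b0(2)[of z] by (auto simp: b1_def)
        qed
      qed (intro integrable_continuous_interval continuous_intros)
      also have "\<dots> \<le> (h b - h a) / 2" using h_lower[OF a0 a(2) b(2)] .
      also have "\<dots> \<le> sqrt (h b) * d" using D_h[OF a0 a(2) b(2)] by (simp add: d_def)
      finally show ?thesis by (simp add: dx mult.assoc)
    qed
    then have q3: "p - \<epsilon>' \<le> sqrt (h b) * x" using k by simp
    \<comment> \<open>This \<open>s\<close> completes the square in \<open>q2\<close>: after
      multiplication by 2 b^2 it reads (b x - s)^2 \<le> b^2 K' / 2 + s^2.\<close>
    define s where "s = e b * b / \<alpha>"
    have sh: "sqrt (h b) * sqrt (h b) = h b" using nonneg(1) by simp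
    \<comment> \<open>The tangent replaces the square here: y^2 \<ge> 2 l sqrt h y - l^2 h, for
      every \<open>l\<close> and also when h vanishes.\<close>
    have "2 * l * (sqrt (h b) * (b * x - s)) - l\<^sup>2 * h b \<le> (b * x - s)\<^sup>2"
    proof -
      have "0 \<le> ((b * x - s) - l * sqrt (h b))\<^sup>2" by simp
      also have "\<dots> = (b * x - s)\<^sup>2 - 2 * l * (sqrt (h b) * (b * x - s)) + l\<^sup>2 * (sqrt (h b) * sqrt (h b))"
        by (simp add: power2_eq_square algebra_simps)
      finally show ?thesis unfolding sh by simp
    qed
    moreover have "2 * l * (b * (p - \<epsilon>') - sqrt (h b) * s) \<le> 2 * l * (sqrt (h b) * (b * x - s))"
    proof (rule mult_left_mono)
      have "b * (p - \<epsilon>') \<le> b * (sqrt (h b) * x)" using q3 b by (intro mult_left_mono) auto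
      then show "b * (p - \<epsilon>') - sqrt (h b) * s \<le> sqrt (h b) * (b * x - s)" by (simp add: algebra_simps)
    qed (use l in simp)
    moreover have "(b * x - s)\<^sup>2 \<le> b\<^sup>2 * K' / 2 + s\<^sup>2"
    proof -
      have "2 * b\<^sup>2 * (x\<^sup>2 / 2) \<le> 2 * b\<^sup>2 * (K' / 4 + e b / \<alpha> * x)" using q2 by (intro mult_left_mono) auto
      then show ?thesis by (simp add: s_def power2_eq_square algebra_simps)
    qed
    ultimately show ?thesis unfolding s_def[symmetric] K'_def[symmetric] by linarith
  qed
  have L1: "((\<lambda>\<alpha>. 2 * l * (b * (p - \<epsilon>') - sqrt (h b) * (e b * b / \<alpha>)) - l\<^sup>2 * h b - (e b * b / \<alpha>)\<^sup>2)
     \<longlongrightarrow> 2 * l * (b * (p - \<epsilon>') - sqrt (h b) * (e b * b / b)) - l\<^sup>2 * h b - (e b * b / b)\<^sup>2) (at_left b)"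
    using b by (intro tendsto_intros) auto
  have L2: "((\<lambda>\<alpha>. b\<^sup>2 * max (K / \<alpha>) (K / b) / 2) \<longlongrightarrow> b\<^sup>2 * max (K / b) (K / b) / 2) (at_left b)"
    using b by (intro tendsto_intros) auto
  have L3: "\<forall>\<^sub>F \<alpha> in at_left b. 2 * l * (b * (p - \<epsilon>') - sqrt (h b) * (e b * b / \<alpha>)) - l\<^sup>2 * h b - (e b * b / \<alpha>)\<^sup>2 \<le> b\<^sup>2 * max (K / \<alpha>) (K / b) / 2"
    using b1(1) key by (intro eventually_at_leftI[of b1]) auto
  have "2 * l * (b * (p - \<epsilon>') - sqrt (h b) * (e b * b / b)) - l\<^sup>2 * h b - (e b * b / b)\<^sup>2 \<le> b\<^sup>2 * max (K / b) (K / b) / 2"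
    by (rule tendsto_le[OF trivial_limit_at_left_real L2 L1 L3])
  then have "2 * l * (b * p - b * \<epsilon>' - sqrt (h b) * e b) - l\<^sup>2 * h b - (e b)\<^sup>2 \<le> b * K / 2"
    using b by (simp add: power2_eq_square right_diff_distrib)
  \<comment> \<open>The coefficient 8 of the mixed error has two equal sources: the inhomogeneity in
    the growth of \<open>h\<close>, contained in \<open>p\<close>, and the one in the growth of
    \<open>D\<close>, contained in \<open>s\<close>.\<close>
  moreover have "b * p = i b - e b * sqrt (h b)" using b by (simp add: p_def)
  moreover have "b * K = ?\<kappa> - b * \<epsilon>"
  proof -
    have "b * (r / b - \<epsilon>) = r - b * \<epsilon>" for r using b by (simp add: right_diff_distrib)
    then show ?thesis unfolding K_def .
  qed
  ultimately have "b * \<epsilon> / 2 \<le> 2 * l * (b * \<epsilon>')" by (simp add: algebra_simps)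
  moreover have "2 * l * (b * \<epsilon>') < b * \<epsilon> / 2"
  proof -
    have "l / (l + 1) < 1" using l by simp
    then have "(b * \<epsilon> / 4) * (l / (l + 1)) < (b * \<epsilon> / 4) * 1" using b \<epsilon> by (intro mult_strict_left_mono) auto
    moreover have "2 * l * (b * \<epsilon>') = (b * \<epsilon> / 4) * (l / (l + 1))" using l by (simp add: \<epsilon>'_def field_simps)
    moreover have "0 < b * \<epsilon>" using b \<epsilon> by simp
    ultimately show ?thesis by linarith
  qed
  ultimately show False by linarith
qed

text \<open>Jensen's inequality for the square root, by its tangent at the average \<open>A\<close>;
  the factor \<open>e\<close> is first replaced by its largest value e z.\<close>

lemma prim_es_bound:
  assumes z: "0 < z" "z < 1" and A: "prim h z = z * A" "0 < A"
  shows "prim (\<lambda>z. e z * sqrt (h z)) z \<le> z * (e z * sqrt A)"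
proof -
  have "prim (\<lambda>z. e z * sqrt (h z)) z \<le> prim (\<lambda>x. (e z / (2 * sqrt A)) * h x + (e z * sqrt A / 2) * 1) z"
  proof (rule prim_mono[OF tame_es _ z(2)])
    show "tame (\<lambda>x. (e z / (2 * sqrt A)) * h x + (e z * sqrt A / 2) * 1)"
      by (intro tame_add tame_mult tame_const tame_h)
    fix x assume x: "0 < x" "x < z"
    have "0 \<le> (sqrt (h x) - sqrt A)\<^sup>2" by simp
    then have "2 * (sqrt (h x) * sqrt A) \<le> h x + A" using nonneg(1)[of x] A(2) by (simp add: power2_diff)
    then have s: "sqrt (h x) \<le> h x / (2 * sqrt A) + sqrt A / 2" using A(2) by (simp add: field_simps)
    have "e x * sqrt (h x) \<le> e z * (h x / (2 * sqrt A) + sqrt A / 2)"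
      using e_mono[of x z] x z nonneg(1)[of x] nonneg(3)[of z] s by (intro mult_mono) auto
    then show "e x * sqrt (h x) \<le> (e z / (2 * sqrt A)) * h x + (e z * sqrt A / 2) * 1"
      by (simp add: distrib_left)
  qed
  also have "\<dots> = (e z / (2 * sqrt A)) * prim h z + (e z * sqrt A / 2) * prim (\<lambda>_. 1) z"
    by (rule prim_add[OF tame_h tame_const z(2)])
  also have "\<dots> = z * (e z * sqrt A)"
  proof -
    have "A / sqrt A = sqrt A" using A(2) by (simp add: real_div_sqrt)
    moreover have "(e z / (2 * sqrt A)) * (z * A) = e z * z * (A / sqrt A) / 2" by simp
    ultimately have "(e z / (2 * sqrt A)) * (z * A) = e z * z * sqrt A / 2" by (simp only:)
    then show ?thesis using A z by (simp add: prim_const field_simps)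
  qed
  finally show ?thesis .
qed

text \<open>The parameter \<open>l\<close> is constant in the interval of integration, so the
  right-hand side of \<open>energy_Dini\<close> is linear in \<open>i\<close>, \<open>h\<close>, e *
  sqrt h and e^2 and is averaged term by term.\<close>

lemma energy_average:
  assumes z: "0 < z" "z < 1" and A: "prim h z = z * A" "0 < A" and I: "prim i z = z * I" and l: "0 \<le> l"
  shows "I + 4 * l * I - 8 * l * (e z * sqrt A) - 2 * l\<^sup>2 * A - 2 * (e z)\<^sup>2 \<le> i z"
proof -
  note tame = tame_add tame_mult tame_const tame_i tame_es tame_h tame_e
  let ?es = "\<lambda>z. e z * sqrt (h z)"
  define \<kappa> where "\<kappa> x = 1 * (4 * l * i x + (- 8 * l) * ?es x) + 1 * ((- 2 * l\<^sup>2) * h x + (- 2) * (e x * e x))" for x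
  have t1: "tame (\<lambda>x. 4 * l * i x + (- 8 * l) * ?es x)" and t2: "tame (\<lambda>x. (- 2 * l\<^sup>2) * h x + (- 2) * (e x * e x))" and tee: "tame (\<lambda>x. e x * e x)"
    by (intro tame)+
  have "prim \<kappa> z \<le> z * i z - prim i z"
  proof (rule averaged_growth[OF tame_i _ _ z])
    show "tame \<kappa>" unfolding \<kappa>_def by (intro tame)
    fix b :: real assume b: "0 < b" "b < 1"
    show "left_Dini_ge i b (\<kappa> b / b)"
      using energy_Dini[OF b l] by (simp add: \<kappa>_def power2_eq_square algebra_simps)
  qed
  moreover have "prim \<kappa> z = 1 * (4 * l * prim i z + (- 8 * l) * prim ?es z) + 1 * ((- 2 * l\<^sup>2) * prim h z + (- 2) * prim (\<lambda>x. e x * e x) z)"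
    unfolding \<kappa>_def prim_add[OF t1 t2 z(2)] prim_add[OF tame_i tame_es z(2)] prim_add[OF tame_h tee z(2)] ..
  moreover have "8 * l * prim ?es z \<le> 8 * l * (z * (e z * sqrt A))"
    using prim_es_bound[OF z A] l by (intro mult_left_mono) auto
  moreover have "prim (\<lambda>x. e x * e x) z \<le> z * (e z * e z)"
  proof -
    have "prim (\<lambda>x. e x * e x) z \<le> prim (\<lambda>x. e z * e z) z"
      by (rule prim_mono[OF tee tame_const z(2)]) (use e_mono nonneg(3) z in \<open>auto intro!: mult_mono\<close>)
    then show ?thesis using prim_const[OF z(1), of "e z * e z"] by (simp add: mult.commute)
  qed
  ultimately have "z * (I + 4 * l * I - 8 * l * (e z * sqrt A) - 2 * l\<^sup>2 * A - 2 * (e z)\<^sup>2) \<le> z * i z"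
    unfolding A I by (simp add: algebra_simps power2_eq_square)
  then show ?thesis using z by simp
qed

text \<open>Apart from the error term, the right-hand side is a lower bound for z times the
  derivative of h / A, where \<open>A\<close> is the average of \<open>h\<close> and
  \<open>N\<close> = h / A - 1 equals z A' / A. The bound \<open>e0\<close> for \<epsilon> makes the
  quadratic error e^2 linear in \<epsilon>.\<close>

lemma frequency_inequality:
  assumes z: "0 < z" "z < 1" and A: "prim h z = z * A" "0 < A"
    and \<epsilon>: "0 \<le> \<epsilon>" "\<epsilon> \<le> e0" "e z \<le> \<epsilon> * sqrt A"
  shows "0 \<le> 2 * (i z - e z * sqrt (h z)) / A - (h z / A - 1) * (h z / A) + (16 + 4 * e0) * \<epsilon> * (h z / A + 1)"
proof -
  define I where "I = prim i z / z"
  have I: "prim i z = z * I" using z by (simp add: I_def)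
  define N where "N = h z / A - 1"
  have h: "h z = (N + 1) * A" using A by (simp add: N_def)
  have N1: "0 \<le> N + 1" using nonneg(1)[of z] A by (simp add: N_def)
  have ez: "0 \<le> e z" using nonneg(3) z by blast
  have eH: "e z * sqrt A \<le> \<epsilon> * A"
    using mult_right_mono[OF \<epsilon>(3), of "sqrt A"] A by (simp add: mult.assoc)
  have ee: "(e z)\<^sup>2 \<le> \<epsilon> * e0 * A"
  proof -
    have "(e z)\<^sup>2 \<le> (\<epsilon> * sqrt A)\<^sup>2" using \<epsilon>(3) ez by (rule power_mono)
    also have "\<dots> = \<epsilon> * \<epsilon> * A" using A by (simp add: power_mult_distrib power2_eq_square)
    also have "\<dots> \<le> \<epsilon> * e0 * A" using \<epsilon> A by (intro mult_right_mono mult_left_mono) auto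
    finally show ?thesis .
  qed
  have sN: "sqrt (N + 1) \<le> N + 2"
  proof -
    have "0 \<le> (sqrt (N + 1) - 1 / 2)\<^sup>2" by simp
    then have "sqrt (N + 1) \<le> sqrt (N + 1) * sqrt (N + 1) + 1 / 4"
      by (simp only: power2_diff) (simp add: power2_eq_square)
    then show ?thesis using N1 by simp
  qed
  have eh: "e z * sqrt (h z) \<le> \<epsilon> * A * (N + 2)"
  proof -
    have "e z * sqrt (h z) = (e z * sqrt A) * sqrt (N + 1)" by (simp add: h real_sqrt_mult)
    also have "\<dots> \<le> (\<epsilon> * A) * (N + 2)" using eH sN N1 A \<epsilon>(1) by (intro mult_mono[OF eH sN]) auto
    finally show ?thesis .
  qed
  have e0N: "0 \<le> e0 * \<epsilon> * (N + 2)" "0 \<le> \<epsilon> * (N + 2)" using \<epsilon> N1 by auto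
  have goal: "0 \<le> 2 * i z - 2 * (e z * sqrt (h z)) - N * (N + 1) * A + (16 + 4 * e0) * \<epsilon> * (N + 2) * A"
  proof (cases "0 \<le> N")
    case False
    \<comment> \<open>For negative \<open>N\<close> the quadratic term already has the right sign;
      the energy is merely nonnegative, and the only error is the one of \<open>eh\<close>.\<close>
    have "N * (N + 1) * A \<le> 0" using False N1 A by (intro mult_nonpos_nonneg) (auto simp: mult_nonpos_nonneg)
    moreover have "0 \<le> (14 + 4 * e0) * \<epsilon> * (N + 2) * A" using \<epsilon> N1 A by (intro mult_nonneg_nonneg) auto
    ultimately show ?thesis using eh nonneg(2)[of z] by (simp add: algebra_simps)
  next
    case True
    have hI: "N * A - 2 * (\<epsilon> * A) \<le> 2 * I"
    proof -
      have "z * h z - z * A \<le> 2 * (z * I) + 2 * (z * (e z * sqrt A))"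
        using h_average(2)[OF z] prim_es_bound[OF z A] unfolding A I by linarith
      then have "z * (N * A) \<le> z * (2 * I + 2 * (e z * sqrt A))" by (simp add: h algebra_simps)
      then have "N * A \<le> 2 * I + 2 * (e z * sqrt A)" using z by simp
      then show ?thesis using eH by linarith
    qed
    \<comment> \<open>The choice l = N / 2 is, up to errors, I / A, the maximizer of 4 l I - 2 l^2
      A. It is admissible since \<open>N\<close> is nonnegative in this case.\<close>
    have "I + 4 * (N / 2) * I - 8 * (N / 2) * (e z * sqrt A) - 2 * (N / 2)\<^sup>2 * A - 2 * (e z)\<^sup>2 \<le> i z"
      by (rule energy_average[OF z A I]) (use True in simp)
    then have "2 * I * (1 + 2 * N) - 8 * N * (e z * sqrt A) - N\<^sup>2 * A - 4 * (e z)\<^sup>2 \<le> 2 * i z"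
      by (simp add: power2_eq_square algebra_simps)
    moreover have "(N * A - 2 * (\<epsilon> * A)) * (1 + 2 * N) \<le> 2 * I * (1 + 2 * N)" using hI True by (intro mult_right_mono) auto
    moreover have "8 * N * (e z * sqrt A) \<le> 8 * N * (\<epsilon> * A)" using eH True by (intro mult_left_mono) auto
    ultimately have "(N * A - 2 * (\<epsilon> * A)) * (1 + 2 * N) - 8 * N * (\<epsilon> * A) - N\<^sup>2 * A - 4 * (\<epsilon> * e0 * A) \<le> 2 * i z"
      using ee by linarith
    then have "(N + N\<^sup>2) * A - \<epsilon> * A * (2 + 12 * N + 4 * e0) \<le> 2 * i z" by (simp add: power2_eq_square algebra_simps)
    \<comment> \<open>Origin of 16 + 4 e0: the error of the energy is 2 + 12 N + 4 e0, the one of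
      \<open>eh\<close> is 2 (N + 2), and their sum 6 + 14 N + 4 e0 is at most (16 + 4 e0) (N +
      2).\<close>
    moreover have "\<epsilon> * A * (2 + 12 * N + 4 * e0) + 2 * (\<epsilon> * A * (N + 2)) \<le> (16 + 4 * e0) * \<epsilon> * (N + 2) * A"
    proof -
      have "0 \<le> (\<epsilon> * A) * (2 * N + 26 + 4 * e0 * N + 4 * e0)" using \<epsilon> A True by (intro mult_nonneg_nonneg) auto
      then show ?thesis by (simp add: algebra_simps)
    qed
    ultimately show ?thesis using eh by (simp add: power2_eq_square algebra_simps)
  qed
  then have "0 \<le> (2 * i z - 2 * (e z * sqrt (h z)) - N * (N + 1) * A + (16 + 4 * e0) * \<epsilon> * (N + 2) * A) / A" using A by simp
  also have "\<dots> = 2 * (i z - e z * sqrt (h z)) / A - N * (N + 1) + (16 + 4 * e0) * \<epsilon> * (N + 2)"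
    using A by (simp add: field_simps)
  finally have fin: "0 \<le> 2 * (i z - e z * sqrt (h z)) / A - N * (N + 1) + (16 + 4 * e0) * \<epsilon> * (N + 2)" .
  have "h z / A = N + 1" by (simp add: N_def)
  then show ?thesis using fin by (simp add: add.assoc)
qed

end

context frequency_ode
begin

text \<open>For z = r^2 this is the quantity H of the statement.\<close>

definition ave :: "real \<Rightarrow> real" where "ave z = prim h z / z"

lemma ave_deriv:
  assumes "0 < z" "z < 1"
  shows "(ave has_real_derivative (h z - ave z) / z) (at z)"
  unfolding ave_def
  by (rule DERIV_cong[OF DERIV_divide[OF prim_deriv[OF tame_h assms] DERIV_ident]])
     (use assms in \<open>simp_all add: field_simps\<close>)

text \<open>Formally z K' is the exponential times z (h / ave)' + C \<tau> z powr \<tau> (h / ave +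
  1). By \<open>frequency_inequality\<close> with \<epsilon> = k z powr \<tau> the negative part of
  the first term is at most (16 + 4 k) k z powr \<tau> (h / ave + 1), and the condition on
  \<open>C\<close> makes the second term dominate. Monotonicity is shown with
  \<open>Dini_mono\<close>, since for \<open>h\<close> only integral bounds on increments are
  given.\<close>

lemma weighted_frequency_mono:
  assumes ab: "0 < a" "a \<le> b" "b < 1" and \<tau>: "0 < \<tau>" and k: "0 \<le> k" and C: "(16 + 4 * k) * k \<le> C * \<tau>"
    and pos: "\<And>z. a \<le> z \<Longrightarrow> z \<le> b \<Longrightarrow> 0 < ave z"
    and small: "\<And>z. a \<le> z \<Longrightarrow> z \<le> b \<Longrightarrow> e z \<le> (k * z powr \<tau>) * sqrt (ave z)"
  defines "K \<equiv> \<lambda>z. exp (C * z powr \<tau>) * (h z / ave z + 1)"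
  shows "K a \<le> K b"
proof (rule Dini_mono[OF ab(2)])
  define E where "E z = exp (C * z powr \<tau>)" for z
  define q where "q z = E z / ave z" for z
  have E': "(E has_real_derivative E z * (C * (\<tau> * z powr (\<tau> - 1)))) (at z)" if "0 < z" for z
    unfolding E_def using that by (auto intro!: derivative_eq_intros)
  have q': "(q has_real_derivative (E z * (C * (\<tau> * z powr (\<tau> - 1))) * ave z - E z * ((h z - ave z) / z)) / (ave z * ave z)) (at z)"
    if "a \<le> z" "z \<le> b" for z
    unfolding q_def using that ab pos[OF that] by (intro DERIV_divide E' ave_deriv) auto
  have sub: "{a..b} \<subseteq> {0<..<1}" using ab by auto
  have c_ave: "continuous_on {a..b} ave"
    using ab by (intro continuous_at_imp_continuous_on ballI DERIV_isCont[OF ave_deriv]) auto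
  have cE: "continuous_on {a..b} E"
    using ab by (intro continuous_at_imp_continuous_on ballI DERIV_isCont[OF E']) auto
  show "continuous_on {a..b} K"
    unfolding K_def E_def[symmetric]
    by (intro continuous_intros c_ave cE continuous_on_subset[OF cont(1) sub]) (use pos in \<open>auto simp: less_imp_neq[THEN not_sym]\<close>)
  fix x \<epsilon> :: real assume x: "a < x" "x \<le> b" and \<epsilon>: "0 < \<epsilon>"
  have x': "0 < x" "x < 1" "a \<le> x" using x ab by auto
  note ave_pos = pos[OF x'(3) x(2)]
  define \<kappa> where "\<kappa> z = 2 * ((i z - e z * sqrt (h z)) / z)" for z
  have c\<kappa>: "continuous_on {0<..<1} \<kappa>" unfolding \<kappa>_def by (intro continuous_intros cont) auto
  define Ed where "Ed = E x * (C * (\<tau> * x powr (\<tau> - 1)))"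
  define qd where "qd = (Ed * ave x - E x * ((h x - ave x) / x)) / (ave x * ave x)"
  have quot: "((\<lambda>y. (f x - f y) / (x - y)) \<longlongrightarrow> d) (at_left x)" if "(f has_real_derivative d) (at x)" for f :: "real \<Rightarrow> real" and d
  proof -
    have "((\<lambda>y. (f y - f x) / (y - x)) \<longlongrightarrow> d) (at x)" using that unfolding has_field_derivative_iff .
    then have "((\<lambda>y. (f y - f x) / (y - x)) \<longlongrightarrow> d) (at_left x)" by (rule filterlim_mono) (auto simp: at_le)
    moreover have "(f y - f x) / (y - x) = (f x - f y) / (x - y)" for y
      using minus_divide_divide[of "f x - f y" "x - y"] by simp
    ultimately show ?thesis by simp
  qed
  have "isCont q x" using DERIV_isCont[OF q'[OF x'(3) x(2)]] .
  then have qlim: "(q \<longlongrightarrow> q x) (at_left x)" unfolding isCont_def by (rule filterlim_mono) (auto simp: at_le)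
  \<comment> \<open>The product rule for differences, with K x - K y written as q y (h x - h y) + h
    x (q x - q y) + (E x - E y). The increment of \<open>h\<close> is replaced by its lower bound,
    the integral of \<kappa>, whose quotient has a limit.\<close>
  have lim: "((\<lambda>y. q y * (integral {y..x} \<kappa> / (x - y)) + h x * ((q x - q y) / (x - y)) + (E x - E y) / (x - y))
     \<longlongrightarrow> q x * \<kappa> x + h x * qd + Ed) (at_left x)"
    unfolding qd_def Ed_def
    by (intro tendsto_intros qlim integral_quotient[OF c\<kappa> x'(1,2)] quot q' E' x' x)
  have "0 \<le> q x * \<kappa> x + h x * qd + Ed"
  proof -
    define s where "s = x powr \<tau>"
    have s: "0 \<le> s" "s \<le> 1" using x' \<tau> by (auto simp: s_def powr_le1)
    have s1: "x powr (\<tau> - 1) = s / x" using x' by (simp add: s_def powr_diff)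
    have "0 \<le> 2 * (i x - e x * sqrt (h x)) / ave x - (h x / ave x - 1) * (h x / ave x) + (16 + 4 * k) * (k * s) * (h x / ave x + 1)"
    proof (rule frequency_inequality[OF x'(1,2)])
      show "prim h x = x * ave x" using x' by (simp add: ave_def)
      show "k * s \<le> k" using k s by (simp add: mult_left_le)
      show "e x \<le> k * s * sqrt (ave x)" using small[OF x'(3) x(2)] by (simp add: s_def)
    qed (use ave_pos k s in auto)
    moreover have "(16 + 4 * k) * (k * s) * (h x / ave x + 1) \<le> (C * \<tau> * s) * (h x / ave x + 1)"
    proof (rule mult_right_mono)
      show "(16 + 4 * k) * (k * s) \<le> C * \<tau> * s" using mult_right_mono[OF C s(1)] by (simp add: mult.assoc)
      show "0 \<le> h x / ave x + 1" using nonneg(1)[of x] ave_pos by simp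
    qed
    ultimately have "0 \<le> 2 * (i x - e x * sqrt (h x)) / ave x - (h x / ave x - 1) * (h x / ave x) + (C * \<tau> * s) * (h x / ave x + 1)" by linarith
    then have "0 \<le> (E x / x) * (2 * (i x - e x * sqrt (h x)) / ave x - (h x / ave x - 1) * (h x / ave x) + (C * \<tau> * s) * (h x / ave x + 1))"
      using x' by (intro mult_nonneg_nonneg) (auto simp: E_def)
    also have "\<dots> = q x * \<kappa> x + h x * qd + Ed"
      unfolding q_def \<kappa>_def qd_def Ed_def s1 using ave_pos x'(1) by (simp add: field_simps)
    finally show ?thesis .
  qed
  then have "- \<epsilon> < q x * \<kappa> x + h x * qd + Ed" using \<epsilon> by linarith
  from order_tendstoD(1)[OF lim this]
  have ev1: "\<forall>\<^sub>F y in at_left x. - \<epsilon> < q y * (integral {y..x} \<kappa> / (x - y)) + h x * ((q x - q y) / (x - y)) + (E x - E y) / (x - y)" .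
  have ev2: "\<forall>\<^sub>F y in at_left x. y \<in> {a<..<x}" using x by (intro eventually_at_leftI[of a]) auto
  have "\<exists>y. - \<epsilon> < q y * (integral {y..x} \<kappa> / (x - y)) + h x * ((q x - q y) / (x - y)) + (E x - E y) / (x - y) \<and> y \<in> {a<..<x}"
    using eventually_happens'[OF trivial_limit_at_left_real eventually_conj[OF ev1 ev2]] .
  then obtain y where y: "a < y" "y < x"
    and lt: "- \<epsilon> < q y * (integral {y..x} \<kappa> / (x - y)) + h x * ((q x - q y) / (x - y)) + (E x - E y) / (x - y)" by auto
  have "- \<epsilon> * (x - y) \<le> (q y * (integral {y..x} \<kappa> / (x - y)) + h x * ((q x - q y) / (x - y)) + (E x - E y) / (x - y)) * (x - y)"
    using lt y by (intro mult_right_mono) auto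
  also have "\<dots> = q y * integral {y..x} \<kappa> + h x * (q x - q y) + (E x - E y)"
    using y by (simp add: distrib_right)
  also have "\<dots> \<le> q y * (h x - h y) + h x * (q x - q y) + (E x - E y)"
  proof -
    define J where "J = integral {y..x} (\<lambda>z. (i z - e z * sqrt (h z)) / z)"
    have "J \<le> (h x - h y) / 2" unfolding J_def using h_lower[of y x] y ab x' by simp
    then have "integral {y..x} \<kappa> \<le> h x - h y"
      unfolding \<kappa>_def Henstock_Kurzweil_Integration.integral_mult_right J_def[symmetric] by simp
    moreover have "0 \<le> q y" using pos[of y] y x by (simp add: q_def E_def)
    ultimately have "q y * integral {y..x} \<kappa> \<le> q y * (h x - h y)" by (rule mult_left_mono)
    then show ?thesis by simp
  qed
  also have "\<dots> = K x - K y"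
    unfolding K_def E_def[symmetric] q_def by (simp add: divide_inverse algebra_simps)
  finally show "\<exists>y. a \<le> y \<and> y < x \<and> - \<epsilon> * (x - y) \<le> K x - K y" using y by (intro exI[of _ y]) auto
qed

end

section \<open>The maximum with a log-convex function\<close>

text \<open>Slopes with respect to \<open>T\<close> increase as for a convex function, although
  supporting lines are only local. If f exceeded its chord somewhere, take the leftmost maximum of f
  minus the chord: a supporting line there cannot rise relative to the chord, because of the points
  to the right, and hence yields another maximum to the left.\<close>

lemma local_support_convex:
  fixes f T :: "real \<Rightarrow> real"
  assumes cont: "continuous_on {x..w} f" "continuous_on {x..w} T"
    and T: "\<And>s t. x \<le> s \<Longrightarrow> s < t \<Longrightarrow> t \<le> w \<Longrightarrow> T s < T t"
    and supp: "\<And>c. x < c \<Longrightarrow> c < w \<Longrightarrow> \<exists>m. \<exists>\<delta>>0. \<forall>t. \<bar>t - c\<bar> < \<delta> \<longrightarrow> f c + m * (T t - T c) \<le> f t"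
    and y: "x < y" "y < w"
  shows "(f y - f x) / (T y - T x) \<le> (f w - f y) / (T w - T y)"
proof -
  have Tp: "0 < T y - T x" "0 < T w - T y" using T[of x y] T[of y w] y by auto
  define s where "s = (f w - f x) / (T w - T x)"
  define \<phi> where "\<phi> t = f t - f x - s * (T t - T x)" for t
  have c\<phi>: "continuous_on {x..w} \<phi>" unfolding \<phi>_def by (intro continuous_intros cont)
  have ends: "\<phi> x = 0" "\<phi> w = 0" using Tp by (auto simp: \<phi>_def s_def)
  have "\<phi> y \<le> 0"
  proof (rule ccontr)
    assume "\<not> \<phi> y \<le> 0"
    obtain c0 where c0: "c0 \<in> {x..w}" "\<And>t. t \<in> {x..w} \<Longrightarrow> \<phi> t \<le> \<phi> c0"
      using continuous_attains_sup[OF compact_Icc _ c\<phi>] y by auto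
    define S where "S = {t \<in> {x..w}. \<phi> c0 \<le> \<phi> t}"
    have "closed S" unfolding S_def by (intro continuous_on_closed_Collect_le continuous_intros c\<phi> closed_atLeastAtMost)
    moreover have bS: "bdd_below S" by (auto simp: S_def)
    moreover have "c0 \<in> S" using c0 by (simp add: S_def)
    ultimately have m: "Inf S \<in> S" by (intro closed_contains_Inf) auto
    \<comment> \<open>The maximum of \<phi> may be attained on a whole set; its leftmost point is
      the one that contradicts the existence of a supporting line.\<close>
    define c where "c = Inf S"
    have c: "c \<in> {x..w}" "\<phi> c = \<phi> c0" using m c0(2)[of c] by (auto simp: S_def c_def)
    have pos: "0 < \<phi> c" using c0(2)[of y] y \<open>\<not> \<phi> y \<le> 0\<close> c(2) by simp
    then have "c \<noteq> x" "c \<noteq> w" using ends by auto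
    then have cw: "x < c" "c < w" using c(1) by auto
    obtain k \<delta> where k: "0 < \<delta>" "\<And>t. \<bar>t - c\<bar> < \<delta> \<Longrightarrow> f c + k * (T t - T c) \<le> f t"
      using supp[OF cw] by blast
    define \<delta>' where "\<delta>' = min (\<delta> / 2) (min (c - x) (w - c))"
    have \<delta>': "0 < \<delta>'" "\<delta>' < \<delta>" "\<delta>' \<le> c - x" "\<delta>' \<le> w - c" using k(1) cw by (auto simp: \<delta>'_def)
    have le: "\<phi> c + (k - s) * (T t - T c) \<le> \<phi> t" if "\<bar>t - c\<bar> < \<delta>" for t
      using k(2)[OF that] by (simp add: \<phi>_def algebra_simps)
    have r: "c + \<delta>' \<in> {x..w}" and l: "c - \<delta>' \<in> {x..w}" using \<delta>' cw by auto
    have "(k - s) * (T (c + \<delta>') - T c) \<le> 0" using le[of "c + \<delta>'"] c0(2)[OF r] c(2) \<delta>' by simp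
    moreover have "0 < T (c + \<delta>') - T c" using T[of c "c + \<delta>'"] \<delta>' cw by simp
    ultimately have "k - s \<le> 0" by (simp add: mult_le_0_iff)
    have "0 \<le> (k - s) * (T (c - \<delta>') - T c)"
      using \<open>k - s \<le> 0\<close> T[of "c - \<delta>'" c] \<delta>' cw by (intro mult_nonpos_nonpos) auto
    then have "\<phi> c \<le> \<phi> (c - \<delta>')" using le[of "c - \<delta>'"] \<delta>' by simp
    then have "c - \<delta>' \<in> S" using l c(2) by (simp add: S_def)
    then have "c \<le> c - \<delta>'" unfolding c_def by (rule cInf_lower[OF _ bS])
    then show False using \<delta>' by simp
  qed
  then have A: "f y - f x \<le> s * (T y - T x)" by (simp add: \<phi>_def)
  have "f w - f x = s * (T w - T x)" using Tp by (simp add: s_def)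
  then have B: "s * (T w - T y) \<le> f w - f y" using A by (simp add: algebra_simps)
  have "(f y - f x) / (T y - T x) \<le> s" using A Tp by (simp add: pos_divide_le_eq)
  also have "s \<le> (f w - f y) / (T w - T y)" using B Tp by (simp add: pos_le_divide_eq)
  finally show ?thesis .
qed

text \<open>\<open>f\<close> is a convex function of the parameter \<open>T\<close>, and
  \<open>p\<close> is its right derivative with respect to \<open>T\<close>. Where \<open>p\<close>
  is continuous, the slopes from both sides are squeezed to the same limit, and the chain rule gives
  the derivative in r.\<close>

lemma convex_parametrized_derivative:
  fixes f T T' :: "real \<Rightarrow> real"
  assumes f: "continuous_on {0<..<1} f"
    and T: "\<And>r. 0 < r \<Longrightarrow> r < 1 \<Longrightarrow> (T has_real_derivative T' r) (at r)" "\<And>r. 0 < r \<Longrightarrow> r < 1 \<Longrightarrow> 0 < T' r"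
    and supp: "\<And>c. 0 < c \<Longrightarrow> c < 1 \<Longrightarrow> \<exists>m. \<exists>\<delta>>0. \<forall>t. \<bar>t - c\<bar> < \<delta> \<longrightarrow> f c + m * (T t - T c) \<le> f t"
  obtains p where "mono_on {0<..<1} p"
    "\<And>r. 0 < r \<Longrightarrow> r < 1 \<Longrightarrow> isCont p r \<Longrightarrow> (f has_real_derivative p r * T' r) (at r)"
proof -
  have Tm: "T s < T t" if "0 < s" "s < t" "t < 1" for s t
    by (rule DERIV_pos_imp_increasing[OF that(2)]) (use T that in \<open>meson less_le_trans le_less_trans\<close>)
  have Tc: "continuous_on {x..w} T" if "0 < x" "w < 1" for x w
    using that by (intro continuous_at_imp_continuous_on ballI DERIV_isCont[OF T(1)]) auto
  define S where "S x y = (f y - f x) / (T y - T x)" for x y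
  have three: "S x y \<le> S y w" if "0 < x" "x < y" "y < w" "w < 1" for x y w
    unfolding S_def
    by (rule local_support_convex) (use that Tm Tc supp f in \<open>auto intro: continuous_on_subset\<close>)
  \<comment> \<open>The infimum of the slopes to the right; bounded below by any slope from the
    left, which \<open>three\<close> provides.\<close>
  define p where "p x = Inf (S x ` {x<..<1})" for x
  have bdd: "bdd_below (S x ` {x<..<1})" if "0 < x" for x
    using that three[of "x / 2" x] by (intro bdd_belowI[of _ "S (x / 2) x"]) auto
  have p1: "p x \<le> S x y" if "0 < x" "x < y" "y < 1" for x y
    unfolding p_def by (rule cInf_lower[OF _ bdd]) (use that in auto)
  have p2: "S x y \<le> p y" if "0 < x" "x < y" "y < 1" for x y
    unfolding p_def
  proof (rule cInf_greatest)
    show "S y ` {y<..<1} \<noteq> {}" using that by (auto intro: dense)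
  qed (use that three in auto)
  have mono: "mono_on {0<..<1} p"
  proof (rule mono_onI)
    fix x y :: real assume "x \<in> {0<..<1}" "y \<in> {0<..<1}" "x \<le> y"
    then show "p x \<le> p y" using p1[of x y] p2[of x y] by (cases "x = y") auto
  qed
  have "(f has_real_derivative p r * T' r) (at r)" if r: "0 < r" "r < 1" and c: "isCont p r" for r
  proof -
    have S_sym: "S x y = S y x" for x y
      unfolding S_def using minus_divide_divide[of "f x - f y" "T x - T y"] by simp
    have lim: "((\<lambda>y. S r y) \<longlongrightarrow> p r) (at r)"
    proof (rule tendsto_sandwich[of "\<lambda>y. min (p r) (p y)" _ _ "\<lambda>y. max (p r) (p y)"])
      have ev: "\<forall>\<^sub>F y in at r. y \<in> {0<..<1} - {r}"
        using r by (intro eventually_at_in_open) auto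
      show "\<forall>\<^sub>F y in at r. min (p r) (p y) \<le> S r y" using ev
      proof eventually_elim
        case (elim y)
        then consider "r < y" | "y < r" by fastforce
        then show ?case
          by cases (use p1[of r y] p1[of y r] S_sym[of r y] r elim in \<open>auto simp: min_le_iff_disj\<close>)
      qed
      show "\<forall>\<^sub>F y in at r. S r y \<le> max (p r) (p y)" using ev
      proof eventually_elim
        case (elim y)
        then consider "r < y" | "y < r" by fastforce
        then show ?case
          by cases (use p2[of r y] p2[of y r] S_sym[of r y] r elim in \<open>auto simp: le_max_iff_disj\<close>)
      qed
      have "(p \<longlongrightarrow> p r) (at r)" using c unfolding isCont_def .
      from tendsto_min[OF tendsto_const this, of "p r"] tendsto_max[OF tendsto_const this, of "p r"]
      show "((\<lambda>y. min (p r) (p y)) \<longlongrightarrow> p r) (at r)" "((\<lambda>y. max (p r) (p y)) \<longlongrightarrow> p r) (at r)" by simp_all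
    qed
    have "((\<lambda>y. (T y - T r) / (y - r)) \<longlongrightarrow> T' r) (at r)"
      using T(1)[OF r] unfolding has_field_derivative_iff .
    from tendsto_mult[OF lim this]
    have "((\<lambda>y. S r y * ((T y - T r) / (y - r))) \<longlongrightarrow> p r * T' r) (at r)" .
    then have "((\<lambda>y. (f y - f r) / (y - r)) \<longlongrightarrow> p r * T' r) (at r)"
    proof (rule Lim_transform_eventually)
      have "\<forall>\<^sub>F y in at r. y \<in> {0<..<1} - {r}" using r by (intro eventually_at_in_open) auto
      then show "\<forall>\<^sub>F y in at r. S r y * ((T y - T r) / (y - r)) = (f y - f r) / (y - r)"
      proof eventually_elim
        case (elim y)
        then have "T y \<noteq> T r" using Tm[of y r] Tm[of r y] r by (cases "y < r") auto
        then show ?case by (simp add: S_def)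
      qed
    qed
    then show ?thesis unfolding has_field_derivative_iff .
  qed
  with mono show ?thesis using that by blast
qed


lemma continuous_on_log_convex:
  fixes \<mu> :: "real \<Rightarrow> real"
  assumes pos: "\<And>r. 0 < r \<Longrightarrow> r < 1 \<Longrightarrow> 0 < \<mu> r" and conv: "convex_on {..<0} (\<lambda>s. ln (\<mu> (exp s)))"
  shows "continuous_on {0<..<1} \<mu>"
proof -
  define g where "g s = ln (\<mu> (exp s))" for s
  have cg: "continuous_on {..<0} g"
    unfolding g_def using conv by (intro convex_on_continuous) auto
  have "continuous_on {0<..<1} (\<lambda>r::real. exp (g (ln r)))"
    by (intro continuous_intros continuous_on_compose2[OF cg]) auto
  then show ?thesis by (rule continuous_on_cong[THEN iffD1, rotated -1]) (auto simp: g_def pos)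
qed

context frequency_ode
begin

text \<open>A supporting line of one of two functions at a point where it attains the maximum also
  supports the maximum. So the two cases can be treated separately, and no information about the set
  where H and \<mu> cross is required.\<close>

lemma max_frequency:
  fixes \<mu> :: "real \<Rightarrow> real"
  assumes \<tau>: "0 < \<tau>" and k: "0 \<le> k" and C: "0 \<le> C" "(16 + 4 * k) * k \<le> C * \<tau>"
    and \<mu>: "\<And>r. 0 < r \<Longrightarrow> r < 1 \<Longrightarrow> 0 < \<mu> r" "mono_on {0<..<1} \<mu>"
    and conv: "convex_on {..<0} (\<lambda>s. ln (\<mu> (exp s)))"
    and small: "\<And>r. 0 < r \<Longrightarrow> r < 1 \<Longrightarrow> e (r\<^sup>2) \<le> (k * r\<^sup>2 powr \<tau>) * sqrt (\<mu> r)"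
  obtains \<psi> where "mono_on {0<..<1} \<psi>"
    "AE r in lebesgue_on {0<..<1}. (\<lambda>s. ln (max (ave (s\<^sup>2)) (\<mu> s))) differentiable (at r) \<and>
       1 / 2 * r * exp (C * r powr (2 * \<tau>)) * deriv (\<lambda>s. ln (max (ave (s\<^sup>2)) (\<mu> s))) r
         + 2 * (exp (C * r powr (2 * \<tau>)) - 1) = \<psi> r"
proof -
  define g where "g s = ln (\<mu> (exp s))" for s
  define E where "E r = exp (C * r powr (2 * \<tau>))" for r
  define T' where "T' r = 1 / (r * E r)" for r
  define T where "T r = - integral {r..1} T'" for r
  define K where "K z = exp (C * z powr \<tau>) * (h z / ave z + 1)" for z
  define F where "F s = ln (max (ave (s\<^sup>2)) (\<mu> s))" for s
  define R where "R s = F s / 2 + 2 * ln s" for s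
  have E_pos: "0 < E r" for r by (simp add: E_def)
  have E_le: "E x \<le> E y" if "0 < x" "x \<le> y" for x y
    using that C(1) \<tau> by (auto simp: E_def intro!: mult_left_mono powr_mono2)
  have T'_pos: "0 < T' r" if "0 < r" for r using that E_pos by (simp add: T'_def)
  have cT': "continuous_on {a..b} T'" if "0 < a" for a b
    unfolding T'_def E_def using that by (intro continuous_intros) auto
  have T: "(T has_real_derivative T' r) (at r)" if r: "0 < r" "r < 1" for r
  proof -
    define a where "a = r / 2"
    have a: "0 < a" "a < r" using r by (auto simp: a_def)
    have "((\<lambda>x. integral {a..x} T' - integral {a..1} T') has_real_derivative T' r) (at r within {a..1})"
      using integral_has_real_derivative[OF cT'[OF a(1)], of r 1] a r by (auto intro!: derivative_eq_intros)
    then have "((\<lambda>x. integral {a..x} T' - integral {a..1} T') has_real_derivative T' r) (at r)"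
      by (simp only: at_within_Icc_at[OF a(2) r(2)])
    then show ?thesis
    proof (rule has_field_derivative_transform_within_open[OF _ open_greaterThanLessThan[of a 1]])
      fix x assume "x \<in> {a<..<1}"
      then have "integral {a..x} T' + integral {x..1} T' = integral {a..1} T'"
        by (intro Henstock_Kurzweil_Integration.integral_combine integrable_continuous_real cT') (use a in auto)
      then show "integral {a..x} T' - integral {a..1} T' = T x" by (simp add: T_def)
    qed (use a r in auto)
  qed
  have \<mu>_eq: "\<mu> r = exp (g (ln r))" if "0 < r" "r < 1" for r using that \<mu>(1)[OF that] by (simp add: g_def)
  have c\<mu>: "continuous_on {0<..<1} \<mu>" by (rule continuous_on_log_convex[OF \<mu>(1) conv])
  have sq: "0 < r\<^sup>2" "r\<^sup>2 < 1" if "0 < r" "r < 1" for r :: real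
    using that by (auto simp: power_less_one_iff)
  have cA: "continuous_on {0<..<1} (\<lambda>s. ave (s\<^sup>2))"
  proof (rule continuous_at_imp_continuous_on, rule ballI)
    fix s :: real assume s: "s \<in> {0<..<1}"
    then have "isCont ave (s\<^sup>2)" by (intro DERIV_isCont[OF ave_deriv]) (auto simp: sq)
    moreover have "isCont (\<lambda>s. s\<^sup>2) s" by (intro continuous_intros)
    ultimately show "isCont (\<lambda>s. ave (s\<^sup>2)) s" by (rule isCont_o2[rotated])
  qed
  have Mp: "0 < max (ave (r\<^sup>2)) (\<mu> r)" if "0 < r" "r < 1" for r using \<mu>(1)[OF that] by (simp add: less_max_iff_disj)
  have cR: "continuous_on {0<..<1} R"
    unfolding R_def F_def
    by (intro continuous_intros c\<mu> cA) (use Mp in \<open>auto simp: less_imp_neq[THEN not_sym]\<close>)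
  have support: "\<exists>m. \<exists>\<delta>>0. \<forall>t. \<bar>t - c\<bar> < \<delta> \<longrightarrow> R c + m * (T t - T c) \<le> R t" if c: "0 < c" "c < 1" for c
  proof (cases "ave (c\<^sup>2) \<le> \<mu> c")
    case True
    \<comment> \<open>A subgradient at ln c of the convex function ln \<mu> of the
      logarithm.\<close>
    define l where "l = Inf ((\<lambda>t. (g (ln c) - g t) / (ln c - t)) ` ({ln c<..} \<inter> {..<0}))"
    have l: "g (ln c) + l * (s - ln c) \<le> g s" if "s < 0" for s
      proof -
      have "ln c \<in> interior {..<0}" using c by (simp add: interior_open)
      from convex_le_Inf_differential[OF conv this, of s] show ?thesis using that by (simp add: l_def g_def)
    qed
    \<comment> \<open>Monotonicity of \<mu> enters here: a nonnegative slope lets the supporting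
      line in ln r be replaced by a smaller one in \<open>T\<close>.\<close>
    have "0 \<le> l"
    proof -
      have "\<mu> (c / 2) \<le> \<mu> c" by (rule mono_onD[OF \<mu>(2)]) (use c in auto)
      then have "g (ln (c / 2)) \<le> g (ln c)" using \<mu>_eq[of c] \<mu>_eq[of "c / 2"] c by simp
      then have "g (ln c - ln 2) \<le> g (ln c)" using c by (simp add: ln_div)
      moreover have "ln c - ln 2 < 0" using ln_less_zero[OF c] ln_gt_zero[of "2 :: real"] by linarith
      ultimately have "0 \<le> l * ln 2" using l[of "ln c - ln 2"] by simp
      then show ?thesis by (simp add: zero_le_mult_iff)
    qed
    define m0 where "m0 = l / 2 + 2"
    have m0: "0 \<le> m0" using \<open>0 \<le> l\<close> by (simp add: m0_def)
    \<comment> \<open>The derivative of ln with respect to \<open>T\<close> is \<open>E\<close>,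
      which increases with r. Thus ln is convex as a function of \<open>T\<close>, and its tangent
      at \<open>c\<close> has slope E c.\<close>
    have W: "((\<lambda>t. ln t - E c * T t) has_real_derivative 1 / t * (1 - E c / E t)) (at t)" if "0 < t" "t < 1" for t
      by (rule DERIV_cong[OF DERIV_diff[OF DERIV_ln DERIV_cmult[OF T[OF that]]]])
         (use that E_pos[of t] in \<open>auto simp: T'_def field_simps\<close>)
    have ineq: "ln c - E c * T c \<le> ln t - E c * T t" if t: "0 < t" "t < 1" for t
    proof (cases "c \<le> t")
      case True
      show ?thesis
      proof (rule DERIV_nonneg_imp_nondecreasing[OF True])
        fix x assume "c \<le> x" "x \<le> t"
        then show "\<exists>y. ((\<lambda>t. ln t - E c * T t) has_real_derivative y) (at x) \<and> 0 \<le> y"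
          using W[of x] c t E_le[of c x] E_pos[of x] by (intro exI[of _ "1 / x * (1 - E c / E x)"]) auto
      qed
    next
      case False
      show ?thesis
      proof (rule DERIV_nonpos_imp_nonincreasing[of t c])
        fix x assume "t \<le> x" "x \<le> c"
        then show "\<exists>y. ((\<lambda>t. ln t - E c * T t) has_real_derivative y) (at x) \<and> y \<le> 0"
          using W[of x] c t E_le[of x c] E_pos[of x] by (intro exI[of _ "1 / x * (1 - E c / E x)"]) (auto intro!: mult_nonneg_nonpos simp: divide_le_0_iff)
      qed (use False in simp)
    qed
    have "R c + (m0 * E c) * (T t - T c) \<le> R t" if t: "\<bar>t - c\<bar> < min c (1 - c)" for t
    proof -
      have t': "0 < t" "t < 1" using t by (auto simp: abs_less_iff)
      have "(m0 * E c) * (T t - T c) \<le> m0 * (ln t - ln c)"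
        using mult_left_mono[OF ineq[OF t'] m0] by (simp add: algebra_simps)
      moreover have "g (ln t) \<le> F t"
        unfolding F_def using \<mu>(1)[OF t'] t' by (simp add: g_def)
      moreover have "F c = g (ln c)" using True c by (simp add: F_def g_def max_def)
      moreover have "m0 * (ln t - ln c) = l * (ln t - ln c) / 2 + 2 * (ln t - ln c)"
        by (simp add: m0_def field_simps)
      moreover have "g (ln c) + l * (ln t - ln c) \<le> g (ln t)" using l[of "ln t"] t' by simp
      moreover have "Fc / 2 + 2 * lc + X \<le> Ft / 2 + 2 * lt"
        if "X \<le> Y" "gt \<le> Ft" "Fc = gc" "Y = L / 2 + 2 * (lt - lc)" "gc + L \<le> gt" for Fc Ft X Y gt gc L lt lc :: real
        using that by argo
      ultimately show ?thesis unfolding R_def by blast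
    qed
    then show ?thesis using c by (intro exI[of _ "m0 * E c"] exI[of _ "min c (1 - c)"]) auto
  next
    case False
    have "open {s \<in> {0<..<1}. \<mu> s < ave (s\<^sup>2)}"
      using continuous_open_preimage[OF continuous_on_diff[OF cA c\<mu>] open_greaterThanLessThan open_greaterThan[of 0]]
      by (simp add: vimage_def Int_def conj_commute)
    moreover have "c \<in> {s \<in> {0<..<1}. \<mu> s < ave (s\<^sup>2)}" using False c by auto
    ultimately obtain \<delta> where \<delta>: "0 < \<delta>" "ball c \<delta> \<subseteq> {s \<in> {0<..<1}. \<mu> s < ave (s\<^sup>2)}"
      unfolding open_contains_ball by blast
    have near: "0 < t \<and> t < 1 \<and> \<mu> t < ave (t\<^sup>2)" if "\<bar>t - c\<bar> < \<delta>" for t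
      using \<delta>(2) that by (auto simp: ball_def dist_real_def abs_minus_commute)
    have K_mono: "K (x\<^sup>2) \<le> K (y\<^sup>2)" if "\<bar>x - c\<bar> < \<delta>" "\<bar>y - c\<bar> < \<delta>" "x \<le> y" for x y
      unfolding K_def
    proof (rule weighted_frequency_mono[OF _ _ _ \<tau> k C(2)])
      have x: "0 < x" and y: "y < 1" "0 < y" using near[OF that(1)] near[OF that(2)] by auto
      show "0 < x\<^sup>2" "x\<^sup>2 \<le> y\<^sup>2" "y\<^sup>2 < 1" using x y that sq[of y] by (auto intro: power_mono)
      fix z assume z: "x\<^sup>2 \<le> z" "z \<le> y\<^sup>2"
      have z0: "0 < z" using z x by (smt (verit) zero_less_power)
      have "x \<le> sqrt z" "sqrt z \<le> y" using z x y by (auto intro: real_le_rsqrt real_le_lsqrt)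
      then have "\<bar>sqrt z - c\<bar> < \<delta>" using that by (auto simp: abs_less_iff)
      note n = near[OF this]
      show "0 < ave z" using n \<mu>(1)[of "sqrt z"] z0 by simp
      have "e z \<le> (k * z powr \<tau>) * sqrt (\<mu> (sqrt z))" using small[of "sqrt z"] n z0 by simp
      also have "\<dots> \<le> (k * z powr \<tau>) * sqrt (ave z)" using n z0 k by (intro mult_left_mono) auto
      finally show "e z \<le> (k * z powr \<tau>) * sqrt (ave z)" .
    qed
    define m where "m = K (c\<^sup>2)"
    define W where "W t = ln (ave (t\<^sup>2)) / 2 + 2 * ln t - m * T t" for t
    have W: "(W has_real_derivative (K (t\<^sup>2) - m) * T' t) (at t)" if "\<bar>t - c\<bar> < \<delta>" for t
    proof -
      have t: "0 < t" "t < 1" "0 < ave (t\<^sup>2)" using near[OF that] \<mu>(1)[of t] by auto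
      have e1: "(t\<^sup>2) powr \<tau> = t powr (2 * \<tau>)" using t powr_powr[of t 2 \<tau>] by simp
      have "((\<lambda>t. t\<^sup>2) has_real_derivative 2 * t) (at t)" by (auto intro!: derivative_eq_intros)
      from DERIV_chain2[OF ave_deriv[OF sq[OF t(1,2)]] this]
      have A: "((\<lambda>t. ave (t\<^sup>2)) has_real_derivative (h (t\<^sup>2) - ave (t\<^sup>2)) / t\<^sup>2 * (2 * t)) (at t)" .
      have B: "((\<lambda>t. ln (ave (t\<^sup>2))) has_real_derivative inverse (ave (t\<^sup>2)) * ((h (t\<^sup>2) - ave (t\<^sup>2)) / t\<^sup>2 * (2 * t))) (at t)"
        by (rule DERIV_chain2[OF DERIV_ln A]) (use t in simp)
      \<comment> \<open>The derivative of R with respect to \<open>T\<close> is exactly the monotone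
        quantity \<open>K\<close> at t^2. Hence R - m T, with m its value at \<open>c\<close>,
        decreases before \<open>c\<close> and increases after it.\<close>
      have eq: "inverse (ave (t\<^sup>2)) * ((h (t\<^sup>2) - ave (t\<^sup>2)) / t\<^sup>2 * (2 * t)) / 2 + 2 * (1 / t) = K (t\<^sup>2) * T' t"
        using t(1,3) E_pos[of t] unfolding K_def e1 E_def[symmetric] T'_def by (simp add: field_simps power2_eq_square)
      show ?thesis unfolding W_def
        by (rule DERIV_cong[OF DERIV_diff[OF DERIV_add[OF DERIV_cdivide[OF B] DERIV_cmult[OF DERIV_ln_divide[OF t(1)]]] DERIV_cmult[OF T[OF t(1,2)]]]])
           (simp only: eq left_diff_distrib)
    qed
    have "W c \<le> W t" if t: "\<bar>t - c\<bar> < \<delta>" for t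
    proof (cases "c \<le> t")
      case True
      show ?thesis
      proof (rule DERIV_nonneg_imp_nondecreasing[OF True])
        fix x assume "c \<le> x" "x \<le> t"
        then have x: "\<bar>x - c\<bar> < \<delta>" using t by (auto simp: abs_less_iff)
        then have "0 \<le> (K (x\<^sup>2) - m) * T' x"
          using K_mono[of c x] T'_pos[of x] near[OF x] \<open>c \<le> x\<close> \<delta> by (auto simp: m_def intro!: mult_nonneg_nonneg)
        then show "\<exists>y. (W has_real_derivative y) (at x) \<and> 0 \<le> y" using W[OF x] by blast
      qed
    next
      case False
      show ?thesis
      proof (rule DERIV_nonpos_imp_nonincreasing[of t c])
        fix x assume "t \<le> x" "x \<le> c"
        then have x: "\<bar>x - c\<bar> < \<delta>" using t by (auto simp: abs_less_iff)
        then have "(K (x\<^sup>2) - m) * T' x \<le> 0"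
          using K_mono[of x c] T'_pos[of x] near[OF x] \<open>x \<le> c\<close> \<delta> by (auto simp: m_def intro!: mult_nonpos_nonneg)
        then show "\<exists>y. (W has_real_derivative y) (at x) \<and> y \<le> 0" using W[OF x] by blast
      qed (use False in simp)
    qed
    moreover have "R t = W t + m * T t" if "\<bar>t - c\<bar> < \<delta>" for t
      using near[OF that] by (simp add: R_def F_def W_def max_def)
    ultimately have "R c + m * (T t - T c) \<le> R t" if "\<bar>t - c\<bar> < \<delta>" for t
      using that \<delta>(1) by (simp add: right_diff_distrib)
    then show ?thesis using \<delta>(1) by blast
  qed
  obtain p where p: "mono_on {0<..<1} p"
    "\<And>r. 0 < r \<Longrightarrow> r < 1 \<Longrightarrow> isCont p r \<Longrightarrow> (R has_real_derivative p r * T' r) (at r)"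
    by (rule convex_parametrized_derivative[OF cR T T'_pos support]) auto
  \<comment> \<open>A monotone function has countably many discontinuities, so the exceptional set
    is null.\<close>
  define N where "N = {r \<in> {0<..<1}. \<not> isCont p r}"
  have "countable N" unfolding N_def by (rule mono_on_ctble_discont_open[OF _ p(1)]) auto
  then have "N \<in> null_sets lebesgue"
    using countable_imp_null_set_lborel null_sets_completionI by blast
  then have "AE r in lebesgue. r \<notin> N" by (rule AE_not_in)
  then have ae: "AE r in lebesgue_on {0<..<1}. r \<in> {0<..<1} \<and> isCont p r"
    by (subst AE_restrict_space_iff) (auto simp: N_def elim!: eventually_mono)
  show ?thesis
  proof (rule that)
    \<comment> \<open>The 2 comes from the constant in \<Phi>: \<open>p\<close> represents \<Phi> +
      2.\<close>
    show "mono_on {0<..<1} (\<lambda>r. p r - 2)" using p(1) by (auto simp: mono_on_def)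
    show "AE r in lebesgue_on {0<..<1}. (\<lambda>s. ln (max (ave (s\<^sup>2)) (\<mu> s))) differentiable (at r) \<and>
       1 / 2 * r * exp (C * r powr (2 * \<tau>)) * deriv (\<lambda>s. ln (max (ave (s\<^sup>2)) (\<mu> s))) r
         + 2 * (exp (C * r powr (2 * \<tau>)) - 1) = p r - 2"
      using ae
    proof eventually_elim
      case (elim r)
      then have r: "0 < r" "r < 1" by auto
      have "((\<lambda>s. 2 * R s - 4 * ln s) has_real_derivative 2 * (p r * T' r) - 4 * (1 / r)) (at r)"
        by (intro DERIV_diff DERIV_cmult p(2) DERIV_ln_divide) (use elim in auto)
      then have D: "(F has_real_derivative 2 * (p r * T' r) - 4 * (1 / r)) (at r)"
        by (rule has_field_derivative_transform_within_open[OF _ open_greaterThanLessThan[of 0 1]])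
           (use elim in \<open>auto simp: R_def\<close>)
      have "deriv F r = 2 * (p r * T' r) - 4 * (1 / r)" by (rule DERIV_imp_deriv[OF D])
      moreover have "F differentiable (at r)" using D unfolding real_differentiable_def by blast
      ultimately show ?case
        using r E_pos[of r] unfolding F_def[symmetric] E_def[symmetric] by (simp add: T'_def field_simps)
    qed
  qed
qed

end

text \<open>The bounds hold uniformly up to z = 0, although the support of v in y may spread as z
  tends to 0. With the finite mass of the Gaussian they make height and energy bounded.\<close>

locale bounded_signorini_flow = signorini_flow u f gu M c for u f :: "('m::finite) spt \<Rightarrow> real" and gu M c +
  fixes B :: real
  assumes bounded: "\<And>x t. x \<in> half_space_closed \<Longrightarrow> -1 < t \<Longrightarrow> t < 0 \<Longrightarrow> \<bar>u (x, t)\<bar> \<le> B \<and> norm (gu (x, t)) \<le> B"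
    and e_mono: "\<And>x y. 0 < x \<Longrightarrow> x \<le> y \<Longrightarrow> y < 1 \<Longrightarrow> x * c x \<le> y * c y"
begin

lemma gint_bound:
  fixes F :: "'m sp \<Rightarrow> real"
  assumes F: "continuous_on half_space_closed F" "\<And>y. y \<in> half_space_closed \<Longrightarrow> R < norm y \<Longrightarrow> F y = 0"
    "\<And>y. y \<in> half_space \<Longrightarrow> F y \<le> A" and A: "0 \<le> A"
  shows "gint F \<le> A * (LINT y|lborel. gauss (y :: 'm sp))"
proof -
  have "gint F \<le> (LINT y|lborel. A * gauss (y :: 'm sp))"
    unfolding gint_def
  proof (rule integral_mono[OF gint_integrable[OF F(1,2)]])
    show "integrable lborel (\<lambda>y. A * gauss (y :: 'm sp))" by (rule integrable_mult_right) (rule integrable_gauss)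
    show "indicator half_space y * (F y * gauss y) \<le> A * gauss y" for y
      using F(3)[of y] A gauss_nonneg[of y] by (auto simp: indicator_def intro!: mult_right_mono)
  qed
  then show ?thesis by simp
qed

lemma bounded_v:
  assumes "y \<in> half_space_closed" "0 < z" "z < 1"
  shows "(v y z)\<^sup>2 \<le> B\<^sup>2" "gv y z \<bullet> gv y z \<le> B\<^sup>2"
proof -
  have "sqrt z *\<^sub>R y \<in> half_space_closed" using assms by (simp add: half_space_closed_def)
  then have b: "\<bar>u (sqrt z *\<^sub>R y, - z)\<bar> \<le> B" "norm (gu (sqrt z *\<^sub>R y, - z)) \<le> B" using bounded[of "sqrt z *\<^sub>R y" "- z"] assms by auto
  show "(v y z)\<^sup>2 \<le> B\<^sup>2" using power_mono[OF b(1), of 2] by (simp add: v_def)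
  have "sqrt z * norm (gu (sqrt z *\<^sub>R y, - z)) \<le> 1 * B" using b assms by (intro mult_mono) auto
  then have "norm (gv y z) \<le> B" using assms by (simp add: gv_def)
  then show "gv y z \<bullet> gv y z \<le> B\<^sup>2" using power_mono[of "norm (gv y z)" B 2] by (simp add: dot_square_norm)
qed

lemma tame_h: "tame h" and tame_en: "tame en"
proof -
  let ?A = "B\<^sup>2 * (LINT y|lborel. gauss (y :: 'm sp))"
  have "h z \<le> ?A" and "en z \<le> ?A" if z: "0 < z" "z < 1" for z
  proof -
    obtain R where R: "\<And>y. y \<in> half_space_closed \<Longrightarrow> R < norm y \<Longrightarrow> v y z = 0 \<and> gv y z = 0"
      using supp_v[OF z(1)] z by (metis order_refl)
    have sub: "y \<in> half_space_closed" if "y \<in> half_space" for y :: "'m sp" using that half_sub by blast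
    show "h z \<le> ?A" unfolding h_def
      by (rule gint_bound[where R = R]) (use R z bounded_v sub in \<open>auto intro!: continuous_intros cont_v_slice\<close>)
    show "en z \<le> ?A" unfolding en_def
      by (rule gint_bound[where R = R]) (use R z bounded_v sub in \<open>auto intro!: continuous_intros cont_gv_slice\<close>)
  qed
  then have "\<bar>h z\<bar> \<le> ?A \<and> \<bar>en z\<bar> \<le> ?A" if "0 < z" "z \<le> b" "b < 1" for z b using that h_nonneg[of z] en_nonneg[of z] by auto
  then show "tame h" "tame en" unfolding tame_def using continuous_h continuous_en by blast+
qed

lemma tame_e: "tame (\<lambda>z. z * c z)"
proof -
  have "\<exists>B. \<forall>z. 0 < z \<longrightarrow> z \<le> b \<longrightarrow> \<bar>z * c z\<bar> \<le> B" if "b < 1" for b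
    using e_mono[of _ b] c_nonneg that by (intro exI[of _ "b * c b"]) auto
  then show ?thesis unfolding tame_def using cont_c by (auto intro!: continuous_intros)
qed

lemma frequency_ode: "frequency_ode h en (\<lambda>z. z * c z) D"
proof
  show "tame h" "tame en" "tame (\<lambda>z. z * c z)" by (fact tame_h tame_en tame_e)+
  show "0 \<le> h z" "0 \<le> en z" "0 \<le> D b z" for b z by (fact h_nonneg en_nonneg D_nonneg)+
  show "0 \<le> z * c z" if "0 < z" "z < 1" for z using c_nonneg that by simp
  show "x * c x \<le> y * c y" if "0 < x" "x \<le> y" "y < 1" for x y by (rule e_mono[OF that])
  show "continuous_on {0<..<1} (D b)" if "0 < b" "b < 1" for b by (rule continuous_D[OF that])
  fix a b :: real assume ab: "0 < a" "a < b" "b < 1"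
  have "integral {a..b} (\<lambda>z. (en z - z * c z * sqrt (h z)) / z) = integral {a..b} (\<lambda>z. - (- (1 * en z) / z + c z * sqrt (h z)))"
    by (rule integral_cong) (use ab in \<open>simp add: diff_divide_distrib\<close>)
  then show "integral {a..b} (\<lambda>z. (en z - z * c z * sqrt (h z)) / z) \<le> (h b - h a) / 2"
    unfolding Henstock_Kurzweil_Integration.integral_neg using growth[OF disjI1[OF refl] ab] by linarith
  have "integral {a..b} (\<lambda>z. (en z + z * c z * sqrt (h z)) / z) = integral {a..b} (\<lambda>z. - (- 1 * en z) / z + c z * sqrt (h z))"
    by (rule integral_cong) (use ab in \<open>simp add: add_divide_distrib\<close>)
  then show "(h b - h a) / 2 \<le> integral {a..b} (\<lambda>z. (en z + z * c z * sqrt (h z)) / z)"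
    using growth[of "- 1", OF _ ab] by simp
  show "h b - h a \<le> 2 * sqrt (h b) * sqrt (D b a)" using h_diff_le[of b a] ab by simp
  have "integral {a..b} (\<lambda>z. (en b - en z) / (2 * z) + z * c z / z * sqrt (D b z)) = integral {a..b} (\<lambda>z. (en b - en z) / (2 * z) + c z * sqrt (D b z))"
    by (rule integral_cong) (use ab in simp)
  then show "D b a / 2 \<le> integral {a..b} (\<lambda>z. (en b - en z) / (2 * z) + z * c z / z * sqrt (D b z))"
    using distance_growth[OF ab] by simp
qed

end

section \<open>The function H as an average in self-similar variables\<close>

lemma G_scale:
  fixes y :: "('m::finite) sp"
  assumes "0 < z"
  shows "sqrt z ^ DIM('m sp) * G (sqrt z *\<^sub>R y, - z) = gauss y"
proof -
  let ?n = "DIM('m sp)"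
  have a: "(4 * pi * z) powr (- real ?n / 2) = (4 * pi) powr (- real ?n / 2) * z powr (- real ?n / 2)"
    using assms by (simp add: powr_mult)
  have c: "sqrt z ^ n * z powr (- real n / 2) = 1" for n :: nat
  proof -
    have "sqrt z ^ n = sqrt z powr real n" using assms by (simp add: powr_realpow)
    also have "\<dots> = (z powr (1 / 2)) powr real n" using assms powr_half_sqrt[of z] by simp
    also have "\<dots> = z powr (real n / 2)" by (simp add: powr_powr)
    finally have "sqrt z ^ n * z powr (- real n / 2) = z powr (real n / 2 + - real n / 2)"
      by (simp only: powr_add)
    also have "real n / 2 + - real n / 2 = 0" by simp
    finally show ?thesis using assms by simp
  qed
  have e: "(norm (sqrt z *\<^sub>R y))\<^sup>2 / (4 * - z) = - (norm y)\<^sup>2 / 4"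
    using assms by (simp add: power_mult_distrib)
  have "G (sqrt z *\<^sub>R y, - z) = (4 * pi * z) powr (- real ?n / 2) * exp ((norm (sqrt z *\<^sub>R y))\<^sup>2 / (4 * - z))"
    using assms by (simp add: G_def)
  also have "\<dots> = z powr (- real ?n / 2) * gauss y"
    unfolding a e gauss_def by (simp only: mult_ac)
  finally have "sqrt z ^ ?n * G (sqrt z *\<^sub>R y, - z) = (sqrt z ^ ?n * z powr (- real ?n / 2)) * gauss y"
    by (simp only: mult_ac)
  then show ?thesis by (simp only: c mult_1)
qed

context bounded_signorini_flow
begin

lemma H_eq_average:
  assumes r: "0 < r" "r < 1"
  shows "H u r = prim h (r\<^sup>2) / r\<^sup>2"
proof -
  have r2: "0 < r\<^sup>2" "r\<^sup>2 < 1" using r by (auto simp: power_less_one_iff)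
  define T where "T \<epsilon> = (half_space :: 'm sp set) \<times> {- r\<^sup>2<..- \<epsilon>}" for \<epsilon> :: real
  define F where "F \<epsilon> p = indicator (T \<epsilon>) p * ((u p)\<^sup>2 * G p)" for \<epsilon> p
  obtain R0 where R0: "\<And>x t. x \<in> half_space_closed \<Longrightarrow> -1 < t \<Longrightarrow> t < 0 \<Longrightarrow> R0 < norm x \<Longrightarrow> u (x, t) = 0 \<and> gu (x, t) = 0"
    using supp by blast
  have meas: "F \<epsilon> \<in> borel_measurable borel" if \<epsilon>: "0 < \<epsilon>" for \<epsilon>
  proof -
    have "T \<epsilon> \<in> sets borel" unfolding T_def by (intro borel_Times) auto
    moreover have "continuous_on (T \<epsilon>) (\<lambda>p. (u p)\<^sup>2 * ((- 4 * pi * snd p) powr (- real DIM('m sp) / 2) * exp ((norm (fst p))\<^sup>2 / (4 * snd p))))"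
      by (intro continuous_intros continuous_on_subset[OF cont_u'])
         (use \<epsilon> r2 half_sub in \<open>auto simp: T_def mult_neg_pos\<close>)
    ultimately have "(\<lambda>p. indicator (T \<epsilon>) p *\<^sub>R ((u p)\<^sup>2 * ((- 4 * pi * snd p) powr (- real DIM('m sp) / 2) * exp ((norm (fst p))\<^sup>2 / (4 * snd p))))) \<in> borel_measurable borel"
      by (rule borel_measurable_continuous_on_indicator)
    moreover have "(\<lambda>p. indicator (T \<epsilon>) p *\<^sub>R ((u p)\<^sup>2 * ((- 4 * pi * snd p) powr (- real DIM('m sp) / 2) * exp ((norm (fst p))\<^sup>2 / (4 * snd p))))) = F \<epsilon>"
      using \<epsilon> by (auto simp: F_def T_def G_def indicator_def fun_eq_iff)
    ultimately show ?thesis by simp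
  qed
  have G_bound: "0 \<le> G p \<and> G p \<le> (4 * pi * \<epsilon>) powr (- real DIM('m sp) / 2)" if "p \<in> T \<epsilon>" "0 < \<epsilon>" for p \<epsilon>
  proof -
    obtain x t where xt: "p = (x, t)" by (cases p)
    with that have p: "p = (x, t)" "t \<le> - \<epsilon>" by (auto simp: T_def)
    have "4 * pi * \<epsilon> \<le> - 4 * pi * t" using mult_left_mono[of \<epsilon> "- t" "4 * pi"] p by simp
    then
    have "(- 4 * pi * t) powr (- real DIM('m sp) / 2) \<le> (4 * pi * \<epsilon>) powr (- real DIM('m sp) / 2)"
      using that by (intro powr_mono2') auto
    moreover have "exp ((norm x)\<^sup>2 / (4 * t)) \<le> 1" using p that by (simp add: divide_nonneg_neg)
    ultimately have "(- 4 * pi * t) powr (- real DIM('m sp) / 2) * exp ((norm x)\<^sup>2 / (4 * t)) \<le> (4 * pi * \<epsilon>) powr (- real DIM('m sp) / 2) * 1"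
      by (intro mult_mono) auto
    then show ?thesis using p that by (simp add: G_def)
  qed
  have int: "integrable lborel (F \<epsilon>)" if \<epsilon>: "0 < \<epsilon>" for \<epsilon>
  proof (rule integrable_bounded_support[OF meas[OF \<epsilon>]])
    show "bounded (cball (0 :: 'm sp) (max R0 0) \<times> {-1..0::real})" by (intro bounded_Times) auto
    show "F \<epsilon> p = 0" if "p \<notin> cball (0 :: 'm sp) (max R0 0) \<times> {-1..0}" for p
    proof (cases "p \<in> T \<epsilon>")
      case True
      then have t: "fst p \<in> half_space_closed" "-1 < snd p" "snd p < 0" using r2 \<epsilon> half_sub by (auto simp: T_def)
      then have "R0 < norm (fst p)" using that by (auto simp: mem_Times_iff)
      from R0[OF t this] show ?thesis by (simp add: F_def)
    qed (simp add: F_def)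
    show "norm (F \<epsilon> p) \<le> B\<^sup>2 * (4 * pi * \<epsilon>) powr (- real DIM('m sp) / 2)" for p
    proof (cases "p \<in> T \<epsilon>")
      case True
      then have t: "fst p \<in> half_space_closed" "-1 < snd p" "snd p < 0" using r2 \<epsilon> half_sub by (auto simp: T_def)
      have "(u p)\<^sup>2 \<le> B\<^sup>2" using power_mono[of "\<bar>u p\<bar>" B 2] bounded[OF t] by simp
      then have "(u p)\<^sup>2 * G p \<le> B\<^sup>2 * (4 * pi * \<epsilon>) powr (- real DIM('m sp) / 2)"
        using G_bound[OF True \<epsilon>] by (intro mult_mono) auto
      then show ?thesis using True G_bound[OF True \<epsilon>] by (simp add: F_def)
    qed (simp add: F_def)
  qed
  have I: "(LINT p|lborel. F \<epsilon> p) = prim h (r\<^sup>2) - prim h \<epsilon>" if \<epsilon>: "0 < \<epsilon>" "\<epsilon> < r\<^sup>2" for \<epsilon>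
  proof -
    have "(LINT p|lborel. F \<epsilon> p) = (LINT z|lborel. indicator {0<..} z * (LINT y|lborel. sqrt z ^ DIM('m sp) * F \<epsilon> (sqrt z *\<^sub>R y, - z)))"
      by (rule parabolic_change_of_variables(1)[OF int[OF \<epsilon>(1)] meas[OF \<epsilon>(1)]]) (use \<epsilon> in \<open>auto simp: F_def T_def\<close>)
    also have "\<dots> = (LINT z|lborel. indicator {0<..<r\<^sup>2} z * h z - indicator {0<..<\<epsilon>} z * h z)"
    proof (rule Bochner_Integration.integral_cong[OF refl])
      fix z :: real
      show "indicator {0<..} z * (LINT y|lborel. sqrt z ^ DIM('m sp) * F \<epsilon> (sqrt z *\<^sub>R y, - z)) = indicator {0<..<r\<^sup>2} z * h z - indicator {0<..<\<epsilon>} z * h z"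
      proof (cases "\<epsilon> \<le> z \<and> z < r\<^sup>2")
        case True
        then have z: "0 < z" using \<epsilon> by simp
        have "sqrt z ^ DIM('m sp) * F \<epsilon> (sqrt z *\<^sub>R y, - z) = indicator half_space y * ((v y z)\<^sup>2 * gauss y)" for y
        proof -
          have "indicator (T \<epsilon>) (sqrt z *\<^sub>R y, - z) = (indicator half_space y :: real)"
            using True z by (auto simp: T_def indicator_def half_space_def zero_less_mult_iff)
          then show ?thesis unfolding G_scale[OF z, of y, symmetric] F_def v_def by (simp only: mult_ac)
        qed
        then show ?thesis using True z by (simp add: h_def gint_def indicator_def)
      qed (use \<epsilon> in \<open>auto simp: F_def T_def indicator_def\<close>)
    qed
    also have "\<dots> = prim h (r\<^sup>2) - prim h \<epsilon>"
      unfolding prim_def using prim_integrable[OF tame_h] r2 \<epsilon> by simp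
    finally show ?thesis .
  qed
  \<comment> \<open>The summand 2 keeps every \<open>d n\<close> strictly below r^2.\<close>
  define d where "d n = r\<^sup>2 / (real n + 2)" for n :: nat
  have d: "0 < d n" "d n < r\<^sup>2" for n
  proof -
    show "0 < d n" unfolding d_def by (rule divide_pos_pos) (use r2 in auto)
    show "d n < r\<^sup>2" using mult_strict_left_mono[of 1 "real n + 2" "r\<^sup>2"] r2 by (simp add: d_def pos_divide_less_eq)
  qed
  have dlim: "d \<longlonglongrightarrow> 0" unfolding d_def by real_asymp
  define F0 where "F0 p = indicator (S_plus r) p * ((u p)\<^sup>2 * G p)" for p
  have mono: "F (d n) p \<le> F (d m) p" if "n \<le> m" for n m p
  proof -
    have "d m \<le> d n" using that r2 by (auto simp: d_def intro!: divide_left_mono)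
    then have "T (d n) \<subseteq> T (d m)" by (auto simp: T_def)
    then show ?thesis using G_bound[OF _ d(1)] by (fastforce simp: F_def indicator_def)
  qed
  have lim: "(\<lambda>n. F (d n) p) \<longlonglongrightarrow> F0 p" for p
  proof (cases "p \<in> S_plus r \<and> snd p < 0")
    case True
    then have "\<forall>\<^sub>F n in sequentially. d n < - snd p" using order_tendstoD(2)[OF dlim, of "- snd p"] by simp
    then have "\<forall>\<^sub>F n in sequentially. F (d n) p = F0 p"
      by eventually_elim (use True in \<open>auto simp: F_def F0_def T_def S_plus_def\<close>)
    then show ?thesis by (rule tendsto_eventually)
  next
    case False
    then have "F0 p = 0" by (cases p) (auto simp: F0_def S_plus_def G_def indicator_def)
    moreover have "F (d n) p = 0" for n using False d[of n] by (auto simp: F_def T_def S_plus_def indicator_def)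
    ultimately show ?thesis by simp
  qed
  have "(\<lambda>n. prim h (r\<^sup>2) - prim h (d n)) \<longlonglongrightarrow> prim h (r\<^sup>2)"
  proof -
    obtain b where b: "\<And>z. 0 < z \<Longrightarrow> z \<le> r\<^sup>2 \<Longrightarrow> \<bar>h z\<bar> \<le> b" using tame_bound[OF tame_h r2(2)] by metis
    have "(\<lambda>n. prim h (d n)) \<longlonglongrightarrow> 0"
    proof (rule Lim_null_comparison)
      show "\<forall>\<^sub>F n in sequentially. norm (prim h (d n)) \<le> b * d n"
      proof (rule always_eventually, rule allI)
        show "norm (prim h (d n)) \<le> b * d n" for n
          using prim_bound[OF tame_h d(1) less_imp_le[OF d(2)] r2(2) b] by simp
      qed
      show "(\<lambda>n. b * d n) \<longlonglongrightarrow> 0" using tendsto_mult[OF tendsto_const dlim, of b] by simp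
    qed
    then show ?thesis using tendsto_diff[OF tendsto_const] by fastforce
  qed
  then have lim2: "(\<lambda>n. LINT p|lborel. F (d n) p) \<longlonglongrightarrow> prim h (r\<^sup>2)" using I d by simp
  have m0: "F0 \<in> borel_measurable borel"
    by (rule borel_measurable_LIMSEQ_real[OF lim]) (use meas d in auto)
  have "(LINT p|lborel. F0 p) = prim h (r\<^sup>2)"
    by (rule integral_monotone_convergence[of lborel "\<lambda>n. F (d n)"])
       (use int d mono lim lim2 m0 in \<open>auto simp: incseq_def\<close>)
  moreover have "(LINT p:S_plus r|lebesgue. (u p)\<^sup>2 * G p) = (LINT p|lborel. F0 p)"
    unfolding set_lebesgue_integral_def real_scaleR_def F0_def[symmetric]
    by (rule integral_completion) (use m0 in simp)
  ultimately show ?thesis by (simp add: H_def)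
qed

end

section \<open>From the solution class to the flow\<close>

lemma continuous_on_moduli:
  fixes g :: "'a::real_normed_vector \<times> real \<Rightarrow> 'b::real_normed_vector"
  assumes ab: "0 < a" "0 < b"
    and x: "\<And>x y t. x \<in> A \<Longrightarrow> y \<in> A \<Longrightarrow> t \<in> I \<Longrightarrow> norm (g (x, t) - g (y, t)) \<le> K * norm (x - y) powr a"
    and t: "\<And>x t s. x \<in> A \<Longrightarrow> t \<in> I \<Longrightarrow> s \<in> I \<Longrightarrow> norm (g (x, t) - g (x, s)) \<le> L * \<bar>t - s\<bar> powr b"
  shows "continuous_on (A \<times> I) g"
  unfolding continuous_on_def
proof (rule ballI)
  fix q assume qA: "q \<in> A \<times> I"
  then obtain y s where q: "q = (y, s)" "y \<in> A" "s \<in> I" by auto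
  let ?m = "\<lambda>p. K * norm (fst p - y) powr a + L * \<bar>snd p - s\<bar> powr b"
  have "continuous_on UNIV ?m"
    by (intro continuous_intros continuous_on_powr') (use ab in auto)
  then have "continuous_on (A \<times> I) ?m" by (rule continuous_on_subset) simp
  then have "(?m \<longlongrightarrow> ?m q) (at q within A \<times> I)" using qA unfolding continuous_on_def by blast
  then have m: "(?m \<longlongrightarrow> 0) (at q within A \<times> I)" by (simp add: q)
  have "((\<lambda>p. g p - g q) \<longlongrightarrow> 0) (at q within A \<times> I)"
  proof (rule Lim_null_comparison[OF _ m])
    have "norm (g p - g q) \<le> ?m p" if p: "p \<in> A \<times> I" for p
    proof -
      obtain x t' where p': "p = (x, t')" "x \<in> A" "t' \<in> I" using p by auto
      have "norm (g p - g q) \<le> norm (g (x, t') - g (y, t')) + norm (g (y, t') - g (y, s))"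
        unfolding p'(1) q(1) using norm_triangle_ineq[of "g (x, t') - g (y, t')" "g (y, t') - g (y, s)"] by simp
      then show ?thesis using x[OF p'(2) q(2) p'(3)] t[OF q(2) p'(3) q(3)] by (simp add: p'(1))
    qed
    then show "\<forall>\<^sub>F p in at q within A \<times> I. norm (g p - g q) \<le> ?m p"
      by (auto simp: eventually_at_filter)
  qed
  then show "(g \<longlongrightarrow> g q) (at q within A \<times> I)" by (simp add: LIM_zero_iff)
qed

lemma has_derivative_space_grad:
  fixes u :: "('m::finite) spt \<Rightarrow> real"
  assumes "(\<lambda>x. u (x, snd p)) differentiable (at (fst p) within half_space_closed)"
  shows "((\<lambda>x. u (x, snd p)) has_derivative (\<lambda>h. space_grad u p \<bullet> h)) (at (fst p) within half_space_closed)"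
    and "dn u p = snd (space_grad u p)"
proof -
  have D: "((\<lambda>x. u (x, snd p)) has_derivative space_deriv u p) (at (fst p) within half_space_closed)"
    using assms unfolding space_deriv_def frechet_derivative_works .
  then have lin: "linear (space_deriv u p)" by (simp add: has_derivative_bounded_linear bounded_linear.linear)
  have e: "space_deriv u p h = space_grad u p \<bullet> h" for h
  proof -
    have "space_deriv u p h = space_deriv u p (\<Sum>b\<in>Basis. (h \<bullet> b) *\<^sub>R b)" by (simp add: euclidean_representation)
    also have "\<dots> = (\<Sum>b\<in>Basis. (h \<bullet> b) * space_deriv u p b)"
      by (simp add: linear_sum[OF lin] linear_cmul[OF lin])
    also have "\<dots> = space_grad u p \<bullet> h"
      unfolding space_grad_def inner_sum_left by (rule sum.cong[OF refl]) (simp add: inner_commute[of h] mult.commute)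
    finally show ?thesis .
  qed
  then have "space_deriv u p = (\<lambda>h. space_grad u p \<bullet> h)" by (simp add: fun_eq_iff)
  then show "((\<lambda>x. u (x, snd p)) has_derivative (\<lambda>h. space_grad u p \<bullet> h)) (at (fst p) within half_space_closed)"
    using D by simp
  show "dn u p = snd (space_grad u p)"
    unfolding dn_def e by (cases "space_grad u p") simp
qed

lemma S_union: "S_plus 1 \<union> S_prime 1 = (half_space_closed :: ('m::finite) sp set) \<times> {-1<..0}"
  by (auto simp: S_plus_def S_prime_def half_space_def half_space_closed_def)

lemma interior_S_plus: "interior (S_plus 1) = (half_space :: ('m::finite) sp set) \<times> {-1<..<0}"
  by (simp add: S_plus_def interior_Times interior_open open_half_space)

lemma half_space_Lipschitz:
  fixes w :: "('m::finite) sp \<Rightarrow> real"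
  assumes "\<And>x. x \<in> half_space_closed \<Longrightarrow> (w has_derivative (\<lambda>h. g x \<bullet> h)) (at x within half_space_closed)"
    and "\<And>x. x \<in> half_space_closed \<Longrightarrow> norm (g x) \<le> b"
    and "x \<in> half_space_closed" "y \<in> half_space_closed"
  shows "\<bar>w x - w y\<bar> \<le> b * norm (x - y)"
proof -
  have cv: "convex (half_space_closed :: 'm sp set)"
    by (intro convexI) (auto simp: half_space_closed_def)
  have on: "onorm (\<lambda>h. g x \<bullet> h) \<le> b" if "x \<in> half_space_closed" for x
  proof (rule onorm_le)
    fix h show "norm (g x \<bullet> h) \<le> b * norm h"
      using Cauchy_Schwarz_ineq2[of "g x" h] mult_right_mono[OF assms(2)[OF that] norm_ge_zero[of h]] by simp
  qed
  have "norm (w x - w y) \<le> b * norm (x - y)"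
    by (rule differentiable_bound[OF cv assms(1) on assms(3,4)])
  then show ?thesis by simp
qed

text \<open>Every point of the half-space can be moved a bounded distance upwards out of the support; this turns
  bounds on the gradient into bounds on the function and its modulus of continuity in time.\<close>

lemma Sf_class_regularity:
  fixes u :: "('m::finite) spt \<Rightarrow> real"
  assumes u: "u \<in> Sf_class f"
  defines "gu \<equiv> space_grad u"
  obtains B R where
    "continuous_on (half_space_closed \<times> {-1<..0}) u"
    "continuous_on (half_space_closed \<times> {-1<..0}) gu"
    "\<And>x t. x \<in> half_space \<Longrightarrow> -1 < t \<Longrightarrow> t \<le> 0 \<Longrightarrow> ((\<lambda>x. u (x, t)) has_derivative (\<lambda>h. gu (x, t) \<bullet> h)) (at x)"
    "\<And>x t. x \<in> half_space_closed \<Longrightarrow> -1 < t \<Longrightarrow> t \<le> 0 \<Longrightarrow> R < norm x \<Longrightarrow> u (x, t) = 0 \<and> gu (x, t) = 0"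
    "\<And>x t. x \<in> half_space_closed \<Longrightarrow> -1 < t \<Longrightarrow> t \<le> 0 \<Longrightarrow> \<bar>u (x, t)\<bar> \<le> B \<and> norm (gu (x, t)) \<le> B"
    "\<And>x t. snd x = 0 \<Longrightarrow> -1 < t \<Longrightarrow> t \<le> 0 \<Longrightarrow> 0 \<le> u (x, t) \<and> snd (gu (x, t)) \<le> 0 \<and> u (x, t) * snd (gu (x, t)) = 0"
proof -
  let ?E = "(half_space_closed :: 'm sp set) \<times> {-1<..0::real}"
  have diff: "(\<lambda>x. u (x, snd p)) differentiable (at (fst p) within half_space_closed)" if "p \<in> ?E" for p
    using u that unfolding Sf_class_def S_union by blast
  have D: "((\<lambda>x. u (x, t)) has_derivative (\<lambda>h. gu (x, t) \<bullet> h)) (at x within half_space_closed)"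
    if "x \<in> half_space_closed" "t \<in> {-1<..0}" for x t
    using has_derivative_space_grad(1)[of u "(x, t)"] diff[of "(x, t)"] that by (simp add: gu_def)
  have dn: "dn u p = snd (gu p)" if "p \<in> ?E" for p
    unfolding gu_def by (rule has_derivative_space_grad(2)[OF diff[OF that]])
  obtain \<alpha> where \<alpha>: "0 < \<alpha>" "\<alpha> < 1" "Holder_par \<alpha> ?E gu"
    using u unfolding Sf_class_def S_union gu_def by blast
  from \<alpha>(3) have bg: "bounded (gu ` ?E)" unfolding Holder_par_def by (rule conjunct1)
  from \<alpha>(3) have "\<exists>K. (\<forall>x y t. (x, t) \<in> ?E \<longrightarrow> (y, t) \<in> ?E \<longrightarrow> norm (gu (x, t) - gu (y, t)) \<le> K * norm (x - y) powr \<alpha>) \<and>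
      (\<forall>x t s. (x, t) \<in> ?E \<longrightarrow> (x, s) \<in> ?E \<longrightarrow> norm (gu (x, t) - gu (x, s)) \<le> K * \<bar>t - s\<bar> powr (\<alpha> / 2))"
    unfolding Holder_par_def by (rule conjunct2)
  then obtain K where K: "(\<forall>x y t. (x, t) \<in> ?E \<longrightarrow> (y, t) \<in> ?E \<longrightarrow> norm (gu (x, t) - gu (y, t)) \<le> K * norm (x - y) powr \<alpha>) \<and>
      (\<forall>x t s. (x, t) \<in> ?E \<longrightarrow> (x, s) \<in> ?E \<longrightarrow> norm (gu (x, t) - gu (x, s)) \<le> K * \<bar>t - s\<bar> powr (\<alpha> / 2))" ..
  have Kx: "norm (gu (x, t) - gu (y, t)) \<le> K * norm (x - y) powr \<alpha>" if "(x, t) \<in> ?E" "(y, t) \<in> ?E" for x y t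
    by (rule conjunct1[OF K, rule_format, OF that])
  have Kt: "norm (gu (x, t) - gu (x, s)) \<le> K * \<bar>t - s\<bar> powr (\<alpha> / 2)" if "(x, t) \<in> ?E" "(x, s) \<in> ?E" for x t s
    by (rule conjunct2[OF K, rule_format, OF that])
  obtain b where b: "\<And>p. p \<in> ?E \<Longrightarrow> norm (gu p) \<le> b"
    using bg unfolding bounded_iff by blast
  have "bounded {p \<in> ?E. u p \<noteq> 0}" using u unfolding Sf_class_def S_union by blast
  then obtain R0 where R0: "\<And>p. p \<in> ?E \<Longrightarrow> u p \<noteq> 0 \<Longrightarrow> norm p \<le> R0" unfolding bounded_iff by blast
  define R where "R = max R0 0"
  have R: "0 \<le> R" by (simp add: R_def)
  have u0: "u (x, t) = 0" if "x \<in> half_space_closed" "t \<in> {-1<..0}" "R < norm x" for x t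
  proof (rule ccontr)
    assume "u (x, t) \<noteq> 0"
    then have "norm (x, t) \<le> R0" using R0[of "(x, t)"] that by simp
    then show False using norm_fst_le[of x t] that(3) by (simp add: R_def)
  qed
  \<comment> \<open>The shift by R + 1 takes every point of the closed half-space out of the ball of
    radius \<open>R\<close>, where \<open>u\<close> vanishes at all times.\<close>
  define up where "up x = (fst x, snd x + (R + 1))" for x :: "'m sp"
  have up: "up x \<in> half_space_closed" "R < norm (up x)" "norm (x - up x) = R + 1" if "x \<in> half_space_closed" for x
  proof -
    show "up x \<in> half_space_closed" using that R by (simp add: up_def half_space_closed_def)
    have "snd (up x) \<le> norm (up x)" using norm_snd_le[of "snd (up x)" "fst (up x)"] by simp
    then show "R < norm (up x)" using that by (simp add: up_def half_space_closed_def)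
    have "x - up x = (0, - (R + 1))" by (cases x) (simp add: up_def)
    then show "norm (x - up x) = R + 1" using R by (simp add: norm_Pair)
  qed
  have Lx: "\<bar>u (x, t) - u (y, t)\<bar> \<le> b * norm (x - y)" if "x \<in> half_space_closed" "y \<in> half_space_closed" "t \<in> {-1<..0}" for x y t
    by (rule half_space_Lipschitz[where g = "\<lambda>x. gu (x, t)"]) (use D b that in auto)
  have bu: "\<bar>u (x, t)\<bar> \<le> b * (R + 1)" if "x \<in> half_space_closed" "t \<in> {-1<..0}" for x t
    using Lx[OF that(1) up(1)[OF that(1)] that(2)] u0[OF up(1)[OF that(1)] that(2) up(2)[OF that(1)]] up(3)[OF that(1)] by simp
  have Lt: "\<bar>u (x, t) - u (x, s)\<bar> \<le> K * (R + 1) * \<bar>t - s\<bar> powr (\<alpha> / 2)" if x: "x \<in> half_space_closed" and ts: "t \<in> {-1<..0}" "s \<in> {-1<..0}" for x t s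
  proof -
    \<comment> \<open>The mean value inequality is applied to the difference of two time slices,
      whose gradient is small by the Hoelder condition in time and which vanishes at the shifted
      point.\<close>
    have "\<bar>(u (x, t) - u (x, s)) - (u (up x, t) - u (up x, s))\<bar> \<le> (K * \<bar>t - s\<bar> powr (\<alpha> / 2)) * norm (x - up x)"
    proof (rule half_space_Lipschitz[where g = "\<lambda>x. gu (x, t) - gu (x, s)"])
      show "((\<lambda>x. u (x, t) - u (x, s)) has_derivative (\<lambda>h. (gu (x, t) - gu (x, s)) \<bullet> h)) (at x within half_space_closed)"
        if "x \<in> half_space_closed" for x
        using has_derivative_diff[OF D[OF that ts(1)] D[OF that ts(2)]] by (simp add: inner_diff_left)
    qed (use x ts Kt up(1)[OF x] in auto)
    then show ?thesis using u0[OF up(1)[OF x] _ up(2)[OF x]] ts up(3)[OF x] by (simp add: mult_ac)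
  qed
  have cu: "continuous_on ?E u"
    by (rule continuous_on_moduli[of 1 "\<alpha> / 2" _ _ _ b "K * (R + 1)"]) (use \<alpha> Lx Lt in auto)
  have cgu: "continuous_on ?E gu"
    by (rule continuous_on_moduli[of \<alpha> "\<alpha> / 2" _ _ _ K K]) (use \<alpha> Kx Kt in auto)
  have sub: "x \<in> half_space_closed" if "x \<in> half_space" for x :: "'m sp"
    using that by (simp add: half_space_def half_space_closed_def)
  have D': "((\<lambda>x. u (x, t)) has_derivative (\<lambda>h. gu (x, t) \<bullet> h)) (at x)" if x: "x \<in> half_space" and t: "t \<in> {-1<..0}" for x t
  proof -
    have "((\<lambda>x. u (x, t)) has_derivative (\<lambda>h. gu (x, t) \<bullet> h)) (at x within half_space)"
      by (rule has_derivative_subset[OF D[OF sub[OF x] t]]) (use sub in auto)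
    then show ?thesis using at_within_open[OF x open_half_space] by simp
  qed
  have gu0: "gu (x, t) = 0" if x: "x \<in> half_space" and t: "t \<in> {-1<..0}" and n: "R < norm x" for x t
  proof -
    have o: "open (half_space \<inter> {x :: 'm sp. R < norm x})"
      by (intro open_Int open_half_space open_Collect_less continuous_intros)
    have "((\<lambda>x. u (x, t)) has_derivative (\<lambda>h. 0)) (at x)"
      by (rule has_derivative_transform_within_open[OF has_derivative_const o]) (use x t n u0 sub in auto)
    then have "(\<lambda>h. gu (x, t) \<bullet> h) = (\<lambda>h. 0)" by (rule has_derivative_unique[OF D'[OF x t]])
    then have "gu (x, t) \<bullet> gu (x, t) = 0" by meson
    then show ?thesis by simp
  qed
  \<comment> \<open>On the boundary the derivative is one-sided, so vanishing of the gradient is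
    obtained there as a limit along the inner normal, which stays outside the ball.\<close>
  have gu0': "gu (x, t) = 0" if x: "x \<in> half_space_closed" and t: "t \<in> {-1<..0}" and n: "R < norm x" for x t
  proof (cases "x \<in> half_space")
    case False
    then have x0: "snd x = 0" using x by (simp add: half_space_def half_space_closed_def)
    then have nx: "norm x = norm (fst x)" by (cases x) (simp add: norm_Pair)
    have c: "continuous_on {0..} (\<lambda>s. gu ((fst x, s), t))"
      by (rule continuous_on_compose2[OF cgu]) (use t in \<open>auto intro!: continuous_intros simp: half_space_closed_def\<close>)
    have "gu ((fst x, 0), t) = 0"
    proof (rule continuous_constant_on_closure[of "{0<..}" "\<lambda>s. gu ((fst x, s), t)"])
      show "gu ((fst x, s), t) = 0" if "s \<in> {0<..}" for s
      proof (rule gu0[OF _ t])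
        show "(fst x, s) \<in> half_space" using that by (simp add: half_space_def)
        show "R < norm (fst x, s)" using n nx norm_fst_le[of "fst x" s] by simp
      qed
    qed (use c in auto)
    then show ?thesis using x0 by (cases x) simp
  qed (use gu0 t n in auto)
  have b0: "0 \<le> b" 
  proof -
    have "(0 :: 'm sp, 0 :: real) \<in> ?E" by (simp add: half_space_closed_def)
    then show ?thesis using b norm_ge_zero order_trans by blast
  qed
  show ?thesis
  proof (rule that[of R "b * (R + 1)"])
    show "continuous_on ?E u" "continuous_on ?E gu" by fact+
    fix x :: "'m sp" and t :: real assume t: "-1 < t" "t \<le> 0"
    show "((\<lambda>x. u (x, t)) has_derivative (\<lambda>h. gu (x, t) \<bullet> h)) (at x)" if "x \<in> half_space" using D' that t by simp
    show "u (x, t) = 0 \<and> gu (x, t) = 0" if "x \<in> half_space_closed" "R < norm x" using u0 gu0' that t by simp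
    show "\<bar>u (x, t)\<bar> \<le> b * (R + 1) \<and> norm (gu (x, t)) \<le> b * (R + 1)" if "x \<in> half_space_closed"
    proof -
      have "b * 1 \<le> b * (R + 1)" using b0 R by (intro mult_left_mono) auto
      then show ?thesis using bu[OF that] b[of "(x, t)"] that t by auto
    qed
    show "0 \<le> u (x, t) \<and> snd (gu (x, t)) \<le> 0 \<and> u (x, t) * snd (gu (x, t)) = 0" if "snd x = 0"
    proof -
      have "(x, t) \<in> S_prime 1" "(x, t) \<in> ?E" using that t by (auto simp: S_prime_def half_space_closed_def)
      then show ?thesis using u dn[of "(x, t)"] unfolding Sf_class_def by fastforce
    qed
  qed
qed

section \<open>Borel representatives and the passage from \<open>heat_eq\<close> to the weak
  equation\<close>

lemma AE_lborel_slices: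
  assumes "AE p in (lborel :: ('a::euclidean_space \<times> real) measure). P p"
  shows "AE z in lborel. AE x in lborel. P (x, - z)"
proof -
  have eq: "(lborel \<Otimes>\<^sub>M lborel :: ('a \<times> real) measure) = distr (lborel \<Otimes>\<^sub>M lborel) (lborel \<Otimes>\<^sub>M lborel) (\<lambda>(t :: real, x :: 'a). (x, t))"
    by (rule lborel_pair.distr_pair_swap)
  have "AE p in distr (lborel \<Otimes>\<^sub>M lborel) (lborel \<Otimes>\<^sub>M lborel) (\<lambda>(t :: real, x :: 'a). (x, t)). P p"
    unfolding eq[symmetric] unfolding lborel_prod by (rule assms)
  from AE_distrD[OF measurable_pair_swap' this]
  have "AE p in (lborel \<Otimes>\<^sub>M lborel). P (case p of (t :: real, x :: 'a) \<Rightarrow> (x, t))" .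
  then have "AE t in lborel. AE x in lborel. P (x, t)"
    using lborel_pair.AE_pair by fastforce
  then have "AE t in distr lborel borel uminus. AE x in lborel. P (x, t :: real)"
    by (simp only: lborel_distr_uminus)
  then show ?thesis by (rule AE_distrD[rotated]) simp
qed

text \<open>Truncation at the essential bound makes the Borel version bounded at every point, not
  just almost everywhere.\<close>

lemma Linf_Borel_version:
  fixes f :: "('a::euclidean_space) \<Rightarrow> real"
  assumes "f \<in> Linf S" and S: "S \<in> sets lebesgue"
  obtains f' M where "f' \<in> borel_measurable borel" "\<And>p. \<bar>f' p\<bar> \<le> M" "AE p in lborel. p \<in> S \<longrightarrow> f p = f' p"
proof -
  from assms(1) obtain M where m: "f \<in> borel_measurable (lebesgue_on S)" and M: "AE p in lebesgue_on S. \<bar>f p\<bar> \<le> M"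
    unfolding Linf_def by blast
  have "(\<lambda>x. if x \<in> S then f x else 0) \<in> borel_measurable (completion lborel)"
    using borel_measurable_if[OF S, of f] m by blast
  then obtain f1 where f1: "f1 \<in> borel_measurable lborel" "AE x in lborel. (if x \<in> S then f x else 0) = f1 x"
    using completion_ex_borel_measurable_real by blast
  have "AE p in lebesgue. p \<in> S \<longrightarrow> \<bar>f p\<bar> \<le> M" using M S by (simp add: AE_restrict_space_iff)
  then have M': "AE p in lborel. p \<in> S \<longrightarrow> \<bar>f p\<bar> \<le> M" by (simp only: AE_completion_iff)
  show ?thesis
  proof (rule that[of "\<lambda>p. max (- \<bar>M\<bar>) (min \<bar>M\<bar> (f1 p))" "\<bar>M\<bar>"])
    show "(\<lambda>p. max (- \<bar>M\<bar>) (min \<bar>M\<bar> (f1 p))) \<in> borel_measurable borel" using f1(1) by simp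
    show "AE p in lborel. p \<in> S \<longrightarrow> f p = max (- \<bar>M\<bar>) (min \<bar>M\<bar> (f1 p))"
      using f1(2) M' by eventually_elim auto
  qed auto
qed

text \<open>The distributional second derivatives put both space derivatives on the mollifier; one
  of them is moved back to \<open>u\<close>, whose pointwise gradient is continuous. After this the
  L2 functions of \<open>heat_eq\<close> occur only through the combination that equals f almost
  everywhere.\<close>

lemma weak_equation:
  fixes u f f' :: "'a::euclidean_space \<times> real \<Rightarrow> real" and gu :: "'a \<times> real \<Rightarrow> 'a"
  assumes heat: "heat_eq S u f" and S: "S \<in> sets lebesgue"
    and cont: "continuous_on (interior S) u" "continuous_on (interior S) gu"
    and deriv: "\<And>x t. (x, t) \<in> interior S \<Longrightarrow> ((\<lambda>x. u (x, t)) has_derivative (\<lambda>h. gu (x, t) \<bullet> h)) (at x)"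
    and f': "f' \<in> borel_measurable borel" "AE p in lborel. p \<in> S \<longrightarrow> f p = f' p"
    and \<epsilon>: "0 < \<epsilon>" "cball p \<epsilon> \<subseteq> interior S"
  shows "(LINT q|lborel. indicator (interior S) q * (u q * (dmoll (0, 1) ((q - p) /\<^sub>R \<epsilon>) / \<epsilon>)
         - dmoll (gu q, 0) ((q - p) /\<^sub>R \<epsilon>) / \<epsilon> - f' q * moll ((q - p) /\<^sub>R \<epsilon>))) = 0"
proof -
  let ?Q = "interior S" and ?K = "cball p \<epsilon>"
  define \<phi> where "\<phi> q = moll ((q - p) /\<^sub>R \<epsilon>)" for q
  define \<phi>1 where "\<phi>1 e q = dmoll e ((q - p) /\<^sub>R \<epsilon>) / \<epsilon>" for e q
  define \<phi>2 where "\<phi>2 e q = frechet_derivative (\<phi>1 e) (at q) e" for e q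
  have D1: "(\<phi> has_derivative (\<lambda>h. \<phi>1 h q)) (at q)" for q
    unfolding \<phi>_def \<phi>1_def by (rule has_derivative_moll_scaled)
  have fr1: "frechet_derivative \<phi> (at q) = (\<lambda>h. \<phi>1 h q)" for q
    using frechet_derivative_at[OF D1] by simp
  have test: "test_function ?Q \<phi>" unfolding \<phi>_def by (rule test_function_moll[OF \<epsilon>])
  have smooth: "\<phi>1 e differentiable (at q)" "continuous_on UNIV (\<phi>2 e)" if e: "e \<in> Basis" for e q
  proof -
    have "Ck (Suc (Suc 0)) \<phi>" using test unfolding test_function_def by blast
    then have "Ck (Suc 0) (\<phi>1 e)" using e fr1 by simp
    then have c: "(\<forall>x. \<phi>1 e differentiable (at x)) \<and> (\<forall>b\<in>Basis. continuous_on UNIV (\<lambda>x. frechet_derivative (\<phi>1 e) (at x) b))"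
      unfolding Ck.simps .
    then show "\<phi>1 e differentiable (at q)" by blast
    show "continuous_on UNIV (\<phi>2 e)" using c e unfolding \<phi>2_def[abs_def] by blast
  qed
  have cont_\<phi>: "continuous_on A \<phi>" "continuous_on A (\<phi>1 e)" for A e
    unfolding \<phi>_def \<phi>1_def using \<epsilon> by (intro continuous_intros; simp)+
  have off: "\<phi> q = 0" "\<phi>1 e q = 0" if "q \<notin> ?K" for e q
    using scaled_eq_0[OF \<epsilon>(1), of "q - p"] that by (auto simp: \<phi>_def \<phi>1_def dist_norm norm_minus_commute)
  have off2: "\<phi>2 e q = 0" if "q \<notin> ?K" for e q
  proof -
    have "(\<phi>1 e has_derivative (\<lambda>h. 0)) (at q)"
      by (rule has_derivative_transform_within_open[OF has_derivative_const, of "- ?K"])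
         (use off that in \<open>auto intro: open_Compl\<close>)
    then show ?thesis unfolding \<phi>2_def using frechet_derivative_at by metis
  qed
  have oQ: "open ?Q" by simp
  have ext: "continuous_on UNIV (\<lambda>q. indicator ?Q q * (F q * w q))"
    if "continuous_on ?Q F" "continuous_on ?Q w" "\<And>q. q \<notin> ?K \<Longrightarrow> w q = 0" for F w :: "'a \<times> real \<Rightarrow> real"
  proof (rule continuous_extend_zero[OF oQ compact_cball \<epsilon>(2)])
    show "continuous_on ?Q (\<lambda>q. indicator ?Q q * (F q * w q))"
      using continuous_on_mult[OF that(1,2)] by (rule continuous_on_eq) simp
  qed (use that(3) in simp)
  have int: "integrable lborel (\<lambda>q. indicator ?Q q * (F q * w q))" "(LINT q|lebesgue. indicator ?Q q * (F q * w q)) = (LINT q|lborel. indicator ?Q q * (F q * w q))"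
    if "continuous_on ?Q F" "continuous_on ?Q w" "\<And>q. q \<notin> ?K \<Longrightarrow> w q = 0" for F w :: "'a \<times> real \<Rightarrow> real"
  proof -
    show "integrable lborel (\<lambda>q. indicator ?Q q * (F q * w q))"
      by (rule integrable_continuous_support[OF ext[OF that] compact_cball]) (use that(3) in auto)
    show "(LINT q|lebesgue. indicator ?Q q * (F q * w q)) = (LINT q|lborel. indicator ?Q q * (F q * w q))"
      by (rule integral_completion) (use ext[OF that] borel_measurable_continuous_onI in auto)
  qed
  have L2int: "integrable lebesgue (\<lambda>q. indicator ?Q q * (w q * \<phi> q))" if w: "w \<in> L2 S" for w
  proof -
    have wm: "(\<lambda>q. if q \<in> S then w q else 0) \<in> borel_measurable lebesgue"
      using w borel_measurable_if[OF S] unfolding L2_def by blast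
    have w2: "integrable lebesgue (\<lambda>q. indicator S q *\<^sub>R (w q)\<^sup>2)"
      using w S integrable_restrict_space[of S lebesgue "\<lambda>q. (w q)\<^sup>2"] by (simp add: L2_def)
    have "integrable lborel (\<lambda>q. (\<phi> q)\<^sup>2)"
      by (rule integrable_continuous_support[OF _ compact_cball[of p \<epsilon>]]) (use off cont_\<phi> in \<open>auto intro!: continuous_intros\<close>)
    then have p2: "integrable lebesgue (\<lambda>q. (\<phi> q)\<^sup>2)"
      using cont_\<phi>(1)[of UNIV] by (subst integrable_completion) (auto intro!: borel_measurable_continuous_onI continuous_intros)
    have eq: "indicator ?Q q * (w q * \<phi> q) = (if q \<in> S then w q else 0) * \<phi> q" for q
      using off(1)[of q] \<epsilon>(2) interior_subset[of S] by (cases "q \<in> ?K") (auto simp: indicator_def)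
    have pm: "\<phi> \<in> borel_measurable lebesgue"
      using cont_\<phi>(1)[of UNIV] by (intro measurable_completion) (simp add: borel_measurable_continuous_onI)
    show ?thesis unfolding eq
    proof (rule Bochner_Integration.integrable_bound[OF Bochner_Integration.integrable_add[OF w2 p2]])
      show "(\<lambda>q. (if q \<in> S then w q else 0) * \<phi> q) \<in> borel_measurable lebesgue"
        by (rule borel_measurable_times[OF wm pm])
      have "\<bar>a * b\<bar> \<le> a\<^sup>2 + b\<^sup>2" for a b :: real
      proof -
        have "2 * \<bar>a * b\<bar> \<le> a\<^sup>2 + b\<^sup>2" using sum_squares_bound[of "\<bar>a\<bar>" "\<bar>b\<bar>"] by (simp add: abs_mult mult.assoc)
        then show ?thesis using abs_ge_zero[of "a * b"] by linarith
      qed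
      then show "AE q in lebesgue. norm ((if q \<in> S then w q else 0) * \<phi> q) \<le> norm (indicator S q *\<^sub>R (w q)\<^sup>2 + (\<phi> q)\<^sup>2)"
        by (intro always_eventually allI) (auto simp: indicator_def)
    qed
  qed
  from heat obtain D Dt where D: "\<And>i. i \<in> Basis \<Longrightarrow> D i \<in> L2 S" "\<And>i. i \<in> Basis \<Longrightarrow> weak_deriv ?Q [(i, 0), (i, 0)] u (D i)"
    and Dt: "Dt \<in> L2 S" "weak_deriv ?Q [(0, 1)] u Dt"
    and eq: "AE p in lebesgue_on S. (\<Sum>i\<in>Basis. D i p) - Dt p = f p"
    unfolding heat_eq_def by blast
  \<comment> \<open>Coordinate by coordinate, integration by parts of \<open>u\<close> times the
    first derivative of the mollifier; its support is a compact subset of the interior, so no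
    boundary term arises.\<close>
  have ibp: "(LINT q|lborel. indicator ?Q q * ((gu q \<bullet> i) * \<phi>1 (i, 0) q)) = - (LINT q|lborel. indicator ?Q q * (u q * \<phi>2 (i, 0) q))"
    if i: "i \<in> Basis" for i :: 'a
  proof -
    have iB: "(i, 0) \<in> Basis" using i by (simp add: Basis_prod_def)
    have cgi: "continuous_on ?Q (\<lambda>q. gu q \<bullet> i)" by (intro continuous_intros cont)
    have c2: "continuous_on ?Q (\<phi>2 (i, 0))" using smooth(2)[OF iB] by (rule continuous_on_subset) simp
    let ?F = "\<lambda>q. indicator ?Q q * (u q * \<phi>1 (i, 0) q)"
    let ?F1 = "\<lambda>q. indicator ?Q q * ((gu q \<bullet> i) * \<phi>1 (i, 0) q)" and ?F2 = "\<lambda>q. indicator ?Q q * (u q * \<phi>2 (i, 0) q)"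
    have cF1: "continuous_on UNIV ?F1" by (rule ext[OF cgi cont_\<phi>(2) off(2)])
    have cF2: "continuous_on UNIV ?F2" by (rule ext[OF cont(1) c2 off2])
    have "(LINT q|lborel. ?F1 q + ?F2 q) = 0"
    proof (rule integral_directional_derivative_zero[where F = ?F and K = ?K and e = "(i, 0)"])
      show "continuous_on UNIV ?F" by (rule ext[OF cont(1) cont_\<phi>(2) off(2)])
      show "continuous_on UNIV (\<lambda>q. ?F1 q + ?F2 q)" by (intro continuous_on_add cF1 cF2)
      show "((\<lambda>s. ?F (q + s *\<^sub>R (i, 0))) has_real_derivative ?F1 q + ?F2 q) (at 0)" for q
      proof (cases "q \<in> ?Q")
        case True
        obtain x t where q: "q = (x, t)" by (cases q)
        have l: "((\<lambda>s::real. x + s *\<^sub>R i) has_derivative (\<lambda>s. s *\<^sub>R i)) (at 0)" by (auto intro!: derivative_eq_intros)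
        have "((\<lambda>x. u (x, t)) has_derivative (\<lambda>h. gu (x, t) \<bullet> h)) (at (x + 0 *\<^sub>R i))" using deriv[of x t] True q by simp
        from has_derivative_compose[OF l this]
        have d0: "((\<lambda>s. u (x + s *\<^sub>R i, t)) has_derivative (\<lambda>s. gu (x, t) \<bullet> (s *\<^sub>R i))) (at 0)" .
        have "(\<lambda>s. u (q + s *\<^sub>R (i, 0))) = (\<lambda>s. u (x + s *\<^sub>R i, t))" "(\<lambda>s. gu (x, t) \<bullet> (s *\<^sub>R i)) = (*) (gu q \<bullet> i)"
          by (auto simp: q fun_eq_iff)
        then have d1: "((\<lambda>s. u (q + s *\<^sub>R (i, 0))) has_real_derivative gu q \<bullet> i) (at 0)"
          unfolding has_field_derivative_def using d0 by simp
        have l2: "((\<lambda>s::real. q + s *\<^sub>R (i, 0)) has_derivative (\<lambda>s. s *\<^sub>R (i, 0))) (at 0)" by (auto intro!: derivative_eq_intros)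
        have fd: "(\<phi>1 (i, 0) has_derivative frechet_derivative (\<phi>1 (i, 0)) (at q)) (at (q + 0 *\<^sub>R (i, 0)))"
          using smooth(1)[OF iB, of q] unfolding frechet_derivative_works by (simp del: scaleR_Pair)
        have lin: "frechet_derivative (\<phi>1 (i, 0)) (at q) (s *\<^sub>R (i, 0)) = s *\<^sub>R \<phi>2 (i, 0) q" for s
          unfolding \<phi>2_def by (rule linear_cmul[OF linear_frechet_derivative[OF smooth(1)[OF iB]]])
        have d2: "((\<lambda>s. \<phi>1 (i, 0) (q + s *\<^sub>R (i, 0))) has_real_derivative \<phi>2 (i, 0) q) (at 0)"
        proof -
          have "(\<lambda>s. s *\<^sub>R \<phi>2 (i, 0) q) = (*) (\<phi>2 (i, 0) q)" by (auto simp: fun_eq_iff)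
          then show ?thesis using has_derivative_compose[OF l2 fd] unfolding has_field_derivative_def lin by (simp del: scaleR_Pair)
        qed
        have "((\<lambda>s. u (q + s *\<^sub>R (i, 0)) * \<phi>1 (i, 0) (q + s *\<^sub>R (i, 0))) has_real_derivative ?F1 q + ?F2 q) (at 0)"
          by (rule DERIV_cong[OF DERIV_mult[OF d1 d2]]) (use True in \<open>simp add: mult.commute del: scaleR_Pair\<close>)
        moreover have "open ((\<lambda>s::real. q + s *\<^sub>R (i, 0)) -` ?Q)"
          by (intro open_vimage oQ continuous_intros)
        ultimately show ?thesis
          by (rule has_field_derivative_transform_within_open) (use True in \<open>auto simp del: scaleR_Pair\<close>)
      next
        case False
        then have "q \<in> - ?K" using \<epsilon>(2) by auto
        have "((\<lambda>s. 0) has_real_derivative ?F1 q + ?F2 q) (at 0)" using False by simp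
        moreover have "open ((\<lambda>s::real. q + s *\<^sub>R (i, 0)) -` (- ?K))"
          by (intro open_vimage continuous_intros open_Compl closed_cball)
        ultimately show ?thesis
          by (rule has_field_derivative_transform_within_open) (use \<open>q \<in> - ?K\<close> off(2) in \<open>auto simp del: scaleR_Pair\<close>)
      qed
    qed (use off(2) off2 in auto)
    then show ?thesis
      using int(1)[OF cgi cont_\<phi>(2) off(2)] int(1)[OF cont(1) c2 off2] by simp
  qed
  have wt: "(LINT q|lborel. indicator ?Q q * (u q * \<phi>1 (0, 1) q)) = - (LINT q|lebesgue. indicator ?Q q * (Dt q * \<phi> q))"
  proof -
    have "(LINT q:?Q|lebesgue. u q * iter_deriv [(0, 1)] \<phi> q) = - (LINT q:?Q|lebesgue. Dt q * \<phi> q)"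
      using Dt(2) test unfolding weak_deriv_def by fastforce
    then show ?thesis
      using int(2)[OF cont(1) cont_\<phi>(2) off(2), of "(0, 1)"] by (simp add: set_lebesgue_integral_def fr1)
  qed
  have wx: "(LINT q|lborel. indicator ?Q q * (u q * \<phi>2 (i, 0) q)) = (LINT q|lebesgue. indicator ?Q q * (D i q * \<phi> q))"
    if i: "i \<in> Basis" for i
  proof -
    have iB: "(i, 0) \<in> Basis" using i by (simp add: Basis_prod_def)
    have c2: "continuous_on ?Q (\<phi>2 (i, 0))" using smooth(2)[OF iB] by (rule continuous_on_subset) simp
    have "(LINT q:?Q|lebesgue. u q * iter_deriv [(i, 0), (i, 0)] \<phi> q) = (LINT q:?Q|lebesgue. D i q * \<phi> q)"
      using D(2)[OF i] test unfolding weak_deriv_def by fastforce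
    then show ?thesis
      using int(2)[OF cont(1) c2 off2] by (simp add: set_lebesgue_integral_def fr1 \<phi>2_def)
  qed
  have wf: "(LINT q|lborel. indicator ?Q q * (f' q * \<phi> q))
      = (\<Sum>i\<in>Basis. LINT q|lebesgue. indicator ?Q q * (D i q * \<phi> q)) - (LINT q|lebesgue. indicator ?Q q * (Dt q * \<phi> q))"
    and fint: "integrable lborel (\<lambda>q. indicator ?Q q * (f' q * \<phi> q))"
  proof -
    let ?r = "\<lambda>q. (\<Sum>i\<in>Basis. indicator ?Q q * (D i q * \<phi> q)) - indicator ?Q q * (Dt q * \<phi> q)"
    have pm: "\<phi> \<in> borel_measurable borel" using cont_\<phi>(1)[of UNIV] by (rule borel_measurable_continuous_onI)
    have mb: "(\<lambda>q. indicator ?Q q * (f' q * \<phi> q)) \<in> borel_measurable lborel"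
      using f'(1) pm borel_measurable_indicator[of ?Q borel] by (simp add: borel_open)
    have ml: "(\<lambda>q. indicator ?Q q * (f' q * \<phi> q)) \<in> borel_measurable lebesgue" using mb by (rule measurable_completion)
    have ri: "integrable lebesgue ?r"
      by (intro Bochner_Integration.integrable_diff Bochner_Integration.integrable_sum L2int D(1) Dt(1))
    have a1: "AE q in lebesgue. q \<in> S \<longrightarrow> (\<Sum>i\<in>Basis. D i q) - Dt q = f q" using eq S by (simp add: AE_restrict_space_iff)
    have a2: "AE q in lebesgue. q \<in> S \<longrightarrow> f q = f' q" using f'(2) by (rule AE_completion)
    have ae: "AE q in lebesgue. ?r q = indicator ?Q q * (f' q * \<phi> q)"
      using a1 a2
    proof eventually_elim
      case (elim q)
      show ?case
      proof (cases "q \<in> ?Q")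
        case True
        then have "f' q = (\<Sum>i\<in>Basis. D i q) - Dt q" using elim interior_subset[of S] by auto
        then show ?thesis using True by (simp add: sum_distrib_right left_diff_distrib)
      qed simp
    qed
    have "integrable lebesgue (\<lambda>q. indicator ?Q q * (f' q * \<phi> q))"
      by (rule integrable_cong_AE_imp[OF ri ml]) (use ae in \<open>auto elim: eventually_mono\<close>)
    then show "integrable lborel (\<lambda>q. indicator ?Q q * (f' q * \<phi> q))" using integrable_completion[OF mb] by blast
    have "(LINT q|lborel. indicator ?Q q * (f' q * \<phi> q)) = (LINT q|lebesgue. indicator ?Q q * (f' q * \<phi> q))"
      by (rule integral_completion[OF mb, symmetric])
    also have "\<dots> = (LINT q|lebesgue. ?r q)"
      by (rule integral_cong_AE[OF ml borel_measurable_integrable[OF ri]]) (use ae in \<open>auto elim: eventually_mono\<close>)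
    also have "\<dots> = (LINT q|lebesgue. (\<Sum>i\<in>Basis. indicator ?Q q * (D i q * \<phi> q))) - (LINT q|lebesgue. indicator ?Q q * (Dt q * \<phi> q))"
      by (intro Bochner_Integration.integral_diff Bochner_Integration.integrable_sum L2int D(1) Dt(1))
    also have "(LINT q|lebesgue. (\<Sum>i\<in>Basis. indicator ?Q q * (D i q * \<phi> q))) = (\<Sum>i\<in>Basis. LINT q|lebesgue. indicator ?Q q * (D i q * \<phi> q))"
      by (intro Bochner_Integration.integral_sum L2int D(1))
    finally show "(LINT q|lborel. indicator ?Q q * (f' q * \<phi> q))
      = (\<Sum>i\<in>Basis. LINT q|lebesgue. indicator ?Q q * (D i q * \<phi> q)) - (LINT q|lebesgue. indicator ?Q q * (Dt q * \<phi> q))" .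
  qed
  have split: "indicator ?Q q * (u q * (dmoll (0, 1) ((q - p) /\<^sub>R \<epsilon>) / \<epsilon>) - dmoll (gu q, 0) ((q - p) /\<^sub>R \<epsilon>) / \<epsilon> - f' q * moll ((q - p) /\<^sub>R \<epsilon>))
    = indicator ?Q q * (u q * \<phi>1 (0, 1) q) - (\<Sum>i\<in>Basis. indicator ?Q q * ((gu q \<bullet> i) * \<phi>1 (i, 0) q)) - indicator ?Q q * (f' q * \<phi> q)" for q
  proof -
    obtain y s where ys: "(q - p) /\<^sub>R \<epsilon> = (y, s)" by (cases "(q - p) /\<^sub>R \<epsilon>")
    have "dmoll (gu q, 0) (y, s) = (\<Sum>i\<in>Basis. (gu q \<bullet> i) * dmoll (i, 0) (y, s))"
      unfolding dmoll_def inner_prod_def fst_conv snd_conv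
      by (subst euclidean_inner[of y "gu q"]) (simp add: sum_distrib_left sum_negf mult_ac)
    then have "dmoll (gu q, 0) ((q - p) /\<^sub>R \<epsilon>) / \<epsilon> = (\<Sum>i\<in>Basis. (gu q \<bullet> i) * \<phi>1 (i, 0) q)"
      by (simp add: \<phi>1_def ys sum_divide_distrib)
    then show ?thesis unfolding \<phi>1_def[symmetric] \<phi>_def[symmetric] by (simp add: right_diff_distrib sum_distrib_left)
  qed
  have cgi: "continuous_on ?Q (\<lambda>q. gu q \<bullet> i)" for i by (intro continuous_intros cont)
  have "(LINT q|lborel. indicator ?Q q * (u q * \<phi>1 (0, 1) q) - (\<Sum>i\<in>Basis. indicator ?Q q * ((gu q \<bullet> i) * \<phi>1 (i, 0) q)) - indicator ?Q q * (f' q * \<phi> q))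
    = (LINT q|lborel. indicator ?Q q * (u q * \<phi>1 (0, 1) q)) - (\<Sum>i\<in>Basis. LINT q|lborel. indicator ?Q q * ((gu q \<bullet> i) * \<phi>1 (i, 0) q)) - (LINT q|lborel. indicator ?Q q * (f' q * \<phi> q))"
  proof -
    have i1: "integrable lborel (\<lambda>q. indicator ?Q q * (u q * \<phi>1 e q))" for e
      by (rule int(1)[OF cont(1) cont_\<phi>(2) off(2)])
    have i2: "integrable lborel (\<lambda>q. indicator ?Q q * ((gu q \<bullet> i) * \<phi>1 e q))" for i e
      by (rule int(1)[OF cgi cont_\<phi>(2) off(2)])
    show ?thesis
      by (subst Bochner_Integration.integral_diff, intro Bochner_Integration.integrable_diff Bochner_Integration.integrable_sum i1 i2, rule fint,
          subst Bochner_Integration.integral_diff, rule i1, intro Bochner_Integration.integrable_sum i2,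
          subst Bochner_Integration.integral_sum, rule i2, rule refl)
  qed
  also have "\<dots> = 0" by (simp add: wt wf ibp wx sum_negf)
  finally show ?thesis unfolding split .
qed

lemma gint_eq_slice_integral:
  fixes f :: "('m::finite) spt \<Rightarrow> real"
  assumes z: "0 < z" and f': "f' \<in> borel_measurable borel"
    and ae: "AE x in lborel. x \<in> half_space \<longrightarrow> f (x, - z) = f' (x, - z)"
  shows "gint (\<lambda>y. (f' (sqrt z *\<^sub>R y, - z))\<^sup>2) = (LINT x:half_space|lebesgue. (f (x, - z))\<^sup>2 * G (x, - z))"
proof -
  let ?F = "\<lambda>x. indicator half_space x * ((f' (x, - z))\<^sup>2 * G (x, - z))"
  have Gm: "(\<lambda>x :: 'm sp. G (x, - z)) \<in> borel_measurable borel"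
    unfolding G_def using z by simp
  have fm: "(\<lambda>x. f' (x, - z)) \<in> borel_measurable borel"
    by (rule measurable_compose[OF _ f']) (simp add: borel_prod[symmetric])
  have m: "?F \<in> borel_measurable borel" using Gm fm by measurable
  have ml: "?F \<in> borel_measurable lebesgue" by (rule measurable_completion) (use m in simp)
  have ae': "AE x in lebesgue. ?F x = indicator half_space x *\<^sub>R ((f (x, - z))\<^sup>2 * G (x, - z))"
    using AE_completion[OF ae] by eventually_elim (auto simp: indicator_def)
  have ml': "(\<lambda>x. indicator half_space x *\<^sub>R ((f (x, - z))\<^sup>2 * G (x, - z))) \<in> borel_measurable lebesgue"
    by (rule borel_measurable_AE[OF ml ae'])
  have "(LINT x:half_space|lebesgue. (f (x, - z))\<^sup>2 * G (x, - z)) = (LINT x|lebesgue. ?F x)"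
    unfolding set_lebesgue_integral_def
    by (rule integral_cong_AE[OF ml' ml]) (use ae' in \<open>auto elim: eventually_mono\<close>)
  also have "\<dots> = (LINT x|lborel. ?F x)" by (rule integral_completion) (use m in simp)
  also have "\<dots> = sqrt z ^ DIM('m sp) * (LINT y|lborel. ?F (sqrt z *\<^sub>R y))"
    by (rule integral_lborel_scale[OF m]) (use z in simp)
  also have "\<dots> = (LINT y|lborel. sqrt z ^ DIM('m sp) * ?F (sqrt z *\<^sub>R y))" by (rule integral_mult_right_zero[symmetric])
  also have "\<dots> = gint (\<lambda>y. (f' (sqrt z *\<^sub>R y, - z))\<^sup>2)"
    unfolding gint_def
  proof (rule Bochner_Integration.integral_cong[OF refl])
    fix y :: "'m sp"
    have "indicator half_space (sqrt z *\<^sub>R y) = (indicator half_space y :: real)"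
      using z by (auto simp: indicator_def half_space_def zero_less_mult_iff)
    then show "sqrt z ^ DIM('m sp) * ?F (sqrt z *\<^sub>R y) = indicator half_space y * ((f' (sqrt z *\<^sub>R y, - z))\<^sup>2 * gauss y)"
      unfolding G_scale[OF z, of y, symmetric] by (simp only: mult_ac)
  qed
  finally show ?thesis by simp
qed

text \<open>\<open>c z\<close> is defined so that its square is \<mu> (sqrt z) / (C\<mu> * z powr (2
  - \<sigma>)), the bound that \<open>growth\<close> gives for the slice of f at r = sqrt z. Then z
  * c z equals k * z powr (\<sigma> / 2) * sqrt (\<mu> (sqrt z)): the exponent \<tau> is \<sigma> /
  2, and monotonicity of \<mu> makes the expression nondecreasing.\<close>

lemma Phi_nondecreasing_Sf_class:
  fixes f u :: "('m::finite) spt \<Rightarrow> real" and \<mu> :: "real \<Rightarrow> real"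
  assumes \<sigma>: "0 < \<sigma>" and C\<mu>: "0 < C\<mu>"
    and f: "f \<in> Linf (S_plus 1)" and u: "u \<in> Sf_class f"
    and pos: "\<And>r. 0 < r \<Longrightarrow> r < 1 \<Longrightarrow> 0 < \<mu> r" and mono: "mono_on {0<..<1} \<mu>"
    and conv: "convex_on {..<0} (\<lambda>s. ln (\<mu> (exp s)))"
    and growth: "\<And>r. 0 < r \<Longrightarrow> r < 1 \<Longrightarrow> C\<mu> * r powr (4 - 2 * \<sigma>) *
       (LINT x:half_space|lebesgue. (f (x, - r\<^sup>2))\<^sup>2 * G (x, - r\<^sup>2)) \<le> \<mu> r"
  shows "Phi_nondecreasing (2 * ((16 + 4 * (1 / sqrt C\<mu>)) * (1 / sqrt C\<mu>)) / \<sigma>) \<sigma> \<mu> u"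
proof -
  define k where "k = 1 / sqrt C\<mu>"
  \<comment> \<open>Equality in (16 + 4 k) k \<le> C \<tau> for \<tau> = \<sigma> / 2.\<close>
  define C where "C = 2 * ((16 + 4 * k) * k) / \<sigma>"
  define c where "c z = k * (sqrt (\<mu> (sqrt z)) * z powr ((\<sigma> - 2) / 2))" for z
  have k: "0 < k" using C\<mu> by (simp add: k_def)
  have sqrt01: "0 < sqrt z" "sqrt z < 1" if "0 < z" "z < 1" for z using that by auto
  have c\<mu>: "continuous_on {0<..<1} \<mu>" by (rule continuous_on_log_convex[OF pos conv])
  have cc: "continuous_on {0<..<1} c"
    unfolding c_def
    by (intro continuous_intros continuous_on_compose2[OF c\<mu>]) auto
  have zc: "z * c z = k * (sqrt (\<mu> (sqrt z)) * z powr (\<sigma> / 2))" if "0 < z" for z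
  proof -
    have "z * z powr ((\<sigma> - 2) / 2) = z powr (1 + (\<sigma> - 2) / 2)" using that by (simp add: powr_add)
    also have "1 + (\<sigma> - 2) / 2 = \<sigma> / 2" by (simp add: field_simps)
    finally have "z * z powr ((\<sigma> - 2) / 2) = z powr (\<sigma> / 2)" .
    moreover have "z * c z = k * (sqrt (\<mu> (sqrt z)) * (z * z powr ((\<sigma> - 2) / 2)))" by (simp add: c_def mult_ac)
    ultimately show ?thesis by simp
  qed
  have zc_mono: "x * c x \<le> y * c y" if xy: "0 < x" "x \<le> y" "y < 1" for x y
  proof -
    have "\<mu> (sqrt x) \<le> \<mu> (sqrt y)" by (rule mono_onD[OF mono]) (use xy in auto)
    then have "sqrt (\<mu> (sqrt x)) * x powr (\<sigma> / 2) \<le> sqrt (\<mu> (sqrt y)) * y powr (\<sigma> / 2)"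
      using xy pos[of "sqrt y"] \<sigma> by (intro mult_mono powr_mono2) (auto simp: less_imp_le)
    then show ?thesis using k xy by (simp add: zc)
  qed
  have c2: "(c z)\<^sup>2 = \<mu> (sqrt z) / (C\<mu> * z powr (2 - \<sigma>))" if z: "0 < z" "z < 1" for z
  proof -
    have p: "(z powr ((\<sigma> - 2) / 2))\<^sup>2 = 1 / z powr (2 - \<sigma>)"
    proof -
      have "(z powr ((\<sigma> - 2) / 2))\<^sup>2 = z powr ((\<sigma> - 2) / 2 + (\<sigma> - 2) / 2)" by (simp only: powr_add power2_eq_square)
      also have "(\<sigma> - 2) / 2 + (\<sigma> - 2) / 2 = - (2 - \<sigma>)" by (simp add: field_simps)
      finally show ?thesis by (simp only: powr_minus inverse_eq_divide)
    qed
    show ?thesis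
      unfolding c_def power_mult_distrib p using C\<mu> pos[OF sqrt01[OF z]] by (simp add: k_def power_divide)
  qed
  have S: "(S_plus 1 :: 'm spt set) \<in> sets lebesgue"
    unfolding S_plus_def by (intro sets_completionI_sets) (simp add: borel_Times)
  obtain f' M where f': "f' \<in> borel_measurable borel" "\<And>p. \<bar>f' p\<bar> \<le> M" "AE p in lborel. p \<in> S_plus 1 \<longrightarrow> f p = f' p"
    by (rule Linf_Borel_version[OF f S]) (rule that)
  define gu where "gu = space_grad u"
  obtain B R where reg:
    "continuous_on (half_space_closed \<times> {-1<..0}) u"
    "continuous_on (half_space_closed \<times> {-1<..0}) gu"
    "\<And>x t. x \<in> half_space \<Longrightarrow> -1 < t \<Longrightarrow> t \<le> 0 \<Longrightarrow> ((\<lambda>x. u (x, t)) has_derivative (\<lambda>h. gu (x, t) \<bullet> h)) (at x)"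
    "\<And>x t. x \<in> half_space_closed \<Longrightarrow> -1 < t \<Longrightarrow> t \<le> 0 \<Longrightarrow> R < norm x \<Longrightarrow> u (x, t) = 0 \<and> gu (x, t) = 0"
    "\<And>x t. x \<in> half_space_closed \<Longrightarrow> -1 < t \<Longrightarrow> t \<le> 0 \<Longrightarrow> \<bar>u (x, t)\<bar> \<le> B \<and> norm (gu (x, t)) \<le> B"
    "\<And>x t. snd x = 0 \<Longrightarrow> -1 < t \<Longrightarrow> t \<le> 0 \<Longrightarrow> 0 \<le> u (x, t) \<and> snd (gu (x, t)) \<le> 0 \<and> u (x, t) * snd (gu (x, t)) = 0"
    unfolding gu_def by (rule Sf_class_regularity[OF u]) blast
  have sub: "half_space \<times> {-1<..<0} \<subseteq> (half_space_closed :: 'm sp set) \<times> {-1<..0::real}"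
    "half_space_closed \<times> {-1<..<0} \<subseteq> (half_space_closed :: 'm sp set) \<times> {-1<..0::real}"
    by (auto simp: half_space_def half_space_closed_def)
  have "AE z in lborel. AE x in lborel. (x, - z) \<in> S_plus 1 \<longrightarrow> f (x, - z) = f' (x, - z)"
    by (rule AE_lborel_slices[OF f'(3)])
  then have fb: "AE z in lborel. 0 < z \<and> z < 1 \<longrightarrow> gint (\<lambda>y. (f' (sqrt z *\<^sub>R y, - z))\<^sup>2) \<le> (c z)\<^sup>2"
  proof eventually_elim
    case (elim z)
    show ?case
    proof (intro impI)
      assume z: "0 < z \<and> z < 1"
      have "AE x in lborel. x \<in> half_space \<longrightarrow> f (x, - z) = f' (x, - z)"
        using elim by eventually_elim (use z in \<open>auto simp: S_plus_def\<close>)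
      then have eq: "gint (\<lambda>y. (f' (sqrt z *\<^sub>R y, - z))\<^sup>2) = (LINT x:half_space|lebesgue. (f (x, - z))\<^sup>2 * G (x, - z))"
        using z f'(1) by (intro gint_eq_slice_integral) auto
      have "sqrt z powr (4 - 2 * \<sigma>) = z powr (2 - \<sigma>)"
      proof -
        have "sqrt z powr (4 - 2 * \<sigma>) = (z powr (1 / 2)) powr (4 - 2 * \<sigma>)" using z powr_half_sqrt[of z] by simp
        also have "\<dots> = z powr (1 / 2 * (4 - 2 * \<sigma>))" by (rule powr_powr)
        also have "1 / 2 * (4 - 2 * \<sigma>) = 2 - \<sigma>" by simp
        finally show ?thesis .
      qed
      then have "(C\<mu> * z powr (2 - \<sigma>)) * gint (\<lambda>y. (f' (sqrt z *\<^sub>R y, - z))\<^sup>2) \<le> \<mu> (sqrt z)"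
        using growth[of "sqrt z"] z unfolding eq by simp
      then show "gint (\<lambda>y. (f' (sqrt z *\<^sub>R y, - z))\<^sup>2) \<le> (c z)\<^sup>2"
        using z C\<mu> unfolding c2[OF conjunct1[OF z] conjunct2[OF z]]
        by (subst pos_le_divide_eq) (auto simp: mult.commute)
    qed
  qed
  have cone: "s *\<^sub>R y \<in> half_space" if "y \<in> half_space" "0 < s" for y :: "'m sp" and s
    using that by (simp add: half_space_def)
  have heat: "heat_eq (S_plus 1) u f" using u unfolding Sf_class_def by blast
  interpret bounded_signorini_flow u f' gu M c B
  proof unfold_locales
    show "open ((half_space :: 'm sp set) \<times> {-1<..<0::real})" by (intro open_Times open_half_space) simp
    show cu: "continuous_on (half_space \<times> {-1<..<0}) u" and cg: "continuous_on (half_space \<times> {-1<..<0}) gu"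
      using reg(1,2) sub(1) continuous_on_subset by blast+
    show d: "((\<lambda>x. u (x, t)) has_derivative (\<lambda>h. gu (x, t) \<bullet> h)) (at x)" if "(x, t) \<in> half_space \<times> {-1<..<0}" for x t
      using reg(3) that by simp
    show "(LINT q|lborel. indicator (half_space \<times> {-1<..<0}) q * (u q * (dmoll (0, 1) ((q - p) /\<^sub>R \<epsilon>) / \<epsilon>)
         - dmoll (gu q, 0) ((q - p) /\<^sub>R \<epsilon>) / \<epsilon> - f' q * moll ((q - p) /\<^sub>R \<epsilon>))) = 0"
      if "0 < \<epsilon>" "cball p \<epsilon> \<subseteq> half_space \<times> {-1<..<0}" for p \<epsilon>
      using weak_equation[OF heat S _ _ _ f'(1,3) that(1), of gu p] cu cg d that(2) unfolding interior_S_plus by blast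
    show "continuous_on (half_space_closed \<times> {-1<..<0}) u" "continuous_on (half_space_closed \<times> {-1<..<0}) gu"
      using reg(1,2) sub(2) continuous_on_subset by blast+
    show "\<exists>R. \<forall>x t. x \<in> half_space_closed \<longrightarrow> -1 < t \<longrightarrow> t < 0 \<longrightarrow> R < norm x \<longrightarrow> u (x, t) = 0 \<and> gu (x, t) = 0"
      using reg(4) by (intro exI[of _ R]) simp
    show "0 \<le> c z" if "0 < z" "z < 1" for z using k pos[OF sqrt01[OF that]] by (simp add: c_def)
  qed (use f' reg(5,6) fb cc zc_mono cone open_half_space in auto)
  interpret F: frequency_ode h en "\<lambda>z. z * c z" D by (rule frequency_ode)
  have C: "0 \<le> C" "(16 + 4 * k) * k \<le> C * (\<sigma> / 2)" "C = 2 * ((16 + 4 * (1 / sqrt C\<mu>)) * (1 / sqrt C\<mu>)) / \<sigma>"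
  proof -
    show "0 \<le> C" unfolding C_def using k \<sigma> by (intro divide_nonneg_pos mult_nonneg_nonneg add_nonneg_nonneg) auto
    show "(16 + 4 * k) * k \<le> C * (\<sigma> / 2)" unfolding C_def using \<sigma> by simp
    show "C = 2 * ((16 + 4 * (1 / sqrt C\<mu>)) * (1 / sqrt C\<mu>)) / \<sigma>" unfolding C_def k_def ..
  qed
  have H_eq: "H u s = F.ave (s\<^sup>2)" if "0 < s" "s < 1" for s
    using H_eq_average[OF that] by (simp add: F.ave_def)
  have small: "r\<^sup>2 * c (r\<^sup>2) \<le> (k * r\<^sup>2 powr (\<sigma> / 2)) * sqrt (\<mu> r)" if "0 < r" "r < 1" for r
    using zc[of "r\<^sup>2"] that by (simp add: mult_ac)
  obtain \<psi> where \<psi>: "mono_on {0<..<1} \<psi>"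
    "AE r in lebesgue_on {0<..<1}. (\<lambda>s. ln (max (F.ave (s\<^sup>2)) (\<mu> s))) differentiable (at r) \<and>
       1 / 2 * r * exp (C * r powr (2 * (\<sigma> / 2))) * deriv (\<lambda>s. ln (max (F.ave (s\<^sup>2)) (\<mu> s))) r
         + 2 * (exp (C * r powr (2 * (\<sigma> / 2))) - 1) = \<psi> r"
    by (rule F.max_frequency[of "\<sigma> / 2" k C \<mu>]) (use \<sigma> k C pos mono conv small in auto)
  have r01: "AE r in lebesgue_on {0<..<1 :: real}. r \<in> {0<..<1}" by (rule AE_I2) simp
  have "AE r in lebesgue_on {0<..<1}. (\<lambda>s. ln (max (H u s) (\<mu> s))) differentiable (at r) \<and> Phi C \<sigma> \<mu> u r = \<psi> r"
    using \<psi>(2) r01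
  proof eventually_elim
    case (elim r)
    have ev: "\<forall>\<^sub>F s in nhds r. ln (max (H u s) (\<mu> s)) = ln (max (F.ave (s\<^sup>2)) (\<mu> s))"
      by (rule eventually_mono[OF eventually_nhds_in_open[OF open_greaterThanLessThan elim(2)]]) (simp add: H_eq)
    have "deriv (\<lambda>s. ln (max (H u s) (\<mu> s))) r = deriv (\<lambda>s. ln (max (F.ave (s\<^sup>2)) (\<mu> s))) r"
      by (rule deriv_cong_ev[OF ev refl])
    moreover have "(\<lambda>s. ln (max (H u s) (\<mu> s))) differentiable (at r)"
      using elim(1) DERIV_cong_ev[OF refl ev refl] unfolding real_differentiable_def by blast
    ultimately show ?case using elim(1) by (simp add: Phi_def)
  qed
  then show ?thesis unfolding Phi_nondecreasing_def C(3)[symmetric] using \<psi>(1) by blast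
qed

theorem theorem6p3:
  fixes \<sigma> C\<^sub>\<mu> :: real
  assumes "0 < \<sigma>" and "0 < C\<^sub>\<mu>"
  shows "\<exists>C>0. \<forall>(f :: ('m::finite) spt \<Rightarrow> real) (u :: 'm spt \<Rightarrow> real) (\<mu> :: real \<Rightarrow> real).
    f \<in> Linf (S_plus 1) \<longrightarrow>
    u \<in> Sf_class f \<longrightarrow>
    (\<forall>r\<in>{0<..<1}. 0 < \<mu> r) \<longrightarrow>
    mono_on {0<..<1} \<mu> \<longrightarrow>
    convex_on {..<0} (\<lambda>s. ln (\<mu> (exp s))) \<longrightarrow>
    (\<forall>r\<in>{0<..<1}. \<mu> r \<ge> C\<^sub>\<mu> * r powr (4 - 2 * \<sigma>) *
       (LINT x:half_space|lebesgue. (f (x, - r\<^sup>2))\<^sup>2 * G (x, - r\<^sup>2))) \<longrightarrow>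
    Phi_nondecreasing C \<sigma> \<mu> u"
proof (intro exI[of _ "2 * ((16 + 4 * (1 / sqrt C\<^sub>\<mu>)) * (1 / sqrt C\<^sub>\<mu>)) / \<sigma>"] conjI allI impI)
  show "0 < 2 * ((16 + 4 * (1 / sqrt C\<^sub>\<mu>)) * (1 / sqrt C\<^sub>\<mu>)) / \<sigma>"
    using assms by (intro divide_pos_pos mult_pos_pos add_pos_pos) auto
  fix f u :: "'m spt \<Rightarrow> real" and \<mu> :: "real \<Rightarrow> real"
  assume a: "f \<in> Linf (S_plus 1)" "u \<in> Sf_class f" "\<forall>r\<in>{0<..<1}. 0 < \<mu> r" "mono_on {0<..<1} \<mu>"
    "convex_on {..<0} (\<lambda>s. ln (\<mu> (exp s)))"
    "\<forall>r\<in>{0<..<1}. \<mu> r \<ge> C\<^sub>\<mu> * r powr (4 - 2 * \<sigma>) *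
       (LINT x:half_space|lebesgue. (f (x, - r\<^sup>2))\<^sup>2 * G (x, - r\<^sup>2))"
  show "Phi_nondecreasing (2 * ((16 + 4 * (1 / sqrt C\<^sub>\<mu>)) * (1 / sqrt C\<^sub>\<mu>)) / \<sigma>) \<sigma> \<mu> u"
    by (rule Phi_nondecreasing_Sf_class[OF assms a(1,2) _ a(4,5)]) (use a(3,6) in auto)
qed

end
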